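(* Let $M$ be a compact connected piecewise flat Landsberg surface (without boundary). Then $$\sum_{x\in M}K(x)=\theta_M\,\chi(M),$$ where $\theta_M$ is the common value of $l_x^\pm(\mathcal S_x^\pm M)$ over all non-vertex points $x\in M$, and $\chi(M)$ is the Euler characteristic number of $M$.
   Context: A Minkowski norm on a finite-dimensional real vector space $V$ is a continuous $F:V\to[0,\infty)$, smooth and positive on $V\setminus\{0\}$, with $F(\lambda y)=\lambda F(y)$ for $\lambda\ge0$, such that for every $y\ne0$ the bilinear form $\langle u,v\rangle^F_y=\frac12\frac{\partial^2}{\partial s\partial t}F^2(y+su+tv)|_{s=t=0}$ is positive definite ($F(-y)=F(y)$ is not required). A Minkowski plane is $\mathbb R^2$ with the translation-invariant Finsler metric given by a Minkowski norm. A piecewise flat Finsler surface is a surface $M$ (without boundary) with a locally finite triangulation $M=\bigcup T_i$ by closed triangles, different triangles being disjoint or meeting in exactly one common edge or one common vertex, where each $T_i$ carries a flat metric $F_i$ such that $(T_i,F_i)$ is isometric to a straight-edged triangle in a Minkowski plane, and $F_i,F_j$ coincide on a common edge of $T_i,T_j$. Tangent cone: let $(T_1,F_1),\dots,(T_n,F_n)$ be the closed triangles containing $x$. Each is enlarged to a Minkowski cone $C_{x,i}$ with vertex $x$ (the planar sector at $x$ spanned by $T_i$; a half plane if $x$ is an edge point but not a vertex, the whole plane if $x$ is interior to a triangle) with $F_i$ extended to it; $T_xM=\bigcup_i C_{x,i}$, glued along common boundary rays (edges). The same notions apply to $T_xM$ itself in place of $M$. Tangent vectors and indicatrices: an outgoing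 (incoming) tangent vector at $p$ is an arrow in a cone at $p$ starting (ending) at $p$. $\mathcal S^+_{p,i}M$ ($\mathcal S^-_{p,i}M$) is the set of outgoing (incoming) vectors at $p$ in $C_{p,i}$ with $F_i=1$; $\mathcal S_p^\pm M=\bigcup_i\mathcal S_{p,i}^\pm M$ are circles, with arc length functional $l_p^\pm$ given on $\mathcal S_{p,i}^\pm M$ by the metric $\langle\cdot,\cdot\rangle^{F_i}_y$ at $y$. For $p\ne x$ in $T_xM$ let $\mathrm{Pr}_x^+(p)\in\mathcal S_x^+M$ ($\mathrm{Pr}_x^-(p)\in\mathcal S_x^-M$) be the unit vector in the direction from $x$ to $p$ (from $p$ to $x$). If a curve $\gamma$ in $T_xM\setminus\{x\}$ has monotonously rotating projection, $\sphericalangle_x^\pm(\gamma)$ is the arc length $l_x^\pm$ of the projected path $\mathrm{Pr}_x^\pm\circ\gamma$, counted with multiplicity. Geodesics: piecewise smooth curves of constant nonzero speed which are locally minimizing for $d$, where $d(p,q)$ is the infimum of the lengths $\int F(\dot c)\,dt$ of piecewise smooth paths from $p$ to $q$. Landsberg: $M$ is a piecewise flat Landsberg surface if for any $x$ on an edge $E$ between two triangles $(T_1,F_1)$ and $(T_2,F_2)$ of $M$, $x$ not a vertex, the homeomorphism $\mathcal S_{x,1}^-M\to\mathcal S_{x,2}^+M$, $u_1^-\mapsto u_2^+$, defined by $\langle u_1^-,v\rangle^{F_1}_{u_1^-}=\langle u_2^+,v\rangle^{F_2}_{u_2^+}$, with $v$ any nonzero vector in the direction of $E$, is an isometry for the metrics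 on the indicatrices defined by $\langle\cdot,\cdot\rangle^{F_i}_y$. For connected such $M$, $l_x^\pm(\mathcal S_x^\pm M)$ is the same constant $\theta_M$ for all non-vertex $x$ and both signs. Curvature at a vertex $x$: fix an orientation of $T_xM$ to distinguish left from right. (i) For $v^-\in\mathcal S_x^-M$ let $c(t)$, $t\le0$, be the unit speed ray with $c(0)=x$, $\dot c=v^-$. Translate a short piece of $c$ around $c(-1)$ by a sufficiently small amount to the left (right); it extends to a geodesic of $T_xM$ on $(-\infty,\infty)$ not passing through $x$, denoted $c_{+,l}$ ($c_{+,r}$). Then $K(x,v^-)=\sphericalangle_x^+(c_{+,l})+\sphericalangle_x^+(c_{+,r})-l_x^+(\mathcal S_x^+M)$. (ii) For $v^+\in\mathcal S_x^+M$ let $c(t)$, $t\ge0$, be the unit speed ray with $c(0)=x$, $\dot c=v^+$. Translating a short piece of $c$ around $c(1)$ slightly to the left (right) and extending gives $c_{-,l}$ ($c_{-,r}$), and $K(x,v^+)=\sphericalangle_x^-(c_{-,l})+\sphericalangle_x^-(c_{-,r})-l_x^-(\mathcal S_x^-M)$. On a piecewise flat Landsberg surface all the numbers $K(x,v^-)$, $K(x,v^+)$ at a given vertex $x$ coincide, and their common value is denoted $K(x)$. For $x$ not a vertex, $K(x)=0$, so the sum in the claim is the finite sum over the vertices. *)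

theory Defs
  imports "HOL-Analysis.Analysis"
begin

section \<open>Minkowski norms and their indicatrices\<close>

primrec Ck_on ::
  "nat \<Rightarrow> ('a::real_normed_vector \<Rightarrow> 'b::real_normed_vector) \<Rightarrow> 'a set \<Rightarrow> bool" where
  "Ck_on 0 f S \<longleftrightarrow> continuous_on S f"
| "Ck_on (Suc n) f S \<longleftrightarrow>
     (\<forall>x\<in>S. f differentiable at x) \<and>
     (\<forall>v. Ck_on n (\<lambda>x. frechet_derivative f (at x) v) S)"

text \<open>Only used for open \<open>S\<close> in finite-dimensional spaces, where it is \<open>C\<^sup>\<infinity>\<close> in the usual sense.\<close>

definition smooth_on ::
  "'a::real_normed_vector set \<Rightarrow> ('a \<Rightarrow> 'b::real_normed_vector) \<Rightarrow> bool" where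
  "smooth_on S f \<longleftrightarrow> (\<forall>n. Ck_on n f S)"

definition fund_form :: "(real^2 \<Rightarrow> real) \<Rightarrow> real^2 \<Rightarrow> real^2 \<Rightarrow> real^2 \<Rightarrow> real" where
  "fund_form F y u v =
     1/2 * deriv (\<lambda>s. deriv (\<lambda>t. (F (y + s *\<^sub>R u + t *\<^sub>R v))\<^sup>2) 0) 0"

definition minkowski_norm :: "(real^2 \<Rightarrow> real) \<Rightarrow> bool" where
  "minkowski_norm F \<longleftrightarrow>
     continuous_on UNIV F \<and>
     (\<forall>y. 0 \<le> F y) \<and>
     smooth_on (- {0}) F \<and>
     (\<forall>y. y \<noteq> 0 \<longrightarrow> 0 < F y) \<and>
     (\<forall>y. \<forall>c\<ge>0. F (c *\<^sub>R y) = c * F y) \<and>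
     (\<forall>y u. y \<noteq> 0 \<longrightarrow> u \<noteq> 0 \<longrightarrow> 0 < fund_form F y u u)"

definition unit_vec :: "(real^2 \<Rightarrow> real) \<Rightarrow> real^2 \<Rightarrow> real^2" where
  "unit_vec F w = w /\<^sub>R F w"

text \<open>The length at time \<open>t\<close> of the velocity of a curve \<open>y\<close> in the indicatrix \<open>F = 1\<close>.\<close>

definition ind_speed :: "(real^2 \<Rightarrow> real) \<Rightarrow> (real \<Rightarrow> real^2) \<Rightarrow> real \<Rightarrow> real" where
  "ind_speed F y t =
     (let D = vector_derivative y (at t) in sqrt (fund_form F (y t) D D))"

text \<open>
  Arc length of a part \<open>A\<close> of the indicatrix, computed in the parametrization of the whole
  indicatrix by the polar angle.
\<close>

definition ind_arclen :: "(real^2 \<Rightarrow> real) \<Rightarrow> (real^2) set \<Rightarrow> real" where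
  "ind_arclen F A =
     (let y = (\<lambda>\<phi>. unit_vec F (vector [cos \<phi>, sin \<phi>]))
      in integral {\<phi> \<in> {0..2 * pi}. y \<phi> \<in> A} (ind_speed F y))"

text \<open>
  \<open>A\<close> and \<open>B\<close> are arcs of the indicatrices of \<open>F\<close> and \<open>G\<close>; \<open>h\<close> is an isometry if it is a
  homeomorphism whose differential, computed on the velocities of curves, preserves the
  metrics given by the fundamental forms.
\<close>

definition ind_isometry ::
  "(real^2 \<Rightarrow> real) \<Rightarrow> (real^2) set \<Rightarrow> (real^2 \<Rightarrow> real) \<Rightarrow> (real^2) set \<Rightarrow>
   (real^2 \<Rightarrow> real^2) \<Rightarrow> bool" where
  "ind_isometry F A G B h \<longleftrightarrow>
     (\<exists>g. homeomorphism A B h g) \<and>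
     (\<forall>y D. \<forall>t\<in>{0..1::real}.
        y ` {0..1} \<subseteq> A \<and> (y has_vector_derivative D) (at t within {0..1}) \<longrightarrow>
        (\<exists>D'. ((h \<circ> y) has_vector_derivative D') (at t within {0..1}) \<and>
              fund_form G (h (y t)) D' D' = fund_form F (y t) D D))"


section \<open>Spaces glued from flat pieces\<close>

text \<open>
  The pieces are the closed triangles of a piecewise flat surface, or the Minkowski cones of a
  tangent cone. Piece \<open>i\<close> is represented through its isometry \<open>chart i\<close> from the subset
  \<open>region i\<close> of the Minkowski plane with norm \<open>fnorm i\<close>; only the values of \<open>chart i\<close> on
  \<open>region i\<close> matter.
\<close>

record ('p, 'i) flat_pieces =
  pieces :: "'i set"
  region :: "'i \<Rightarrow> (real^2) set"
  chart :: "'i \<Rightarrow> real^2 \<Rightarrow> 'p"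
  fnorm :: "'i \<Rightarrow> real^2 \<Rightarrow> real"

definition piece :: "('p, 'i, 'z) flat_pieces_scheme \<Rightarrow> 'i \<Rightarrow> 'p set" where
  "piece X i = chart X i ` region X i"

text \<open>
  \<open>has_pw_integral X G \<gamma> a b L\<close>: on \<open>[a,b]\<close> the curve \<open>\<gamma>\<close> is piecewise smooth, i.e. a finite
  concatenation of curves each of which stays in one piece and is smooth in the chart of that
  piece, and \<open>L\<close> is the sum of the integrals of \<open>G i c\<close> over these curves, \<open>c\<close> being the
  coordinate expression of the curve in piece \<open>i\<close>. Smoothness on the closed interval is
  expressed by a smooth extension of \<open>c\<close> to the real line.
\<close>

inductive has_pw_integral ::
  "('p, 'i, 'z) flat_pieces_scheme \<Rightarrow> ('i \<Rightarrow> (real \<Rightarrow> real^2) \<Rightarrow> real \<Rightarrow> real) \<Rightarrow>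
   (real \<Rightarrow> 'p) \<Rightarrow> real \<Rightarrow> real \<Rightarrow> real \<Rightarrow> bool"
  for X G \<gamma> where
  smooth_piece:
    "a \<le> b \<Longrightarrow> i \<in> pieces X \<Longrightarrow> smooth_on UNIV c \<Longrightarrow>
     (\<And>t. t \<in> {a..b} \<Longrightarrow> c t \<in> region X i \<and> \<gamma> t = chart X i (c t)) \<Longrightarrow>
     has_pw_integral X G \<gamma> a b (integral {a..b} (G i c))"
| join:
    "has_pw_integral X G \<gamma> a b L \<Longrightarrow> has_pw_integral X G \<gamma> b d L' \<Longrightarrow>
     has_pw_integral X G \<gamma> a d (L + L')"

definition has_length ::
  "('p, 'i, 'z) flat_pieces_scheme \<Rightarrow> (real \<Rightarrow> 'p) \<Rightarrow> real \<Rightarrow> real \<Rightarrow> real \<Rightarrow> bool" where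
  "has_length X =
     has_pw_integral X (\<lambda>i c t. fnorm X i (vector_derivative c (at t)))"

definition fdist :: "('p, 'i, 'z) flat_pieces_scheme \<Rightarrow> 'p \<Rightarrow> 'p \<Rightarrow> real" where
  "fdist X p q = Inf {L. \<exists>\<gamma> a b. \<gamma> a = p \<and> \<gamma> b = q \<and> has_length X \<gamma> a b L}"

text \<open>Geodesics on the whole real line, with speed \<open>\<kappa>\<close>.\<close>

definition geodesic :: "('p, 'i, 'z) flat_pieces_scheme \<Rightarrow> (real \<Rightarrow> 'p) \<Rightarrow> bool" where
  "geodesic X \<gamma> \<longleftrightarrow>
     (\<exists>\<kappa>>0. \<forall>a b. a \<le> b \<longrightarrow> has_length X \<gamma> a b (\<kappa> * (b - a))) \<and>
     (\<forall>t. \<exists>e>0. \<forall>a b. t - e < a \<and> a \<le> b \<and> b < t + e \<longrightarrow>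
        has_length X \<gamma> a b (fdist X (\<gamma> a) (\<gamma> b)))"


section \<open>Tangent cones\<close>

definition star :: "('p, 'i, 'z) flat_pieces_scheme \<Rightarrow> 'p \<Rightarrow> 'i set" where
  "star X x = {i \<in> pieces X. x \<in> piece X i}"

definition coord :: "('p, 'i, 'z) flat_pieces_scheme \<Rightarrow> 'p \<Rightarrow> 'i \<Rightarrow> real^2" where
  "coord X x i = the_inv_into (region X i) (chart X i) x"

text \<open>The cone of piece \<open>i\<close> at \<open>x\<close>, with its vertex moved to the origin.\<close>

definition tcone :: "('p, 'i, 'z) flat_pieces_scheme \<Rightarrow> 'p \<Rightarrow> 'i \<Rightarrow> (real^2) set" where
  "tcone X x i = {a *\<^sub>R (q - coord X x i) | a q. 0 \<le> a \<and> q \<in> region X i}"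

text \<open>
  The vector \<open>w\<close> in the cone of piece \<open>i\<close> and \<open>w'\<close> in that of \<open>j\<close> are identified if they are
  the same multiple of the displacements from \<open>x\<close> to one common point of both pieces. A point of
  the tangent cone is the class of all pairs identified with each other.
\<close>

definition tpoint ::
  "('p, 'i, 'z) flat_pieces_scheme \<Rightarrow> 'p \<Rightarrow> 'i \<Rightarrow> real^2 \<Rightarrow> ('i \<times> (real^2)) set" where
  "tpoint X x i w =
     {(j, w'). j \<in> star X x \<and>
        (\<exists>a q q'. 0 \<le> a \<and> q \<in> region X i \<and> q' \<in> region X j \<and> chart X i q = chart X j q' \<and>
           w = a *\<^sub>R (q - coord X x i) \<and> w' = a *\<^sub>R (q' - coord X x j))}"

definition tangent_cone ::
  "('p, 'i, 'z) flat_pieces_scheme \<Rightarrow> 'p \<Rightarrow> (('i \<times> (real^2)) set, 'i) flat_pieces" where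
  "tangent_cone X x =
     \<lparr>pieces = star X x, region = tcone X x, chart = tpoint X x, fnorm = fnorm X\<rparr>"

definition apex :: "('p, 'i, 'z) flat_pieces_scheme \<Rightarrow> 'p \<Rightarrow> ('i \<times> (real^2)) set" where
  "apex X x = {(i, 0) | i. i \<in> star X x}"

text \<open>
  Throughout, a sign \<open>s\<close> is \<open>1\<close> for outgoing and \<open>-1\<close> for incoming tangent vectors at \<open>x\<close>: an
  outgoing vector \<open>u\<close> is the arrow from \<open>0\<close> to \<open>u\<close>, an incoming one the arrow from \<open>-u\<close> to \<open>0\<close>.
\<close>

definition indicatrix ::
  "('p, 'i, 'z) flat_pieces_scheme \<Rightarrow> real \<Rightarrow> 'p \<Rightarrow> 'i \<Rightarrow> (real^2) set" where
  "indicatrix X s x i = {u. s *\<^sub>R u \<in> tcone X x i \<and> fnorm X i u = 1}"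

definition total_angle :: "('p, 'i, 'z) flat_pieces_scheme \<Rightarrow> real \<Rightarrow> 'p \<Rightarrow> real" where
  "total_angle X s x = (\<Sum>i\<in>star X x. ind_arclen (fnorm X i) (indicatrix X s x i))"

text \<open>
  \<open>has_rotation X x s \<gamma> A\<close>: the curve \<open>\<gamma>\<close> in the tangent cone at \<open>x\<close>, defined on the whole real
  line, has projection to the indicatrix of sign \<open>s\<close> of total arc length \<open>A\<close>.
\<close>

definition has_rotation ::
  "('p, 'i, 'z) flat_pieces_scheme \<Rightarrow> 'p \<Rightarrow> real \<Rightarrow> (real \<Rightarrow> ('i \<times> (real^2)) set) \<Rightarrow> real \<Rightarrow> bool"
  where
  "has_rotation X x s \<gamma> A \<longleftrightarrow>
     (\<exists>f. (\<forall>r\<ge>0. has_pw_integral (tangent_cone X x)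
                   (\<lambda>i c. ind_speed (fnorm X i) (\<lambda>t. unit_vec (fnorm X i) (s *\<^sub>R c t)))
                   \<gamma> (- r) r (f r)) \<and>
          (f \<longlongrightarrow> A) at_top)"


section \<open>Piecewise flat surfaces\<close>

record ('p, 'i) flat_surface = "('p, 'i) flat_pieces" +
  topo :: "'p topology"

definition topological_surface :: "'p topology \<Rightarrow> bool" where
  "topological_surface T \<longleftrightarrow>
     Hausdorff_space T \<and> second_countable T \<and>
     (\<forall>x\<in>topspace T. \<exists>U. openin T U \<and> x \<in> U \<and>
        subtopology T U homeomorphic_space (euclidean :: (real^2) topology))"

text \<open>
  In the last condition two pieces overlap in at most one edge. It says that \<open>F\<^sub>i\<close> and \<open>F\<^sub>j\<close>
  give the same length to every directed segment of that edge, i.e. agree as metrics on it.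
\<close>

definition pf_finsler_surface :: "('p, 'i, 'z) flat_surface_scheme \<Rightarrow> bool" where
  "pf_finsler_surface M \<longleftrightarrow>
     topological_surface (topo M) \<and>
     (\<Union>i\<in>pieces M. piece M i) = topspace (topo M) \<and>
     (\<forall>x\<in>topspace (topo M). \<exists>U. openin (topo M) U \<and> x \<in> U \<and>
        finite {i \<in> pieces M. piece M i \<inter> U \<noteq> {}}) \<and>
     (\<forall>i\<in>pieces M.
        2 simplex region M i \<and> minkowski_norm (fnorm M i) \<and>
        embedding_map (top_of_set (region M i)) (topo M) (chart M i)) \<and>
     (\<forall>i\<in>pieces M. \<forall>j\<in>pieces M. i \<noteq> j \<longrightarrow>
        piece M i \<inter> piece M j = {} \<or>
        (\<exists>p q. p extreme_point_of region M i \<and> q extreme_point_of region M j \<and>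
           piece M i \<inter> piece M j = {chart M i p} \<and> chart M i p = chart M j q) \<or>
        (\<exists>e e'. e edge_of region M i \<and> e' edge_of region M j \<and>
           piece M i \<inter> piece M j = chart M i ` e \<and> chart M i ` e = chart M j ` e')) \<and>
     (\<forall>i\<in>pieces M. \<forall>j\<in>pieces M. i \<noteq> j \<longrightarrow>
        (\<forall>p\<in>region M i. \<forall>q\<in>region M i. \<forall>p'\<in>region M j. \<forall>q'\<in>region M j.
           chart M i p = chart M j p' \<and> chart M i q = chart M j q' \<longrightarrow>
           fnorm M i (q - p) = fnorm M j (q' - p')))"

definition vertices :: "('p, 'i, 'z) flat_pieces_scheme \<Rightarrow> 'p set" where
  "vertices M = {chart M i p | i p. i \<in> pieces M \<and> p extreme_point_of region M i}"

definition edges :: "('p, 'i, 'z) flat_pieces_scheme \<Rightarrow> 'p set set" where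
  "edges M = {chart M i ` e | i e. i \<in> pieces M \<and> e edge_of region M i}"

definition faces :: "('p, 'i, 'z) flat_pieces_scheme \<Rightarrow> 'p set set" where
  "faces M = piece M ` pieces M"

definition euler_char :: "('p, 'i, 'z) flat_pieces_scheme \<Rightarrow> int" where
  "euler_char M = int (card (vertices M)) - int (card (edges M)) + int (card (faces M))"

text \<open>
  The correspondence \<open>u\<^sub>1 \<mapsto> u\<^sub>2\<close> is determined by the pairing with vectors along the edge; such
  a vector appears as \<open>v\<close> in chart \<open>i\<close> and as \<open>v'\<close> in chart \<open>j\<close>.
\<close>

definition landsberg :: "('p, 'i, 'z) flat_surface_scheme \<Rightarrow> bool" where
  "landsberg M \<longleftrightarrow>
     (\<forall>x i j. i \<in> star M x \<and> j \<in> star M x \<and> i \<noteq> j \<and> x \<notin> vertices M \<longrightarrow>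
        (\<exists>h. ind_isometry (fnorm M i) (indicatrix M (-1) x i)
                          (fnorm M j) (indicatrix M 1 x j) h \<and>
             (\<forall>u\<in>indicatrix M (-1) x i.
                \<forall>v\<in>tcone M x i. \<forall>v'\<in>tcone M x j. v \<noteq> 0 \<and> tpoint M x i v = tpoint M x j v' \<longrightarrow>
                  fund_form (fnorm M i) u u v = fund_form (fnorm M j) (h u) (h u) v')))"

definition pf_landsberg_surface :: "('p, 'i, 'z) flat_surface_scheme \<Rightarrow> bool" where
  "pf_landsberg_surface M \<longleftrightarrow> pf_finsler_surface M \<and> landsberg M"

text \<open>The constant \<open>\<theta>\<^sub>M\<close>.\<close>

definition theta :: "('p, 'i, 'z) flat_surface_scheme \<Rightarrow> real" where
  "theta M =
     (THE \<theta>. \<forall>x \<in> topspace (topo M) - vertices M. \<forall>s\<in>{1, -1}. total_angle M s x = \<theta>)"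


section \<open>Curvature\<close>

definition cross2 :: "real^2 \<Rightarrow> real^2 \<Rightarrow> real" where
  "cross2 u v = u$1 * v$2 - u$2 * v$1"

text \<open>
  \<open>\<epsilon> i\<close> tells whether the orientation of the tangent cone agrees in piece \<open>i\<close> with the standard
  one of the chart. Coherence: two cones with a common ray lie on different sides of it.
\<close>

definition cone_orientation ::
  "('p, 'i, 'z) flat_pieces_scheme \<Rightarrow> 'p \<Rightarrow> ('i \<Rightarrow> real) \<Rightarrow> bool" where
  "cone_orientation X x \<epsilon> \<longleftrightarrow>
     (\<forall>i\<in>star X x. \<epsilon> i \<in> {1, -1}) \<and>
     (\<forall>i\<in>star X x. \<forall>j\<in>star X x. i \<noteq> j \<longrightarrow>
        (\<forall>w\<in>tcone X x i. \<forall>w'\<in>tcone X x j. w \<noteq> 0 \<and> tpoint X x i w = tpoint X x j w' \<longrightarrow>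
          (\<forall>a\<in>tcone X x i. \<forall>b\<in>tcone X x j.
             (\<epsilon> i * cross2 w a) * (\<epsilon> j * cross2 w' b) \<le> 0)))"

text \<open>
  Let \<open>u\<close> be a unit tangent vector of sign \<open>s\<close> at \<open>x\<close>, written in the cone of piece \<open>i\<close>. The unit
  speed ray \<open>c\<close> with velocity \<open>u\<close> at \<open>x\<close> is \<open>c(t) = tu\<close>, \<open>st \<ge> 0\<close>. The next predicate says that
  translating by \<open>n\<close>, within the cone of piece \<open>i\<close>, is possible for a short piece of \<open>c\<close> around
  \<open>c(s)\<close>.
\<close>

definition translatable ::
  "('p, 'i, 'z) flat_pieces_scheme \<Rightarrow> 'p \<Rightarrow> real \<Rightarrow> 'i \<Rightarrow> real^2 \<Rightarrow> real^2 \<Rightarrow> bool" where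
  "translatable X x s i u n \<longleftrightarrow>
     (\<exists>d>0. \<forall>t. \<bar>t - s\<bar> < d \<longrightarrow> t *\<^sub>R u + n \<in> tcone X x i)"

definition extends_translate ::
  "('p, 'i, 'z) flat_pieces_scheme \<Rightarrow> 'p \<Rightarrow> real \<Rightarrow> 'i \<Rightarrow> real^2 \<Rightarrow> real^2 \<Rightarrow>
   (real \<Rightarrow> ('i \<times> (real^2)) set) \<Rightarrow> bool" where
  "extends_translate X x s i u n \<gamma> \<longleftrightarrow>
     geodesic (tangent_cone X x) \<gamma> \<and> (\<forall>t. \<gamma> t \<noteq> apex X x) \<and>
     (\<exists>d>0. \<forall>t. \<bar>t - s\<bar> < d \<longrightarrow> \<gamma> t = tpoint X x i (t *\<^sub>R u + n))"

text \<open>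
  \<open>side_rotation X x \<epsilon> s i u \<sigma> A\<close>: all sufficiently small translates to the left (\<open>\<sigma> = 1\<close>) or to
  the right (\<open>\<sigma> = -1\<close>) of the ray of \<open>u\<close> extend to geodesics avoiding the apex, whose projection
  to the indicatrix of sign \<open>-s\<close> has arc length \<open>A\<close>. If the ray lies on an edge, it has a
  representative \<open>j, u'\<close> in each of the two adjacent cones, one of which contains the left and
  the other one the right translates.
\<close>

definition side_rotation ::
  "('p, 'i, 'z) flat_pieces_scheme \<Rightarrow> 'p \<Rightarrow> ('i \<Rightarrow> real) \<Rightarrow> real \<Rightarrow> 'i \<Rightarrow> real^2 \<Rightarrow>
   real \<Rightarrow> real \<Rightarrow> bool" where
  "side_rotation X x \<epsilon> s i u \<sigma> A \<longleftrightarrow>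
     (\<exists>\<delta>>0. \<forall>j u' n.
        j \<in> star X x \<and> s *\<^sub>R u' \<in> tcone X x j \<and> tpoint X x j (s *\<^sub>R u') = tpoint X x i (s *\<^sub>R u) \<and>
        norm n < \<delta> \<and> 0 < \<sigma> * (\<epsilon> j * cross2 u' n) \<and> translatable X x s j u' n \<longrightarrow>
        (\<exists>\<gamma>. extends_translate X x s j u' n \<gamma>) \<and>
        (\<forall>\<gamma>. extends_translate X x s j u' n \<gamma> \<longrightarrow> has_rotation X x (- s) \<gamma> A))"

text \<open>\<open>k = K(x, u)\<close>, for \<open>u\<close> incoming (\<open>s = -1\<close>) or outgoing (\<open>s = 1\<close>).\<close>

definition has_dir_curvature ::
  "('p, 'i, 'z) flat_pieces_scheme \<Rightarrow> 'p \<Rightarrow> real \<Rightarrow> 'i \<Rightarrow> real^2 \<Rightarrow> real \<Rightarrow> bool" where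
  "has_dir_curvature X x s i u k \<longleftrightarrow>
     (\<exists>\<epsilon> A B. cone_orientation X x \<epsilon> \<and>
        side_rotation X x \<epsilon> s i u 1 A \<and> side_rotation X x \<epsilon> s i u (-1) B \<and>
        k = A + B - total_angle X (- s) x)"

definition curvature :: "('p, 'i, 'z) flat_pieces_scheme \<Rightarrow> 'p \<Rightarrow> real" where
  "curvature X x =
     (if x \<in> vertices X
      then (THE k. \<forall>s\<in>{1, -1}. \<forall>i\<in>star X x. \<forall>u\<in>indicatrix X s x i. has_dir_curvature X x s i u k)
      else 0)"

end

theory Submission
  imports Defs
begin

text \<open>
  Write \<open>\<nu>\<^sub>i(S)\<close> for the arc length of the part of the indicatrix of \<open>F\<^sub>i\<close> in a cone \<open>S\<close>; it is additive
  in \<open>S\<close>. The Landsberg isometry pairs directions as a refracted geodesic does, so a geodesic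
  crossing an edge sweeps equal angles on both sides, and \<open>\<nu>\<close> of an outer half plane in one triangle
  is \<open>\<nu>\<close> of the inner half plane in the next one. Hence \<open>\<theta> = \<nu>\<^sub>i(\<real>\<^sup>2)\<close> does not depend on the triangle, and
  a geodesic passing a vertex \<open>x\<close> close to a given ray sweeps, on either side, the angle of a
  half plane bounded by that ray, the two half planes adding up to \<open>\<theta>\<close>. So \<open>K(x)\<close> is \<open>\<theta>\<close> minus the
  total angle at \<open>x\<close>, for both signs of the indicatrix.

  The three cones at the corners of a triangle and their negatives tile the plane, so the two total
  angles of all vertices add up to \<open>F \<theta>\<close>, \<open>F\<close> the number of triangles. With \<open>2 E = 3 F\<close> this gives
  \<open>2 \<Sum> K(x) = 2 V \<theta> - F \<theta> = 2 \<theta> (V - E + F)\<close>.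

  That the refracted curves are geodesics is shown by calibration: functions
  that grow along every curve at most at the rate of its length, with equality on the geodesic.
\<close>

text \<open>The definition of \<open>curvature\<close> quantifies over all geodesics that extend a
  translate, so it is not enough to construct one. A unit speed minimizing curve that agrees with a
  refracted line for a moment follows it forever: inside a cone by the equality case of the triangle
  inequality, at a ray because the crossing point is a critical point of length, and strict
  convexity leaves one outgoing direction. The construction ends after finitely many rays because
  the angle still to be swept is carried unchanged across a ray and drops by the full angle of every
  cone that is traversed. Norms need not be reversible: outgoing rays are treated by reversing time
  and norms together, which reads the Landsberg isometry backwards and so needs its surjectivity.
  \<open>K\<close> combines incoming rays with outgoing angles and conversely, so a single value
  also requires both total angles of a vertex to agree. The topology of the surface enters in two
  ways: exactly two triangles meet along an edge, and triangles are connected through edges, not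
  merely through vertices.\<close>

notation scaleR (infixr "*." 75)

section \<open>The plane\<close>

lemma vec2_eq_iff: "(u::real^2) = v \<longleftrightarrow> u$1 = v$1 \<and> u$2 = v$2"
 by (simp add: vec_eq_iff forall_2)

lemma cross2_simps [simp]:
 "cross2 u u = 0" "cross2 0 u = 0" "cross2 u 0 = 0"
 "cross2 (a *. u) v = a * cross2 u v" "cross2 u (a *. v) = a * cross2 u v"
 "cross2 (-u) v = - cross2 u v" "cross2 u (-v) = - cross2 u v"
 by (simp_all add: cross2_def algebra_simps)

lemma cross2_add:
 "cross2 (u + v) w = cross2 u w + cross2 v w" "cross2 w (u + v) = cross2 w u + cross2 w v"
 "cross2 (u - v) w = cross2 u w - cross2 v w" "cross2 w (u - v) = cross2 w u - cross2 w v"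
 by (simp_all add: cross2_def algebra_simps)

lemma cross2_commute: "cross2 u v = - cross2 v u"
 by (simp add: cross2_def)

text \<open>Cramer's rule. Multiplied by the determinant it is a polynomial identity, which is
  checked first.\<close>

lemma cross2_decomp:
 assumes "cross2 a b ~= 0"
 shows "w = (cross2 w b / cross2 a b) *. a + (cross2 a w / cross2 a b) *. b"
proof -
 have "cross2 a b *. w = cross2 w b *. a + cross2 a w *. b"
  by (simp add: vec2_eq_iff cross2_def algebra_simps)
 then have "(1 / cross2 a b) *. (cross2 a b *. w)
   = (1 / cross2 a b) *. (cross2 w b *. a + cross2 a w *. b)" by simp
 then show ?thesis using assms by (simp add: scaleR_add_right)
qed

lemma cross2_eq_0_iff:
 assumes "y ~= 0"
 shows "cross2 y w = 0 \<longleftrightarrow> (\<exists>c. w = c *. y)"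
proof
 assume c: "cross2 y w = 0"
 show "\<exists>c. w = c *. y"
 proof (cases "y$1 = 0")
  case True
  then have "y$2 ~= 0" using assms by (simp add: vec2_eq_iff)
  then show ?thesis using c True
   by (intro exI[of _ "w$2 / y$2"]) (auto simp: vec2_eq_iff cross2_def)
 next
  case False
  then show ?thesis using c
   by (intro exI[of _ "w$1 / y$1"]) (auto simp: vec2_eq_iff cross2_def field_simps)
 qed
qed auto

lemma continuous_on_cross2 [continuous_intros]:
 "continuous_on S f ==> continuous_on S g ==> continuous_on S (\<lambda>x. cross2 (f x) (g x))"
 unfolding cross2_def by (intro continuous_intros)

lemma DERIV_transform_ev:
 fixes f :: "real => real"
 shows "(f has_real_derivative D) (at x) ==> eventually (\<lambda>t. f t = g t) (nhds x) ==>
  (g has_real_derivative D) (at x)"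
 using DERIV_cong_ev[OF refl _ refl, of f g x D] by auto

section \<open>Minkowski norms\<close>

text \<open>For a unit vector \<open>u\<close> this covector is the pairing
  \<open>fund_form F u u\<close> (see \<open>fund_form_self\<close>), so the Landsberg
  correspondence matches the values of \<open>dn\<close> on the edge.\<close>

definition dn :: "(real^2 => real) => real^2 => real^2 => real" where
 "dn F y = frechet_derivative F (at y)"

definition hess :: "(real^2 => real) => real^2 => real^2 => real^2 => real" where
 "hess F y u v = frechet_derivative (\<lambda>x. dn F x v) (at y) u"

text \<open>The differential turned by a quarter turn: a tangent of the level curve, normalised by
  \<open>cross2 y (tau F y) = F y\<close> for nonzero \<open>y\<close> (Euler's relation).\<close>

definition tau :: "(real^2 => real) => real^2 => real^2" where
 "tau F y = vector [- dn F y (axis 2 1), dn F y (axis 1 1)]"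

text \<open>What the theory of geodesics uses: first derivatives and strict convexity, the latter in
  the form that the supporting covector at \<open>y\<close> touches \<open>F\<close> only along the
  ray of \<open>y\<close>. The class is closed under reversal of the norm
  (\<open>conv_norm_reverse\<close>).\<close>

locale conv_norm =
 fixes F :: "real^2 => real"
 assumes cont: "continuous_on UNIV F"
  and pos: "y ~= 0 ==> 0 < F y"
  and hom: "0 <= c ==> F (c *. y) = c * F y"
  and diff: "y ~= 0 ==> F differentiable (at y)"
  and dn_less: "y ~= 0 ==> (\<And>c. 0 <= c ==> w ~= c *. y) ==> dn F y w < F w"

text \<open>The calculus common to both norm locales. It is kept apart from convexity because it is
  used in the proof that \<open>minkowski\<close> norms satisfy \<open>conv_norm\<close>.\<close>

locale diff_norm =
 fixes F :: "real^2 => real"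
 assumes pos': "y ~= 0 ==> 0 < F y"
  and hom': "0 <= c ==> F (c *. y) = c * F y"
  and diff': "y ~= 0 ==> F differentiable (at y)"
begin

lemma zero [simp]: "F 0 = 0"
 using hom'[of 0 0] by simp

lemma nonneg: "0 <= F y"
 by (cases "y = 0") (auto simp: pos' less_imp_le)

lemma eq_0_iff [simp]: "F y = 0 \<longleftrightarrow> y = 0"
 using pos'[of y] by (cases "y = 0") auto

lemma has_der: "y ~= 0 ==> (F has_derivative dn F y) (at y)"
 unfolding dn_def using diff' frechet_derivative_works by blast

lemma dn_bl: "y ~= 0 ==> bounded_linear (dn F y)"
 using has_der has_derivative_bounded_linear by blast

lemma dn_lin:
 assumes "y ~= 0"
 shows "dn F y (u + v) = dn F y u + dn F y v" "dn F y (c *. u) = c * dn F y u"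
  "dn F y (u - v) = dn F y u - dn F y v" "dn F y (- u) = - dn F y u" "dn F y 0 = 0"
proof -
 interpret b: bounded_linear "dn F y" using assms by (rule dn_bl)
 show "dn F y (u + v) = dn F y u + dn F y v" "dn F y (c *. u) = c * dn F y u"
  "dn F y (u - v) = dn F y u - dn F y v" "dn F y (- u) = - dn F y u" "dn F y 0 = 0"
  by (simp_all add: b.add b.scaleR b.diff b.neg b.zero)
qed

lemma dn_curve:
 assumes "(z has_vector_derivative z') (at t within S)" "z t ~= 0"
 shows "((\<lambda>t. F (z t)) has_real_derivative dn F (z t) z') (at t within S)"
proof -
 have "((\<lambda>t. F (z t)) has_derivative (\<lambda>h. dn F (z t) (h *. z'))) (at t within S)"
  using has_derivative_compose[OF assms(1)[unfolded has_vector_derivative_def] has_der[OF assms(2)]]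
  by simp
 moreover have "(\<lambda>h. dn F (z t) (h *. z')) = (*) (dn F (z t) z')"
  using assms(2) by (auto simp: dn_lin)
 ultimately show ?thesis by (simp add: has_field_derivative_def)
qed

lemma line_hvd: "((\<lambda>t. y + t *. v) has_vector_derivative v) (at t within S)"
 by (auto intro!: derivative_eq_intros)

lemma dn_line:
 "y + t *. v ~= 0 ==> ((\<lambda>t. F (y + t *. v)) has_real_derivative dn F (y + t *. v) v) (at t)"
 by (rule dn_curve) (auto intro: line_hvd)

lemma euler:
 assumes "y ~= 0"
 shows "dn F y y = F y"
proof -
 have "((\<lambda>t. F (0 + t *. y)) has_real_derivative dn F (0 + 1 *. y) y) (at 1)"
  using assms by (intro dn_line) auto
 moreover have "((\<lambda>t. F (0 + t *. y)) has_real_derivative F y) (at 1)"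
 proof (rule has_field_derivative_transform_within_open)
  show "((\<lambda>t. t * F y) has_real_derivative F y) (at 1)"
   by (auto intro!: derivative_eq_intros)
 qed (auto simp: hom' open_greaterThan intro: open_greaterThan[of 0])
 ultimately show ?thesis using DERIV_unique by fastforce
qed

lemma dn_scale:
 assumes "0 < c" "y ~= 0"
 shows "dn F (c *. y) v = dn F y v"
proof -
 have 1: "((\<lambda>t. F (c *. (y + t *. v))) has_real_derivative dn F (c *. (y + 0 *. v)) (c *. v)) (at 0)"
  using assms by (intro dn_curve) (auto intro!: derivative_eq_intros)
 have 2: "((\<lambda>t. c * F (y + t *. v)) has_real_derivative c * dn F (y + 0 *. v) v) (at 0)"
  using assms by (intro DERIV_cmult dn_line) auto
 show ?thesis using DERIV_unique[OF 1, of "c * dn F y v"] 2 assms by (simp add: hom' dn_lin)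
qed

lemma unit [simp]: "y ~= 0 ==> F (unit_vec F y) = 1"
 by (simp add: unit_vec_def hom' nonneg)

lemma unit_eq_0_iff [simp]: "unit_vec F y = 0 \<longleftrightarrow> y = 0"
 by (auto simp: unit_vec_def)

lemma unit_scale: "0 < c ==> unit_vec F (c *. y) = unit_vec F y"
 by (cases "y = 0") (auto simp: unit_vec_def hom' field_simps)

lemma unit_1: "F y = 1 ==> unit_vec F y = y"
 by (simp add: unit_vec_def)

lemma dn_coords: "y ~= 0 ==> dn F y v = v$1 * dn F y (axis 1 1) + v$2 * dn F y (axis 2 1)"
proof -
 assume y: "y ~= 0"
 have "v = v$1 *. axis 1 1 + v$2 *. axis 2 1" by (simp add: vec2_eq_iff axis_def)
 then have "dn F y v = dn F y (v$1 *. axis 1 1 + v$2 *. axis 2 1)" by (rule arg_cong)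
 also have "\<dots> = v$1 * dn F y (axis 1 1) + v$2 * dn F y (axis 2 1)" using y by (simp add: dn_lin)
 finally show "dn F y v = v$1 * dn F y (axis 1 1) + v$2 * dn F y (axis 2 1)" .
qed

text \<open>The kernel of \<open>dn F y\<close> is the line of \<open>tau F y\<close>, and
  \<open>cross2 y\<close> is the coordinate on it, since
  \<open>cross2 y (tau F y) = 1\<close>.\<close>

lemma tangent_eq:
 assumes "F y = 1" "dn F y D = 0"
 shows "D = cross2 y D *. tau F y"
proof -
 have y: "y ~= 0" using assms by auto
 define a b where "a = dn F y (axis 1 1)" and "b = dn F y (axis 2 1)"
 have 1: "y$1 * a + y$2 * b = 1"
  using euler[OF y] dn_coords[OF y, of y] assms by (simp add: a_def b_def)
 have 2: "D$1 * a + D$2 * b = 0"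
  using dn_coords[OF y, of D] assms by (simp add: a_def b_def)
 have "D$1 - cross2 y D * (- b) = - D$1 * (y$1 * a + y$2 * b - 1) + y$1 * (D$1 * a + D$2 * b)"
  "D$2 - cross2 y D * a = - D$2 * (y$1 * a + y$2 * b - 1) + y$2 * (D$1 * a + D$2 * b)"
  by (simp_all add: cross2_def algebra_simps)
 then have "D$1 = cross2 y D * (- b)" "D$2 = cross2 y D * a" using 1 2 by simp_all
 then show ?thesis by (simp add: vec2_eq_iff tau_def a_def b_def)
qed

end

sublocale conv_norm \<subseteq> diff_norm F
 by unfold_locales (auto simp: pos hom diff)

context conv_norm
begin

lemma dn_le: "y ~= 0 ==> dn F y w <= F w"
proof (cases "\<exists>c\<ge>0. w = c *. y")
 case True
 assume "y ~= 0"
 then show ?thesis using True by (auto simp: dn_lin euler hom)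
next
 case False
 assume "y ~= 0"
 then show ?thesis using dn_less[of y w] False by force
qed

lemma dn_ge: "y ~= 0 ==> - F (- w) <= dn F y w"
 using dn_le[of y "- w"] by (simp add: dn_lin)

text \<open>The supporting covector at \<open>u + v\<close> has the value \<open>F (u + v)\<close>
  there, so it must touch \<open>F\<close> at both summands, and strict convexity puts both on the
  ray of \<open>u + v\<close>.\<close>

lemma triangle_eq:
 assumes "F u + F v <= F (u + v)" "v ~= 0"
 shows "\<exists>c\<ge>0. u = c *. v"
proof (cases "u + v = 0")
 case True
 then show ?thesis using assms pos[of v] nonneg[of u] by simp
next
 case nz: False
 have "dn F (u + v) u + dn F (u + v) v = F (u + v)"
  using euler[OF nz] by (simp add: dn_lin nz)
 then have "dn F (u + v) u = F u" "dn F (u + v) v = F v"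
  using dn_le[OF nz, of u] dn_le[OF nz, of v] assms by linarith+
 then obtain c d where c: "c \<ge> 0" "u = c *. (u + v)" "d \<ge> 0" "v = d *. (u + v)"
  using dn_less[OF nz] by (metis less_irrefl)
 then have "d ~= 0" using assms by auto
 then have "u + v = (1 / d) *. v" using c(4) by (metis divide_inverse inverse_eq_divide mult_1 scaleR_one scaleR_scaleR left_inverse)
 then have "u = (c / d) *. v" using c(2) by (metis mult.right_neutral scaleR_scaleR times_divide_eq_right)
 then show ?thesis using c by (intro exI[of _ "c / d"]) auto
qed

text \<open>Two unit vectors on the same side of \<open>e\<close> with the same pairing with \<open>e\<close> agree: otherwise the
 difference of their differentials, a multiple of \<open>cross2 e\<close>, would take opposite signs on them.\<close>

lemma dn_inj:
 assumes e: "e ~= 0" and "F v = 1" "F w = 1" and eq: "dn F v e = dn F w e"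
  and side: "0 <= \<eta> * cross2 e v" "0 <= \<eta> * cross2 e w" "\<eta> ~= 0"
 shows "v = w"
proof (rule ccontr)
 assume ne: "v ~= w"
 have v: "v ~= 0" and w: "w ~= 0" using assms by auto
 have *: "\<And>x y c. F x = 1 ==> F y = 1 ==> x ~= y ==> c \<ge> 0 ==> x ~= c *. y"
  by (auto simp: hom)
 have 1: "dn F v w < 1" "dn F w v < 1"
  using dn_less[OF v, of w] dn_less[OF w, of v] *[of w v] *[of v w] assms ne by auto
 define g where "g x = dn F v x - dn F w x" for x
 have g: "g (x + y) = g x + g y" "g (c *. x) = c * g x" for x y c
  by (auto simp: g_def dn_lin v w algebra_simps)
 have ge: "g e = 0" using eq by (simp add: g_def)
 have gv: "g v > 0" "g w < 0" using 1 euler[OF v] euler[OF w] assms by (auto simp: g_def)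
 have cv: "cross2 e v ~= 0"
 proof
  assume "cross2 e v = 0"
  then obtain c where "v = c *. e" using cross2_eq_0_iff[OF e] by auto
  then show False using gv g(2) ge by simp
 qed
 have "w = (cross2 w v / cross2 e v) *. e + (cross2 e w / cross2 e v) *. v"
  by (rule cross2_decomp[OF cv])
 then have gw: "g w = (cross2 e w / cross2 e v) * g v" using g ge by (metis add_0 mult_zero_right)
 moreover have "cross2 e w / cross2 e v \<ge> 0"
  using side cv by (auto simp: zero_le_divide_iff zero_le_mult_iff)
 ultimately have "g w \<ge> 0" unfolding gw using gv by (intro mult_nonneg_nonneg) auto
 then show False using gv by simp
qed

end

locale minkowski =
 fixes F :: "real^2 => real"
 assumes mink: "minkowski_norm F"

sublocale minkowski \<subseteq> diff_norm F
proof
 show "F differentiable (at y)" if "y ~= 0" for y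
 proof -
  have "Ck_on (Suc 0) F (- {0})" using mink unfolding minkowski_norm_def smooth_on_def by blast
  then show ?thesis using that by simp
 qed
qed (use mink in \<open>auto simp: minkowski_norm_def\<close>)

context minkowski
begin

lemma Ck2: "Ck_on (Suc (Suc 0)) F (- {0})"
 using mink unfolding minkowski_norm_def smooth_on_def by blast

lemma continuous_on_F [continuous_intros]: "continuous_on S f ==> continuous_on S (\<lambda>x. F (f x))"
 using mink unfolding minkowski_norm_def by (metis continuous_on_compose2 subset_UNIV)

lemma dn_differentiable: "y ~= 0 ==> (\<lambda>x. dn F x v) differentiable (at y)"
 using Ck2 by (simp add: dn_def)

lemma continuous_on_hess: "continuous_on (- {0}) (\<lambda>x. hess F x u v)"
 using Ck2 by (simp add: dn_def hess_def)

lemma continuous_on_dn: "continuous_on (- {0}) (\<lambda>x. dn F x v)"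
 by (intro continuous_at_imp_continuous_on ballI differentiable_imp_continuous_within dn_differentiable) simp

lemma hess_line:
 assumes "y + t *. u ~= 0"
 shows "((\<lambda>t. dn F (y + t *. u) v) has_real_derivative hess F (y + t *. u) u v) (at t)"
proof -
 let ?z = "y + t *. u"
 have d: "((\<lambda>x. dn F x v) has_derivative (\<lambda>w. hess F ?z w v)) (at ?z)"
  unfolding hess_def using dn_differentiable[OF assms] frechet_derivative_works by blast
 then have l: "linear (\<lambda>w. hess F ?z w v)" by (rule has_derivative_linear)
 have "((\<lambda>t. dn F (y + t *. u) v) has_derivative (\<lambda>h. hess F ?z (h *. u) v)) (at t)"
  using has_derivative_compose[OF line_hvd[unfolded has_vector_derivative_def] d] by simp
 moreover have "(\<lambda>h. hess F ?z (h *. u) v) = (*) (hess F ?z u v)"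
  using linear_scale[OF l] by (auto simp: mult.commute)
 ultimately show ?thesis by (simp add: has_field_derivative_def)
qed

lemma hess_scale1:
 assumes "y ~= 0"
 shows "hess F y (c *. u) v = c * hess F y u v"
proof -
 have "((\<lambda>x. dn F x v) has_derivative (\<lambda>w. hess F y w v)) (at y)"
  unfolding hess_def using dn_differentiable[OF assms] frechet_derivative_works by blast
 then show ?thesis using linear_scale[OF has_derivative_linear] by fastforce
qed

lemma hess_add1:
 assumes "y ~= 0"
 shows "hess F y (u + u') v = hess F y u v + hess F y u' v"
proof -
 have "((\<lambda>x. dn F x v) has_derivative (\<lambda>w. hess F y w v)) (at y)"
  unfolding hess_def using dn_differentiable[OF assms] frechet_derivative_works by blast
 then show ?thesis using linear_add[OF has_derivative_linear] by fastforce
qed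

lemma hess_0line:
 assumes "y ~= 0"
 shows "((\<lambda>t. dn F (y + t *. u) v) has_real_derivative hess F y u v) (at 0)"
 using hess_line[of y 0 u v] assms by simp

lemma eventually_line_nz:
 assumes "y ~= (0::real^2)"
 shows "eventually (\<lambda>t. y + t *. u ~= 0) (nhds (0::real))"
proof -
 have "((\<lambda>t. y + t *. u) \<longlongrightarrow> y + 0 *. u) (nhds (0::real))"
  by (intro tendsto_intros filterlim_ident)
 then have "((\<lambda>t. y + t *. u) \<longlongrightarrow> y) (nhds (0::real))" by simp
 then show ?thesis using assms tendsto_imp_eventually_ne by blast
qed

lemma hess_lin2:
 assumes "y ~= 0"
 shows "hess F y u (c *. v) = c * hess F y u v" "hess F y u (v + v') = hess F y u v + hess F y u v'"
proof -
 have ev: "eventually (\<lambda>t. y + t *. u ~= 0) (nhds (0::real))" using assms by (rule eventually_line_nz)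
 have "((\<lambda>t. dn F (y + t *. u) (c *. v)) has_real_derivative c * hess F y u v) (at 0)"
  by (rule DERIV_transform_ev[OF DERIV_cmult[OF hess_0line[OF assms, of u v], of c]])
   (use ev in \<open>auto elim!: eventually_mono simp: dn_lin\<close>)
 then show "hess F y u (c *. v) = c * hess F y u v"
  using DERIV_unique[OF hess_0line[OF assms]] by blast
 have "((\<lambda>t. dn F (y + t *. u) (v + v')) has_real_derivative hess F y u v + hess F y u v') (at 0)"
  by (rule DERIV_transform_ev[OF DERIV_add[OF hess_0line[OF assms, of u v] hess_0line[OF assms, of u v']]])
   (use ev in \<open>auto elim!: eventually_mono simp: dn_lin\<close>)
 then show "hess F y u (v + v') = hess F y u v + hess F y u v'"
  using DERIV_unique[OF hess_0line[OF assms]] by blast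
qed

lemma inner_deriv:
 assumes "z ~= 0"
 shows "deriv (\<lambda>t. (F (z + t *. v))\<^sup>2) 0 = 2 * F z * dn F z v"
proof -
 have "((\<lambda>t. F (z + t *. v)) has_real_derivative dn F z v) (at 0)"
  using dn_line[of z 0 v] assms by simp
 then have "((\<lambda>t. (F (z + t *. v))\<^sup>2) has_real_derivative 2 * F z * dn F z v) (at 0)"
  by (auto intro!: derivative_eq_intros)
 then show ?thesis by (rule DERIV_imp_deriv)
qed

text \<open>The product rule for half the square of \<open>F\<close>. The inner derivative is
  computed only off the origin, so the outer one compares germs.\<close>

lemma fund_form_eq:
 assumes "y ~= 0"
 shows "fund_form F y u v = dn F y u * dn F y v + F y * hess F y u v"
proof -
 have ev: "eventually (\<lambda>t. y + t *. u ~= 0) (nhds (0::real))" using assms by (rule eventually_line_nz)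
 have "((\<lambda>s. F (y + s *. u)) has_real_derivative dn F y u) (at 0)"
  using dn_line[of y 0 u] assms by simp
 then have "((\<lambda>s. 2 * F (y + s *. u) * dn F (y + s *. u) v) has_real_derivative
   2 * (dn F y u * dn F y v + F y * hess F y u v)) (at 0)"
  using hess_0line[OF assms, of u v] by (auto intro!: derivative_eq_intros simp: algebra_simps)
 then have "deriv (\<lambda>s. 2 * F (y + s *. u) * dn F (y + s *. u) v) 0
   = 2 * (dn F y u * dn F y v + F y * hess F y u v)" by (rule DERIV_imp_deriv)
 moreover have "deriv (\<lambda>s. deriv (\<lambda>t. (F (y + s *. u + t *. v))\<^sup>2) 0) 0
   = deriv (\<lambda>s. 2 * F (y + s *. u) * dn F (y + s *. u) v) 0"
  using ev by (intro deriv_cong_ev refl) (auto elim!: eventually_mono simp: inner_deriv)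
 ultimately show ?thesis by (simp add: fund_form_def)
qed

lemma fund_form_pos: "y ~= 0 ==> u ~= 0 ==> 0 < fund_form F y u u"
 using mink unfolding minkowski_norm_def by blast

lemma fund_form_scale: "y ~= 0 ==> fund_form F y (c *. u) (c *. u) = c\<^sup>2 * fund_form F y u u"
 by (simp add: fund_form_eq dn_lin hess_scale1 hess_lin2 power2_eq_square algebra_simps)

text \<open>\<open>dn\<close> is homogeneous of degree 0, so it is constant along the ray of
  \<open>u\<close>.\<close>

lemma hess_self: "u ~= 0 ==> hess F u u v = 0"
proof -
 assume u: "u ~= 0"
 have "((\<lambda>t. dn F (u + t *. u) v) has_real_derivative 0) (at 0)"
 proof (rule has_field_derivative_transform_within_open[where S = "{-1<..<1}"])
  show "((\<lambda>t. dn F u v) has_real_derivative 0) (at 0)" by simp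
  show "dn F u v = dn F (u + x *. u) v" if "x \<in> {-1<..<1}" for x
   using dn_scale[of "1 + x" u v] u that by (simp add: scaleR_add_left)
 qed auto
 then show ?thesis using DERIV_unique[OF hess_0line[OF u]] by blast
qed

lemma fund_form_self: "u ~= 0 ==> fund_form F u u v = F u * dn F u v"
 by (simp add: fund_form_eq hess_self euler)

text \<open>Strict convexity of \<open>F\<^sup>2\<close> along the segment joining two independent unit vectors.\<close>

lemma dn_less_unit:
 assumes "F y = 1" "F w = 1" "cross2 y w ~= 0"
 shows "dn F y w < 1"
proof -
 define d where "d = w - y"
 have nz: "y + t *. d ~= 0" for t
 proof
  assume "y + t *. d = 0"
  then have "cross2 (y + t *. d) d = 0" by simp
  then show False using assms cross2_commute[of w y] by (simp add: cross2_add d_def algebra_simps)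
 qed
 have d0: "d ~= 0" using assms by (auto simp: d_def)
 define f where "f t = (F (y + t *. d))\<^sup>2" for t
 define f' where "f' t = 2 * F (y + t *. d) * dn F (y + t *. d) d" for t
 have 1: "(f has_real_derivative f' t) (at t)" for t
  unfolding f_def f'_def by (rule derivative_eq_intros dn_line nz refl | simp)+
 have 2: "(f' has_real_derivative 2 * fund_form F (y + t *. d) d d) (at t)" for t
  unfolding f'_def fund_form_eq[OF nz]
  by (rule derivative_eq_intros dn_line hess_line nz refl | simp add: algebra_simps)+
 have inc: "f' 0 < f' t" if "0 < t" for t
  using DERIV_pos_imp_increasing[OF that, of f'] 2 fund_form_pos[OF nz d0]
  by (metis mult_pos_pos zero_less_numeral)
 obtain s where "0 < s" "s < 1" "f 1 - f 0 = (1 - 0) * f' s"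
  using MVT2[of 0 1 f f'] 1 by auto
 moreover have "f 1 = 1" "f 0 = 1" "f' 0 = 2 * dn F y d"
  using assms by (auto simp: f_def f'_def d_def)
 ultimately have "dn F y d < 0" using inc[of s] by simp
 moreover have "y ~= 0" using assms by auto
 ultimately show ?thesis using euler[of y] assms by (simp add: d_def dn_lin)
qed

end

text \<open>For independent vectors both are normalised and strict convexity on the segment between
  them applies. A parallel vector off the ray of \<open>y\<close> is a negative multiple, where
  \<open>dn\<close> is negative.\<close>

sublocale minkowski \<subseteq> conv_norm F
proof
 show "continuous_on UNIV F" using mink by (simp add: minkowski_norm_def)
next
 fix y w :: "real^2" assume y: "y ~= 0" and w: "\<And>c. 0 <= c ==> w ~= c *. y"
 have w0: "w ~= 0" using w[of 0] by auto
 show "dn F y w < F w"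
 proof (cases "cross2 y w = 0")
  case True
  then obtain c where c: "w = c *. y" using cross2_eq_0_iff[OF y] by auto
  then have "c < 0" using w[of c] by (meson not_le)
  then have "dn F y w < 0" using y c pos'[OF y] by (simp add: dn_lin euler mult_neg_pos)
  then show ?thesis using nonneg[of w] by linarith
 next
  case False
  have "cross2 (unit_vec F y) (unit_vec F w) ~= 0"
   using False y w0 by (simp add: unit_vec_def)
  then have "dn F (unit_vec F y) (unit_vec F w) < 1"
   using y w0 by (intro dn_less_unit) auto
  moreover have "dn F (unit_vec F y) (unit_vec F w) = dn F y w / F w"
   using y w0 by (simp add: unit_vec_def dn_scale dn_lin pos' divide_inverse mult.commute)
  ultimately show ?thesis using pos'[OF w0] by simp
 qed
qed (auto simp: pos' hom' diff')

section \<open>Arc length of the indicatrix\<close>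

text \<open>Density of the arc length with respect to the area form: a curve \<open>z\<close> projects to the indicatrix
 with speed \<open>\<bar>cross2 z z'\<bar> * kap F z\<close>.\<close>

definition kap :: "(real^2 => real) => real^2 => real" where
 "kap F z = sqrt (fund_form F (unit_vec F z) (tau F (unit_vec F z)) (tau F (unit_vec F z))) / (F z)\<^sup>2"

definition pol :: "real => real^2" where
 "pol \<phi> = vector [cos \<phi>, sin \<phi>]"

text \<open>The arc length of the part of the indicatrix in the cone \<open>S\<close>: along
  \<open>pol\<close> the factor \<open>cross2 z z'\<close> of the density is 1. Cutting off the
  integrand rather than the domain makes the dependence on \<open>S\<close> linear in its indicator
  function.\<close>

definition nu :: "(real^2 => real) => (real^2) set => real" where
 "nu F S = integral {0..2*pi} (\<lambda>\<phi>. if pol \<phi> \<in> S then kap F (pol \<phi>) else 0)"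

lemma pol_nth [simp]: "pol \<phi> $ 1 = cos \<phi>" "pol \<phi> $ 2 = sin \<phi>"
 by (simp_all add: pol_def)

lemma pol_nz [simp]: "pol \<phi> ~= 0"
proof
 assume "pol \<phi> = 0"
 then have "cos \<phi> = 0" "sin \<phi> = 0" by (metis pol_nth zero_index)+
 then show False using sin_zero_abs_cos_one by fastforce
qed

lemma cross2_pol: "cross2 (pol a) (pol b) = sin (b - a)"
 by (simp add: cross2_def sin_diff mult.commute)

lemma pol_hvd: "(pol has_vector_derivative vector [- sin \<phi>, cos \<phi>]) (at \<phi> within S)"
proof -
 have "pol = (\<lambda>\<phi>. cos \<phi> *. axis 1 1 + sin \<phi> *. axis 2 1)"
  by (auto simp: vec2_eq_iff axis_def)
 moreover have "vector [- sin \<phi>, cos \<phi>] = (cos \<phi> *. 0 + (- sin \<phi>) *. axis 1 1)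
   + (sin \<phi> *. 0 + cos \<phi> *. (axis 2 1 :: real^2))"
  by (auto simp: vec2_eq_iff axis_def)
 moreover have "((\<lambda>\<phi>. cos \<phi> *. axis 1 1 + sin \<phi> *. axis 2 1) has_vector_derivative
   ((cos \<phi> *. 0 + (- sin \<phi>) *. axis 1 1) + (sin \<phi> *. 0 + cos \<phi> *. (axis 2 1 :: real^2))))
   (at \<phi> within S)"
  by (intro has_vector_derivative_add has_vector_derivative_scaleR has_vector_derivative_const)
   (auto intro: DERIV_subset[OF DERIV_cos] DERIV_subset[OF DERIV_sin])
 ultimately show ?thesis by simp
qed

lemma continuous_on_pol [continuous_intros]:
 "continuous_on S f ==> continuous_on S (\<lambda>x. pol (f x))"
proof -
 assume "continuous_on S f"
 moreover have "continuous_on UNIV pol"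
  using pol_hvd has_vector_derivative_continuous by (intro continuous_at_imp_continuous_on) blast
 ultimately show ?thesis by (metis continuous_on_compose2 subset_UNIV)
qed

lemma pol_periodic: "pol (\<phi> + 2 * pi * of_int k) = pol \<phi>"
proof -
 have "sin (2 * pi * of_int k) = 0" "cos (2 * pi * of_int k) = 1"
  using sin_int_2pin[of k] cos_int_2pin[of k] by (simp_all add: mult.commute)
 then show ?thesis by (simp add: vec2_eq_iff sin_add cos_add)
qed

lemma norm2: "(norm (w::real^2))\<^sup>2 = (w$1)\<^sup>2 + (w$2)\<^sup>2"
 by (simp add: norm_vec_def L2_set_def sum_2)

lemma inner2: "(v::real^2) \<bullet> w = v$1 * w$1 + v$2 * w$2"
 by (simp add: inner_vec_def sum_2)

lemma polar_ex: "\<exists>\<alpha>. (w::real^2) = norm w *. pol \<alpha>"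
proof (cases "w = 0")
 case False
 then have "(w$1 / norm w)\<^sup>2 + (w$2 / norm w)\<^sup>2 = 1"
  unfolding power_divide add_divide_distrib[symmetric] norm2[symmetric] by simp
 then obtain t where t: "w$1 / norm w = cos t" "w$2 / norm w = sin t"
  using sincos_total_2pi by metis
 show ?thesis using False
  by (intro exI[of _ t]) (simp add: vec2_eq_iff t[symmetric])
qed simp

context minkowski
begin

lemma dn_tau: "y ~= 0 ==> dn F y (tau F y) = 0"
 by (subst dn_coords) (auto simp: tau_def)

lemma tau_nz: "y ~= 0 ==> tau F y ~= 0"
proof
 assume y: "y ~= 0" and "tau F y = 0"
 then have "dn F y (axis 1 1) = 0" "dn F y (axis 2 1) = 0"
  by (auto simp: tau_def vec2_eq_iff)
 then have "dn F y y = 0" using dn_coords[OF y, of y] by simp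
 then show False using euler[OF y] y by simp
qed

lemma kap_pos: "z ~= 0 ==> 0 < kap F z"
 unfolding kap_def by (intro divide_pos_pos) (auto intro!: fund_form_pos tau_nz pos')

lemma kap_scale: "0 < c ==> z ~= 0 ==> kap F (c *. z) = kap F z / c\<^sup>2"
 by (simp add: kap_def hom' unit_scale power_mult_distrib mult.commute)

lemma tangent_speed:
 assumes "F w = 1" "dn F w D = 0"
 shows "sqrt (fund_form F w D D) = \<bar>cross2 w D\<bar> * kap F w"
proof -
 have w: "w ~= 0" using assms by auto
 have "fund_form F w D D = fund_form F w (cross2 w D *. tau F w) (cross2 w D *. tau F w)"
  using tangent_eq[OF assms] by simp
 also have "\<dots> = (cross2 w D)\<^sup>2 * fund_form F w (tau F w) (tau F w)"
  by (rule fund_form_scale[OF w])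
 finally show ?thesis by (simp add: kap_def unit_1 assms real_sqrt_mult)
qed

text \<open>Normalising \<open>z\<close> adds a multiple of \<open>z\<close> to the velocity, which
  \<open>cross2\<close> does not see, and divides both vectors by \<open>F\<close>;
  \<open>kap\<close> is homogeneous of degree -2 and compensates the division.\<close>

lemma ind_speed_eq:
 assumes z: "(z has_vector_derivative z') (at t)" and nz: "z t ~= 0"
 shows "ind_speed F (\<lambda>t. unit_vec F (z t)) t = \<bar>cross2 (z t) z'\<bar> * kap F (z t)"
proof -
 let ?f = "F (z t)"
 define D where "D = (1 / ?f) *. z' + (- dn F (z t) z' / ?f\<^sup>2) *. z t"
 have f: "?f ~= 0" using nz by simp
 have "((\<lambda>t. inverse (F (z t))) has_real_derivative - dn F (z t) z' / ?f\<^sup>2) (at t)"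
  using DERIV_inverse_fun[OF dn_curve[OF z nz] f] by (simp add: power2_eq_square divide_inverse)
 from has_vector_derivative_scaleR[OF this z]
 have "((\<lambda>t. unit_vec F (z t)) has_vector_derivative D) (at t)"
  unfolding unit_vec_def D_def by (simp add: inverse_eq_divide)
 then have vd: "vector_derivative (\<lambda>t. unit_vec F (z t)) (at t) = D"
  by (rule vector_derivative_at)
 let ?y = "unit_vec F (z t)"
 have "dn F ?y D = dn F (z t) D"
  unfolding unit_vec_def using nz by (intro dn_scale) (auto simp: pos')
 also have "\<dots> = 0"
  unfolding D_def using f by (simp only: dn_lin(1,2)[OF nz] euler[OF nz]) (simp add: power2_eq_square)
 finally have "sqrt (fund_form F ?y D D) = \<bar>cross2 ?y D\<bar> * kap F ?y"
  using nz by (intro tangent_speed) auto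
 moreover have "cross2 ?y D = cross2 (z t) z' / ?f\<^sup>2"
  by (simp add: unit_vec_def D_def cross2_add power2_eq_square divide_inverse)
 moreover have "kap F ?y = kap F (z t) * ?f\<^sup>2"
  unfolding unit_vec_def using nz by (subst kap_scale) (auto simp: pos' power_inverse field_simps)
 ultimately show ?thesis using f by (simp add: ind_speed_def vd Let_def abs_divide)
qed

lemma continuous_on_kap: "continuous_on (- {0}) (kap F)"
proof -
 let ?e = "axis 1 1 :: real^2" and ?f = "axis 2 1 :: real^2"
 \<comment> \<open>\<open>q\<close> is the fundamental form on \<open>tau\<close>, expanded by
   bilinearity. It is a polynomial in \<open>F\<close> and in first and second derivatives of
   \<open>F\<close>, which are continuous off the origin.\<close>
 define q where "q y = F y * (dn F y ?f * dn F y ?f * hess F y ?e ?e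
   - dn F y ?f * dn F y ?e * hess F y ?e ?f - dn F y ?f * dn F y ?e * hess F y ?f ?e
   + dn F y ?e * dn F y ?e * hess F y ?f ?f)" for y
 have eq: "fund_form F y (tau F y) (tau F y) = q y" if y: "y ~= 0" for y
 proof -
  have t: "tau F y = (- dn F y ?f) *. ?e + dn F y ?e *. ?f"
   by (simp add: vec2_eq_iff tau_def axis_def)
  have "fund_form F y (tau F y) (tau F y) = F y * hess F y (tau F y) (tau F y)"
   using y by (simp add: fund_form_eq dn_tau)
  also have "hess F y (tau F y) (tau F y) = dn F y ?f * dn F y ?f * hess F y ?e ?e
   - dn F y ?f * dn F y ?e * hess F y ?e ?f - dn F y ?f * dn F y ?e * hess F y ?f ?e
   + dn F y ?e * dn F y ?e * hess F y ?f ?f"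
   unfolding t by (simp only: hess_add1[OF y] hess_scale1[OF y] hess_lin2[OF y]) (simp add: algebra_simps)
  finally show ?thesis by (simp add: q_def)
 qed
 have "continuous_on (- {0}) q"
  unfolding q_def by (intro continuous_intros continuous_on_dn continuous_on_hess)
 moreover have u: "continuous_on (- {0}) (unit_vec F)"
  unfolding unit_vec_def by (intro continuous_intros) auto
 ultimately have "continuous_on (- {0}) (\<lambda>z. q (unit_vec F z))"
  by (rule continuous_on_compose2) auto
 then have "continuous_on (- {0}) (\<lambda>z. sqrt (q (unit_vec F z)) / (F z)\<^sup>2)"
  by (intro continuous_intros) auto
 then show ?thesis
  by (rule continuous_on_eq) (auto simp: kap_def eq)
qed

lemma continuous_on_kap' [continuous_intros]:
 "continuous_on S f ==> (\<And>x. x \<in> S ==> f x ~= 0) ==> continuous_on S (\<lambda>x. kap F (f x))"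
 by (rule continuous_on_compose2[OF continuous_on_kap]) auto

lemma ind_arclen_nu:
 assumes "\<And>c w. 0 < c ==> w \<in> S ==> c *. w \<in> S"
 shows "ind_arclen F {u. u \<in> S \<and> F u = 1} = nu F S"
proof -
 let ?y = "\<lambda>\<phi>. unit_vec F (pol \<phi>)"
 have m: "?y \<phi> \<in> {u. u \<in> S \<and> F u = 1} \<longleftrightarrow> pol \<phi> \<in> S" for \<phi>
 proof -
  have "pol \<phi> \<in> S" if "unit_vec F (pol \<phi>) \<in> S"
   using assms[of "F (pol \<phi>)", OF _ that] by (simp add: unit_vec_def pos')
  then show ?thesis using assms[of "inverse (F (pol \<phi>))" "pol \<phi>"]
   by (auto simp: unit_vec_def hom' nonneg pos')
 qed
 have "ind_arclen F {u. u \<in> S \<and> F u = 1} = integral {\<phi> \<in> {0..2*pi}. pol \<phi> \<in> S} (ind_speed F ?y)"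
  unfolding ind_arclen_def Let_def by (simp only: pol_def[symmetric] m)
 also have "\<dots> = integral {\<phi> \<in> {0..2*pi}. pol \<phi> \<in> S} (\<lambda>\<phi>. kap F (pol \<phi>))"
  by (intro integral_cong, subst ind_speed_eq[OF pol_hvd])
   (auto simp: cross2_def simp flip: power2_eq_square)
 also have "\<dots> = integral {0..2*pi} (\<lambda>\<phi>. if \<phi> \<in> {\<phi> \<in> {0..2*pi}. pol \<phi> \<in> S} then kap F (pol \<phi>) else 0)"
  by (subst integral_restrict_Int) (auto intro: arg_cong2[where f = integral])
 also have "\<dots> = nu F S"
  unfolding nu_def by (rule integral_cong) auto
 finally show ?thesis .
qed

lemma integrable_nu:
 assumes "closed S"
 shows "(\<lambda>\<phi>. if pol \<phi> \<in> S then kap F (pol \<phi>) else 0) integrable_on {a..b}"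
proof -
 have "closed (pol -` S)"
  using assms by (intro closed_vimage) (auto intro: continuous_intros)
 then have "compact ({a..b} \<inter> pol -` S)" by (intro compact_Int_closed) auto
 moreover have "continuous_on ({a..b} \<inter> pol -` S) (\<lambda>\<phi>. kap F (pol \<phi>))"
  by (intro continuous_intros) auto
 ultimately have "(\<lambda>\<phi>. kap F (pol \<phi>)) integrable_on ({a..b} \<inter> pol -` S)"
  by (intro set_borel_integral_eq_integral(1)) (unfold set_integrable_def, rule borel_integrable_compact)
 then have "(\<lambda>\<phi>. if \<phi> \<in> pol -` S then kap F (pol \<phi>) else 0) integrable_on {a..b}"
  by (subst integrable_restrict_Int) (simp add: Int_commute)
 then show ?thesis by simp
qed

text \<open>By periodicity the integral over a full turn may start at any angle
  \<open>\<alpha>\<close> and run in either sense \<open>\<eta>\<close>.\<close>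

lemma has_integral_nu:
 assumes S: "closed S" and \<eta>: "\<eta> = 1 \<or> \<eta> = -1"
 shows "((\<lambda>s. if pol (\<alpha> + \<eta> * s) \<in> S then kap F (pol (\<alpha> + \<eta> * s)) else 0) has_integral nu F S) {0..2*pi}"
proof -
 define g where "g \<phi> = (if pol \<phi> \<in> S then kap F (pol \<phi>) else 0)" for \<phi>
 have int: "g integrable_on {a..b}" for a b unfolding g_def by (rule integrable_nu[OF S])
 have per: "g (x + 2 * pi * of_int k) = g x" for x k by (simp add: g_def pol_periodic)
 have aff: "((\<lambda>x. g (m * x + c)) has_integral integral {a..b} g) ((\<lambda>x. m * x - m * c) ` {a..b})"
  if "m = 1 \<or> m = -1" for m c a b
  using has_integral_affinity[of g "integral {a..b} g" a b m c] int[of a b] that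
  by (auto simp: has_integral_integral[symmetric])
 have shift: "integral {a + 2 * pi * of_int k..b + 2 * pi * of_int k} g = integral {a..b} g" for a b k
 proof -
  have "(\<lambda>x. g (1 * x + - (2 * pi * of_int k))) = g" using per[of _ "- k"] by auto
  then have "(g has_integral integral {a..b} g) {a + 2 * pi * of_int k..b + 2 * pi * of_int k}"
   using aff[of 1 "- (2 * pi * of_int k)" a b] by (simp add: add.commute)
  then show ?thesis by (rule integral_unique)
 qed
 have base: "integral {a..a + 2 * pi} g = nu F S" for a
 proof -
  \<comment> \<open>\<open>2 * pi * k\<close> is the multiple of a full turn that is greater than
    \<open>a\<close> and at most \<open>a + 2 * pi\<close>; the part before it is shifted by one
    turn.\<close>
  define k where "k = floor (a / (2 * pi)) + 1"
  define c where "c = 2 * pi * of_int k"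
  have k: "of_int k - 1 <= a / (2 * pi)" "a / (2 * pi) < of_int k"
   unfolding k_def by linarith+
  have "a < c" "c <= a + 2 * pi"
   using k(2) k(1) by (simp_all add: c_def field_simps)
  then have "integral {a..a + 2 * pi} g = integral {a..c} g + integral {c..a + 2 * pi} g"
   using Henstock_Kurzweil_Integration.integral_combine[OF _ _ int] by simp
  also have "integral {a..c} g = integral {a + 2 * pi..c + 2 * pi} g" using shift[of a 1 c] by simp
  also have "\<dots> + integral {c..a + 2 * pi} g = integral {c..c + 2 * pi} g"
   using Henstock_Kurzweil_Integration.integral_combine[OF _ _ int, of c "a + 2 * pi" "c + 2 * pi"] \<open>a < c\<close> \<open>c <= a + 2 * pi\<close> by simp
  also have "\<dots> = integral {0..2 * pi} g" using shift[of 0 k "2 * pi"] by (simp add: c_def add.commute)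
  finally show ?thesis unfolding nu_def g_def .
 qed
 have "((\<lambda>s. g (\<alpha> + \<eta> * s)) has_integral nu F S) {0..2*pi}"
  using \<eta>
 proof
  assume "\<eta> = 1"
  then show ?thesis using aff[of 1 \<alpha> \<alpha> "\<alpha> + 2 * pi"] by (simp add: base add.commute)
 next
  assume "\<eta> = -1"
  then show ?thesis using aff[of "-1" \<alpha> "\<alpha> - 2 * pi" "\<alpha>"] base[of "\<alpha> - 2 * pi"]
   by (simp add: add.commute)
 qed
 then show ?thesis by (simp add: g_def)
qed

end

section \<open>Sectors and half planes\<close>

definition sec :: "real^2 => real^2 => (real^2) set" where
 "sec e z = {w. 0 <= cross2 e z * cross2 e w \<and> 0 <= cross2 e z * cross2 w z}"

definition hp :: "real^2 => real^2 => (real^2) set" where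
 "hp e z = {w. 0 <= cross2 e z * cross2 e w}"

lemma closed_sec: "closed (sec e z)"
 unfolding sec_def by (intro closed_Collect_conj closed_Collect_le continuous_intros)

lemma closed_hp: "closed (hp e z)"
 unfolding hp_def by (intro closed_Collect_le continuous_intros)

text \<open>The factor \<open>cross2 e z\<close> in both inequalities cancels the orientation, so a
  sector does not depend on the order of its rays.\<close>

lemma sec_commute: "sec e z = sec z e"
proof (rule set_eqI)
 fix w
 have "cross2 z e = - cross2 e z" "cross2 z w = - cross2 w z" "cross2 w e = - cross2 e w"
  by (rule cross2_commute)+
 then show "w \<in> sec e z \<longleftrightarrow> w \<in> sec z e" unfolding sec_def by auto
qed

lemma nonneg_cmult_iff: "0 < c ==> 0 <= c * x \<longleftrightarrow> 0 <= (x::real)"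
 by (simp add: zero_le_mult_iff)

lemma sec_scale:
 assumes "0 < a" "0 < b"
 shows "sec (a *. e) (b *. z) = sec e z"
proof (rule set_eqI)
 fix w
 have "cross2 (a *. e) (b *. z) * cross2 (a *. e) w = (a * b * a) * (cross2 e z * cross2 e w)"
  "cross2 (a *. e) (b *. z) * cross2 w (b *. z) = (a * b * b) * (cross2 e z * cross2 w z)"
  by simp_all
 then show "w \<in> sec (a *. e) (b *. z) \<longleftrightarrow> w \<in> sec e z"
  unfolding sec_def mem_Collect_eq using assms by (simp only: nonneg_cmult_iff mult_pos_pos)
qed

lemma mem_sec_uminus: "w \<in> sec (- e) (- z) \<longleftrightarrow> - w \<in> sec e z"
 by (simp add: sec_def)

lemma mem_sec_iff:
 assumes "cross2 p q ~= 0"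
 shows "x *. p + y *. q \<in> sec p q \<longleftrightarrow> 0 <= x \<and> 0 <= y"
proof -
 have "cross2 p q * cross2 p (x *. p + y *. q) = (cross2 p q * cross2 p q) * y"
  "cross2 p q * cross2 (x *. p + y *. q) q = (cross2 p q * cross2 p q) * x"
  by (simp_all add: cross2_add)
 moreover have "0 < cross2 p q * cross2 p q" using assms by (simp add: zero_less_mult_iff) linarith
 ultimately show ?thesis unfolding sec_def mem_Collect_eq by (simp only: nonneg_cmult_iff) auto
qed

lemma sec_eq:
 assumes "cross2 p q ~= 0"
 shows "sec p q = {x *. p + y *. q | x y. 0 <= x \<and> 0 <= y}"
proof (rule set_eqI)
 fix w
 obtain x y where w: "w = x *. p + y *. q" using cross2_decomp[OF assms] by metis
 show "w \<in> sec p q \<longleftrightarrow> w \<in> {x *. p + y *. q | x y. 0 <= x \<and> 0 <= y}"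
 proof
  assume "w \<in> sec p q"
  then show "w \<in> {x *. p + y *. q | x y. 0 <= x \<and> 0 <= y}"
   unfolding w mem_sec_iff[OF assms] by blast
 next
  assume "w \<in> {x *. p + y *. q | x y. 0 <= x \<and> 0 <= y}"
  then show "w \<in> sec p q" using mem_sec_iff[OF assms] by auto
 qed
qed

lemma finite_pol_line:
 assumes "a ~= 0"
 shows "finite {\<phi> \<in> {0..2*pi}. cross2 a (pol \<phi>) = 0}"
proof -
 obtain \<alpha> where \<alpha>: "a = norm a *. pol \<alpha>" using polar_ex by blast
 have "{\<phi> \<in> {0..2*pi}. cross2 a (pol \<phi>) = 0} \<subseteq> (\<lambda>i. \<alpha> + of_int i * pi) ` {\<lfloor>- \<alpha> / pi\<rfloor> - 1..\<lceil>(2 * pi - \<alpha>) / pi\<rceil> + 1}"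
 proof
  fix \<phi> assume "\<phi> \<in> {\<phi> \<in> {0..2*pi}. cross2 a (pol \<phi>) = 0}"
  then have \<phi>: "0 <= \<phi>" "\<phi> <= 2 * pi" "cross2 (norm a *. pol \<alpha>) (pol \<phi>) = 0" using \<alpha> by auto
  then have "sin (\<phi> - \<alpha>) = 0" using assms by (simp add: cross2_pol)
  then obtain i where i: "\<phi> - \<alpha> = of_int i * pi" using sin_zero_iff_int2 by blast
  then have "- \<alpha> / pi <= of_int i" "of_int i <= (2 * pi - \<alpha>) / pi" using \<phi> by (auto simp: field_simps)
  then have "i \<in> {\<lfloor>- \<alpha> / pi\<rfloor> - 1..\<lceil>(2 * pi - \<alpha>) / pi\<rceil> + 1}" by (simp, linarith)
  then show "\<phi> \<in> (\<lambda>i. \<alpha> + of_int i * pi) ` {\<lfloor>- \<alpha> / pi\<rfloor> - 1..\<lceil>(2 * pi - \<alpha>) / pi\<rceil> + 1}"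
   using i by (intro image_eqI[of _ _ i]) auto
 qed
 then show ?thesis by (rule finite_subset) simp
qed

text \<open>Arc length swept by a direction that starts at the polar angle \<open>\<alpha>\<close>
  and turns through \<open>\<psi>\<close> in the sense \<open>\<eta>\<close>, which is 1 or
  -1.\<close>

definition Phi :: "(real^2 => real) => real => real => real => real" where
 "Phi F \<alpha> \<eta> \<psi> = integral {0..\<psi>} (\<lambda>s. kap F (pol (\<alpha> + \<eta> * s)))"

definition ang :: "real^2 => real^2 => real" where
 "ang e z = arccos ((e \<bullet> z) / (norm e * norm z))"

lemma inner_cross2: "(e \<bullet> z)\<^sup>2 + (cross2 e z)\<^sup>2 = (norm e * norm z)\<^sup>2"
 unfolding power_mult_distrib norm2 inner2 cross2_def by (simp add: power2_eq_square algebra_simps)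

lemma cos_ang: "e ~= 0 ==> z ~= 0 ==> cos (ang e z) = (e \<bullet> z) / (norm e * norm z)"
 unfolding ang_def using Cauchy_Schwarz_ineq2[of e z]
 by (intro cos_arccos_abs) (simp add: abs_mult)

lemma ang_bounds: "e ~= 0 ==> z ~= 0 ==> 0 <= ang e z \<and> ang e z <= pi"
proof -
 assume "e ~= 0" "z ~= 0"
 then have "\<bar>(e \<bullet> z) / (norm e * norm z)\<bar> <= 1" using Cauchy_Schwarz_ineq2[of e z] by (simp add: abs_mult)
 then show ?thesis unfolding ang_def by (intro conjI arccos_lbound arccos_ubound) linarith+
qed

lemma sin_ang:
 assumes "e ~= 0" "z ~= 0"
 shows "sin (ang e z) = \<bar>cross2 e z\<bar> / (norm e * norm z)"
proof -
 have "(sin (ang e z))\<^sup>2 = 1 - (cos (ang e z))\<^sup>2" by (simp add: sin_squared_eq)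
 also have "\<dots> = (\<bar>cross2 e z\<bar> / (norm e * norm z))\<^sup>2"
  using inner_cross2[of e z] assms by (simp add: cos_ang power_divide field_simps)
 finally show ?thesis
  using ang_bounds[OF assms] by (intro power2_eq_imp_eq[of "sin (ang e z)"]) (auto intro: sin_ge_zero)
qed

lemma ang_polar:
 assumes e: "e ~= 0" "e = norm e *. pol \<alpha>" and z: "z ~= 0" and \<eta>: "\<eta> = 1 \<or> \<eta> = -1"
  and s: "0 <= \<eta> * cross2 e z"
 shows "z = norm z *. pol (\<alpha> + \<eta> * ang e z)"
proof -
 define c s where "c = cos \<alpha>" and "s = sin \<alpha>"
 have e12: "e$1 = norm e * c" "e$2 = norm e * s" using arg_cong[OF e(2), of "\<lambda>v. v$1"] arg_cong[OF e(2), of "\<lambda>v. v$2"]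
  by (simp_all add: c_def s_def)
 have cs: "c\<^sup>2 + s\<^sup>2 = 1" by (simp add: c_def s_def)
 have ne: "norm e ~= 0" "norm z ~= 0" using e z by auto
 have 1: "norm z * cos (ang e z) = c * z$1 + s * z$2"
  using ne e z by (simp add: cos_ang inner2 e12 field_simps)
 have "norm z * (\<eta> * sin (ang e z)) = \<eta> * (\<eta> * cross2 e z) / norm e"
  using ne e z s \<eta> by (auto simp: sin_ang abs_if field_simps)
 also have "\<dots> = c * z$2 - s * z$1"
  using ne \<eta> by (auto simp: cross2_def e12 field_simps)
 finally have 2: "norm z * (\<eta> * sin (ang e z)) = c * z$2 - s * z$1" .
 have sc: "sin (\<eta> * ang e z) = \<eta> * sin (ang e z)" "cos (\<eta> * ang e z) = cos (ang e z)" using \<eta> by auto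
 have "norm z * cos (\<alpha> + \<eta> * ang e z) = c * (norm z * cos (ang e z)) - s * (norm z * (\<eta> * sin (ang e z)))"
  by (simp add: cos_add sc c_def s_def algebra_simps)
 also have "\<dots> = (c\<^sup>2 + s\<^sup>2) * z$1" unfolding 1 2 by (simp add: power2_eq_square algebra_simps)
 finally have a: "norm z * cos (\<alpha> + \<eta> * ang e z) = z$1" using cs by simp
 have "norm z * sin (\<alpha> + \<eta> * ang e z) = s * (norm z * cos (ang e z)) + c * (norm z * (\<eta> * sin (ang e z)))"
  by (simp add: sin_add sc c_def s_def algebra_simps)
 also have "\<dots> = (c\<^sup>2 + s\<^sup>2) * z$2" unfolding 1 2 by (simp add: power2_eq_square algebra_simps)
 finally show ?thesis using a cs by (simp add: vec2_eq_iff)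
qed

lemma ang_pos:
 assumes "cross2 e z ~= 0"
 shows "0 < ang e z \<and> ang e z < pi"
proof -
 have nz: "e ~= 0" "z ~= 0" using assms by auto
 then have "sin (ang e z) > 0" using assms by (simp add: sin_ang)
 then have "ang e z ~= 0" "ang e z ~= pi" by auto
 then show ?thesis using ang_bounds[OF nz] by linarith
qed

lemma ang_scale: "0 < c ==> ang e (c *. z) = ang e z"
 by (simp add: ang_def)

lemma continuous_on_ang:
 assumes "e ~= 0" "continuous_on S f" "\<And>x. x \<in> S ==> f x ~= 0"
 shows "continuous_on S (\<lambda>x. ang e (f x))"
proof -
 have "\<bar>(e \<bullet> f x) / (norm e * norm (f x))\<bar> <= 1" if "x \<in> S" for x
  using Cauchy_Schwarz_ineq2[of e "f x"] assms(1) assms(3)[OF that] by (simp add: abs_mult)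
 then have "- 1 <= (e \<bullet> f x) / (norm e * norm (f x)) \<and> (e \<bullet> f x) / (norm e * norm (f x)) <= 1" if "x \<in> S" for x
  using that by (meson abs_le_D1 abs_le_D2 minus_le_iff)
 moreover have "continuous_on S (\<lambda>x. (e \<bullet> f x) / (norm e * norm (f x)))"
  using assms by (intro continuous_intros) auto
 ultimately show ?thesis unfolding ang_def by (intro continuous_on_arccos) auto
qed

lemma sec_pol_iff:
 assumes e: "e = r *. pol \<alpha>" "0 < r" and z: "z = q *. pol (\<alpha> + \<eta> * \<psi>)" "0 < q"
  and \<eta>: "\<eta> = 1 \<or> \<eta> = -1" and \<psi>: "0 < \<psi>" "\<psi> < pi" and s: "0 <= s" "s < 2 * pi"
 shows "pol (\<alpha> + \<eta> * s) \<in> sec e z \<longleftrightarrow> s <= \<psi>" "pol (\<alpha> + \<eta> * s) \<in> hp e z \<longleftrightarrow> s <= pi"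
proof -
 have 1: "cross2 e z * cross2 e (pol (\<alpha> + \<eta> * s)) = (r * q * r) * (sin \<psi> * sin s)"
  using \<eta> by (auto simp: e z cross2_pol)
 have 2: "cross2 e z * cross2 (pol (\<alpha> + \<eta> * s)) z = (r * q * q) * (sin \<psi> * sin (\<psi> - s))"
  using \<eta> sin_minus[of "\<psi> - s"] by (auto simp: e z cross2_pol)
 have sp: "0 < sin \<psi>" using \<psi> by (simp add: sin_gt_zero)
 have iff: "0 <= sin s \<longleftrightarrow> s <= pi"
  using sin_lt_zero[of s] sin_ge_zero[of s] s by force
 have "0 <= sin (\<psi> - s)" if "s <= \<psi>" using that \<psi> s by (intro sin_ge_zero) auto
 moreover have "s <= \<psi>" if "s <= pi" "0 <= sin (\<psi> - s)"
  using sin_gt_zero[of "s - \<psi>"] that \<psi> sin_minus[of "s - \<psi>"] by force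
 ultimately show "pol (\<alpha> + \<eta> * s) \<in> sec e z \<longleftrightarrow> s <= \<psi>" "pol (\<alpha> + \<eta> * s) \<in> hp e z \<longleftrightarrow> s <= pi"
  using iff \<psi> e z sp unfolding sec_def hp_def mem_Collect_eq 1 2
  by (auto simp: nonneg_cmult_iff mult_pos_pos)
qed

context minkowski
begin

lemma continuous_on_kap_pol: "continuous_on S (\<lambda>s. kap F (pol (\<alpha> + \<eta> * s)))"
 by (intro continuous_intros) auto

lemma Phi_deriv:
 assumes "0 < \<psi>"
 shows "(Phi F \<alpha> \<eta> has_real_derivative kap F (pol (\<alpha> + \<eta> * \<psi>))) (at \<psi>)"
proof -
 have "((\<lambda>x. integral {0..x} (\<lambda>s. kap F (pol (\<alpha> + \<eta> * s)))) has_real_derivative kap F (pol (\<alpha> + \<eta> * \<psi>)))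
   (at \<psi> within {0..\<psi> + 1})"
  using assms by (intro integral_has_real_derivative continuous_on_kap_pol) auto
 moreover have "at \<psi> within {0..\<psi> + 1} = at \<psi>" using assms by (intro at_within_interior) auto
 ultimately show ?thesis by (simp add: Phi_def[abs_def])
qed

lemma continuous_on_Phi: "continuous_on {0..b} (Phi F \<alpha> \<eta>)"
 unfolding Phi_def[abs_def]
 by (intro indefinite_integral_continuous_1 integrable_continuous_interval continuous_on_kap_pol)

lemma Phi_0 [simp]: "Phi F \<alpha> \<eta> 0 = 0"
 by (simp add: Phi_def)

lemma Phi_pos:
 assumes "0 < \<psi>"
 shows "0 < Phi F \<alpha> \<eta> \<psi>"
proof -
 have "Phi F \<alpha> \<eta> 0 < Phi F \<alpha> \<eta> \<psi>"
 proof (rule DERIV_pos_imp_increasing_open[OF assms _ continuous_on_Phi])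
  fix x :: real assume "0 < x"
  then show "\<exists>y. (Phi F \<alpha> \<eta> has_real_derivative y) (at x) \<and> 0 < y"
   using Phi_deriv kap_pos[OF pol_nz] by blast
 qed
 then show ?thesis by simp
qed

lemma nu_Phi:
 assumes S: "closed S" and \<eta>: "\<eta> = 1 \<or> \<eta> = -1" and \<psi>: "0 <= \<psi>" "\<psi> <= 2 * pi"
  and iff: "\<And>s. 0 <= s ==> s < 2 * pi ==> pol (\<alpha> + \<eta> * s) \<in> S \<longleftrightarrow> s <= \<psi>"
 shows "nu F S = Phi F \<alpha> \<eta> \<psi>"
proof -
 \<comment> \<open>At \<open>s = 2 * pi\<close> the direction of \<open>s = 0\<close> returns, so
   the description by \<open>s <= \<psi>\<close> may fail at this one point.\<close>
 have "((\<lambda>s. if s \<in> {0..\<psi>} then kap F (pol (\<alpha> + \<eta> * s)) else 0) has_integral nu F S) {0..2*pi}"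
  by (rule has_integral_spike_finite[OF _ _ has_integral_nu[OF S \<eta>], where S = "{2 * pi}"])
   (use iff in auto)
 then have "((\<lambda>s. kap F (pol (\<alpha> + \<eta> * s))) has_integral nu F S) {0..\<psi>}"
  using \<psi> by (subst (asm) has_integral_restrict) auto
 then show ?thesis unfolding Phi_def by (simp add: integral_unique)
qed

lemma nu_sec_ang:
 assumes e: "e = norm e *. pol \<alpha>" and \<eta>: "\<eta> = 1 \<or> \<eta> = -1" and s: "0 < \<eta> * cross2 e z"
 shows "nu F (sec e z) = Phi F \<alpha> \<eta> (ang e z)" "nu F (hp e z) = Phi F \<alpha> \<eta> pi"
proof -
 have nz: "e ~= 0" "z ~= 0" using s by auto
 have "cross2 e z ~= 0" using s by auto
 then have a: "0 < ang e z" "ang e z < pi" using ang_pos[of e z] by auto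
 have z: "z = norm z *. pol (\<alpha> + \<eta> * ang e z)" using nz s by (intro ang_polar[OF _ e _ \<eta>]) auto
 note * = sec_pol_iff[OF e _ z _ \<eta> a]
 show "nu F (sec e z) = Phi F \<alpha> \<eta> (ang e z)"
  using nz a by (intro nu_Phi[OF closed_sec \<eta>] *) auto
 show "nu F (hp e z) = Phi F \<alpha> \<eta> pi"
  using nz a by (intro nu_Phi[OF closed_hp \<eta>] *) auto
qed

lemma nu_sec_pos:
 assumes "cross2 p q ~= 0"
 shows "0 < nu F (sec p q)"
proof -
 obtain \<alpha> where \<alpha>: "p = norm p *. pol \<alpha>" using polar_ex by blast
 show ?thesis using nu_sec_ang(1)[OF \<alpha>, of "sgn (cross2 p q)" q] assms ang_pos[OF assms]
  by (auto simp: Phi_pos sgn_if mult_less_0_iff split: if_splits)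
qed

text \<open>A relation between indicator functions that holds off finitely many lines through the
  origin integrates to a relation between arc lengths, since each line meets the circle in finitely
  many angles.\<close>

lemma nu_linear_relation:
 assumes "finite K" "\<And>k. k \<in> K ==> closed (S k)" "finite L" "0 \<notin> L"
  and rel: "\<And>w. (\<And>a. a \<in> L ==> cross2 a w ~= 0) ==> (\<Sum>k\<in>K. c k * (if w \<in> S k then 1 else 0)) = (0::real)"
 shows "(\<Sum>k\<in>K. c k * nu F (S k)) = 0"
proof -
 let ?I = "\<lambda>k \<phi>. if pol \<phi> \<in> S k then kap F (pol \<phi>) else 0"
 have "((\<lambda>\<phi>. \<Sum>k\<in>K. c k * ?I k \<phi>) has_integral (\<Sum>k\<in>K. c k * nu F (S k))) {0..2*pi}"
  using assms(1,2) unfolding nu_def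
  by (intro has_integral_sum has_integral_mult_right integrable_integral integrable_nu) auto
 moreover have "((\<lambda>\<phi>. \<Sum>k\<in>K. c k * ?I k \<phi>) has_integral 0) {0..2*pi}"
 proof (rule has_integral_spike_finite[of "\<Union>a\<in>L. {\<phi> \<in> {0..2*pi}. cross2 a (pol \<phi>) = 0}"])
  show "finite (\<Union>a\<in>L. {\<phi> \<in> {0..2*pi}. cross2 a (pol \<phi>) = 0})"
   using assms(3,4) finite_pol_line by (intro finite_UN_I) metis+
  fix \<phi> assume "\<phi> \<in> {0..2*pi} - (\<Union>a\<in>L. {\<phi> \<in> {0..2*pi}. cross2 a (pol \<phi>) = 0})"
  then have "(\<Sum>k\<in>K. c k * (if pol \<phi> \<in> S k then 1 else 0)) = (0::real)" by (intro rel) auto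
  then have "kap F (pol \<phi>) * (\<Sum>k\<in>K. c k * (if pol \<phi> \<in> S k then 1 else 0)) = 0" by simp
  then show "(\<Sum>k\<in>K. c k * ?I k \<phi>) = 0"
   by (simp add: sum_distrib_left if_distrib mult.left_commute cong: if_cong sum.cong) (metis (no_types, lifting) mult.commute sum.cong)
 qed simp
 ultimately show ?thesis by (rule has_integral_unique)
qed

lemma nu_Un:
 assumes "closed S" "closed T" "finite L" "0 \<notin> L" "\<And>w. w \<in> S ==> w \<in> T ==> \<exists>a\<in>L. cross2 a w = 0"
 shows "nu F (S \<union> T) = nu F S + nu F T"
proof -
 \<comment> \<open>Additivity as a relation between three indicator functions: coefficient 1 for the
   union and -1 for each part. It may fail only where the parts overlap, which is on the lines of
   \<open>L\<close>.\<close>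
 define S' where "S' k = (if k = 0 then S \<union> T else if k = 1 then S else T)" for k :: nat
 define c where "c k = (if k = 0 then 1 else -1 :: real)" for k :: nat
 have "(\<Sum>k\<in>{0,1,2}. c k * nu F (S' k)) = 0"
  by (rule nu_linear_relation[where L = L]) (use assms in \<open>auto simp: S'_def c_def\<close>)
 then show ?thesis by (simp add: S'_def c_def)
qed

lemma nu_sec_split:
 assumes c: "cross2 p q ~= 0" and z: "z = a *. p + b *. q" and ab: "0 < a" "0 < b"
 shows "nu F (sec p q) = nu F (sec p z) + nu F (sec z q)"
proof -
 let ?D = "cross2 p q"
 have pz: "cross2 p z = b * ?D" and zq: "cross2 z q = a * ?D" by (simp_all add: z cross2_add)
 have D: "0 < ?D * ?D" using c by (simp add: zero_less_mult_iff) linarith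
 \<comment> \<open>In the coordinates of \<open>p\<close> and \<open>q\<close> the ray of
   \<open>z\<close> has the equation \<open>y * a = x * b\<close> and splits the quadrant.\<close>
 have iff: "w \<in> sec p z \<longleftrightarrow> 0 <= y \<and> y * a <= x * b" "w \<in> sec z q \<longleftrightarrow> 0 <= x \<and> x * b <= y * a"
  if w: "w = x *. p + y *. q" for w x y
 proof -
  have qp: "cross2 q p = - ?D" by (rule cross2_commute)
  have "cross2 p z * cross2 p w = (?D * ?D) * (b * y)"
   "cross2 p z * cross2 w z = (?D * ?D) * (b * (x * b - y * a))"
   "cross2 z q * cross2 z w = (?D * ?D) * (a * (y * a - x * b))"
   "cross2 z q * cross2 w q = (?D * ?D) * (a * x)"
   unfolding pz zq by (simp_all add: w z cross2_add qp algebra_simps)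
  then show "w \<in> sec p z \<longleftrightarrow> 0 <= y \<and> y * a <= x * b" "w \<in> sec z q \<longleftrightarrow> 0 <= x \<and> x * b <= y * a"
   unfolding sec_def mem_Collect_eq using D ab by (auto simp: zero_le_mult_iff)
 qed
 have "sec p q = sec p z \<union> sec z q"
 proof (rule set_eqI)
  fix w
  obtain x y where w: "w = x *. p + y *. q" using cross2_decomp[OF c] by blast
  have "0 <= y ==> y * a <= x * b ==> 0 <= x" "0 <= x ==> x * b <= y * a ==> 0 <= y"
   using ab by (smt (verit) mult_nonneg_nonneg mult_neg_pos)+
  then show "w \<in> sec p q \<longleftrightarrow> w \<in> sec p z \<union> sec z q"
   using iff[OF w] mem_sec_iff[OF c, of x y] w by auto
 qed
 moreover have "nu F (sec p z \<union> sec z q) = nu F (sec p z) + nu F (sec z q)"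
 proof (rule nu_Un[of _ _ "{z}"])
  show "0 \<notin> {z}" using pz ab c by auto
  fix w assume a: "w \<in> sec p z" "w \<in> sec z q"
  obtain x y where w: "w = x *. p + y *. q" using cross2_decomp[OF c] by blast
  have "cross2 z w = (a * y - x * b) * ?D"
   using cross2_commute[of q p] by (simp add: w z cross2_add algebra_simps)
  then show "\<exists>a\<in>{z}. cross2 a w = 0" using iff[OF w] a by (auto simp: mult.commute)
 qed (auto simp: closed_sec)
 ultimately show ?thesis by simp
qed

lemma nu_hp_split:
 assumes c: "cross2 e z ~= 0"
 shows "nu F (hp e z) = nu F (sec e z) + nu F (sec z (- e))"
proof -
 have "hp e z = sec e z \<union> sec z (- e)"
 proof (rule set_eqI)
  fix w show "w \<in> hp e z \<longleftrightarrow> w \<in> sec e z \<union> sec z (- e)"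
   using cross2_commute[of z e] cross2_commute[of z w] cross2_commute[of w e] by (auto simp: hp_def sec_def)
 qed
 moreover have "nu F (sec e z \<union> sec z (- e)) = nu F (sec e z) + nu F (sec z (- e))"
 proof (rule nu_Un[of _ _ "{z}"])
  show "0 \<notin> {z}" using c by auto
  fix w assume a: "w \<in> sec e z" "w \<in> sec z (- e)"
  then have "cross2 e z * cross2 w z \<ge> 0" "cross2 e z * cross2 w z <= 0"
   using cross2_commute[of z e] cross2_commute[of z w] by (auto simp: sec_def)
  then have "cross2 e z * cross2 w z = 0" by linarith
  then show "\<exists>a\<in>{z}. cross2 a w = 0" using c cross2_commute[of z w] by auto
 qed (auto simp: closed_sec)
 ultimately show ?thesis by simp
qed

lemma nu_hp_compl:
 assumes "cross2 e z ~= 0"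
 shows "nu F (hp e z) + nu F (hp e (- z)) = nu F UNIV"
proof -
 have "nu F (hp e z \<union> hp e (- z)) = nu F (hp e z) + nu F (hp e (- z))"
 proof (rule nu_Un[of _ _ "{e}"])
  show "0 \<notin> {e}" using assms by auto
  fix w assume "w \<in> hp e z" "w \<in> hp e (- z)"
  then have "cross2 e z * cross2 e w = 0" by (auto simp: hp_def)
  then show "\<exists>a\<in>{e}. cross2 a w = 0" using assms by auto
 qed (auto simp: closed_hp)
 moreover have "hp e z \<union> hp e (- z) = UNIV" by (auto simp: hp_def)
 ultimately show ?thesis by simp
qed

end

section \<open>Arc length swept by a moving vector\<close>

lemma inner_pol: "pol a \<bullet> pol b = cos (b - a)"
 by (simp add: inner2 cos_diff mult.commute)

lemma norm_pol: "norm (pol a) = 1"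
 using inner_pol[of a a] by (simp add: norm_eq_sqrt_inner)

text \<open>On the open half plane the angle is given by the arctangent of a quotient of two
  functions linear in \<open>w\<close>, which makes its derivative rational.\<close>

lemma ang_arctan:
 assumes s: "0 < \<eta> * cross2 e w" and \<eta>: "\<eta> = 1 \<or> \<eta> = -1"
 shows "ang e w = pi / 2 - arctan ((e \<bullet> w) / (\<eta> * cross2 e w))"
proof -
 have c: "cross2 e w ~= 0" and nz: "e ~= 0" "w ~= 0" using s by auto
 define a where "a = ang e w"
 have a: "0 < a" "a < pi" using ang_pos[OF c] by (auto simp: a_def)
 have "\<bar>cross2 e w\<bar> = \<eta> * cross2 e w" using s \<eta> by (auto simp: abs_if)
 then have "(e \<bullet> w) / (\<eta> * cross2 e w) = cos a / sin a"
  using nz by (simp add: a_def cos_ang sin_ang)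
 also have "\<dots> = tan (pi / 2 - a)" by (simp add: tan_def sin_diff cos_diff)
 also have "arctan \<dots> = pi / 2 - a" using a by (intro arctan_tan) auto
 finally show ?thesis by (simp add: a_def)
qed

lemma cross2_hrd:
 "(z has_vector_derivative z') (at t) ==> ((\<lambda>t. cross2 e (z t)) has_real_derivative cross2 e z') (at t)"
proof -
 assume z: "(z has_vector_derivative z') (at t)"
 have "bounded_linear (cross2 e)"
  by (rule linear_conv_bounded_linear[THEN iffD1]) (auto intro!: linearI simp: cross2_add)
 from bounded_linear.has_vector_derivative[OF this z] show ?thesis
  by (simp add: has_real_derivative_iff_has_vector_derivative)
qed

lemma inner_hrd:
 "(z has_vector_derivative z') (at t) ==> ((\<lambda>t. e \<bullet> z t) has_real_derivative e \<bullet> z') (at t)"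
 using bounded_linear.has_vector_derivative[OF bounded_linear_inner_right, of z z' "at t" e]
 by (simp add: has_real_derivative_iff_has_vector_derivative)

text \<open>Angular velocity is areal velocity over the square of the distance; the reference vector
  \<open>e\<close> cancels by the identities \<open>sum\<close> and \<open>num\<close>.\<close>

lemma ang_deriv:
 assumes z: "(z has_vector_derivative z') (at t)" and \<eta>: "\<eta> = 1 \<or> \<eta> = -1"
  and s: "0 < \<eta> * cross2 e (z t)"
 shows "((\<lambda>t. ang e (z t)) has_real_derivative \<eta> * cross2 (z t) z' / (norm (z t))\<^sup>2) (at t)"
proof -
 define N where "N t = e \<bullet> z t" for t
 define D where "D t = \<eta> * cross2 e (z t)" for t
 have nz: "e ~= 0" "z t ~= 0" using s by auto
 have N: "(N has_real_derivative e \<bullet> z') (at t)" unfolding N_def by (rule inner_hrd[OF z])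
 have D: "(D has_real_derivative \<eta> * cross2 e z') (at t)"
  unfolding D_def by (intro DERIV_cmult cross2_hrd[OF z])
 have D0: "D t > 0" using s by (simp add: D_def)
 have sum: "(D t)\<^sup>2 + (N t)\<^sup>2 = (norm e)\<^sup>2 * (norm (z t))\<^sup>2"
  using inner_cross2[of e "z t"] \<eta> by (auto simp: D_def N_def power_mult_distrib)
 have num: "(e \<bullet> z') * D t - N t * (\<eta> * cross2 e z') = - (norm e)\<^sup>2 * (\<eta> * cross2 (z t) z')"
  unfolding D_def N_def norm2 inner2 cross2_def by (simp add: power2_eq_square algebra_simps)
 have "((\<lambda>t. pi / 2 - arctan (N t / D t)) has_real_derivative
   0 - inverse (1 + (N t / D t)\<^sup>2) * (((e \<bullet> z') * D t - N t * (\<eta> * cross2 e z')) / (D t * D t))) (at t)"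
  using N D D0 by (intro DERIV_diff DERIV_const DERIV_chain2[OF DERIV_arctan] DERIV_divide) auto
 moreover have "0 - inverse (1 + (N t / D t)\<^sup>2) * (((e \<bullet> z') * D t - N t * (\<eta> * cross2 e z')) / (D t * D t))
   = \<eta> * cross2 (z t) z' / (norm (z t))\<^sup>2"
 proof -
  have "(1 + (N t / D t)\<^sup>2) * (D t * D t) = (norm e)\<^sup>2 * (norm (z t))\<^sup>2"
   unfolding sum[symmetric] using D0 by (simp add: field_simps power2_eq_square)
  moreover have "0 - inverse A * (X / B) = - X / (A * B)" for A X B :: real by (simp add: divide_inverse)
  ultimately show ?thesis unfolding num using nz by simp
 qed
 ultimately have "((\<lambda>t. pi / 2 - arctan (N t / D t)) has_real_derivative
   \<eta> * cross2 (z t) z' / (norm (z t))\<^sup>2) (at t)" by simp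
 then show ?thesis
 proof (rule DERIV_transform_ev)
  have "isCont D t" using D by (rule DERIV_isCont)
  then have "(D \<longlongrightarrow> D t) (nhds t)" by (simp add: isCont_def tendsto_at_iff_tendsto_nhds)
  then have "eventually (\<lambda>t. 0 < D t) (nhds t)" using D0 by (rule order_tendstoD)
  then show "eventually (\<lambda>t. pi / 2 - arctan (N t / D t) = ang e (z t)) (nhds t)"
   by eventually_elim (simp add: N_def D_def ang_arctan[OF _ \<eta>])
 qed
qed

context minkowski
begin

lemma kap_pol_ang:
 assumes e: "e = norm e *. pol \<alpha>" "e ~= 0" and \<eta>: "\<eta> = 1 \<or> \<eta> = -1"
  and s: "0 <= \<eta> * cross2 e z" and z: "z ~= 0"
 shows "kap F (pol (\<alpha> + \<eta> * ang e z)) = kap F z * (norm z)\<^sup>2"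
proof -
 have "kap F (norm z *. pol (\<alpha> + \<eta> * ang e z)) = kap F (pol (\<alpha> + \<eta> * ang e z)) / (norm z)\<^sup>2"
  using z by (intro kap_scale) auto
 then show ?thesis using ang_polar[OF e(2,1) z \<eta> s] z by (simp add: field_simps)
qed

text \<open>The square of the norm in the angular velocity cancels against the homogeneity of
  \<open>kap\<close>, so that no Euclidean quantity is left.\<close>

lemma Phi_chain:
 assumes e: "e = norm e *. pol \<alpha>" and \<eta>: "\<eta> = 1 \<or> \<eta> = -1"
  and z: "(z has_vector_derivative z') (at t)" and s: "0 < \<eta> * cross2 e (z t)"
 shows "((\<lambda>t. Phi F \<alpha> \<eta> (ang e (z t))) has_real_derivative \<eta> * cross2 (z t) z' * kap F (z t)) (at t)"
proof -
 have nz: "e ~= 0" "z t ~= 0" "cross2 e (z t) ~= 0" using s by auto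
 have "((\<lambda>t. Phi F \<alpha> \<eta> (ang e (z t))) has_real_derivative
   kap F (pol (\<alpha> + \<eta> * ang e (z t))) * (\<eta> * cross2 (z t) z' / (norm (z t))\<^sup>2)) (at t)"
  using ang_pos[OF nz(3)] by (intro DERIV_chain2[OF Phi_deriv ang_deriv[OF z \<eta> s]]) auto
 then show ?thesis using nz s by (simp add: kap_pol_ang[OF e _ \<eta>] field_simps)
qed

text \<open>Sectors are measured from \<open>- v\<close>, the direction of the line at time minus
  infinity: every point of the line lies on one side of it, and the sector from \<open>- v\<close>
  to the moving point grows with time.\<close>

lemma line_rotation:
 assumes c: "cross2 p v ~= 0" and ab: "a < b"
 shows "((\<lambda>t. \<bar>cross2 (p + t *. v) v\<bar> * kap F (p + t *. v)) has_integral
  nu F (sec (p + a *. v) (p + b *. v))) {a..b}"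
proof -
 define \<eta> where "\<eta> = sgn (cross2 p v)"
 have \<eta>: "\<eta> = 1 \<or> \<eta> = -1" using c by (auto simp: \<eta>_def sgn_if)
 define e where "e = - v"
 obtain \<alpha> where \<alpha>: "e = norm e *. pol \<alpha>" using polar_ex by blast
 define z where "z t = p + t *. v" for t
 have cz: "cross2 (z t) v = cross2 p v" "cross2 e (z t) = cross2 p v" for t
  using cross2_commute[of v p] by (simp_all add: z_def e_def cross2_add)
 have s: "0 < \<eta> * cross2 e (z t)" for t using c by (simp add: cz \<eta>_def sgn_if)
 have d: "(z has_vector_derivative v) (at t)" for t unfolding z_def by (rule line_hvd)
 have "((\<lambda>t. Phi F \<alpha> \<eta> (ang e (z t))) has_real_derivative \<eta> * cross2 (z t) v * kap F (z t)) (at t)" for t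
  by (rule Phi_chain[OF \<alpha> \<eta> d s])
 then have "((\<lambda>t. \<eta> * cross2 (z t) v * kap F (z t)) has_integral
   Phi F \<alpha> \<eta> (ang e (z b)) - Phi F \<alpha> \<eta> (ang e (z a))) {a..b}"
  using ab by (intro fundamental_theorem_of_calculus)
   (auto simp: has_real_derivative_iff_has_vector_derivative[symmetric] intro: DERIV_subset)
 moreover have "Phi F \<alpha> \<eta> (ang e (z t)) = nu F (sec e (z t))" for t
  using nu_sec_ang(1)[OF \<alpha> \<eta> s] by simp
 moreover have "nu F (sec e (z b)) = nu F (sec e (z a)) + nu F (sec (z a) (z b))"
  using c ab by (intro nu_sec_split[where a = "b - a" and b = 1])
   (auto simp: cz, simp add: z_def e_def algebra_simps)
 moreover have "\<eta> * cross2 (z t) v = \<bar>cross2 (z t) v\<bar>" for t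
  by (simp add: cz \<eta>_def sgn_mult_abs abs_sgn mult.commute)
 ultimately show ?thesis by (simp add: z_def)
qed

text \<open>Up to scaling \<open>p + b *. v\<close> is \<open>x *. p + v\<close> with
  \<open>x = 1 / b\<close>, whose angle with \<open>p\<close> is continuous at
  \<open>x = 0\<close>.\<close>

lemma nu_sec_tendsto:
 assumes c: "cross2 p v ~= 0"
 shows "((\<lambda>b. nu F (sec p (p + b *. v))) \<longlongrightarrow> nu F (sec p v)) at_top"
proof -
 define \<eta> where "\<eta> = sgn (cross2 p v)"
 have \<eta>: "\<eta> = 1 \<or> \<eta> = -1" using c by (auto simp: \<eta>_def sgn_if)
 obtain \<alpha> where \<alpha>: "p = norm p *. pol \<alpha>" using polar_ex by blast
 have nz: "p ~= 0" "v ~= 0" using c by auto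
 have s: "0 < \<eta> * cross2 p v" using c by (simp add: \<eta>_def sgn_if)
 let ?f = "\<lambda>x. Phi F \<alpha> \<eta> (ang p (x *. p + v))"
 have nz': "x *. p + v ~= 0" for x
 proof
  assume "x *. p + v = 0"
  then have "cross2 p (x *. p + v) = 0" by simp
  then show False using c by (simp add: cross2_add)
 qed
 have "continuous_on UNIV (\<lambda>x. ang p (x *. p + v))"
  using nz nz' by (intro continuous_on_ang continuous_intros) auto
 then have "continuous_on UNIV ?f"
  using ang_bounds[OF nz(1) nz'] by (intro continuous_on_compose2[OF continuous_on_Phi, of UNIV _ pi]) auto
 then have "isCont ?f 0" by (simp add: continuous_on_eq_continuous_at)
 then have l: "(?f \<longlongrightarrow> ?f 0) (at 0)" by (simp add: isCont_def)
 have "((\<lambda>b. inverse b) \<longlongrightarrow> (0::real)) at_top" by (rule tendsto_inverse_0_at_top) (rule filterlim_ident)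
 then have "filterlim inverse (at (0::real)) at_top"
  by (auto simp: filterlim_at eventually_at_top_linorder intro!: exI[of _ 1])
 from filterlim_compose[OF l this] have "((\<lambda>b. ?f (inverse b)) \<longlongrightarrow> ?f 0) at_top" .
 moreover have "?f 0 = nu F (sec p v)" using nu_sec_ang(1)[OF \<alpha> \<eta> s] by simp
 moreover have "eventually (\<lambda>b. ?f (inverse b) = nu F (sec p (p + b *. v))) at_top"
  using eventually_gt_at_top[of 0]
 proof eventually_elim
  fix b :: real assume b: "0 < b"
  have "nu F (sec p (p + b *. v)) = Phi F \<alpha> \<eta> (ang p (p + b *. v))"
   using b s by (intro nu_sec_ang(1)[OF \<alpha> \<eta>]) (simp add: cross2_add, metis mult_pos_pos mult.left_commute)
  also have "ang p (p + b *. v) = ang p (b *. (inverse b *. p + v))" using b by (simp add: scaleR_add_right)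
  also have "\<dots> = ang p (inverse b *. p + v)" by (rule ang_scale[OF b])
  finally show "?f (inverse b) = nu F (sec p (p + b *. v))" by simp
 qed
 ultimately show ?thesis by (auto elim: Lim_transform_eventually)
qed

end

text \<open>Along the indicatrix the isometry preserves arc length, so, fixing the endpoint in direction \<open>e\<close>,
 it maps the arc from \<open>e\<close> to \<open>u\<close> to an arc of the same length.\<close>

lemma isometry_arc:
 assumes MF: "minkowski F" and MG: "minkowski G" and e: "e ~= 0" and e': "e' ~= 0"
  and Fe: "F e = G e'" and Fe': "F (- e) = G (- e')"
  and \<eta>: "\<eta> = 1 \<or> \<eta> = -1" and \<eta>': "\<eta>' = 1 \<or> \<eta>' = -1"
  and iso: "ind_isometry F {u. F u = 1 \<and> 0 <= \<eta> * cross2 e u} G {u. G u = 1 \<and> 0 <= \<eta>' * cross2 e' u} h"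
  and dn: "\<And>u. F u = 1 ==> 0 <= \<eta> * cross2 e u ==> dn F u e = dn G (h u) e'"
  and u: "F u = 1" "0 < \<eta> * cross2 e u"
 shows "nu F (sec e u) = nu G (sec e' (h u)) \<and> 0 < \<eta>' * cross2 e' (h u) \<and> G (h u) = 1"
proof -
 interpret F: minkowski F by fact
 interpret G: minkowski G by fact
 define A where "A = {u. F u = 1 \<and> 0 <= \<eta> * cross2 e u}"
 define B where "B = {u. G u = 1 \<and> 0 <= \<eta>' * cross2 e' u}"
 obtain g where hg: "homeomorphism A B h g" using iso by (auto simp: ind_isometry_def A_def B_def)
 have hB: "h x \<in> B" if "x \<in> A" for x using hg that by (auto simp: homeomorphism_def)
 have hinj: "x = y" if "x \<in> A" "y \<in> A" "h x = h y" for x y using hg that by (metis homeomorphism_apply1)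
 have hcont: "continuous_on A h" using hg by (simp add: homeomorphism_def)
 have hG: "G (h x) = 1" "0 <= \<eta>' * cross2 e' (h x)" "h x ~= 0" if "x \<in> A" for x
  using hB[OF that] by (auto simp: B_def)
 obtain \<alpha> where \<alpha>: "e = norm e *. pol \<alpha>" using polar_ex by blast
 obtain \<alpha>' where \<alpha>': "e' = norm e' *. pol \<alpha>'" using polar_ex by blast
 \<comment> \<open>The arc of \<open>F\<close> from the direction of \<open>e\<close> at time 0 to
   that of \<open>- e\<close> at time 1, traversed with constant Euclidean angular velocity.\<close>
 define y where "y t = unit_vec F (pol (\<alpha> + \<eta> * (pi * t)))" for t
 have cy: "cross2 e (y t) = norm e * \<eta> * sin (pi * t) / F (pol (\<alpha> + \<eta> * (pi * t)))" for t
  using \<eta> by (subst \<alpha>) (auto simp: y_def unit_vec_def cross2_pol divide_inverse)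
 have y1: "F (y t) = 1" "y t ~= 0" for t by (auto simp: y_def)
 have eta2: "\<eta> * (x * \<eta> * z / w) = x * z / w" for x z w using \<eta> by auto
 have yA: "y t \<in> A" if "t \<in> {0..1}" for t
 proof -
  have "0 <= sin (pi * t)" using that by (intro sin_ge_zero) (auto simp: mult_left_le)
  then have "0 <= \<eta> * cross2 e (y t)" unfolding cy eta2 by (intro divide_nonneg_nonneg mult_nonneg_nonneg F.nonneg) auto
  then show ?thesis by (simp add: A_def y1)
 qed
 have cyp: "0 < \<eta> * cross2 e (y t)" if "t \<in> {0<..<1}" for t
 proof -
  have "0 < sin (pi * t)" using that by (intro sin_gt_zero) auto
  then show ?thesis using e unfolding cy eta2 by (intro divide_pos_pos mult_pos_pos F.pos') auto
 qed
 have angy: "ang e (y t) = pi * t" if "t \<in> {0..1}" for t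
 proof -
  have ceq: "cos (ang e (y t)) = cos (pi * t)"
  proof -
   have "e \<bullet> y t = norm e * (inverse (F (pol (\<alpha> + \<eta> * (pi * t)))) * cos (pi * t))"
    using \<eta> by (subst \<alpha>) (auto simp: y_def unit_vec_def inner_pol)
   moreover have "norm (y t) = inverse (F (pol (\<alpha> + \<eta> * (pi * t))))"
    by (simp add: y_def unit_vec_def F.nonneg norm_pol)
   ultimately show ?thesis using e by (simp add: cos_ang y1)
  qed
  have b: "0 <= ang e (y t)" "ang e (y t) <= pi" using ang_bounds[OF e y1(2)] by auto
  have "0 <= pi * t" "pi * t <= pi" using that by (auto simp: mult_left_le)
  from cos_inj_pi[OF b this ceq] show ?thesis .
 qed
 \<comment> \<open>At the ends of the arc \<open>dn\<close> takes the values \<open>F e\<close> and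
   \<open>- F (- e)\<close>. Since \<open>G\<close> has the same values on \<open>e'\<close> and
   \<open>- e'\<close>, \<open>dn_inj\<close> identifies the images of the end points.\<close>
 have h0: "h (y 0) = unit_vec G e'"
 proof -
  have y0: "y 0 = unit_vec F e" unfolding y_def using \<alpha> e F.unit_scale[of "norm e" "pol \<alpha>"] by simp
  have "dn G (h (y 0)) e' = dn F (y 0) e" using yA[of 0] dn[of "y 0"] by (auto simp: A_def)
  also have "\<dots> = F e" using e by (simp add: y0 unit_vec_def F.dn_scale F.pos' F.euler)
  also have "\<dots> = dn G (unit_vec G e') e'" using e' by (simp add: Fe unit_vec_def G.dn_scale G.pos' G.euler)
  finally show ?thesis
   using hG[OF yA, of 0] hG[OF yA, of 0] e' \<eta>'
   by (intro G.dn_inj[of e' _ _ \<eta>']) (auto simp: unit_vec_def[of G e'] G.hom' G.nonneg)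
 qed
 have hp1: "h (y 1) = unit_vec G (- e')"
 proof -
  have "pol (\<alpha> + \<eta> * pi) = - pol \<alpha>" using \<eta> by (auto simp: vec2_eq_iff cos_diff)
  then have y1': "y 1 = unit_vec F (- e)" unfolding y_def
   using \<alpha> e F.unit_scale[of "norm e" "- pol \<alpha>"] by simp
  have "dn G (h (y 1)) e' = dn F (y 1) e" using yA[of 1] dn[of "y 1"] by (auto simp: A_def)
  also have "\<dots> = - dn F (unit_vec F (- e)) (- e)" using e by (simp add: y1' F.dn_lin)
  also have "\<dots> = - F (- e)" using e by (simp add: unit_vec_def F.dn_scale[of _ "- e", unfolded scaleR_minus_right] F.pos' F.euler)
  also have "\<dots> = - dn G (unit_vec G (- e')) (- e')"
   using e' by (simp add: Fe' unit_vec_def G.dn_scale[of _ "- e'", unfolded scaleR_minus_right] G.pos' G.euler)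
  also have "\<dots> = dn G (unit_vec G (- e')) e'" using e' by (simp add: G.dn_lin)
  finally show ?thesis
   using hG[OF yA, of 1] e' \<eta>'
   by (intro G.dn_inj[of e' _ _ \<eta>']) (auto simp: unit_vec_def[of G "- e'"] G.hom'[of _ "- e'", unfolded scaleR_minus_right] G.nonneg)
 qed
 \<comment> \<open>The only unit vectors on the line of \<open>e'\<close> are the images of the two
   end points, so injectivity of \<open>h\<close> keeps the images of inner points off this
   line.\<close>
 have inner_pos: "0 < \<eta>' * cross2 e' (h x)" if x: "x \<in> A" "0 < \<eta> * cross2 e x" for x
 proof (rule ccontr)
  assume "\<not> ?thesis"
  then have "cross2 e' (h x) = 0" using hG[OF x(1)] \<eta>' by auto
  then obtain c where c: "h x = c *. e'" using cross2_eq_0_iff[OF e'] by auto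
  have "c ~= 0" using hG[OF x(1)] c by auto
  have "h x = unit_vec G (h x)" using hG[OF x(1)] by (simp add: G.unit_1)
  also have "\<dots> = unit_vec G e' \<or> unit_vec G (h x) = unit_vec G (- e')"
   using G.unit_scale[of c e'] G.unit_scale[of "- c" "- e'"] c \<open>c ~= 0\<close> by (cases "c > 0") auto
  finally have "h x = h (y 0) \<or> h x = h (y 1)" using h0 hp1 \<open>h x = unit_vec G (h x)\<close> by metis
  then have "x = y 0 \<or> x = y 1" using hinj[OF x(1)] yA by auto
  then show False using x(2) by (auto simp: cy)
 qed
 \<comment> \<open>\<open>P\<close> and \<open>Q\<close> are the arc lengths swept up to time
   \<open>t\<close> in the image and in the source.\<close>
 define P where "P t = Phi G \<alpha>' \<eta>' (ang e' (h (y t)))" for t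
 define Q where "Q t = Phi F \<alpha> \<eta> (ang e (y t))" for t
 have ycont: "continuous_on {0..1} y"
  unfolding y_def unit_vec_def by (intro continuous_intros) auto
 have Pcont: "continuous_on {0..1} P"
 proof -
  have "continuous_on {0..1} (\<lambda>t. h (y t))"
   using yA by (intro continuous_on_compose2[OF hcont ycont]) auto
  then have "continuous_on {0..1} (\<lambda>t. ang e' (h (y t)))"
   using hG yA by (intro continuous_on_ang e') auto
  then show ?thesis unfolding P_def
   using ang_bounds[OF e'] hG yA by (intro continuous_on_compose2[OF G.continuous_on_Phi[of pi]]) auto
 qed
 have Qcont: "continuous_on {0..1} Q" unfolding Q_def
  using ang_bounds[OF e y1(2)]
  by (intro continuous_on_compose2[OF F.continuous_on_Phi[of pi]] continuous_on_ang e ycont) (auto simp: y1)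
 have PQ0: "P 0 = 0" "Q 0 = 0" using angy[of 0] h0 e'
  by (auto simp: P_def Q_def unit_vec_def ang_scale G.pos') (auto simp: ang_def power2_eq_square[symmetric] power2_norm_eq_inner)
 have P1: "0 < P 1"
 proof -
  have "ang e' (h (y 1)) = pi" using e' unfolding hp1 unit_vec_def
   by (subst ang_scale) (auto simp: G.pos' ang_def power2_norm_eq_inner simp flip: power2_eq_square)
  then show ?thesis by (simp add: P_def G.Phi_pos)
 qed
 \<comment> \<open>The isometry determines only the absolute value of the speed of the image; that
   it moves away from \<open>e'\<close> has to be derived from the end points.\<close>
 have der: "\<exists>q p. (Q has_real_derivative q) (at t) \<and> (P has_real_derivative p) (at t) \<and> 0 < q \<and> \<bar>p\<bar> = q"
  if t: "t \<in> {0<..<1}" for t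
 proof -
  have at: "at t within {0..1} = at t" using t by (intro at_within_interior) auto
  have tA: "y t \<in> A" using yA t by auto
  have "\<exists>D. (y has_vector_derivative D) (at t)"
  proof -
   have "((\<lambda>t. \<alpha> + \<eta> * (pi * t)) has_vector_derivative (\<eta> * pi)) (at t)"
    by (auto intro!: derivative_eq_intros)
   from vector_diff_chain_at[OF this pol_hvd]
   have p: "((\<lambda>t. pol (\<alpha> + \<eta> * (pi * t))) has_vector_derivative
     (\<eta> * pi) *. vector [- sin (\<alpha> + \<eta> * (pi * t)), cos (\<alpha> + \<eta> * (pi * t))]) (at t)" (is "(?p has_vector_derivative ?p') _")
    by (simp add: o_def)
   have "((\<lambda>t. F (?p t)) has_real_derivative dn F (?p t) ?p') (at t)" by (rule F.dn_curve[OF p]) simp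
   from has_vector_derivative_scaleR[OF DERIV_inverse_fun[OF this] p] show ?thesis
    unfolding y_def unit_vec_def by auto
  qed
  then obtain D where D: "(y has_vector_derivative D) (at t)" by blast
  have "\<exists>D'. ((h \<circ> y) has_vector_derivative D') (at t within {0..1}) \<and>
    fund_form G (h (y t)) D' D' = fund_form F (y t) D D"
  proof -
   have "\<forall>y D. \<forall>t\<in>{0..1}. y ` {0..1} \<subseteq> A \<and> (y has_vector_derivative D) (at t within {0..1}) -->
    (\<exists>D'. ((h \<circ> y) has_vector_derivative D') (at t within {0..1}) \<and>
       fund_form G (h (y t)) D' D' = fund_form F (y t) D D)"
    using iso unfolding ind_isometry_def A_def[symmetric] by blast
   from bspec[OF this[THEN spec, THEN spec, of y D], of t] show ?thesis
    using t D yA at by auto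
  qed
  then obtain D' where D': "((\<lambda>t. h (y t)) has_vector_derivative D') (at t)"
   and eq: "fund_form G (h (y t)) D' D' = fund_form F (y t) D D" using at by (auto simp: o_def)
  have ev: "eventually (\<lambda>s. s \<in> {0<..<1}) (nhds t)" using t by (intro eventually_nhds_in_open) auto
  have "((\<lambda>t. 1) has_real_derivative dn F (y t) D) (at t)"
   using DERIV_transform_ev[OF F.dn_curve[OF D y1(2)]] y1 by auto
  then have d0: "dn F (y t) D = 0" by (metis DERIV_const DERIV_unique)
  have "((\<lambda>t. 1) has_real_derivative dn G (h (y t)) D') (at t)"
   by (rule DERIV_transform_ev[OF G.dn_curve[OF D']])
    (use hG tA ev yA in \<open>auto elim!: eventually_mono\<close>)
  then have d0': "dn G (h (y t)) D' = 0" by (metis DERIV_const DERIV_unique)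
  have Qd: "(Q has_real_derivative \<eta> * cross2 (y t) D * kap F (y t)) (at t)"
   unfolding Q_def by (rule F.Phi_chain[OF \<alpha> \<eta> D cyp[OF t]])
  have Pd: "(P has_real_derivative \<eta>' * cross2 (h (y t)) D' * kap G (h (y t))) (at t)"
   unfolding P_def using inner_pos[OF tA cyp[OF t]] by (intro G.Phi_chain[OF \<alpha>' \<eta>' D'])
  have "(Phi F \<alpha> \<eta> has_real_derivative kap F (pol (\<alpha> + \<eta> * (pi * t)))) (at (pi * t))"
   using t by (intro F.Phi_deriv) auto
  then have "((\<lambda>t. Phi F \<alpha> \<eta> (pi * t)) has_real_derivative kap F (pol (\<alpha> + \<eta> * (pi * t))) * (pi * 1)) (at t)"
   by (rule DERIV_chain2) (intro DERIV_cmult DERIV_ident)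
  then have "((\<lambda>t. Phi F \<alpha> \<eta> (pi * t)) has_real_derivative kap F (pol (\<alpha> + \<eta> * (pi * t))) * pi) (at t)"
   by simp
  then have "(Q has_real_derivative kap F (pol (\<alpha> + \<eta> * (pi * t))) * pi) (at t)"
   by (rule DERIV_transform_ev) (use ev angy in \<open>auto elim!: eventually_mono simp: Q_def\<close>)
  then have q: "\<eta> * cross2 (y t) D * kap F (y t) > 0"
   using DERIV_unique[OF Qd] F.kap_pos[OF pol_nz] by simp
  have a: "\<bar>cross2 (h (y t)) D'\<bar> * kap G (h (y t)) = \<bar>cross2 (y t) D\<bar> * kap F (y t)"
   using F.tangent_speed[OF y1(1) d0] G.tangent_speed[OF hG(1)[OF tA] d0'] eq by simp
  have k: "0 < kap G (h (y t))" "0 < kap F (y t)"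
   using hG[OF tA] y1 by (auto intro!: G.kap_pos F.kap_pos)
  have "\<bar>\<eta>' * cross2 (h (y t)) D' * kap G (h (y t))\<bar> = \<eta> * cross2 (y t) D * kap F (y t)"
  proof -
   have "\<bar>\<eta>' * cross2 (h (y t)) D' * kap G (h (y t))\<bar> = \<bar>cross2 (h (y t)) D'\<bar> * kap G (h (y t))"
    using \<eta>' k by (auto simp: abs_mult)
   also have "\<dots> = \<bar>\<eta> * cross2 (y t) D * kap F (y t)\<bar>" unfolding a using \<eta> k by (auto simp: abs_mult)
   finally show ?thesis using q by simp
  qed
  then show ?thesis using Pd Qd q by blast
 qed
 \<comment> \<open>The derivative of \<open>P\<close> has no zero, so \<open>P\<close> is injective
   by Rolle, hence monotone, and \<open>P 0 < P 1\<close> makes it increasing.\<close>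
 have Pinj: "P a ~= P b" if ab: "0 <= a" "a < b" "b <= 1" for a b
 proof
  assume "P a = P b"
  moreover have "P differentiable (at x)" if "a < x" "x < b" for x
   using der[of x] that ab by (auto simp: real_differentiable_def)
  ultimately obtain x where x: "a < x" "x < b" "DERIV P x :> 0"
   using Rolle[of a b P] ab continuous_on_subset[OF Pcont, of "{a..b}"] by auto
  then obtain q p where "(P has_real_derivative p) (at x)" "0 < q" "\<bar>p\<bar> = q" using der[of x] ab by auto
  then show False using DERIV_unique[OF x(3)] by auto
 qed
 have Pinj_on: "inj_on P {a..1}" if "0 <= a" for a
  using Pinj that by (intro linorder_inj_onI) auto
 have Pmono: "P a < P b" if ab: "0 < a" "a < b" "b < 1" for a b
 proof -
  have "P 0 < P a \<and> P a < P 1 \<or> P 1 < P a \<and> P a < P 0"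
   using ab by (intro continuous_inj_imp_mono Pcont Pinj_on) auto
  then have "P a < P 1" using PQ0 P1 by auto
  moreover have "P a < P b \<and> P b < P 1 \<or> P 1 < P b \<and> P b < P a"
   using ab by (intro continuous_inj_imp_mono Pinj_on continuous_on_subset[OF Pcont]) auto
  ultimately show ?thesis by auto
 qed
 have PQ: "P t = Q t" if t: "t \<in> {0<..<1}" for t
 proof -
  have "P t - Q t = P 0 - Q 0"
  proof (rule DERIV_isconst2[where f = "\<lambda>t. P t - Q t" and a = 0 and b = t])
   show "0 < t" "0 <= t" "t <= t" using t by auto
   show "continuous_on {0..t} (\<lambda>t. P t - Q t)"
    using t by (intro continuous_intros continuous_on_subset[OF Pcont] continuous_on_subset[OF Qcont]) auto
   fix x assume x: "0 < x" "x < t"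
   then obtain q p where d: "(Q has_real_derivative q) (at x)" "(P has_real_derivative p) (at x)" "0 < q" "\<bar>p\<bar> = q"
    using der[of x] t by auto
   have "\<not> p < 0"
   proof
    assume "p < 0"
    then obtain r where r: "r > 0" "\<And>h. 0 < h ==> h < r ==> P (x + h) < P x"
     using DERIV_neg_dec_right[OF d(2)] by blast
    define h where "h = min r (1 - x) / 2"
    have "0 < h" "h < r" "x + h < 1" using r x t by (auto simp: h_def min_def field_simps)
    then show False using Pmono[of x "x + h"] r(2)[of h] x by auto
   qed
   then have "p = q" using d by auto
   then show "((\<lambda>t. P t - Q t) has_real_derivative 0) (at x)" using DERIV_diff[OF d(2,1)] by simp
  qed
  then show ?thesis using PQ0 by simp
 qed
 have uA: "u \<in> A" using u by (auto simp: A_def)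
 have u0: "u ~= 0" using u by auto
 define t where "t = ang e u / pi"
 have "cross2 e u ~= 0" using u by auto
 then have t: "t \<in> {0<..<1}" using ang_pos[of e u] by (auto simp: t_def)
 have "u = norm u *. pol (\<alpha> + \<eta> * ang e u)" using u by (intro ang_polar[OF e \<alpha> u0 \<eta>]) auto
 then have "unit_vec F u = unit_vec F (pol (\<alpha> + \<eta> * ang e u))" using u0 by (metis F.unit_scale zero_less_norm_iff)
 then have ut: "u = y t" using u by (simp add: F.unit_1 y_def t_def)
 have "nu F (sec e u) = Q t" using F.nu_sec_ang(1)[OF \<alpha> \<eta> u(2)] by (simp add: Q_def ut)
 moreover have "nu G (sec e' (h u)) = P t"
  using G.nu_sec_ang(1)[OF \<alpha>' \<eta>' inner_pos[OF uA u(2)]] by (simp add: P_def ut)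
 ultimately show ?thesis using PQ[OF t] inner_pos[OF uA u(2)] hG[OF uA] by simp
qed

section \<open>Piecewise smooth curves\<close>

lemma Ck_on_const: "Ck_on n (\<lambda>x. c) S"
 by (induction n arbitrary: c) (auto simp: continuous_on_const)

lemma smooth_on_line: "smooth_on S (\<lambda>t::real. p + t *. v)"
proof -
 have d: "((\<lambda>t::real. p + t *. v) has_derivative (\<lambda>h. h *. v)) (at x)" for x
  by (auto intro!: derivative_eq_intros)
 have fd: "frechet_derivative (\<lambda>t::real. p + t *. v) (at x) = (\<lambda>h. h *. v)" for x
  using frechet_derivative_at[OF d] by simp
 have "Ck_on n (\<lambda>t::real. p + t *. v) S" for n
 proof (cases n)
  case 0
  then show ?thesis by (auto intro!: continuous_intros)
 next
  case (Suc m)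
  then show ?thesis using d by (auto simp: fd Ck_on_const differentiable_def)
 qed
 then show ?thesis by (simp add: smooth_on_def)
qed

lemma smooth_curve:
 fixes c :: "real => real^2"
 assumes "smooth_on UNIV c"
 shows "(c has_vector_derivative vector_derivative c (at t)) (at t)"
  and "continuous_on S (\<lambda>t. vector_derivative c (at t))"
  and "continuous_on S c"
proof -
 have C1: "Ck_on (Suc 0) c UNIV" using assms unfolding smooth_on_def by blast
 then have d: "c differentiable (at t)" for t by simp
 then show v: "(c has_vector_derivative vector_derivative c (at t)) (at t)" for t
  by (simp add: vector_derivative_works)
 have "vector_derivative c (at t) = frechet_derivative c (at t) 1" for t
  using frechet_derivative_at[OF v[of t, unfolded has_vector_derivative_def]] by (metis scaleR_one)
 moreover have "continuous_on UNIV (\<lambda>t. frechet_derivative c (at t) 1)" using C1 by simp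
 ultimately show "continuous_on S (\<lambda>t. vector_derivative c (at t))"
  using continuous_on_subset by (metis (no_types, lifting) continuous_on_cong subset_UNIV)
 show "continuous_on S c"
  using d by (intro continuous_at_imp_continuous_on ballI differentiable_imp_continuous_within)
qed

text \<open>One smooth piece of a curve in one chart. The set of times is arbitrary, so that open
  intervals around a time can be used as well as closed ones.\<close>

definition rep :: "('p, 'i, 'z) flat_pieces_scheme => (real => 'p) => 'i => (real => real^2) => real set => bool" where
 "rep X \<gamma> i c S \<longleftrightarrow> i \<in> pieces X \<and> smooth_on UNIV c \<and> (\<forall>t\<in>S. c t \<in> region X i \<and> \<gamma> t = chart X i (c t))"

lemma rep_subset: "rep X \<gamma> i c S ==> T \<subseteq> S ==> rep X \<gamma> i c T"
 by (auto simp: rep_def)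

lemma rep_pw: "rep X \<gamma> i c {a..b} ==> a <= b ==> has_pw_integral X G \<gamma> a b (integral {a..b} (G i c))"
 by (rule smooth_piece) (auto simp: rep_def)

lemma pw_induct [consumes 1, case_names smooth join]:
 assumes "has_pw_integral X G \<gamma> a b L"
  and "\<And>a b i c. a <= b ==> rep X \<gamma> i c {a..b} ==> P a b (integral {a..b} (G i c))"
  and "\<And>a b d L L'. has_pw_integral X G \<gamma> a b L ==> has_pw_integral X G \<gamma> b d L' ==>
   P a b L ==> P b d L' ==> P a d (L + L')"
 shows "P a b L"
 using assms(1)
proof induction
 case (smooth_piece a b i c)
 then show ?case by (intro assms(2)) (auto simp: rep_def)
next
 case (join a b L d L')
 then show ?case using assms(3) by blast
qed

lemma pw_le: "has_pw_integral X G \<gamma> a b L ==> a <= b"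
 by (induction rule: pw_induct) auto

lemma pw_first:
 "has_pw_integral X G \<gamma> a b L ==> a < b ==> \<exists>b' i c. a < b' \<and> b' <= b \<and> rep X \<gamma> i c {a..b'}"
proof (induction rule: pw_induct)
 case (join a b d L L')
 have le: "a <= b" "b <= d" using pw_le[OF join(1)] pw_le[OF join(2)] by auto
 show ?case
 proof (cases "a < b")
  case True
  then show ?thesis using join(3) le by (meson order_trans)
 next
  case False
  then have "a = b" using le by simp
  then show ?thesis using join by blast
 qed
qed blast

lemma pw_last:
 "has_pw_integral X G \<gamma> a b L ==> a < b ==> \<exists>a' i c. a <= a' \<and> a' < b \<and> rep X \<gamma> i c {a'..b}"
proof (induction rule: pw_induct)
 case (join a b d L L')
 have le: "a <= b" "b <= d" using pw_le[OF join(1)] pw_le[OF join(2)] by auto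
 show ?case
 proof (cases "b < d")
  case True
  then show ?thesis using join(4) le by (meson order_trans)
 next
  case False
  then have "b = d" using le by simp
  then show ?thesis using join by blast
 qed
qed blast

text \<open>The value does not depend on the subdivision: all sums are integrals of one function
  \<open>g\<close>, which takes some local representation at each time and differs from the
  integrand of a piece at most in its end points.\<close>

lemma pw_unique:
 assumes int: "\<And>i c a b. a <= b ==> rep X \<gamma> i c {a..b} ==> G i c integrable_on {a..b}"
  and loc: "\<And>i j c d t e. 0 < e ==> rep X \<gamma> i c {t - e<..<t + e} ==> rep X \<gamma> j d {t - e<..<t + e} ==>
   G i c t = G j d t"
  and L: "has_pw_integral X G \<gamma> a b L" "has_pw_integral X G \<gamma> a b L'"
 shows "L = L'"
proof -
 define g where "g t = (SOME y. \<exists>i c e. 0 < e \<and> rep X \<gamma> i c {t - e<..<t + e} \<and> y = G i c t)" for t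
 have g: "g t = G i c t" if r: "rep X \<gamma> i c {a..b}" and t: "a < t" "t < b" for t i c a b
 proof -
  define e0 where "e0 = min (t - a) (b - t)"
  have "0 < e0" "{t - e0<..<t + e0} \<subseteq> {a..b}" using t by (auto simp: e0_def)
  then have r0: "0 < e0" "rep X \<gamma> i c {t - e0<..<t + e0}" using rep_subset[OF r] by auto
  then have "\<exists>y i c e. 0 < e \<and> rep X \<gamma> i c {t - e<..<t + e} \<and> y = G i c t" by blast
  from someI_ex[OF this] obtain j d e where j: "0 < e" "rep X \<gamma> j d {t - e<..<t + e}" "g t = G j d t"
   unfolding g_def by blast
  define e1 where "e1 = min e e0"
  have "0 < e1" "{t - e1<..<t + e1} \<subseteq> {t - e<..<t + e}" "{t - e1<..<t + e1} \<subseteq> {t - e0<..<t + e0}"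
   using j r0 by (auto simp: e1_def)
  then have "0 < e1" "rep X \<gamma> i c {t - e1<..<t + e1}" "rep X \<gamma> j d {t - e1<..<t + e1}"
   using rep_subset[OF j(2)] rep_subset[OF r0(2)] by auto
  from loc[OF this] j(3) show ?thesis by simp
 qed
 have "(g has_integral L) {a..b}" if "has_pw_integral X G \<gamma> a b L" for a b L
  using that
 proof (induction rule: pw_induct)
  case (smooth a b i c)
  have "(G i c has_integral integral {a..b} (G i c)) {a..b}"
   using int[OF smooth] by (rule integrable_integral)
  then show ?case
   by (rule has_integral_spike_finite[where S = "{a, b}", rotated 2]) (auto intro!: g[OF smooth(2)])
 next
  case (join a b d L L')
  then show ?case using has_integral_combine pw_le[OF join(1)] pw_le[OF join(2)] by blast
 qed
 from this[OF L(1)] this[OF L(2)] show ?thesis by (rule has_integral_unique)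
qed

context conv_norm
begin

lemma lower_bound: "\<exists>m>0. \<forall>w. m * norm w <= F w"
proof -
 have "compact (sphere (0::real^2) 1)" "sphere (0::real^2) 1 ~= {}" by simp_all
 moreover have "continuous_on (sphere 0 1) F" using cont continuous_on_subset by blast
 ultimately obtain x where x: "x \<in> sphere 0 1" "\<And>y. y \<in> sphere 0 1 ==> F x <= F y"
  using continuous_attains_inf by metis
 have "F x * norm w <= F w" for w
 proof (cases "w = 0")
  case False
  then have "F x <= F (inverse (norm w) *. w)" by (intro x) simp
  then show ?thesis using False by (simp add: hom field_simps)
 qed simp
 moreover have "0 < F x" using x by (intro pos) auto
 ultimately show ?thesis by blast
qed

lemma continuous_on_F' [continuous_intros]: "continuous_on S f ==> continuous_on S (\<lambda>x. F (f x))"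
 using cont by (metis continuous_on_compose2 subset_UNIV)

lemma speed_integrable: "smooth_on UNIV c ==> (\<lambda>t. F (vector_derivative c (at t))) integrable_on {a..b}"
 by (intro integrable_continuous_interval continuous_intros smooth_curve)

text \<open>The supporting covector at the displacement calibrates the straight segment: its
  integral along \<open>c\<close> is the norm of the displacement, and pointwise it is at most
  \<open>F\<close> of the velocity.\<close>

lemma le_length:
 assumes c: "smooth_on UNIV c" and ab: "a <= b"
 shows "F (c b - c a) <= integral {a..b} (\<lambda>t. F (vector_derivative c (at t)))"
proof (cases "c b - c a = 0")
 case True
 then show ?thesis by (simp add: Henstock_Kurzweil_Integration.integral_nonneg speed_integrable[OF c] nonneg)
next
 case False
 let ?\<xi> = "dn F (c b - c a)"
 have "((\<lambda>t. ?\<xi> (vector_derivative c (at t))) has_integral ?\<xi> (c b) - ?\<xi> (c a)) {a..b}"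
  using ab smooth_curve(1)[OF c]
  by (intro fundamental_theorem_of_calculus bounded_linear.has_vector_derivative[OF dn_bl[OF False]])
   (auto intro: has_vector_derivative_at_within)
 moreover have "?\<xi> (c b) - ?\<xi> (c a) = F (c b - c a)" using euler[OF False] False by (simp add: dn_lin)
 ultimately show ?thesis
  using has_integral_le[OF _ integrable_integral[OF speed_integrable[OF c]]] dn_le[OF False] by metis
qed

end

section \<open>Cones glued along rays\<close>

text \<open>The two boundary rays of the cone \<open>i\<close> are spanned by \<open>ray i False\<close> and \<open>ray i True\<close>, and
 \<open>opp\<close> maps such a flag to the one it is glued to.\<close>

locale fan =
 fixes Y :: "('q, 'i) flat_pieces" and ray :: "'i => bool => real^2" and opp :: "'i => bool => 'i \<times> bool"
 assumes fin: "finite (pieces Y)"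
  and norm: "i \<in> pieces Y ==> conv_norm (fnorm Y i)"
  and indep: "i \<in> pieces Y ==> cross2 (ray i k) (ray i (\<not> k)) ~= 0"
  and reg: "i \<in> pieces Y ==> region Y i = {a *. ray i False + b *. ray i True | a b. 0 <= a \<and> 0 <= b}"
  and chart_inj: "i \<in> pieces Y ==> inj_on (chart Y i) (region Y i)"
  and glue: "i \<in> pieces Y ==> j \<in> pieces Y ==> i ~= j ==> w \<in> region Y i ==> w' \<in> region Y j ==>
   chart Y i w = chart Y j w' \<longleftrightarrow>
    (w = 0 \<and> w' = 0) \<or> (\<exists>k l a. 0 < a \<and> opp i k = (j, l) \<and> w = a *. ray i k \<and> w' = a *. ray j l)"
  and opp: "i \<in> pieces Y ==> opp i k = (j, l) ==> j \<in> pieces Y \<and> j ~= i \<and> opp j l = (i, k)"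
  and opp_ne: "i \<in> pieces Y ==> fst (opp i k) ~= fst (opp i (\<not> k))"
  and match: "i \<in> pieces Y ==> opp i k = (j, l) ==> fnorm Y i (ray i k) = fnorm Y j (ray j l)"
   "i \<in> pieces Y ==> opp i k = (j, l) ==> fnorm Y i (- ray i k) = fnorm Y j (- ray j l)"
begin

text \<open>The coefficient of the other ray in the basis of the two rays: it vanishes on ray
  \<open>k\<close> and is 1 at \<open>ray i (\<not> k)\<close>.\<close>

definition hgt :: "'i => bool => real^2 => real" where
 "hgt i k w = cross2 (ray i k) w / cross2 (ray i k) (ray i (\<not> k))"

lemma hgt_lin [simp]: "hgt i k (u + v) = hgt i k u + hgt i k v" "hgt i k (u - v) = hgt i k u - hgt i k v"
 "hgt i k (c *. u) = c * hgt i k u" "hgt i k (- u) = - hgt i k u" "hgt i k 0 = 0"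
 by (simp_all add: hgt_def cross2_add add_divide_distrib diff_divide_distrib)

lemma hgt_ray [simp]: "hgt i k (ray i k) = 0"
 "i \<in> pieces Y ==> hgt i k (ray i (\<not> k)) = 1" "i \<in> pieces Y ==> hgt i (\<not> k) (ray i k) = 1"
 using indep[of i k] indep[of i "\<not> k"] by (simp_all add: hgt_def)

lemma hgt_decomp: "i \<in> pieces Y ==> w = hgt i (\<not> k) w *. ray i k + hgt i k w *. ray i (\<not> k)"
 using cross2_decomp[OF indep[of i k], of w] cross2_commute[of w "ray i (\<not> k)"]
  cross2_commute[of "ray i k" "ray i (\<not> k)"]
 by (simp add: hgt_def)

lemma region_iff: "i \<in> pieces Y ==> w \<in> region Y i \<longleftrightarrow> 0 <= hgt i k w \<and> 0 <= hgt i (\<not> k) w"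
proof -
 assume i: "i \<in> pieces Y"
 have "w \<in> region Y i \<longleftrightarrow> 0 <= hgt i True w \<and> 0 <= hgt i False w"
 proof
  assume "w \<in> region Y i"
  then obtain a b where "w = a *. ray i False + b *. ray i True" "0 <= a" "0 <= b" using reg[OF i] by auto
  then show "0 <= hgt i True w \<and> 0 <= hgt i False w"
   using hgt_ray(2,3)[OF i, of True] hgt_ray(2,3)[OF i, of False] by simp
 next
  assume "0 <= hgt i True w \<and> 0 <= hgt i False w"
  then show "w \<in> region Y i" using hgt_decomp[OF i, of w False] by (auto simp: reg[OF i])
 qed
 then show ?thesis by (cases k) auto
qed

lemma hgt_eq_0: "i \<in> pieces Y ==> hgt i k w = 0 ==> w = hgt i (\<not> k) w *. ray i k"
 using hgt_decomp[of i w k] by simp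

lemma ray_nz: "i \<in> pieces Y ==> ray i k ~= 0"
 using indep[of i k] by auto

lemma tendsto_hgt: "(f \<longlongrightarrow> l) A ==> ((\<lambda>x. hgt i k (f x)) \<longlongrightarrow> hgt i k l) A"
 unfolding hgt_def cross2_def divide_inverse by (intro tendsto_intros)

lemma continuous_on_hgt [continuous_intros]: "continuous_on S f ==> continuous_on S (\<lambda>x. hgt i k (f x))"
 unfolding hgt_def divide_inverse by (intro continuous_intros)

text \<open>The sum norm in ray coordinates. For vectors along a ray it is the absolute value of the
  coordinate, hence agrees in the two cones glued there.\<close>

definition nm :: "'i => real^2 => real" where
 "nm i w = \<bar>hgt i False w\<bar> + \<bar>hgt i True w\<bar>"

lemma nm_k: "nm i w = \<bar>hgt i k w\<bar> + \<bar>hgt i (\<not> k) w\<bar>"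
 by (cases k) (auto simp: nm_def)

lemma nm_triangle: "\<bar>nm i u - nm i v\<bar> <= nm i (u - v)"
 unfolding nm_def hgt_lin by linarith

lemma nm_upper: "\<exists>B>0. \<forall>w. nm i w <= B * norm w"
proof -
 define d where "d k = \<bar>cross2 (ray i k) (ray i (\<not> k))\<bar>" for k
 define r where "r k = (\<bar>ray i k $ 1\<bar> + \<bar>ray i k $ 2\<bar>) / d k" for k
 have "\<bar>hgt i k w\<bar> <= r k * norm w" for k w
 proof -
  have "\<bar>cross2 (ray i k) w\<bar> <= \<bar>ray i k $ 1\<bar> * \<bar>w $ 2\<bar> + \<bar>ray i k $ 2\<bar> * \<bar>w $ 1\<bar>"
   unfolding cross2_def using abs_triangle_ineq4 by (metis abs_mult)
  also have "\<dots> <= \<bar>ray i k $ 1\<bar> * norm w + \<bar>ray i k $ 2\<bar> * norm w"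
   by (intro add_mono mult_left_mono component_le_norm_cart) auto
  finally have "\<bar>cross2 (ray i k) w\<bar> / d k <= (\<bar>ray i k $ 1\<bar> + \<bar>ray i k $ 2\<bar>) * norm w / d k"
   by (intro divide_right_mono) (auto simp: d_def distrib_right)
  then show ?thesis by (simp add: hgt_def r_def d_def abs_divide)
 qed
 from this[of False] this[of True] have "nm i w <= (r False + r True + 1) * norm w" for w
  unfolding nm_def distrib_right using norm_ge_zero[of w] by (metis add.commute add_mono add_increasing2 mult_1)
 moreover have "0 <= r k" for k by (auto simp: r_def d_def)
 ultimately show ?thesis by (intro exI[of _ "r False + r True + 1"]) (auto simp: add_nonneg_pos)
qed

lemma nm_lower: assumes "i \<in> pieces Y" shows "\<exists>m>0. \<forall>w. m * nm i w <= fnorm Y i w"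
proof -
 interpret conv_norm "fnorm Y i" using assms by (rule norm)
 obtain m where m: "m > 0" "\<And>w. m * norm w <= fnorm Y i w" using lower_bound by blast
 obtain B where B: "B > 0" "\<And>w. nm i w <= B * norm w" using nm_upper by blast
 have "m / B * nm i w <= fnorm Y i w" for w
 proof -
  have "m / B * nm i w <= m / B * (B * norm w)" using m B by (intro mult_left_mono) auto
  moreover have "m / B * (B * norm w) = m * norm w" using B by simp
  ultimately show ?thesis using m(2)[of w] by linarith
 qed
 then show ?thesis using m B by (intro exI[of _ "m / B"]) auto
qed

text \<open>The unit ball of the dual norm.\<close>

definition covec :: "'i => (real^2 => real) => bool" where
 "covec i \<xi> \<longleftrightarrow> linear \<xi> \<and> (\<forall>w. \<xi> w <= fnorm Y i w)"

lemma covec_dn: "i \<in> pieces Y ==> y ~= 0 ==> covec i (dn (fnorm Y i) y)"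
proof -
 assume i: "i \<in> pieces Y" and y: "y ~= 0"
 interpret conv_norm "fnorm Y i" using i by (rule norm)
 show ?thesis unfolding covec_def using dn_le[OF y] dn_bl[OF y] bounded_linear.linear by blast
qed

lemma covec_bound: assumes i: "i \<in> pieces Y" shows "\<exists>K>0. \<forall>\<xi> w. covec i \<xi> --> \<bar>\<xi> w\<bar> <= K * nm i w"
proof -
 interpret conv_norm "fnorm Y i" using i by (rule norm)
 let ?F = "fnorm Y i"
 define K where "K = ?F (ray i False) + ?F (- ray i False) + ?F (ray i True) + ?F (- ray i True) + 1"
 have "\<bar>\<xi> w\<bar> <= K * nm i w" if x: "covec i \<xi>" for \<xi> w
 proof -
  have l: "linear \<xi>" and le: "\<And>w. \<xi> w <= ?F w" using x by (auto simp: covec_def)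
  have b: "\<bar>\<xi> (ray i k)\<bar> <= K" for k
   using le[of "ray i k"] le[of "- ray i k"] linear_neg[OF l, of "ray i k"]
    nonneg[of "ray i True"] nonneg[of "ray i False"] nonneg[of "- ray i True"] nonneg[of "- ray i False"]
   by (cases k) (auto simp: K_def)
  have "\<xi> w = hgt i True w * \<xi> (ray i False) + hgt i False w * \<xi> (ray i True)"
   using arg_cong[OF hgt_decomp[OF i, of w False], of \<xi>] l by (simp add: linear_add linear_scale)
  then have "\<bar>\<xi> w\<bar> <= \<bar>hgt i True w\<bar> * \<bar>\<xi> (ray i False)\<bar> + \<bar>hgt i False w\<bar> * \<bar>\<xi> (ray i True)\<bar>"
   by (metis abs_mult abs_triangle_ineq)
  also have "\<dots> <= \<bar>hgt i True w\<bar> * K + \<bar>hgt i False w\<bar> * K" by (intro add_mono mult_left_mono b) auto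
  finally show ?thesis by (simp add: nm_def algebra_simps)
 qed
 moreover have "K > 0" unfolding K_def
  using nonneg[of "ray i True"] nonneg[of "ray i False"] nonneg[of "- ray i True"] nonneg[of "- ray i False"] by linarith
 ultimately show ?thesis by blast
qed

text \<open>Functions that grow at most at unit rate; they bound lengths and distances from below.\<close>

definition cal :: "('q => real) => bool" where
 "cal g \<longleftrightarrow> (\<forall>m\<in>pieces Y. \<forall>w1\<in>region Y m. \<forall>w2\<in>region Y m.
   g (chart Y m w2) - g (chart Y m w1) <= fnorm Y m (w2 - w1))"

lemma cal_length: "has_length Y \<gamma> a b L ==> cal g ==> g (\<gamma> b) - g (\<gamma> a) <= L"
 unfolding has_length_def
proof (induction rule: pw_induct)
 case (smooth a b i c)
 then have i: "i \<in> pieces Y" "smooth_on UNIV c" "c a \<in> region Y i" "c b \<in> region Y i"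
  "\<gamma> a = chart Y i (c a)" "\<gamma> b = chart Y i (c b)" by (auto simp: rep_def)
 interpret conv_norm "fnorm Y i" using i(1) by (rule norm)
 have "g (\<gamma> b) - g (\<gamma> a) <= fnorm Y i (c b - c a)" using smooth i by (auto simp: cal_def)
 also have "\<dots> <= integral {a..b} (\<lambda>t. fnorm Y i (vector_derivative c (at t)))"
  by (rule le_length[OF i(2) smooth(1)])
 finally show ?case .
qed auto

lemma cal_0: "cal (\<lambda>_. 0)"
 unfolding cal_def
proof (intro ballI)
 fix m w1 w2 assume "m \<in> pieces Y"
 then interpret conv_norm "fnorm Y m" by (rule norm)
 show "(0::real) - 0 <= fnorm Y m (w2 - w1)" using nonneg by simp
qed

lemma fdist_le: "has_length Y \<gamma> a b L ==> fdist Y (\<gamma> a) (\<gamma> b) <= L"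
 unfolding fdist_def
proof (rule cInf_lower)
 show "bdd_below {L. \<exists>\<gamma>' a' b'. \<gamma>' a' = \<gamma> a \<and> \<gamma>' b' = \<gamma> b \<and> has_length Y \<gamma>' a' b' L}"
  using cal_length[OF _ cal_0] by (intro bdd_belowI[of _ 0]) auto
qed blast

lemma fdist_ge: "has_length Y \<gamma> a b L ==> cal g ==> g (\<gamma> b) - g (\<gamma> a) <= fdist Y (\<gamma> a) (\<gamma> b)"
 unfolding fdist_def
proof (rule cInf_greatest)
 assume "cal g"
 fix x assume "x \<in> {L. \<exists>\<gamma>' a' b'. \<gamma>' a' = \<gamma> a \<and> \<gamma>' b' = \<gamma> b \<and> has_length Y \<gamma>' a' b' L}"
 then obtain \<gamma>' a' b' where "\<gamma>' a' = \<gamma> a" "\<gamma>' b' = \<gamma> b" "has_length Y \<gamma>' a' b' x" by blast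
 then show "g (\<gamma> b) - g (\<gamma> a) <= x" using cal_length \<open>cal g\<close> by metis
qed blast

lemma line_length:
 assumes i: "i \<in> pieces Y" and ab: "a <= b"
  and r: "\<And>t. a <= t ==> t <= b ==> n + t *. v \<in> region Y i \<and> \<gamma> t = chart Y i (n + t *. v)"
 shows "has_length Y \<gamma> a b ((b - a) * fnorm Y i v)"
proof -
 have "rep Y \<gamma> i (\<lambda>t. n + t *. v) {a..b}" using i r by (auto simp: rep_def smooth_on_line)
 from rep_pw[OF this ab, of "\<lambda>i c t. fnorm Y i (vector_derivative c (at t))"]
 have "has_length Y \<gamma> a b (integral {a..b} (\<lambda>t. fnorm Y i (vector_derivative (\<lambda>t. n + t *. v) (at t))))"
  by (simp add: has_length_def)
 moreover have "vector_derivative (\<lambda>t. n + t *. v) (at t) = v" for t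
  by (rule vector_derivative_at) (auto intro!: derivative_eq_intros)
 ultimately show ?thesis using ab by simp
qed

lemma region_convex: "i \<in> pieces Y ==> u \<in> region Y i ==> w \<in> region Y i ==> 0 <= a ==> 0 <= b ==>
 a *. u + b *. w \<in> region Y i"
 by (auto simp: region_iff[of i _ True] add_nonneg_nonneg)

lemma fdist_segment2:
 assumes i: "i \<in> pieces Y" "w1 \<in> region Y i" "z \<in> region Y i"
  and j: "j \<in> pieces Y" "z' \<in> region Y j" "w2 \<in> region Y j" and z: "chart Y i z = chart Y j z'"
 shows "fdist Y (chart Y i w1) (chart Y j w2) <= fnorm Y i (z - w1) + fnorm Y j (w2 - z')"
proof -
 define \<gamma> where "\<gamma> t = (if t <= 0 then chart Y i (z + t *. (z - w1)) else chart Y j (z' + t *. (w2 - z')))" for t :: real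
 have "has_length Y \<gamma> (-1) 0 ((0 - (-1)) * fnorm Y i (z - w1))"
 proof (rule line_length[OF i(1)])
  fix t :: real assume t: "-1 <= t" "t <= 0"
  have "z + t *. (z - w1) = (1 + t) *. z + (- t) *. w1" by (simp add: algebra_simps)
  then show "z + t *. (z - w1) \<in> region Y i \<and> \<gamma> t = chart Y i (z + t *. (z - w1))"
   using region_convex[OF i(1,3,2), of "1 + t" "- t"] t by (simp add: \<gamma>_def)
 qed simp
 moreover have "has_length Y \<gamma> 0 1 ((1 - 0) * fnorm Y j (w2 - z'))"
 proof (rule line_length[OF j(1)])
  fix t :: real assume t: "0 <= t" "t <= 1"
  have "z' + t *. (w2 - z') = (1 - t) *. z' + t *. w2" by (simp add: algebra_simps)
  then show "z' + t *. (w2 - z') \<in> region Y j \<and> \<gamma> t = chart Y j (z' + t *. (w2 - z'))"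
   using region_convex[OF j, of "1 - t" t] t z by (auto simp: \<gamma>_def)
 qed simp
 ultimately have "has_length Y \<gamma> (-1) 1 (fnorm Y i (z - w1) + fnorm Y j (w2 - z'))"
  unfolding has_length_def by (auto dest: join)
 from fdist_le[OF this] show ?thesis by (simp add: \<gamma>_def)
qed

lemma fdist_segment:
 assumes i: "i \<in> pieces Y" "w1 \<in> region Y i" "w2 \<in> region Y i"
 shows "fdist Y (chart Y i w1) (chart Y i w2) <= fnorm Y i (w2 - w1)"
proof -
 interpret conv_norm "fnorm Y i" using i(1) by (rule norm)
 show ?thesis using fdist_segment2[OF i(1) i(2) i(2) i(1) i(2) i(3)] by simp
qed

lemma segment_length:
 assumes "i \<in> pieces Y" "w1 \<in> region Y i" "w2 \<in> region Y i"
 shows "\<exists>\<gamma> a b L. has_length Y \<gamma> a b L \<and> \<gamma> a = chart Y i w1 \<and> \<gamma> b = chart Y i w2"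
proof -
 have "has_length Y (\<lambda>t. chart Y i (w1 + t *. (w2 - w1))) 0 1 ((1 - 0) * fnorm Y i (w2 - w1))"
 proof (rule line_length[OF assms(1)])
  fix t :: real assume t: "0 <= t" "t <= 1"
  have "w1 + t *. (w2 - w1) = (1 - t) *. w1 + t *. w2" by (simp add: algebra_simps)
  then show "w1 + t *. (w2 - w1) \<in> region Y i \<and> chart Y i (w1 + t *. (w2 - w1)) = chart Y i (w1 + t *. (w2 - w1))"
   using region_convex[OF assms, of "1 - t" t] t by auto
 qed simp
 then show ?thesis
  by (rule_tac x = "\<lambda>t. chart Y i (w1 + t *. (w2 - w1))" in exI, rule_tac x = 0 in exI, rule_tac x = 1 in exI) auto
qed

lemma fdist_ge':
 assumes "i \<in> pieces Y" "w1 \<in> region Y i" "w2 \<in> region Y i" "cal g"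
 shows "g (chart Y i w2) - g (chart Y i w1) <= fdist Y (chart Y i w1) (chart Y i w2)"
 using segment_length[OF assms(1-3)] fdist_ge[OF _ assms(4)] by metis

text \<open>A calibration may be prescribed cone by cone; compatibility at glued points makes the
  choice of a representative irrelevant.\<close>

lemma cal_glue:
 assumes lip: "\<And>m w1 w2. m \<in> pieces Y ==> w1 \<in> region Y m ==> w2 \<in> region Y m ==> f m w2 - f m w1 <= fnorm Y m (w2 - w1)"
  and eq: "\<And>m n w w'. m \<in> pieces Y ==> n \<in> pieces Y ==> m ~= n ==> w \<in> region Y m ==> w' \<in> region Y n ==>
   chart Y m w = chart Y n w' ==> f m w = f n w'"
 shows "\<exists>g. cal g \<and> (\<forall>m\<in>pieces Y. \<forall>w\<in>region Y m. g (chart Y m w) = f m w)"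
proof -
 define g where "g P = (SOME y. \<exists>m w. m \<in> pieces Y \<and> w \<in> region Y m \<and> P = chart Y m w \<and> y = f m w)" for P
 have g: "g (chart Y m w) = f m w" if "m \<in> pieces Y" "w \<in> region Y m" for m w
 proof -
  have "\<exists>y m' w'. m' \<in> pieces Y \<and> w' \<in> region Y m' \<and> chart Y m w = chart Y m' w' \<and> y = f m' w'"
   using that by blast
  from someI_ex[OF this] obtain m' w' where "m' \<in> pieces Y" "w' \<in> region Y m'" "chart Y m w = chart Y m' w'"
   "g (chart Y m w) = f m' w'" unfolding g_def by blast
  then show ?thesis using eq[of m m' w w'] chart_inj[of m] that by (cases "m = m'") (auto dest: inj_onD)
 qed
 then show ?thesis using lip by (intro exI[of _ g]) (auto simp: cal_def)
qed

section \<open>Calibrations with prescribed covectors near a point\<close>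

definition clamp :: "real => real => real" where
 "clamp x r = max (- r) (min x r)"

text \<open>A covector cut off between plus and minus a tent around \<open>p\<close>: near
  \<open>p\<close> it is the covector itself, outside the tent it is 0.\<close>

definition bump :: "'i => real^2 => real => real => (real^2 => real) => real^2 => real" where
 "bump i p \<kappa> \<rho> \<xi> w = clamp (\<xi> (w - p)) (max 0 (\<rho> - \<kappa> * nm i (w - p)))"

text \<open>The covector, the tent and its negative all grow at most at the rate of the norm, and
  this bound survives maxima and minima.\<close>

lemma bump_lip:
 assumes i: "i \<in> pieces Y" and \<kappa>: "0 <= \<kappa>" "\<And>w. \<kappa> * nm i w <= fnorm Y i w" and \<xi>: "covec i \<xi>"
 shows "bump i p \<kappa> \<rho> \<xi> w2 - bump i p \<kappa> \<rho> \<xi> w1 <= fnorm Y i (w2 - w1)"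
proof -
 have "\<xi> (w2 - p) - \<xi> (w1 - p) = \<xi> (w2 - w1)"
  using \<xi> linear_diff[of \<xi> "w2 - p" "w1 - p"] by (simp add: covec_def)
 then have 1: "\<xi> (w2 - p) - \<xi> (w1 - p) <= fnorm Y i (w2 - w1)" using \<xi> by (simp add: covec_def)
 have "\<kappa> * \<bar>nm i (w2 - p) - nm i (w1 - p)\<bar> <= \<kappa> * nm i (w2 - w1)"
  using nm_triangle[of i "w2 - p" "w1 - p"] \<kappa> by (intro mult_left_mono) auto
 then have "\<bar>\<kappa> * nm i (w2 - p) - \<kappa> * nm i (w1 - p)\<bar> <= \<kappa> * nm i (w2 - w1)"
  using \<kappa>(1) by (simp add: right_diff_distrib[symmetric] abs_mult)
 then have 2: "\<bar>\<kappa> * nm i (w2 - p) - \<kappa> * nm i (w1 - p)\<bar> <= fnorm Y i (w2 - w1)" using \<kappa>(2) order_trans by blast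
 show ?thesis using 1 2 unfolding bump_def clamp_def max_def min_def by (auto split: if_splits)
qed

lemma bump_0: "\<rho> <= \<kappa> * nm i (w - p) ==> bump i p \<kappa> \<rho> \<xi> w = 0"
 by (simp add: bump_def clamp_def)

lemma bump_near:
 assumes "\<bar>\<xi> (w - p)\<bar> <= K * nm i (w - p)" "(K + \<kappa>) * nm i (w - p) <= \<rho>"
 shows "bump i p \<kappa> \<rho> \<xi> w = \<xi> (w - p)"
 using assms by (auto simp: bump_def clamp_def distrib_right)

lemma nm_near:
 assumes "0 < \<rho>" "0 < c"
 shows "\<exists>\<delta>>0. \<forall>w. norm (w - p) < \<delta> --> c * nm i (w - p) <= \<rho>"
proof -
 obtain B where B: "B > 0" "\<And>w. nm i w <= B * norm w" using nm_upper by blast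
 have "c * nm i (w - p) <= \<rho>" if "norm (w - p) < \<rho> / (c * B)" for w
 proof -
  have "c * nm i (w - p) <= c * (B * norm (w - p))" using B assms by (intro mult_left_mono) auto
  also have "\<dots> <= c * (B * (\<rho> / (c * B)))" using that B assms by (intro mult_left_mono) auto
  finally show ?thesis using B assms by simp
 qed
 moreover have "0 < \<rho> / (c * B)" using B assms by simp
 ultimately show ?thesis by blast
qed

text \<open>\<open>\<delta>\<close> is chosen before the covector, because in
  \<open>fdist_local\<close> the covector depends on the second end point of the segment.\<close>

lemma cal_interior:
 assumes i: "i \<in> pieces Y" and p: "0 < hgt i k p" "0 < hgt i (\<not> k) p"
 shows "\<exists>\<delta>>0. \<forall>\<xi>. covec i \<xi> -->
  (\<exists>g. cal g \<and> (\<forall>w\<in>region Y i. norm (w - p) < \<delta> --> g (chart Y i w) = \<xi> (w - p)))"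
proof -
 obtain \<kappa> where \<kappa>: "\<kappa> > 0" "\<And>w. \<kappa> * nm i w <= fnorm Y i w" using nm_lower[OF i] by blast
 obtain K where K: "K > 0" "\<And>\<xi> w. covec i \<xi> ==> \<bar>\<xi> w\<bar> <= K * nm i w" using covec_bound[OF i] by blast
 \<comment> \<open>A tent of this height and slope \<open>\<kappa>\<close> has come down to 0 on
   both boundary rays, so the bump extends by 0 to the other cones.\<close>
 define \<rho> where "\<rho> = \<kappa> * min (hgt i k p) (hgt i (\<not> k) p)"
 have \<rho>: "\<rho> > 0" using \<kappa> p by (simp add: \<rho>_def)
 obtain \<delta> where \<delta>: "\<delta> > 0" "\<And>w. norm (w - p) < \<delta> ==> (K + \<kappa>) * nm i (w - p) <= \<rho>"
  using nm_near[OF \<rho>, of "K + \<kappa>" p i] K \<kappa> by auto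
 have ray0: "bump i p \<kappa> \<rho> \<xi> w = 0" if "hgt i l w = 0" for \<xi> w l
 proof (rule bump_0)
  have "min (hgt i k p) (hgt i (\<not> k) p) <= \<bar>hgt i l (w - p)\<bar>" using that p by (cases "l = k") auto
  also have "\<dots> <= nm i (w - p)" by (cases l) (auto simp: nm_def)
  finally show "\<rho> <= \<kappa> * nm i (w - p)" using \<kappa> by (simp add: \<rho>_def)
 qed
 have "\<exists>g. cal g \<and> (\<forall>w\<in>region Y i. norm (w - p) < \<delta> --> g (chart Y i w) = \<xi> (w - p))" if \<xi>: "covec i \<xi>" for \<xi>
 proof -
  define f where "f m = (if m = i then bump i p \<kappa> \<rho> \<xi> else (\<lambda>_. 0))" for m
  have z: "bump i p \<kappa> \<rho> \<xi> w = 0" if n: "n \<in> pieces Y" "i ~= n" "w \<in> region Y i" "w' \<in> region Y n"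
   "chart Y i w = chart Y n w'" for n w w'
  proof -
   consider "w = 0" | k' a where "w = a *. ray i k'"
    using glue[OF i n(1-4)] n(5) by blast
   then show ?thesis by cases (auto intro: ray0[where l = k], metis hgt_lin(3) hgt_ray(1) mult_zero_right ray0)
  qed
  have "\<exists>g. cal g \<and> (\<forall>m\<in>pieces Y. \<forall>w\<in>region Y m. g (chart Y m w) = f m w)"
  proof (rule cal_glue)
   fix m w1 w2 assume m: "m \<in> pieces Y"
   interpret conv_norm "fnorm Y m" using m by (rule norm)
   show "f m w2 - f m w1 <= fnorm Y m (w2 - w1)"
    using bump_lip[OF i _ \<kappa>(2) \<xi>] \<kappa>(1) nonneg by (auto simp: f_def)
  next
   fix m n w w' assume "m \<in> pieces Y" "n \<in> pieces Y" "m ~= n" "w \<in> region Y m" "w' \<in> region Y n"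
    "chart Y m w = chart Y n w'"
   then show "f m w = f n w'" using z[of n w w'] z[of m w' w] by (auto simp: f_def)
  qed
  then obtain g where "cal g" "\<And>w. w \<in> region Y i ==> g (chart Y i w) = bump i p \<kappa> \<rho> \<xi> w"
   using i by (auto simp: f_def)
  then show ?thesis using bump_near[of \<xi> _ p K i \<kappa> \<rho>, OF K(2)[OF \<xi>] \<delta>(2)] by (intro exI[of _ g]) auto
 qed
 then show ?thesis using \<delta>(1) by blast
qed

lemma cal_ray:
 assumes i: "i \<in> pieces Y" and o: "opp i k = (j, l)" and a: "0 < a"
 shows "\<exists>\<delta>>0. \<forall>\<xi> \<xi>'. covec i \<xi> --> covec j \<xi>' --> \<xi> (ray i k) = \<xi>' (ray j l) -->
  (\<exists>g. cal g \<and>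
   (\<forall>w\<in>region Y i. norm (w - a *. ray i k) < \<delta> --> g (chart Y i w) = \<xi> (w - a *. ray i k)) \<and>
   (\<forall>w\<in>region Y j. norm (w - a *. ray j l) < \<delta> --> g (chart Y j w) = \<xi>' (w - a *. ray j l)))"
proof -
 have j: "j \<in> pieces Y" "j ~= i" "opp j l = (i, k)" using opp[OF i o] by auto
 obtain \<kappa>1 where \<kappa>1: "\<kappa>1 > 0" "\<And>w. \<kappa>1 * nm i w <= fnorm Y i w" using nm_lower[OF i] by blast
 obtain \<kappa>2 where \<kappa>2: "\<kappa>2 > 0" "\<And>w. \<kappa>2 * nm j w <= fnorm Y j w" using nm_lower[OF j(1)] by blast
 \<comment> \<open>One slope for both cones, so that the two bumps coincide on the common
   ray.\<close>
 define \<kappa> where "\<kappa> = min \<kappa>1 \<kappa>2"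
 have nmn: "0 <= nm m w" for m w by (simp add: nm_def)
 have \<kappa>: "0 < \<kappa>" "\<kappa> * nm i w <= fnorm Y i w" "\<kappa> * nm j w <= fnorm Y j w" for w
 proof -
  show "0 < \<kappa>" using \<kappa>1 \<kappa>2 by (simp add: \<kappa>_def)
  have "\<kappa> * nm i w <= \<kappa>1 * nm i w" "\<kappa> * nm j w <= \<kappa>2 * nm j w"
   by (auto simp: \<kappa>_def nmn intro!: mult_right_mono)
  then show "\<kappa> * nm i w <= fnorm Y i w" "\<kappa> * nm j w <= fnorm Y j w"
   using \<kappa>1(2)[of w] \<kappa>2(2)[of w] by linarith+
 qed
 obtain K1 where K1: "K1 > 0" "\<And>\<xi> w. covec i \<xi> ==> \<bar>\<xi> w\<bar> <= K1 * nm i w" using covec_bound[OF i] by blast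
 obtain K2 where K2: "K2 > 0" "\<And>\<xi> w. covec j \<xi> ==> \<bar>\<xi> w\<bar> <= K2 * nm j w" using covec_bound[OF j(1)] by blast
 \<comment> \<open>With this height both tents vanish at the apex and on the other boundary rays of
   the two cones.\<close>
 define \<rho> where "\<rho> = \<kappa> * a"
 have \<rho>: "\<rho> > 0" using \<kappa> a by (simp add: \<rho>_def)
 obtain \<delta>1 where \<delta>1: "\<delta>1 > 0" "\<And>w. norm (w - a *. ray i k) < \<delta>1 ==> (K1 + \<kappa>) * nm i (w - a *. ray i k) <= \<rho>"
  using nm_near[OF \<rho>, of "K1 + \<kappa>" "a *. ray i k" i] K1 \<kappa> by auto
 obtain \<delta>2 where \<delta>2: "\<delta>2 > 0" "\<And>w. norm (w - a *. ray j l) < \<delta>2 ==> (K2 + \<kappa>) * nm j (w - a *. ray j l) <= \<rho>"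
  using nm_near[OF \<rho>, of "K2 + \<kappa>" "a *. ray j l" j] K2 \<kappa> by auto
 have ray0: "bump m (a *. ray m h) \<kappa> \<rho> \<xi> w = 0" if m: "m \<in> pieces Y" and "hgt m (\<not> h) w = 0" for \<xi> w m h
 proof (rule bump_0)
  have "a <= \<bar>hgt m (\<not> h) (w - a *. ray m h)\<bar>" using that a by simp
  also have "\<dots> <= nm m (w - a *. ray m h)" by (cases h) (auto simp: nm_def)
  finally show "\<rho> <= \<kappa> * nm m (w - a *. ray m h)" using \<kappa> by (simp add: \<rho>_def)
 qed
 have "\<exists>g. cal g \<and>
   (\<forall>w\<in>region Y i. norm (w - a *. ray i k) < min \<delta>1 \<delta>2 --> g (chart Y i w) = \<xi> (w - a *. ray i k)) \<and>
   (\<forall>w\<in>region Y j. norm (w - a *. ray j l) < min \<delta>1 \<delta>2 --> g (chart Y j w) = \<xi>' (w - a *. ray j l))"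
  if \<xi>: "covec i \<xi>" and \<xi>': "covec j \<xi>'" and eq: "\<xi> (ray i k) = \<xi>' (ray j l)" for \<xi> \<xi>'
 proof -
  let ?bi = "bump i (a *. ray i k) \<kappa> \<rho> \<xi>" and ?bj = "bump j (a *. ray j l) \<kappa> \<rho> \<xi>'"
  define f where "f m = (if m = i then ?bi else if m = j then ?bj else (\<lambda>_. 0))" for m
  have on_ray: "?bi (x *. ray i k) = ?bj (x *. ray j l)" for x
  proof -
   have "nm i (x *. ray i k - a *. ray i k) = \<bar>x - a\<bar>" "nm j (x *. ray j l - a *. ray j l) = \<bar>x - a\<bar>"
    unfolding nm_k[of i _ k] nm_k[of j _ l] using i j
    by (simp_all add: left_diff_distrib[symmetric])
   moreover have "\<xi> (x *. ray i k - a *. ray i k) = \<xi>' (x *. ray j l - a *. ray j l)"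
    using \<xi> \<xi>' eq by (simp add: covec_def linear_scale flip: scaleR_diff_left)
   ultimately show ?thesis by (simp add: bump_def)
  qed
  have ij: "?bi w = ?bj w'" if w: "w \<in> region Y i" "w' \<in> region Y j" "chart Y i w = chart Y j w'" for w w'
  proof -
   consider "w = 0" "w' = 0" | k' l' x where "0 < x" "opp i k' = (j, l')" "w = x *. ray i k'" "w' = x *. ray j l'"
    using glue[OF i j(1) j(2)[symmetric] w(1,2)] w(3) by auto
   then show ?thesis
   proof cases
    case 1
    then show ?thesis using on_ray[of 0] by simp
   next
    case 2
    then have "k' = k" using opp_ne[OF i, of k] o by (cases "k' = k") auto
    then show ?thesis using 2 o on_ray by auto
   qed
  qed
  have io: "?bi w = 0" if n: "n \<in> pieces Y" "n ~= i" "n ~= j" and w: "w \<in> region Y i" "w' \<in> region Y n"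
   "chart Y i w = chart Y n w'" for n w w'
  proof -
   consider "w = 0" | k' l' x where "opp i k' = (n, l')" "w = x *. ray i k'"
    using glue[OF i n(1) n(2)[symmetric] w(1,2)] w(3) by auto
   then show ?thesis
   proof cases
    case 2
    then have "k' = (\<not> k)" using o n by (cases "k' = k") auto
    then show ?thesis using 2 by (intro ray0[OF i]) auto
   qed (auto intro: ray0[OF i])
  qed
  have jo: "?bj w = 0" if n: "n \<in> pieces Y" "n ~= i" "n ~= j" and w: "w \<in> region Y j" "w' \<in> region Y n"
   "chart Y j w = chart Y n w'" for n w w'
  proof -
   consider "w = 0" | k' l' x where "opp j k' = (n, l')" "w = x *. ray j k'"
    using glue[OF j(1) n(1) n(3)[symmetric] w(1,2)] w(3) by auto
   then show ?thesis
   proof cases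
    case 2
    then have "k' = (\<not> l)" using j n by (cases "k' = l") auto
    then show ?thesis using 2 by (intro ray0[OF j(1)]) auto
   qed (auto intro: ray0[OF j(1)])
  qed
  have "\<exists>g. cal g \<and> (\<forall>m\<in>pieces Y. \<forall>w\<in>region Y m. g (chart Y m w) = f m w)"
  proof (rule cal_glue)
   fix m w1 w2 assume m: "m \<in> pieces Y"
   interpret conv_norm "fnorm Y m" using m by (rule norm)
   show "f m w2 - f m w1 <= fnorm Y m (w2 - w1)"
    using bump_lip[OF i _ \<kappa>(2) \<xi>] bump_lip[OF j(1) _ \<kappa>(3) \<xi>'] \<kappa>(1) nonneg by (auto simp: f_def)
  next
   fix m n w w' assume "m \<in> pieces Y" "n \<in> pieces Y" "m ~= n" "w \<in> region Y m" "w' \<in> region Y n"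
    "chart Y m w = chart Y n w'"
   then show "f m w = f n w'"
    using ij[of w w'] ij[of w' w] io[of n w w'] io[of m w' w] jo[of n w w'] jo[of m w' w] j(2)
    by (auto simp: f_def)
  qed
  then obtain g where "cal g" "\<And>w. w \<in> region Y i ==> g (chart Y i w) = ?bi w"
   "\<And>w. w \<in> region Y j ==> g (chart Y j w) = ?bj w"
   using i j by (auto simp: f_def)
  moreover have "?bi w = \<xi> (w - a *. ray i k)" if "norm (w - a *. ray i k) < min \<delta>1 \<delta>2" for w
   using bump_near[of \<xi> _ "a *. ray i k" K1 i \<kappa> \<rho>, OF K1(2)[OF \<xi>] \<delta>1(2)] that by auto
  moreover have "?bj w = \<xi>' (w - a *. ray j l)" if "norm (w - a *. ray j l) < min \<delta>1 \<delta>2" for w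
   using bump_near[of \<xi>' _ "a *. ray j l" K2 j \<kappa> \<rho>, OF K2(2)[OF \<xi>'] \<delta>2(2)] that by auto
  ultimately show ?thesis by (intro exI[of _ g]) auto
 qed
 moreover have "0 < min \<delta>1 \<delta>2" using \<delta>1 \<delta>2 by simp
 ultimately show ?thesis by blast
qed

end

section \<open>Regular curves are locally minimizing\<close>

context fan
begin

lemma hgt_hrd:
 "(c has_vector_derivative c') (at t) ==> ((\<lambda>s. hgt i k (c s)) has_real_derivative hgt i k c') (at t)"
 unfolding hgt_def by (intro DERIV_cdivide cross2_hrd)

lemma fnorm_ray:
 assumes i: "i \<in> pieces Y" and o: "opp i k = (j, l)"
 shows "fnorm Y i (x *. ray i k) = fnorm Y j (x *. ray j l)"
proof -
 interpret Fi: conv_norm "fnorm Y i" using i by (rule norm)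
 interpret Fj: conv_norm "fnorm Y j" using opp[OF i o] by (intro norm) auto
 have "fnorm Y i ((- x) *. (- ray i k)) = fnorm Y j ((- x) *. (- ray j l))" if "x < 0"
  using that match(2)[OF i o] by (simp only: Fi.hom Fj.hom)
 then show ?thesis using match(1)[OF i o] by (cases "0 <= x") (auto simp: Fi.hom Fj.hom)
qed

lemma vector_derivative_ev:
 fixes c d :: "real => real^2"
 assumes "smooth_on UNIV c" "smooth_on UNIV d" "0 < e" "\<And>s. s \<in> {t - e<..<t + e} ==> c s = d s"
 shows "vector_derivative c (at t) = vector_derivative d (at t)"
proof -
 have "(d has_vector_derivative vector_derivative c (at t)) (at t)"
  by (rule has_vector_derivative_transform_within_open[OF smooth_curve(1)[OF assms(1)], where S = "{t - e<..<t + e}"])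
   (use assms in auto)
 then show ?thesis using vector_derivative_at by metis
qed

text \<open>On an open time interval, representations in two different cones confine the curve to
  the common ray, or to the apex if there is none; the alternative \<open>x = 0\<close> covers the
  apex.\<close>

lemma common_ray:
 assumes c: "rep Y \<gamma> i c {t - e<..<t + e}" and d: "rep Y \<gamma> j d {t - e<..<t + e}" and ij: "i ~= j" and e: "0 < e"
 obtains x k l where "opp i k = (j, l) \<or> x = 0"
  "vector_derivative c (at t) = x *. ray i k" "vector_derivative d (at t) = x *. ray j l"
  "\<exists>y. c t = y *. ray i k"
proof -
 let ?I = "{t - e<..<t + e}"
 have i: "i \<in> pieces Y" "smooth_on UNIV c" and j: "j \<in> pieces Y" "smooth_on UNIV d"
  using c d by (auto simp: rep_def)
 have in_reg: "c s \<in> region Y i" "d s \<in> region Y j" "chart Y i (c s) = chart Y j (d s)" if "s \<in> ?I" for s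
  using c d that by (auto simp: rep_def)
 have gl: "(c s = 0 \<and> d s = 0) \<or> (\<exists>k l a. 0 < a \<and> opp i k = (j, l) \<and> c s = a *. ray i k \<and> d s = a *. ray j l)"
  if "s \<in> ?I" for s
  using glue[OF i(1) j(1) ij in_reg(1,2)[OF that]] in_reg(3)[OF that] by blast
 show thesis
 proof (cases "\<exists>k l. opp i k = (j, l)")
  case True
  then obtain k l where o: "opp i k = (j, l)" by blast
  have k': "k' = k \<and> l' = l" if "opp i k' = (j, l')" for k' l'
   using opp_ne[OF i(1), of k] o that by (cases "k' = k") auto
  have cs: "c s = hgt i (\<not> k) (c s) *. ray i k" "d s = hgt i (\<not> k) (c s) *. ray j l" if "s \<in> ?I" for s
   using gl[OF that] k' i by auto
  define x where "x = hgt i (\<not> k) (vector_derivative c (at t))"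
  have h: "((\<lambda>s. hgt i (\<not> k) (c s)) has_real_derivative x) (at t)"
   unfolding x_def by (rule hgt_hrd[OF smooth_curve(1)[OF i(2)]])
  have hv: "((\<lambda>s. hgt i (\<not> k) (c s) *. r) has_vector_derivative x *. r) (at t)" for r :: "real^2"
   using has_vector_derivative_scaleR[OF h has_vector_derivative_const[of r]] by simp
  have "(c has_vector_derivative x *. ray i k) (at t)" "(d has_vector_derivative x *. ray j l) (at t)"
   by (rule has_vector_derivative_transform_within_open[OF hv, where S = ?I]; use e cs in auto)+
  then have "vector_derivative c (at t) = x *. ray i k" "vector_derivative d (at t) = x *. ray j l"
   by (simp_all add: vector_derivative_at)
  moreover have "\<exists>y. c t = y *. ray i k" using cs(1)[of t] e by auto
  ultimately show thesis using that o by blast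
 next
  case False
  then have "c s = 0" "d s = 0" if "s \<in> ?I" for s using gl[OF that] by auto
  then have z: "c s = 0 + s *. 0" "d s = 0 + s *. 0" if "s \<in> ?I" for s using that by auto
  have "vector_derivative c (at t) = vector_derivative (\<lambda>s. 0 + s *. 0) (at t)"
   "vector_derivative d (at t) = vector_derivative (\<lambda>s. 0 + s *. 0) (at t)"
   using z by (intro vector_derivative_ev[OF i(2) smooth_on_line e]; simp)
    (use z in \<open>intro vector_derivative_ev[OF j(2) smooth_on_line e]; simp\<close>)
  then have v: "vector_derivative c (at t) = 0 *. ray i k" "vector_derivative d (at t) = 0 *. ray j l" for k l
   by simp_all
  have "\<exists>y. c t = y *. ray i k" for k using z(1)[of t] e by (intro exI[of _ 0]) auto
  then show thesis using that[OF disjI2[OF refl] v] by blast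
 qed
qed

lemma length_unique:
 assumes "has_length Y \<gamma> a b L" "has_length Y \<gamma> a b L'"
 shows "L = L'"
proof (rule pw_unique[OF _ _ assms[unfolded has_length_def]])
 fix i c and a b :: real assume "rep Y \<gamma> i c {a..b}"
 then have i: "i \<in> pieces Y" "smooth_on UNIV c" by (auto simp: rep_def)
 interpret conv_norm "fnorm Y i" using i(1) by (rule norm)
 show "(\<lambda>t. fnorm Y i (vector_derivative c (at t))) integrable_on {a..b}" by (rule speed_integrable[OF i(2)])
next
 fix i j c d and t e :: real
 assume e: "0 < e" and c: "rep Y \<gamma> i c {t - e<..<t + e}" and d: "rep Y \<gamma> j d {t - e<..<t + e}"
 show "fnorm Y i (vector_derivative c (at t)) = fnorm Y j (vector_derivative d (at t))"
 proof (cases "i = j")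
  case True
  have i: "i \<in> pieces Y" using c by (auto simp: rep_def)
  have "c s = d s" if "s \<in> {t - e<..<t + e}" for s
   using c d that True inj_onD[OF chart_inj[OF i]] by (simp add: rep_def)
  then show ?thesis using vector_derivative_ev[of c d e t] c d e True by (simp add: rep_def)
 next
  case False
  have i: "i \<in> pieces Y" "j \<in> pieces Y" using c d by (auto simp: rep_def)
  interpret Fi: conv_norm "fnorm Y i" using i(1) by (rule norm)
  interpret Fj: conv_norm "fnorm Y j" using i(2) by (rule norm)
  obtain x k l where "opp i k = (j, l) \<or> x = 0"
   "vector_derivative c (at t) = x *. ray i k" "vector_derivative d (at t) = x *. ray j l"
   using common_ray[OF c d False e] by metis
  then show ?thesis using fnorm_ray[OF i(1)] by auto
 qed
qed

text \<open>Geodesics through the interior of a cone, and geodesics refracted at a ray.\<close>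

definition regA :: "(real => 'q) => real => 'i => real^2 => real^2 => real => bool" where
 "regA c t i n v e \<longleftrightarrow> 0 < e \<and> i \<in> pieces Y \<and> fnorm Y i v = 1 \<and>
   (\<forall>s. \<bar>s - t\<bar> < e --> (\<forall>k. 0 < hgt i k (n + s *. v)) \<and> c s = chart Y i (n + s *. v))"

text \<open>Equality of the two differentials on the common ray is Snell's law. The affine lines
  before and after the crossing share the time parameter and meet the ray at time
  \<open>t\<close>.\<close>

definition regB :: "(real => 'q) => real => 'i => bool => real^2 => real^2 => 'i => bool => real^2 => real^2 =>
  real => real => bool" where
 "regB c t i k n v j l n' v' a e \<longleftrightarrow> 0 < e \<and> 0 < a \<and> i \<in> pieces Y \<and> opp i k = (j, l) \<and>
   fnorm Y i v = 1 \<and> fnorm Y j v' = 1 \<and> hgt i k v < 0 \<and> 0 < hgt j l v' \<and>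
   dn (fnorm Y i) v (ray i k) = dn (fnorm Y j) v' (ray j l) \<and>
   n + t *. v = a *. ray i k \<and> n' + t *. v' = a *. ray j l \<and>
   (\<forall>s. t - e < s \<and> s <= t --> n + s *. v \<in> region Y i \<and> c s = chart Y i (n + s *. v)) \<and>
   (\<forall>s. t <= s \<and> s < t + e --> n' + s *. v' \<in> region Y j \<and> c s = chart Y j (n' + s *. v'))"

definition regular :: "(real => 'q) => real => bool" where
 "regular c t \<longleftrightarrow> (\<exists>i n v e. regA c t i n v e) \<or> (\<exists>i k n v j l n' v' a e. regB c t i k n v j l n' v' a e)"

lemma small_time:
 fixes v :: "real^2"
 assumes "0 < \<delta>"
 shows "\<exists>e>0. \<forall>s. \<bar>s - t\<bar> < e --> norm ((s - t) *. v) < \<delta>"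
proof -
 have "norm ((s - t) *. v) < \<delta>" if "\<bar>s - t\<bar> < \<delta> / (norm v + 1)" for s
 proof -
  have "norm ((s - t) *. v) <= \<bar>s - t\<bar> * (norm v + 1)" by (simp add: mult_left_mono)
  also have "\<dots> < \<delta>" using that by (simp add: pos_less_divide_eq add_nonneg_pos)
  finally show ?thesis .
 qed
 moreover have "0 < \<delta> / (norm v + 1)" using assms by (simp add: add_nonneg_pos)
 ultimately show ?thesis by blast
qed

lemma region_pos: "i \<in> pieces Y ==> (\<And>k. 0 < hgt i k w) ==> w \<in> region Y i"
 using region_iff[of i w True] by (auto simp: less_imp_le)

text \<open>The differential at the velocity, or at a ray the two differentials matched by Snell's
  law, extend to a calibration that grows at unit rate along the curve, so length and distance
  coincide nearby.\<close>

lemma regular_local: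
 assumes "regular c t"
 shows "\<exists>e>0. \<forall>a b. t - e < a \<and> a <= b \<and> b < t + e -->
  has_length Y c a b (b - a) \<and> fdist Y (c a) (c b) = b - a"
 using assms unfolding regular_def
proof (elim disjE exE)
 fix i n v e assume "regA c t i n v e"
 then have e: "0 < e" and i: "i \<in> pieces Y" and v: "fnorm Y i v = 1"
  and c: "\<And>s k. \<bar>s - t\<bar> < e ==> 0 < hgt i k (n + s *. v)" "\<And>s. \<bar>s - t\<bar> < e ==> c s = chart Y i (n + s *. v)"
  by (auto simp: regA_def)
 interpret conv_norm "fnorm Y i" using i by (rule norm)
 have v0: "v ~= 0" using v by auto
 have cr: "n + s *. v \<in> region Y i" if "\<bar>s - t\<bar> < e" for s using region_pos[OF i] c(1)[OF that] by blast
 obtain \<delta> where \<delta>: "\<delta> > 0" "\<And>\<xi>. covec i \<xi> ==>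
  (\<exists>g. cal g \<and> (\<forall>w\<in>region Y i. norm (w - (n + t *. v)) < \<delta> --> g (chart Y i w) = \<xi> (w - (n + t *. v))))"
  using cal_interior[OF i, of True "n + t *. v"] c(1)[of t] e by auto
 obtain g where g: "cal g" "\<And>w. w \<in> region Y i ==> norm (w - (n + t *. v)) < \<delta> ==>
   g (chart Y i w) = dn (fnorm Y i) v (w - (n + t *. v))"
  using \<delta>(2)[OF covec_dn[OF i v0]] by blast
 obtain e' where e': "e' > 0" "\<And>s. \<bar>s - t\<bar> < e' ==> norm ((s - t) *. v) < \<delta>" using small_time[OF \<delta>(1)] by blast
 have "has_length Y c a b (b - a) \<and> fdist Y (c a) (c b) = b - a"
  if ab: "t - min e e' < a" "a <= b" "b < t + min e e'" for a b
 proof -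
  have len: "has_length Y c a b (b - a)"
   using line_length[OF i ab(2), of n v c] cr c(2) ab v by auto
  have gc: "g (c s) = s - t" if "a <= s" "s <= b" for s
  proof -
   have s: "\<bar>s - t\<bar> < e" "\<bar>s - t\<bar> < e'" using that ab by auto
   have "(n + s *. v) - (n + t *. v) = (s - t) *. v" by (simp add: algebra_simps)
   then have "g (c s) = dn (fnorm Y i) v ((s - t) *. v)"
    using g(2)[OF cr[OF s(1)]] e'(2)[OF s(2)] c(2)[OF s(1)] by metis
   then show ?thesis using v0 v by (simp add: dn_lin euler)
  qed
  have "b - a <= fdist Y (c a) (c b)" using fdist_ge[OF len g(1)] gc[of a] gc[of b] ab by simp
  then show ?thesis using len fdist_le[OF len] by simp
 qed
 then show ?thesis using e e' by (intro exI[of _ "min e e'"]) auto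
next
 fix i k n v j l n' v' a e assume "regB c t i k n v j l n' v' a e"
 then have e: "0 < e" and a: "0 < a" and i: "i \<in> pieces Y" and o: "opp i k = (j, l)" and v: "fnorm Y i v = 1"
  and v': "fnorm Y j v' = 1" and dn: "dn (fnorm Y i) v (ray i k) = dn (fnorm Y j) v' (ray j l)"
  and p: "n + t *. v = a *. ray i k" "n' + t *. v' = a *. ray j l"
  and c: "\<And>s. t - e < s ==> s <= t ==> n + s *. v \<in> region Y i \<and> c s = chart Y i (n + s *. v)"
  and c': "\<And>s. t <= s ==> s < t + e ==> n' + s *. v' \<in> region Y j \<and> c s = chart Y j (n' + s *. v')"
  by (auto simp: regB_def)
 have j: "j \<in> pieces Y" using opp[OF i o] by auto
 interpret Fi: conv_norm "fnorm Y i" using i by (rule norm)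
 interpret Fj: conv_norm "fnorm Y j" using j by (rule norm)
 have v0: "v ~= 0" "v' ~= 0" using v v' by auto
 obtain \<delta> where \<delta>: "\<delta> > 0" "\<And>\<xi> \<xi>'. covec i \<xi> ==> covec j \<xi>' ==> \<xi> (ray i k) = \<xi>' (ray j l) ==>
  (\<exists>g. cal g \<and>
   (\<forall>w\<in>region Y i. norm (w - a *. ray i k) < \<delta> --> g (chart Y i w) = \<xi> (w - a *. ray i k)) \<and>
   (\<forall>w\<in>region Y j. norm (w - a *. ray j l) < \<delta> --> g (chart Y j w) = \<xi>' (w - a *. ray j l)))"
  using cal_ray[OF i o a] by blast
 obtain g where g: "cal g"
  "\<And>w. w \<in> region Y i ==> norm (w - a *. ray i k) < \<delta> ==> g (chart Y i w) = dn (fnorm Y i) v (w - a *. ray i k)"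
  "\<And>w. w \<in> region Y j ==> norm (w - a *. ray j l) < \<delta> ==> g (chart Y j w) = dn (fnorm Y j) v' (w - a *. ray j l)"
  using \<delta>(2)[OF covec_dn[OF i v0(1)] covec_dn[OF j v0(2)] dn] by blast
 obtain e1 where e1: "e1 > 0" "\<And>s. \<bar>s - t\<bar> < e1 ==> norm ((s - t) *. v) < \<delta>" using small_time[OF \<delta>(1)] by blast
 obtain e2 where e2: "e2 > 0" "\<And>s. \<bar>s - t\<bar> < e2 ==> norm ((s - t) *. v') < \<delta>" using small_time[OF \<delta>(1)] by blast
 define E where "E = min e (min e1 e2)"
 have E: "E > 0" "E <= e" "E <= e1" "E <= e2" using e e1 e2 by (auto simp: E_def)
 have "has_length Y c x y (y - x) \<and> fdist Y (c x) (c y) = y - x"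
  if xy: "t - E < x" "x <= y" "y < t + E" for x y
 proof -
  have l1: "has_length Y c u w (w - u)" if "t - E < u" "u <= w" "w <= t" for u w
   using line_length[OF i that(2), of n v c] c v that E by auto
  have l2: "has_length Y c u w (w - u)" if "t <= u" "u <= w" "w < t + E" for u w
   using line_length[OF j that(2), of n' v' c] c' v' that E by auto
  have len: "has_length Y c x y (y - x)"
  proof -
   consider "y <= t" | "t <= x" | "x < t" "t < y" by linarith
   then show ?thesis
   proof cases
    case 3
    then have "has_length Y c x y ((t - x) + (y - t))"
     using l1[of x t] l2[of t y] xy unfolding has_length_def by (intro join[where b = t]) auto
    then show ?thesis by simp
   qed (use l1 l2 xy in auto)
  qed
  have gc: "g (c s) = s - t" if "x <= s" "s <= y" for s
  proof (cases "s <= t")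
   case True
   have s: "t - e < s" "\<bar>s - t\<bar> < e1" using that xy E True by auto
   have "(n + s *. v) - a *. ray i k = (s - t) *. v" unfolding p(1)[symmetric] by (simp add: algebra_simps)
   then have "g (c s) = dn (fnorm Y i) v ((s - t) *. v)"
    using g(2)[of "n + s *. v"] c[OF s(1) True] e1(2)[OF s(2)] by simp
   then show ?thesis using v0 v by (simp add: Fi.dn_lin Fi.euler)
  next
   case False
   have s: "s < t + e" "\<bar>s - t\<bar> < e2" using that xy E False by auto
   have "(n' + s *. v') - a *. ray j l = (s - t) *. v'" unfolding p(2)[symmetric] by (simp add: algebra_simps)
   then have "g (c s) = dn (fnorm Y j) v' ((s - t) *. v')"
    using g(3)[of "n' + s *. v'"] c'[OF _ s(1)] e2(2)[OF s(2)] False by simp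
   then show ?thesis using v0 v' by (simp add: Fj.dn_lin Fj.euler)
  qed
  have "y - x <= fdist Y (c x) (c y)" using fdist_ge[OF len g(1)] gc[of x] gc[of y] xy by simp
  then show ?thesis using len fdist_le[OF len] by simp
 qed
 then show ?thesis using E by blast
qed

text \<open>\<open>geodesic\<close> at unit speed, with the local condition turned into a value of
  \<open>fdist\<close>. Uniqueness of lengths gives it for every geodesic that has unit speed on
  some interval.\<close>

definition locmin :: "(real => 'q) => bool" where
 "locmin \<gamma> \<longleftrightarrow> (\<forall>a b. a <= b --> has_length Y \<gamma> a b (b - a)) \<and>
   (\<forall>t. \<exists>e>0. \<forall>a b. t - e < a \<and> a <= b \<and> b < t + e --> fdist Y (\<gamma> a) (\<gamma> b) = b - a)"

lemma regular_locmin: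
 assumes "\<And>t. regular c t"
 shows "locmin c"
 unfolding locmin_def
proof (intro conjI allI impI)
 fix a b :: real assume "a <= b"
 then show "has_length Y c a b (b - a)"
 proof (induction a b rule: Bolzano)
  case (trans a b d)
  then have "has_length Y c a d ((b - a) + (d - b))" unfolding has_length_def by (intro join)
  then show ?case by simp
 next
  case (local x)
  obtain e where e: "e > 0" "\<And>a b. x - e < a \<and> a <= b \<and> b < x + e ==> has_length Y c a b (b - a)"
   using regular_local[OF assms] by meson
  show ?case using e by (intro exI[of _ e]) auto
 qed
next
 fix t
 show "\<exists>e>0. \<forall>a b. t - e < a \<and> a <= b \<and> b < t + e --> fdist Y (c a) (c b) = b - a"
  using regular_local[OF assms] by meson
qed

lemma locmin_geodesic: "locmin \<gamma> ==> geodesic Y \<gamma>"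
proof -
 assume l: "locmin \<gamma>"
 have "\<exists>\<kappa>>0. \<forall>a b. a <= b --> has_length Y \<gamma> a b (\<kappa> * (b - a))"
  using l by (intro exI[of _ 1]) (auto simp: locmin_def)
 moreover have "\<exists>e>0. \<forall>a b. t - e < a \<and> a <= b \<and> b < t + e --> has_length Y \<gamma> a b (fdist Y (\<gamma> a) (\<gamma> b))" for t
 proof -
  obtain e where "e > 0" "\<And>a b. t - e < a \<and> a <= b \<and> b < t + e ==> fdist Y (\<gamma> a) (\<gamma> b) = b - a"
   using l unfolding locmin_def by meson
  then show ?thesis using l by (intro exI[of _ e]) (auto simp: locmin_def)
 qed
 ultimately show ?thesis by (simp add: geodesic_def)
qed

lemma geodesic_locmin:
 assumes g: "geodesic Y \<gamma>" and l: "has_length Y \<gamma> a b (b - a)" "a < b"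
 shows "locmin \<gamma>"
proof -
 obtain \<kappa> where \<kappa>: "\<And>a b. a <= b ==> has_length Y \<gamma> a b (\<kappa> * (b - a))" using g by (auto simp: geodesic_def)
 have "\<kappa> * (b - a) = b - a" using length_unique[OF \<kappa>[of a b] l(1)] l(2) by simp
 then have "\<kappa> = 1" using l(2) by simp
 then have len: "has_length Y \<gamma> a b (b - a)" if "a <= b" for a b using \<kappa>[OF that] by simp
 have "\<exists>e>0. \<forall>a b. t - e < a \<and> a <= b \<and> b < t + e --> fdist Y (\<gamma> a) (\<gamma> b) = b - a" for t
 proof -
  obtain e where "e > 0" "\<And>a b. t - e < a \<and> a <= b \<and> b < t + e ==> has_length Y \<gamma> a b (fdist Y (\<gamma> a) (\<gamma> b))"
   using g unfolding geodesic_def by meson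
  then show ?thesis using length_unique[OF _ len] by (intro exI[of _ e]) auto
 qed
 then show ?thesis using len by (simp add: locmin_def)
qed

text \<open>The differentials at \<open>r\<close> and \<open>- r\<close> realise the extreme values
  on \<open>r\<close>, and their convex combinations everything between.\<close>

lemma covec_mix:
 assumes i: "i \<in> pieces Y" and r: "r ~= 0" and \<tau>: "- fnorm Y i (- r) <= \<tau>" "\<tau> <= fnorm Y i r"
 shows "\<exists>\<xi>. covec i \<xi> \<and> \<xi> r = \<tau>"
proof -
 interpret conv_norm "fnorm Y i" using i by (rule norm)
 let ?F = "fnorm Y i"
 have pos: "0 < ?F r" "0 < ?F (- r)" using r by (auto simp: pos)
 define \<theta> where "\<theta> = (\<tau> + ?F (- r)) / (?F r + ?F (- r))"
 have \<theta>: "0 <= \<theta>" "\<theta> <= 1" using \<tau> pos by (auto simp: \<theta>_def)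
 define \<xi> where "\<xi> w = \<theta> * dn ?F r w + (1 - \<theta>) * dn ?F (- r) w" for w
 have "linear \<xi>" using r by (intro linearI) (auto simp: \<xi>_def dn_lin algebra_simps)
 moreover have "\<xi> w <= ?F w" for w
 proof -
  have "\<xi> w <= \<theta> * ?F w + (1 - \<theta>) * ?F w"
   unfolding \<xi>_def using r \<theta> by (intro add_mono mult_left_mono dn_le) auto
  then show ?thesis by (simp add: algebra_simps)
 qed
 moreover have "dn ?F (- r) r = - ?F (- r)" using euler[of "- r"] r dn_lin(4)[of "- r" "- r"] by simp
 then have "\<xi> r = \<tau>"
 proof -
  assume a: "dn ?F (- r) r = - ?F (- r)"
  have "\<xi> r = \<theta> * (?F r + ?F (- r)) - ?F (- r)" using r by (simp add: \<xi>_def a euler algebra_simps)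
  then show ?thesis using pos by (simp add: \<theta>_def)
 qed
 ultimately show ?thesis by (auto simp: covec_def)
qed

text \<open>The segment is calibrated by the differential at \<open>q - p\<close>. If
  \<open>p\<close> lies on a ray, the neighbouring cone needs a covector with the same value on the
  ray; it exists because the two norms agree along the ray in both directions.\<close>

lemma fdist_local:
 assumes i: "i \<in> pieces Y" and p: "p \<in> region Y i" "p ~= 0"
 shows "\<exists>\<delta>>0. \<forall>q\<in>region Y i. norm (q - p) < \<delta> --> fdist Y (chart Y i p) (chart Y i q) = fnorm Y i (q - p)"
proof -
 interpret conv_norm "fnorm Y i" using i by (rule norm)
 have fin: "fdist Y (chart Y i p) (chart Y i q) = fnorm Y i (q - p)"
  if q: "q \<in> region Y i" and g: "q ~= p ==> \<exists>g. cal g \<and> g (chart Y i q) - g (chart Y i p) = fnorm Y i (q - p)" for q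
 proof -
  have "\<exists>g. cal g \<and> g (chart Y i q) - g (chart Y i p) = fnorm Y i (q - p)"
   using g cal_0 by (cases "q = p") auto
  then have "fnorm Y i (q - p) <= fdist Y (chart Y i p) (chart Y i q)"
   using fdist_ge'[OF i p(1) q] by metis
  then show ?thesis using fdist_segment[OF i p(1) q] by simp
 qed
 show ?thesis
 proof (cases "\<exists>k. hgt i k p = 0")
  case False
  then have pos: "0 < hgt i k p" for k using p region_iff[OF i, of p k] by (metis order_le_less)
  obtain \<delta> where \<delta>: "\<delta> > 0" "\<And>\<xi>. covec i \<xi> ==>
    (\<exists>g. cal g \<and> (\<forall>w\<in>region Y i. norm (w - p) < \<delta> --> g (chart Y i w) = \<xi> (w - p)))"
   using cal_interior[OF i pos pos] by metis
  have "fdist Y (chart Y i p) (chart Y i q) = fnorm Y i (q - p)" if q: "q \<in> region Y i" "norm (q - p) < \<delta>" for q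
  proof (rule fin[OF q(1)])
   assume "q ~= p"
   then have ne: "q - p ~= 0" by simp
   obtain g where g: "cal g" "\<And>w. w \<in> region Y i ==> norm (w - p) < \<delta> ==> g (chart Y i w) = dn (fnorm Y i) (q - p) (w - p)"
    using \<delta>(2)[OF covec_dn[OF i ne]] by blast
   have "g (chart Y i q) - g (chart Y i p) = fnorm Y i (q - p)"
    using g(2)[OF q] g(2)[OF p(1)] \<delta>(1) euler[OF ne] ne by (simp add: dn_lin)
   then show "\<exists>g. cal g \<and> g (chart Y i q) - g (chart Y i p) = fnorm Y i (q - p)" using g(1) by blast
  qed
  then show ?thesis using \<delta>(1) by blast
 next
  case True
  then obtain k where k: "hgt i k p = 0" by blast
  define a where "a = hgt i (\<not> k) p"
  have pa: "p = a *. ray i k" using hgt_eq_0[OF i k] by (simp add: a_def)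
  have "a ~= 0" using pa p(2) by (metis scaleR_zero_left)
  moreover have "0 <= a" using p(1) region_iff[OF i, of p k] by (simp add: a_def)
  ultimately have a: "0 < a" by simp
  obtain j l where o: "opp i k = (j, l)" by fastforce
  have j: "j \<in> pieces Y" using opp[OF i o] by auto
  obtain \<delta> where \<delta>: "\<delta> > 0" "\<And>\<xi> \<xi>'. covec i \<xi> ==> covec j \<xi>' ==> \<xi> (ray i k) = \<xi>' (ray j l) ==>
   (\<exists>g. cal g \<and>
    (\<forall>w\<in>region Y i. norm (w - p) < \<delta> --> g (chart Y i w) = \<xi> (w - p)) \<and>
    (\<forall>w\<in>region Y j. norm (w - a *. ray j l) < \<delta> --> g (chart Y j w) = \<xi>' (w - a *. ray j l)))"
   using cal_ray[OF i o a] unfolding pa[symmetric] by blast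
  have "fdist Y (chart Y i p) (chart Y i q) = fnorm Y i (q - p)" if q: "q \<in> region Y i" "norm (q - p) < \<delta>" for q
  proof (rule fin[OF q(1)])
   assume "q ~= p"
   then have ne: "q - p ~= 0" by simp
   have "- fnorm Y j (- ray j l) <= dn (fnorm Y i) (q - p) (ray i k)"
    "dn (fnorm Y i) (q - p) (ray i k) <= fnorm Y j (ray j l)"
    using dn_le[OF ne] dn_ge[OF ne] match[OF i o] by metis+
   then obtain \<xi>' where \<xi>': "covec j \<xi>'" "dn (fnorm Y i) (q - p) (ray i k) = \<xi>' (ray j l)"
    using covec_mix[OF j ray_nz[OF j]] by metis
   obtain g where g: "cal g" "\<And>w. w \<in> region Y i ==> norm (w - p) < \<delta> ==> g (chart Y i w) = dn (fnorm Y i) (q - p) (w - p)"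
    using \<delta>(2)[OF covec_dn[OF i ne] \<xi>'] by blast
   have "g (chart Y i q) - g (chart Y i p) = fnorm Y i (q - p)"
    using g(2)[OF q] g(2)[OF p(1)] \<delta>(1) euler[OF ne] ne by (simp add: dn_lin)
   then show "\<exists>g. cal g \<and> g (chart Y i q) - g (chart Y i p) = fnorm Y i (q - p)" using g(1) by blast
  qed
  then show ?thesis using \<delta>(1) by blast
 qed
qed

end

section \<open>A short piece determines a geodesic\<close>

context fan
begin

text \<open>The incoming half of a regular curve, in the form common to both kinds of points.\<close>

lemma regular_left:
 assumes "regular c t"
 obtains i n v e where "0 < e" "i \<in> pieces Y" "fnorm Y i v = 1" "n + t *. v \<in> region Y i" "n + t *. v ~= 0"
  "c t = chart Y i (n + t *. v)"
  "\<And>s k. t - e < s ==> s < t ==> 0 < hgt i k (n + s *. v)"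
  "\<And>s. t - e < s ==> s < t ==> c s = chart Y i (n + s *. v)"
  "regA c t i n v e \<or> (\<exists>k j l n' v' a. regB c t i k n v j l n' v' a e)"
 using assms unfolding regular_def
proof (elim disjE exE)
 fix i n v e assume r: "regA c t i n v e"
 then have c: "\<And>s k. \<bar>s - t\<bar> < e ==> 0 < hgt i k (n + s *. v)" and i: "i \<in> pieces Y" and e: "0 < e" by (auto simp: regA_def)
 have "n + t *. v \<in> region Y i" using region_pos[OF i] c[of t] e by auto
 moreover have "n + t *. v ~= 0" using c[of t True] e hgt_lin(5)[of i True] by (metis abs_zero diff_self less_irrefl)
 ultimately show thesis using r that[of e i v n] by (auto simp: regA_def)
next
 fix i k n v j l n' v' a e assume r: "regB c t i k n v j l n' v' a e"
 then have i: "i \<in> pieces Y" and a: "0 < a" and e: "0 < e" and hv: "hgt i k v < 0" and p: "n + t *. v = a *. ray i k"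
  and c: "\<And>s. t - e < s ==> s <= t ==> n + s *. v \<in> region Y i \<and> c s = chart Y i (n + s *. v)"
  by (auto simp: regB_def)
 have hs: "hgt i h (n + s *. v) = hgt i h (a *. ray i k) + (s - t) * hgt i h v" for h s
  unfolding p[symmetric] by (simp add: algebra_simps)
 \<comment> \<open>Before time \<open>t\<close> the height above the crossed ray is positive because
   it decreases to 0; the other height is positive near \<open>t\<close> by continuity.\<close>
 have "((\<lambda>s. hgt i (\<not> k) (n + s *. v)) \<longlongrightarrow> hgt i (\<not> k) (n + t *. v)) (at t)"
  by (intro tendsto_hgt tendsto_intros)
 moreover have "0 < hgt i (\<not> k) (n + t *. v)" using i a by (simp only: p) simp
 ultimately have "eventually (\<lambda>s. 0 < hgt i (\<not> k) (n + s *. v)) (at t)" by (rule order_tendstoD)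
 then obtain d where d: "d > 0" "\<And>s. s ~= t ==> dist s t < d ==> 0 < hgt i (\<not> k) (n + s *. v)"
  unfolding eventually_at by auto
 have pos: "0 < hgt i h (n + s *. v)" if "t - min e d < s" "s < t" for s h
 proof (cases "h = k")
  case True
  then show ?thesis using that hs[of k s] hv i by (simp add: mult_neg_neg)
 next
  case False
  then show ?thesis using d(2)[of s] that by (cases h; cases k) (auto simp: dist_real_def)
 qed
 have "regB c t i k n v j l n' v' a (min e d)" using r d(1) by (auto simp: regB_def)
 moreover have "n + t *. v ~= 0" using a ray_nz[OF i] by (simp add: p)
 ultimately show thesis
  using that[where e = "min e d" and i = i and n = n and v = v, OF _ i _ _ _ _ pos] c[of t] c e d(1) r
  by (simp add: regB_def) blast
qed

lemma interior_glue:
 assumes i: "i \<in> pieces Y" "\<And>k. 0 < hgt i k w" and m: "m \<in> pieces Y" "w' \<in> region Y m" and eq: "chart Y i w = chart Y m w'"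
 shows "m = i \<and> w' = w"
proof (cases "m = i")
 case True
 then show ?thesis using inj_onD[OF chart_inj[OF i(1)], of w w'] eq region_pos[OF i] m by auto
next
 case False
 then consider "w = 0" | k a where "w = a *. ray i k"
  using glue[OF i(1) m(1) _ region_pos[OF i] m(2)] eq by blast
 then show ?thesis
 proof cases
  case 2
  then show ?thesis using i(2)[of k] by simp
 qed (use i(2)[of True] in auto)
qed

text \<open>The position at time \<open>t\<close> follows by continuity. After it the direction is
  forced by minimality on intervals that contain \<open>t\<close> in their interior.\<close>

lemma extend_step:
 assumes r: "regular c t" and g: "locmin \<gamma>" and e0: "0 < e0" and eq: "\<And>s. t - e0 < s ==> s < t ==> \<gamma> s = c s"
 shows "\<exists>e1>0. \<forall>s. t <= s \<and> s < t + e1 --> \<gamma> s = c s"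
proof -
 obtain i n v e where e: "0 < e" and i: "i \<in> pieces Y" and v: "fnorm Y i v = 1"
  and p: "n + t *. v \<in> region Y i" "n + t *. v ~= 0" and ct: "c t = chart Y i (n + t *. v)"
  and left: "\<And>s k. t - e < s ==> s < t ==> 0 < hgt i k (n + s *. v)"
   "\<And>s. t - e < s ==> s < t ==> c s = chart Y i (n + s *. v)"
  and AB: "regA c t i n v e \<or> (\<exists>k j l n' v' a. regB c t i k n v j l n' v' a e)"
  by (rule regular_left[OF r], rule that)
 interpret Fi: conv_norm "fnorm Y i" using i by (rule norm)
 have v0: "v ~= 0" using v by auto
 define p where "p = n + t *. v"
 have ns: "n + s *. v = p + (s - t) *. v" for s by (simp add: p_def algebra_simps)
 have len: "has_length Y \<gamma> a b (b - a)" if "a <= b" for a b using g that by (simp add: locmin_def)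
 obtain e2 where e2: "e2 > 0" "\<And>a b. t - e2 < a ==> a <= b ==> b < t + e2 ==> fdist Y (\<gamma> a) (\<gamma> b) = b - a"
  using g unfolding locmin_def by meson
 define E where "E = min e (min e0 e2)"
 have E: "E > 0" "E <= e" "E <= e0" "E <= e2" using e e0 e2 by (auto simp: E_def)
 \<comment> \<open>The last smooth piece before \<open>t\<close> runs through the interior of cone
   \<open>i\<close>, hence is represented there, and its value at \<open>t\<close> is the limit of
   the line.\<close>
 have \<gamma>t: "\<gamma> t = chart Y i p"
 proof -
  obtain t1 m d where t1: "t1 < t" "rep Y \<gamma> m d {t1..t}"
   using pw_last[OF len[of "t - 1" t, unfolded has_length_def]] by auto
  then have m: "m \<in> pieces Y" "smooth_on UNIV d" and dr: "\<And>s. t1 <= s ==> s <= t ==> d s \<in> region Y m \<and> \<gamma> s = chart Y m (d s)"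
   by (auto simp: rep_def)
  have md: "m = i \<and> d s = n + s *. v" if "max t1 (t - E) < s" "s < t" for s
  proof (rule interior_glue[OF i left(1) m(1)])
   have s: "t - e < s" "s < t" "t - e0 < s" "t1 <= s" "s <= t" using that E by auto
   then show "t - e < s" "s < t" "d s \<in> region Y m" using dr by auto
   show "chart Y i (n + s *. v) = chart Y m (d s)"
    using dr[OF s(4,5)] eq[OF s(3,2)] left(2)[OF s(1,2)] by simp
  qed
  have mi: "m = i" using md[of "(max t1 (t - E) + t) / 2"] t1 E by auto
  have "eventually (\<lambda>s. d s = n + s *. v) (at_left t)"
   unfolding eventually_at_left_field using md t1 E by (intro exI[of _ "max t1 (t - E)"]) auto
  moreover have "(d \<longlongrightarrow> d t) (at_left t)"
   using smooth_curve(3)[OF m(2), of UNIV] by (auto simp: continuous_on_def intro: tendsto_within_subset[OF _ subset_UNIV])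
  ultimately have "((\<lambda>s. n + s *. v) \<longlongrightarrow> d t) (at_left t)" by (rule Lim_transform_eventually[rotated])
  moreover have "((\<lambda>s. n + s *. v) \<longlongrightarrow> n + t *. v) (at_left t)" by (intro tendsto_intros)
  ultimately have "d t = n + t *. v" using tendsto_unique trivial_limit_at_left_real by blast
  then show ?thesis using dr[of t] t1 mi by (simp add: p_def)
 qed
 obtain t2 m d where t2: "t < t2" "rep Y \<gamma> m d {t..t2}"
  using pw_first[OF len[of t "t + 1", unfolded has_length_def]] by auto
 then have m: "m \<in> pieces Y" "smooth_on UNIV d" and dr: "\<And>s. t <= s ==> s <= t2 ==> d s \<in> region Y m \<and> \<gamma> s = chart Y m (d s)"
  by (auto simp: rep_def)
 have near: "\<exists>e3>0. \<forall>s. \<bar>s - t\<bar> < e3 --> norm (d s - d t) < \<delta>" if "0 < \<delta>" for \<delta>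
 proof -
  have "continuous_on UNIV d" by (rule smooth_curve(3)[OF m(2)])
  then show ?thesis using that unfolding continuous_on_iff by (simp add: dist_norm)
 qed
 define ta where "ta = t - E / 2"
 have ta: "t - e < ta" "t - e0 < ta" "t - e2 < ta" "ta < t" using E by (auto simp: ta_def)
 have \<gamma>a: "\<gamma> ta = chart Y i (n + ta *. v)" "n + ta *. v \<in> region Y i"
  using left[OF ta(1,4)] eq[OF ta(2,4)] region_pos[OF i] by auto
 have w: "p - (n + ta *. v) = (t - ta) *. v" by (simp add: p_def algebra_simps)
 have Fw: "fnorm Y i ((t - ta) *. v) = t - ta" using ta v by (simp add: Fi.hom)
 \<comment> \<open>If the next piece stays in cone \<open>i\<close>, the distances between the
   points at times \<open>ta < t < s\<close> add up, and the equality case of the triangle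
   inequality makes these points collinear.\<close>
 have same: "\<exists>e1>0. \<forall>s. t < s \<and> s < t + e1 --> s <= t2 \<and> d s = n + s *. v" if mi: "m = i"
 proof -
  have dt: "d t = p" using inj_onD[OF chart_inj[OF i], of "d t" p] dr[of t] t2 \<gamma>t p mi by (simp add: p_def)
  obtain \<delta> where \<delta>: "\<delta> > 0" "\<And>q. q \<in> region Y i ==> norm (q - p) < \<delta> ==>
    fdist Y (chart Y i p) (chart Y i q) = fnorm Y i (q - p)"
   using fdist_local[OF i p] unfolding p_def by blast
  obtain e3 where e3: "e3 > 0" "\<And>s. \<bar>s - t\<bar> < e3 ==> norm (d s - p) < \<delta>" using near[OF \<delta>(1)] dt by auto
  define e1 where "e1 = min e3 (min E (t2 - t))"
  have "s <= t2 \<and> d s = n + s *. v" if s: "t < s" "s < t + e1" for s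
  proof -
   have s': "\<bar>s - t\<bar> < e3" "s < t2" "s < t + e2" using s E by (auto simp: e1_def)
   let ?q = "d s"
   have q: "?q \<in> region Y i" "\<gamma> s = chart Y i ?q" using dr[of s] s s' mi by auto
   have Fu: "fnorm Y i (?q - p) = s - t"
    using \<delta>(2)[OF q(1) e3(2)[OF s'(1)]] e2(2)[of t s] s s' e2(1) \<gamma>t q by simp
   have "s - ta <= fnorm Y i (?q - (n + ta *. v))"
    using fdist_segment[OF i \<gamma>a(2) q(1)] e2(2)[of ta s] ta s s' \<gamma>a q by simp
   also have "?q - (n + ta *. v) = (?q - p) + (t - ta) *. v" using w by (simp add: algebra_simps)
   finally have "fnorm Y i (?q - p) + fnorm Y i ((t - ta) *. v) <= fnorm Y i ((?q - p) + (t - ta) *. v)"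
    using Fu Fw by simp
   from Fi.triangle_eq[OF this] obtain z where z: "z \<ge> 0" "?q - p = z *. ((t - ta) *. v)" using v0 ta by auto
   have "z * (t - ta) = s - t" using Fu unfolding z(2) Fi.hom[OF z(1)] Fw .
   then have "?q - p = (s - t) *. v" using z by simp
   then have "?q = p + (s - t) *. v" by (metis add.commute diff_add_cancel)
   then show ?thesis using ns[of s] s' by simp
  qed
  moreover have "e1 > 0" using e3 E t2 by (simp add: e1_def)
  ultimately show ?thesis by blast
 qed
 have "\<exists>e1>0. \<forall>s. t < s \<and> s < t + e1 --> \<gamma> s = c s"
  using AB
 proof (elim disjE exE)
  assume A: "regA c t i n v e"
  then have "m = i" using interior_glue[OF i, of p m "d t"] dr[of t] t2 \<gamma>t m by (auto simp: regA_def p_def)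
  then obtain e1 where "e1 > 0" "\<And>s. t < s ==> s < t + e1 ==> s <= t2 \<and> d s = n + s *. v" using same by blast
  then show ?thesis using A dr \<open>m = i\<close> by (intro exI[of _ "min e1 e"]) (auto simp: regA_def)
 next
  fix k j l n' v' a assume B: "regB c t i k n v j l n' v' a e"
  then have a: "0 < a" and o: "opp i k = (j, l)" and v': "fnorm Y j v' = 1" and hv: "hgt i k v < 0" "0 < hgt j l v'"
   and dn: "dn (fnorm Y i) v (ray i k) = dn (fnorm Y j) v' (ray j l)"
   and pp: "p = a *. ray i k" "n' + t *. v' = a *. ray j l"
   and c': "\<And>s. t <= s ==> s < t + e ==> c s = chart Y j (n' + s *. v')"
   by (auto simp: regB_def p_def)
  have j: "j \<in> pieces Y" "j ~= i" using opp[OF i o] by auto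
  interpret Fj: conv_norm "fnorm Y j" using j(1) by (rule norm)
  \<comment> \<open>Staying in cone \<open>i\<close> would mean going straight on, which makes the
    height above ray \<open>k\<close> negative.\<close>
  have "m ~= i"
  proof
   assume "m = i"
   then obtain e1 where e1: "e1 > 0" "\<And>s. t < s ==> s < t + e1 ==> s <= t2 \<and> d s = n + s *. v" using same by blast
   define s where "s = t + e1 / 2"
   have s: "t < s" "s < t + e1" using e1 by (auto simp: s_def)
   have "n + s *. v \<in> region Y i" using e1(2)[OF s] dr[of s] s \<open>m = i\<close> by auto
   then have "0 <= hgt i k (n + s *. v)" using region_iff[OF i, of _ k] by auto
   moreover have "hgt i k (n + s *. v) = (s - t) * hgt i k v" unfolding ns pp by simp
   ultimately show False using s hv mult_pos_neg[of "s - t" "hgt i k v"] by simp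
  qed
  have pr: "p \<in> region Y i" "p ~= 0" using p by (simp_all add: p_def)
  obtain x k' l' where x: "0 < x" "opp i k' = (m, l')" "p = x *. ray i k'" "d t = x *. ray m l'"
   using glue[OF i m(1) \<open>m ~= i\<close>[symmetric] pr(1), of "d t"] dr[of t] t2 \<gamma>t pr(2) by auto
  have k': "k' = k"
  proof (rule ccontr)
   assume "k' ~= k"
   then have "k' = (\<not> k)" by auto
   then have "hgt i k p = x" using x(3) hgt_ray(2)[OF i, of k] by simp
   then show False using pp(1) x(1) by simp
  qed
  have mj: "m = j" "l' = l" using x(2) o k' by auto
  have "x = a" using arg_cong[OF x(3), of "hgt i (\<not> k)"] pp(1) k' i by simp
  then have dt: "d t = a *. ray j l" using x(4) mj by simp
  define p' where "p' = a *. ray j l"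
  have p'r: "p' \<in> region Y j" "p' ~= 0" using dr[of t] t2 dt mj ray_nz[OF j(1)] a by (auto simp: p'_def)
  obtain \<delta> where \<delta>: "\<delta> > 0" "\<And>q. q \<in> region Y j ==> norm (q - p') < \<delta> ==>
    fdist Y (chart Y j p') (chart Y j q) = fnorm Y j (q - p')"
   using fdist_local[OF j(1) p'r] by blast
  obtain e3 where e3: "e3 > 0" "\<And>s. \<bar>s - t\<bar> < e3 ==> norm (d s - p') < \<delta>" using near[OF \<delta>(1)] dt by (auto simp: p'_def)
  define e1 where "e1 = min e3 (min E (t2 - t))"
  have "\<gamma> s = c s" if s: "t < s" "s < t + e1" for s
  proof -
   have s': "\<bar>s - t\<bar> < e3" "s < t2" "s < t + e2" "s < t + e" using s E by (auto simp: e1_def)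
   let ?q = "d s"
   have q: "?q \<in> region Y j" "\<gamma> s = chart Y j ?q" using dr[of s] s s' mj by auto
   have \<gamma>t': "\<gamma> t = chart Y j p'" using dr[of t] t2 dt mj by (simp add: p'_def)
   have Fu: "fnorm Y j (?q - p') = s - t"
    using \<delta>(2)[OF q(1) e3(2)[OF s'(1)]] e2(2)[of t s] s s' e2(1) \<gamma>t' q by simp
   then have ne: "?q - p' ~= 0" using s by auto
   \<comment> \<open>\<open>f \<tau>\<close> is the length of the broken segment through the ray
     point with coordinate \<open>a + \<tau>\<close>. Since the curve is minimizing it has a local
     minimum at 0, and the vanishing derivative is Snell's law for the direction of
     \<open>?q - p'\<close>.\<close>
   define f where "f \<tau> = fnorm Y i ((t - ta) *. v + \<tau> *. ray i k) + fnorm Y j ((?q - p') + \<tau> *. (- ray j l))" for \<tau>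
   have fge: "f 0 <= f \<tau>" if "\<bar>0 - \<tau>\<bar> < a" for \<tau>
   proof -
    have at: "0 < a + \<tau>" using that by auto
    have zr: "(a + \<tau>) *. ray i k \<in> region Y i" "(a + \<tau>) *. ray j l \<in> region Y j"
     using at i j region_iff[OF i, of _ k] region_iff[OF j(1), of _ l] by auto
    have "chart Y i ((a + \<tau>) *. ray i k) = chart Y j ((a + \<tau>) *. ray j l)"
     using glue[OF i j(1) j(2)[symmetric] zr] at o by blast
    from fdist_segment2[OF i \<gamma>a(2) zr(1) j(1) zr(2) q(1) this]
    have "s - ta <= fnorm Y i ((a + \<tau>) *. ray i k - (n + ta *. v)) + fnorm Y j (?q - (a + \<tau>) *. ray j l)"
     using e2(2)[of ta s] ta s s' \<gamma>a q by simp
    also have "(a + \<tau>) *. ray i k - (n + ta *. v) = (t - ta) *. v + \<tau> *. ray i k"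
     using w by (simp add: pp algebra_simps)
    also have "?q - (a + \<tau>) *. ray j l = (?q - p') + \<tau> *. (- ray j l)" by (simp add: p'_def algebra_simps)
    finally show ?thesis using Fu Fw by (simp add: f_def)
   qed
   have "(f has_real_derivative dn (fnorm Y i) ((t - ta) *. v + 0 *. ray i k) (ray i k)
     + dn (fnorm Y j) ((?q - p') + 0 *. (- ray j l)) (- ray j l)) (at 0)"
    unfolding f_def using v0 ta ne by (intro DERIV_add Fi.dn_line Fj.dn_line) auto
   then have "(f has_real_derivative dn (fnorm Y i) v (ray i k) - dn (fnorm Y j) (?q - p') (ray j l)) (at 0)"
    using v0 ta ne by (simp add: Fi.dn_scale Fj.dn_lin)
   from DERIV_local_min[OF this a] fge
   have "dn (fnorm Y j) (?q - p') (ray j l) = dn (fnorm Y j) v' (ray j l)" using dn by auto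
   moreover define u where "u = (1 / (s - t)) *. (?q - p')"
   ultimately have du: "dn (fnorm Y j) u (ray j l) = dn (fnorm Y j) v' (ray j l)"
    using s ne by (simp add: Fj.dn_scale)
   have Fu1: "fnorm Y j u = 1" using Fu s by (simp add: u_def Fj.hom)
   define \<eta> where "\<eta> = 1 / cross2 (ray j l) (ray j (\<not> l))"
   have hw: "\<eta> * cross2 (ray j l) x = hgt j l x" for x by (simp add: \<eta>_def hgt_def)
   have "0 <= hgt j l u"
    using q(1) region_iff[OF j(1), of ?q l] s by (simp add: u_def p'_def)
   then have "u = v'"
    using Fj.dn_inj[OF ray_nz[OF j(1)] Fu1 v' du, of \<eta>] hv indep[OF j(1), of l] by (simp add: hw) (simp add: \<eta>_def)
   then have "?q - p' = (s - t) *. v'" using s by (auto simp: u_def)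
   then have "?q = p' + (s - t) *. v'" by (metis add.commute diff_add_cancel)
   also have "\<dots> = n' + s *. v'" unfolding p'_def pp(2)[symmetric] by (simp add: algebra_simps)
   finally have "?q = n' + s *. v'" .
   then show ?thesis using c'[of s] s s' q by simp
  qed
  moreover have "e1 > 0" using e3 E t2 by (simp add: e1_def)
  ultimately show ?thesis by blast
 qed
 then obtain e1 where "e1 > 0" "\<And>s. t < s ==> s < t + e1 ==> \<gamma> s = c s" by blast
 then show ?thesis using \<gamma>t ct by (intro exI[of _ e1]) (auto simp: p_def order_le_less)
qed

text \<open>Continuous induction: \<open>extend_step\<close> pushes the agreement beyond the infimum
  of the times of disagreement.\<close>

lemma regular_unique_forward:
 assumes r: "\<And>t. regular c t" and g: "locmin \<gamma>" and d: "0 < d" "\<And>s. s0 - d < s ==> s < s0 ==> \<gamma> s = c s"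
  and t: "s0 <= t"
 shows "\<gamma> t = c t"
proof (rule ccontr)
 assume ne: "\<gamma> t ~= c t"
 define S where "S = {t. s0 <= t \<and> \<gamma> t ~= c t}"
 define T where "T = Inf S"
 have bdd: "bdd_below S" "S ~= {}" using t ne by (auto simp: S_def intro: bdd_belowI[of _ s0])
 have T: "s0 <= T" unfolding T_def using bdd by (intro cInf_greatest) (auto simp: S_def)
 have below: "\<gamma> s = c s" if "s0 <= s" "s < T" for s
  using cInf_lower[of s S] bdd that by (auto simp: T_def S_def)
 have "\<gamma> s = c s" if "T - d < s" "s < T" for s
  using below[of s] d(2)[of s] that T by (cases "s0 <= s") auto
 from extend_step[OF r g d(1) this] obtain e1 where e1: "e1 > 0" "\<And>s. T <= s ==> s < T + e1 ==> \<gamma> s = c s" by blast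
 have "T + e1 <= s" if "s \<in> S" for s
 proof (rule ccontr)
  assume "\<not> T + e1 <= s"
  then have "s < T + e1" by simp
  then show False using e1(2)[of s] below[of s] that by (cases "s < T") (auto simp: S_def)
 qed
 then have "T + e1 <= T" unfolding T_def using bdd by (intro cInf_greatest) auto
 then show False using e1 by simp
qed

end

section \<open>Reversal of time and norms\<close>

lemma Ck_on_reflect:
 fixes f :: "'a::real_normed_vector => 'b::real_normed_vector"
 shows "Ck_on n f UNIV ==> Ck_on n (\<lambda>x. f (- x)) UNIV"
proof (induction n arbitrary: f)
 case 0
 then show ?case by (auto intro!: continuous_on_compose2[of UNIV f] continuous_intros)
next
 case (Suc n)
 have d: "((\<lambda>x. f (- x)) has_derivative (\<lambda>v. frechet_derivative f (at (- x)) (- v))) (at x)" for x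
 proof -
  have "(uminus has_derivative (\<lambda>v. - v)) (at x)" by (auto intro!: derivative_eq_intros)
  moreover have "(f has_derivative frechet_derivative f (at (- x))) (at (- x))"
   using Suc.prems frechet_derivative_works by auto
  ultimately show ?thesis by (rule has_derivative_compose)
 qed
 have "frechet_derivative (\<lambda>x. f (- x)) (at x) = (\<lambda>v. frechet_derivative f (at (- x)) (- v))" for x
  using frechet_derivative_at[OF d] by simp
 moreover have "Ck_on n (\<lambda>x. frechet_derivative f (at (- x)) (- v)) UNIV" for v
  using Suc.IH[of "\<lambda>x. frechet_derivative f (at x) (- v)"] Suc.prems by simp
 ultimately show ?case using d by (auto simp: differentiable_def)
qed

lemma smooth_on_reflect: "smooth_on UNIV c ==> smooth_on UNIV (\<lambda>x. c (- x))"
 by (simp add: smooth_on_def Ck_on_reflect)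

lemma pw_reverse:
 assumes "has_pw_integral X G \<gamma> a b L"
  and X': "pieces X' = pieces X" "region X' = region X" "chart X' = chart X"
  and G: "\<And>i c a b. smooth_on UNIV c ==> a <= b ==> integral {a..b} (G i c) = integral {- b..- a} (G' i (\<lambda>t. c (- t)))"
 shows "has_pw_integral X' G' (\<lambda>t. \<gamma> (- t)) (- b) (- a) L"
 using assms(1)
proof (induction rule: pw_induct)
 case (smooth a b i c)
 then have "rep X' (\<lambda>t. \<gamma> (- t)) i (\<lambda>t. c (- t)) {- b..- a}" by (auto simp: rep_def X' smooth_on_reflect)
 from rep_pw[OF this, of G'] show ?case using smooth G[of c a b i] by (simp add: rep_def)
next
 case (join a b d L L')
 from has_pw_integral.join[OF join(4,3)] show ?case by (simp add: add.commute)
qed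

text \<open>In the reversed norms a curve run backwards keeps its length.\<close>

definition rev_pieces :: "('q, 'i) flat_pieces => ('q, 'i) flat_pieces" where
 "rev_pieces Y = Y\<lparr>fnorm := \<lambda>i v. fnorm Y i (- v)\<rparr>"

lemma rev_pieces_simps [simp]:
 "pieces (rev_pieces Y) = pieces Y" "region (rev_pieces Y) = region Y" "chart (rev_pieces Y) = chart Y"
 "fnorm (rev_pieces Y) = (\<lambda>i v. fnorm Y i (- v))" "rev_pieces (rev_pieces Y) = Y"
 by (simp_all add: rev_pieces_def)

lemma has_length_reverse:
 assumes "has_length Y \<gamma> a b L"
 shows "has_length (rev_pieces Y) (\<lambda>t. \<gamma> (- t)) (- b) (- a) L"
 unfolding has_length_def
proof (rule pw_reverse[OF assms[unfolded has_length_def]])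
 fix i and c :: "real => real^2" and a b :: real assume c: "smooth_on UNIV c" and ab: "a <= b"
 have "vector_derivative (\<lambda>t. c (- t)) (at t) = - vector_derivative c (at (- t))" for t
 proof -
  have "(uminus has_vector_derivative (-1)) (at t)" by (auto intro!: derivative_eq_intros)
  from vector_diff_chain_at[OF this smooth_curve(1)[OF c, of "- t"]]
  show ?thesis by (auto simp: o_def intro!: vector_derivative_at)
 qed
 then show "integral {a..b} (\<lambda>t. fnorm Y i (vector_derivative c (at t))) =
   integral {- b..- a} (\<lambda>t. fnorm (rev_pieces Y) i (vector_derivative (\<lambda>t. c (- t)) (at t)))"
  by (simp add: Henstock_Kurzweil_Integration.integral_reflect_real[where f = "\<lambda>t. fnorm Y i (vector_derivative c (at t))"])
qed simp_all

lemma fdist_reverse: "fdist (rev_pieces Y) p q = fdist Y q p"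
proof -
 have "\<exists>\<gamma>' a b. \<gamma>' a = q \<and> \<gamma>' b = p \<and> has_length (rev_pieces X) \<gamma>' a b L"
  if g: "\<gamma> a = p" "\<gamma> b = q" "has_length X \<gamma> a b L" for X :: "('a, 'b) flat_pieces" and \<gamma> a b L p q
  using has_length_reverse[OF g(3)] g
  by (intro exI[of _ "\<lambda>t. \<gamma> (- t)"] exI[of _ "- b"] exI[of _ "- a"]) auto
 from this[of _ _ p _ q "rev_pieces Y"] this[of _ _ q _ p Y]
 have "{L. \<exists>\<gamma> a b. \<gamma> a = p \<and> \<gamma> b = q \<and> has_length (rev_pieces Y) \<gamma> a b L} =
   {L. \<exists>\<gamma> a b. \<gamma> a = q \<and> \<gamma> b = p \<and> has_length Y \<gamma> a b L}" by auto
 then show ?thesis by (simp add: fdist_def)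
qed

lemma dn_reverse:
 assumes "F differentiable (at (- y))"
 shows "((\<lambda>v. F (- v)) has_derivative (\<lambda>w. dn F (- y) (- w))) (at y)" "dn (\<lambda>v. F (- v)) y w = dn F (- y) (- w)"
proof -
 have "(uminus has_derivative (\<lambda>v. - v)) (at y)" by (auto intro!: derivative_eq_intros)
 moreover have "(F has_derivative dn F (- y)) (at (- y))"
  using assms frechet_derivative_works unfolding dn_def by blast
 ultimately show d: "((\<lambda>v. F (- v)) has_derivative (\<lambda>w. dn F (- y) (- w))) (at y)" by (rule has_derivative_compose)
 show "dn (\<lambda>v. F (- v)) y w = dn F (- y) (- w)"
  using fun_cong[OF frechet_derivative_at[OF d], of w] by (simp add: dn_def)
qed

lemma conv_norm_reverse:
 assumes "conv_norm F"
 shows "conv_norm (\<lambda>v. F (- v))"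
proof -
 interpret conv_norm F by fact
 show ?thesis
 proof
  show "continuous_on UNIV (\<lambda>v. F (- v))" by (intro continuous_intros)
  show "0 < F (- y)" if "y ~= 0" for y using that by (intro pos) auto
  show "F (- (c *. y)) = c * F (- y)" if "0 <= c" for c y using hom[OF that, of "- y"] by simp
  show "(\<lambda>v. F (- v)) differentiable (at y)" if "y ~= 0" for y
   using dn_reverse(1)[of F y] diff[of "- y"] that by (auto simp: differentiable_def)
  fix y w :: "real^2" assume y: "y ~= 0" and w: "\<And>c. 0 <= c ==> w ~= c *. y"
  have "- w ~= c *. (- y)" if "0 <= c" for c using w[OF that] by simp
  then have "dn F (- y) (- w) < F (- w)" using y by (intro dn_less) auto
  then show "dn (\<lambda>v. F (- v)) y w < F (- w)" using dn_reverse(2)[of F y w] diff[of "- y"] y by simp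
 qed
qed

context fan
begin

lemma reverse: "fan (rev_pieces Y) ray opp"
proof (rule fan.intro)
 show "finite (pieces (rev_pieces Y))" using fin by simp
 fix i assume "i \<in> pieces (rev_pieces Y)"
 then have i: "i \<in> pieces Y" by simp
 show "conv_norm (fnorm (rev_pieces Y) i)" using norm[OF i] by (simp add: conv_norm_reverse)
 show "cross2 (ray i k) (ray i (\<not> k)) ~= 0" for k by (rule indep[OF i])
 show "region (rev_pieces Y) i = {a *. ray i False + b *. ray i True | a b. 0 <= a \<and> 0 <= b}"
  using reg[OF i] by simp
 show "inj_on (chart (rev_pieces Y) i) (region (rev_pieces Y) i)" using chart_inj[OF i] by simp
 show "fst (opp i k) ~= fst (opp i (\<not> k))" for k by (rule opp_ne[OF i])
 show "fnorm (rev_pieces Y) i (ray i k) = fnorm (rev_pieces Y) j (ray j l)"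
  "fnorm (rev_pieces Y) i (- ray i k) = fnorm (rev_pieces Y) j (- ray j l)"
  "j \<in> pieces (rev_pieces Y) \<and> j ~= i \<and> opp j l = (i, k)" if "opp i k = (j, l)" for j k l
  using match[OF i that] opp[OF i that] by simp_all
 show "chart (rev_pieces Y) i w = chart (rev_pieces Y) j w' \<longleftrightarrow>
    (w = 0 \<and> w' = 0) \<or> (\<exists>k l a. 0 < a \<and> opp i k = (j, l) \<and> w = a *. ray i k \<and> w' = a *. ray j l)"
  if "j \<in> pieces (rev_pieces Y)" "i ~= j" "w \<in> region (rev_pieces Y) i" "w' \<in> region (rev_pieces Y) j" for j w w'
  using glue[OF i _ that(2)] that by simp
qed

text \<open>At a crossing the two cones exchange their roles. Both differentials change sign on the
  ray, so Snell's law is preserved.\<close>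

lemma regular_reverse:
 assumes "regular c t"
 shows "fan.regular (rev_pieces Y) ray opp (\<lambda>s. c (- s)) (- t)"
proof -
 interpret R: fan "rev_pieces Y" ray opp by (rule reverse)
 from assms show ?thesis unfolding regular_def
 proof (elim disjE exE)
  fix i n v e assume A: "regA c t i n v e"
  have "R.regA (\<lambda>s. c (- s)) (- t) i n (- v) e"
   unfolding R.regA_def
  proof (intro conjI allI impI)
   fix s assume "\<bar>s - - t\<bar> < e"
   then have "\<bar>- s - t\<bar> < e" by linarith
   then have "(\<forall>k. 0 < hgt i k (n + (- s) *. v)) \<and> c (- s) = chart Y i (n + (- s) *. v)"
    using A unfolding regA_def by blast
   moreover have "n + (- s) *. v = n + s *. - v" by simp
   ultimately have "(\<forall>k. 0 < hgt i k (n + s *. - v)) \<and> c (- s) = chart Y i (n + s *. - v)" by metis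
   then show "c (- s) = chart (rev_pieces Y) i (n + s *. - v)" "0 < hgt i k (n + s *. - v)" for k
    unfolding rev_pieces_simps by blast+
  next
   show "0 < e" "i \<in> pieces (rev_pieces Y)" "fnorm (rev_pieces Y) i (- v) = 1"
    using A by (simp_all add: regA_def)
  qed
  then show ?thesis unfolding R.regular_def by blast
 next
  fix i k n v j l n' v' a e assume B: "regB c t i k n v j l n' v' a e"
  then have i: "i \<in> pieces Y" and o: "opp i k = (j, l)" and nz: "v ~= 0" "v' ~= 0"
   and j: "j \<in> pieces Y" "opp j l = (i, k)"
   using opp[of i k j l] by (auto simp: regB_def)
  interpret Fi: conv_norm "fnorm Y i" using i by (rule norm)
  interpret Fj: conv_norm "fnorm Y j" using j(1) by (rule norm)
  have "R.regB (\<lambda>s. c (- s)) (- t) j l n' (- v') i k n (- v) a e"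
   unfolding R.regB_def
  proof (intro conjI allI impI)
   show "dn (fnorm (rev_pieces Y) j) (- v') (ray j l) = dn (fnorm (rev_pieces Y) i) (- v) (ray i k)"
    using B nz dn_reverse(2)[of "fnorm Y j" "- v'"] dn_reverse(2)[of "fnorm Y i" "- v"] Fi.diff[of v] Fj.diff[of v']
    by (simp add: regB_def Fi.dn_lin Fj.dn_lin)
   fix s
   show "n' + s *. - v' \<in> region (rev_pieces Y) j" "c (- s) = chart (rev_pieces Y) j (n' + s *. - v')"
    if "- t - e < s \<and> s <= - t"
   proof -
    have "t <= - s \<and> - s < t + e" using that by auto
    then have "n' + (- s) *. v' \<in> region Y j \<and> c (- s) = chart Y j (n' + (- s) *. v')" using B unfolding regB_def by blast
    then show "n' + s *. - v' \<in> region (rev_pieces Y) j" "c (- s) = chart (rev_pieces Y) j (n' + s *. - v')" by simp_all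
   qed
   show "n + s *. - v \<in> region (rev_pieces Y) i" "c (- s) = chart (rev_pieces Y) i (n + s *. - v)"
    if "- t <= s \<and> s < - t + e"
   proof -
    have "t - e < - s \<and> - s <= t" using that by auto
    then have "n + (- s) *. v \<in> region Y i \<and> c (- s) = chart Y i (n + (- s) *. v)" using B unfolding regB_def by blast
    then show "n + s *. - v \<in> region (rev_pieces Y) i" "c (- s) = chart (rev_pieces Y) i (n + s *. - v)" by simp_all
   qed
  qed (use B j in \<open>simp_all add: regB_def\<close>)
  then show ?thesis unfolding R.regular_def by blast
 qed
qed

lemma locmin_reverse:
 assumes l: "locmin \<gamma>"
 shows "fan.locmin (rev_pieces Y) (\<lambda>t. \<gamma> (- t))"
proof -
 interpret R: fan "rev_pieces Y" ray opp by (rule reverse)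
 show ?thesis unfolding R.locmin_def
 proof (intro conjI allI impI)
  fix a b :: real assume ab: "a <= b"
  have "\<And>a b. a <= b ==> has_length Y \<gamma> a b (b - a)" using l by (simp add: locmin_def)
  from has_length_reverse[OF this[of "- b" "- a"]] ab show "has_length (rev_pieces Y) (\<lambda>t. \<gamma> (- t)) a b (b - a)" by simp
 next
  fix t
  obtain e where e: "e > 0" "\<And>a b. - t - e < a \<and> a <= b \<and> b < - t + e ==> fdist Y (\<gamma> a) (\<gamma> b) = b - a"
   using l unfolding locmin_def by meson
  have "fdist Y (\<gamma> (- b)) (\<gamma> (- a)) = b - a" if "t - e < a \<and> a <= b \<and> b < t + e" for a b
   using e(2)[of "- b" "- a"] that by simp
  then show "\<exists>e>0. \<forall>a b. t - e < a \<and> a <= b \<and> b < t + e --> fdist (rev_pieces Y) (\<gamma> (- a)) (\<gamma> (- b)) = b - a"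
   unfolding fdist_reverse using e(1) by blast
 qed
qed

text \<open>Backward uniqueness is forward uniqueness in the reversed fan.\<close>

lemma regular_unique:
 assumes r: "\<And>t. regular c t" and g: "locmin \<gamma>" and d: "0 < d" "\<And>s. \<bar>s - s0\<bar> < d ==> \<gamma> s = c s"
 shows "\<gamma> = c"
proof
 fix t
 interpret R: fan "rev_pieces Y" ray opp by (rule reverse)
 show "\<gamma> t = c t"
 proof (cases "s0 <= t")
  case True
  have "\<gamma> s = c s" if "s0 - d < s" "s < s0" for s using that by (intro d(2)) linarith
  from regular_unique_forward[OF r g d(1) this True] show ?thesis .
 next
  case False
  define c' \<gamma>' where "c' s = c (- s)" and "\<gamma>' s = \<gamma> (- s)" for s
  have "R.regular c' t" for t using regular_reverse[OF r, of "- t"] by (simp add: c'_def[abs_def])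
  moreover have "R.locmin \<gamma>'" using locmin_reverse[OF g] by (simp add: \<gamma>'_def[abs_def])
  moreover have "\<gamma>' s = c' s" if "- s0 - d < s" "s < - s0" for s
   unfolding c'_def \<gamma>'_def using that by (intro d(2)) linarith
  moreover have "- s0 <= - t" using False by simp
  ultimately have "\<gamma>' (- t) = c' (- t)" using R.regular_unique_forward[of c' \<gamma>' d "- s0" "- t"] d(1) by blast
  then have "\<gamma> t = c t" by (simp add: c'_def \<gamma>'_def)
  then show ?thesis by simp
 qed
qed

end

lemma has_pw_integral_cong:
 assumes "has_pw_integral X G c' a b L" "\<And>t. a <= t ==> c t = c' t"
 shows "has_pw_integral X G c a b L"
 using assms
proof (induction rule: pw_induct)
 case (smooth a b i d)
 then have "rep X c i d {a..b}" by (auto simp: rep_def)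
 from rep_pw[OF this smooth(1)] show ?case .
next
 case (join a b d L L')
 then have "has_pw_integral X G c a b L" by blast
 moreover have "has_pw_integral X G c b d L'" using join(4,5) pw_le[OF join(1)] by (meson order_trans)
 ultimately show ?case by (rule has_pw_integral.join)
qed

section \<open>Following a line from cone to cone\<close>

context fan
begin

text \<open>Every time has a neighbourhood with a representation by at most two pieces, and
  Bolzano's subdivision passes to compact intervals.\<close>

lemma regular_pw:
 assumes "\<And>t. regular c t" "a <= b"
 shows "\<exists>L. has_pw_integral Y G c a b L"
 using assms(2)
proof (induction a b rule: Bolzano)
 case (trans a b d)
 then show ?case using has_pw_integral.join by blast
next
 case (local t)
 from assms(1)[of t] show ?case unfolding regular_def
 proof (elim disjE exE)
  fix i n v e assume A: "regA c t i n v e"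
  then have "rep Y c i (\<lambda>s. n + s *. v) {x..y}" if "x <= t" "t <= y" "y - x < e" for x y
   using that region_pos[of i] by (auto simp: rep_def regA_def smooth_on_line)
  then have "\<exists>L. has_pw_integral Y G c x y L" if "x <= t" "t <= y" "y - x < e" for x y
   using rep_pw[of Y c i "\<lambda>s. n + s *. v" x y G] that by auto
  then show ?thesis using A by (intro exI[of _ e]) (simp add: regA_def)
 next
  fix i k n v j l n' v' a e assume B: "regB c t i k n v j l n' v' a e"
  then have j: "j \<in> pieces Y" using opp[of i k j l] by (auto simp: regB_def)
  have "\<exists>L. has_pw_integral Y G c x y L" if "x <= t" "t <= y" "y - x < e" for x y
  proof -
   have "rep Y c i (\<lambda>s. n + s *. v) {x..t}" "rep Y c j (\<lambda>s. n' + s *. v') {t..y}"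
    using B that j by (auto simp: rep_def regB_def smooth_on_line)
   from rep_pw[OF this(1) that(1)] rep_pw[OF this(2) that(2)] show ?thesis using has_pw_integral.join by blast
  qed
  then show ?thesis using B by (intro exI[of _ e]) (auto simp: regB_def)
 qed
qed

lemma regular_not_apex:
 assumes "regular c t" "j \<in> pieces Y"
 shows "c t ~= chart Y j 0"
proof
 assume eq: "c t = chart Y j 0"
 have z: "0 \<in> region Y m" if "m \<in> pieces Y" for m using region_iff[OF that, of 0 True] by simp
 obtain i n v e where i: "i \<in> pieces Y" "n + t *. v \<in> region Y i" "n + t *. v ~= 0" "c t = chart Y i (n + t *. v)"
  by (rule regular_left[OF assms(1)])
 show False
 proof (cases "i = j")
  case True
  then show ?thesis using inj_onD[OF chart_inj[OF i(1)], of "n + t *. v" 0] i eq z by auto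
 next
  case False
  then obtain k l a where "0 < (a::real)" "0 = a *. ray j l"
   using glue[OF i(1) assms(2) False i(2) z[OF assms(2)]] i(3,4) eq by metis
  then show ?thesis using ray_nz[OF assms(2), of l] by simp
 qed
qed

lemma regular_cong:
 assumes r: "regular c t" and d: "0 < d" "\<And>s. \<bar>s - t\<bar> < d ==> c' s = c s"
 shows "regular c' t"
 using r unfolding regular_def
proof (elim disjE exE)
 fix i n v e assume "regA c t i n v e"
 then have "regA c' t i n v (min e d)" using d by (auto simp: regA_def)
 then show "(\<exists>i n v e. regA c' t i n v e) \<or> (\<exists>i k n v j l n' v' a e. regB c' t i k n v j l n' v' a e)" by blast
next
 fix i k n v j l n' v' a e assume "regB c t i k n v j l n' v' a e"
 then have "regB c' t i k n v j l n' v' a (min e d)" using d by (auto simp: regB_def)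
 then show "(\<exists>i n v e. regA c' t i n v e) \<or> (\<exists>i k n v j l n' v' a e. regB c' t i k n v j l n' v' a e)" by blast
qed

text \<open>At time \<open>t0\<close> the line is in the cone and, where it is on a ray, moves
  inwards; \<open>cross2 n v ~= 0\<close> keeps it off the apex.\<close>

definition start :: "'i => real^2 => real^2 => real => bool" where
 "start i n v t0 \<longleftrightarrow> i \<in> pieces Y \<and> fnorm Y i v = 1 \<and> cross2 n v ~= 0 \<and>
   (\<forall>k. 0 <= hgt i k (n + t0 *. v) \<and> (hgt i k (n + t0 *. v) = 0 --> 0 < hgt i k v))"

lemma hgt_line: "hgt i k (n + t *. v) = hgt i k (n + t0 *. v) + (t - t0) * hgt i k v"
 by (simp add: algebra_simps)

lemma exit_ray:
 assumes s: "start i n v t0" and ex: "\<exists>k. hgt i k v < 0"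
 obtains k \<tau> a where "hgt i k v < 0" "t0 < \<tau>" "0 < a" "n + \<tau> *. v = a *. ray i k"
  "\<And>t h. t0 < t ==> t < \<tau> ==> 0 < hgt i h (n + t *. v)"
proof -
 have i: "i \<in> pieces Y" and c: "cross2 n v ~= 0" and h0: "\<And>k. 0 <= hgt i k (n + t0 *. v)"
  and h1: "\<And>k. hgt i k (n + t0 *. v) = 0 ==> 0 < hgt i k v" using s by (auto simp: start_def)
 \<comment> \<open>The time at which the line meets the line of ray \<open>k\<close>, provided that
   it approaches it; the smaller of the candidates is the exit time.\<close>
 define T where "T k = t0 + hgt i k (n + t0 *. v) / (- hgt i k v)" for k
 obtain k where k: "hgt i k v < 0" "hgt i (\<not> k) v < 0 ==> T k <= T (\<not> k)"
 proof -
  obtain k0 where k0: "hgt i k0 v < 0" using ex by blast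
  show thesis
  proof (cases "hgt i (\<not> k0) v < 0 \<and> T (\<not> k0) < T k0")
   case True
   then show ?thesis using that[of "\<not> k0"] by auto
  next
   case False
   then show ?thesis using that[of k0] k0 by auto
  qed
 qed
 define \<tau> where "\<tau> = T k"
 have pk: "0 < hgt i k (n + t0 *. v)" using h0[of k] h1[of k] k(1) by force
 have "0 < hgt i k (n + t0 *. v) / (- hgt i k v)" using pk k(1) by (intro divide_pos_pos) auto
 then have \<tau>: "t0 < \<tau>" unfolding \<tau>_def T_def by linarith
 have zk: "hgt i k (n + \<tau> *. v) = 0" using k(1) by (subst hgt_line[of _ _ _ _ _ t0]) (simp add: \<tau>_def T_def)
 define a where "a = hgt i (\<not> k) (n + \<tau> *. v)"
 have za: "n + \<tau> *. v = a *. ray i k" using hgt_eq_0[OF i zk] unfolding a_def .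
 have "0 <= a"
 proof (cases "hgt i (\<not> k) v < 0")
  case True
  then have "\<tau> <= T (\<not> k)" using k by (simp add: \<tau>_def)
  then have "(\<tau> - t0) * (- hgt i (\<not> k) v) <= hgt i (\<not> k) (n + t0 *. v)"
   using True pos_le_divide_eq[of "- hgt i (\<not> k) v" "\<tau> - t0" "hgt i (\<not> k) (n + t0 *. v)"]
   unfolding T_def by linarith
  then show ?thesis unfolding a_def hgt_line[of _ _ _ \<tau> _ t0] by simp
 next
  case False
  then show ?thesis unfolding a_def hgt_line[of _ _ _ \<tau> _ t0] using h0[of "\<not> k"] \<tau> by simp
 qed
 moreover have "a ~= 0"
 proof
  assume "a = 0"
  then have "n + \<tau> *. v = 0" using za by simp
  then have "cross2 (n + \<tau> *. v) v = 0" by simp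
  then show False using c by (simp add: cross2_add)
 qed
 ultimately have a: "0 < a" by simp
 have "0 < hgt i h (n + t *. v)" if t: "t0 < t" "t < \<tau>" for t h
 proof -
  have e: "hgt i h (n + t *. v) * (\<tau> - t0) = (\<tau> - t) * hgt i h (n + t0 *. v) + (t - t0) * hgt i h (n + \<tau> *. v)"
   by (simp add: algebra_simps)
  have "0 < (\<tau> - t) * hgt i h (n + t0 *. v) + (t - t0) * hgt i h (n + \<tau> *. v)"
  proof (cases "h = k")
   case True
   then show ?thesis using pk zk t by simp
  next
   case False
   then have "h = (\<not> k)" by auto
   then have "0 < (t - t0) * hgt i h (n + \<tau> *. v)" using a t by (simp only: a_def) simp
   moreover have "0 <= (\<tau> - t) * hgt i h (n + t0 *. v)" using h0 t by (intro mult_nonneg_nonneg) auto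
   ultimately show ?thesis by linarith
  qed
  then show ?thesis unfolding e[symmetric] using \<tau> by (simp add: zero_less_mult_iff)
 qed
 then show thesis using that k(1) \<tau> a za by blast
qed

end

text \<open>\<open>N i p q\<close> is the angle of the sector between \<open>p\<close> and \<open>q\<close> in the cone \<open>i\<close>, and \<open>G\<close> the
 integrand of the rotation of a curve.\<close>

locale fan_rot = fan Y ray opp
 for Y :: "('q, 'i) flat_pieces" and ray :: "'i => bool => real^2" and opp :: "'i => bool => 'i \<times> bool" +
 fixes N :: "'i => real^2 => real^2 => real" and G :: "'i => (real => real^2) => real => real"
 assumes N_scale: "i \<in> pieces Y ==> 0 < a ==> 0 < b ==> N i (a *. p) (b *. q) = N i p q"
  and N_comm: "i \<in> pieces Y ==> N i p q = N i q p"
  and N_split: "i \<in> pieces Y ==> cross2 p q ~= 0 ==> 0 < a ==> 0 < b ==> z = a *. p + b *. q ==>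
   N i p q = N i p z + N i z q"
  and N_pos: "i \<in> pieces Y ==> cross2 p q ~= 0 ==> 0 < N i p q"
  and N_line: "i \<in> pieces Y ==> cross2 n v ~= 0 ==> a < b ==>
   integral {a..b} (G i (\<lambda>t. n + t *. v)) = N i (n + a *. v) (n + b *. v)"
  and N_lim: "i \<in> pieces Y ==> cross2 p v ~= 0 ==> ((\<lambda>b. N i p (p + b *. v)) \<longlongrightarrow> N i p v) at_top"
  and refract: "i \<in> pieces Y ==> opp i k = (j, l) ==> fnorm Y i v = 1 ==> hgt i k v < 0 ==>
   \<exists>v'. fnorm Y j v' = 1 \<and> 0 < hgt j l v' \<and> dn (fnorm Y i) v (ray i k) = dn (fnorm Y j) v' (ray j l) \<and>
    N i (ray i k) v = N j (ray j l) v'"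
begin

text \<open>The total angle is measured in the plane of the starting cone alone, as if the line went
  straight on there; this is possible because refraction preserves the angle that remains.\<close>

definition fwd :: "'i => real^2 => real^2 => real => bool" where
 "fwd i n v t0 \<longleftrightarrow> (\<exists>c f. (\<exists>\<tau>>t0. \<forall>t. t0 <= t \<and> t <= \<tau> --> n + t *. v \<in> region Y i \<and> c t = chart Y i (n + t *. v)) \<and>
   (\<forall>t>t0. regular c t) \<and> (\<forall>r>t0. has_pw_integral Y G c t0 r (f r)) \<and>
   (f \<longlongrightarrow> N i (n + t0 *. v) v) at_top)"

lemma line_pw:
 assumes i: "i \<in> pieces Y" and c: "cross2 n v ~= 0" and t: "t0 < r"
  and l: "\<And>t. t0 <= t ==> t <= r ==> n + t *. v \<in> region Y i \<and> c t = chart Y i (n + t *. v)"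
 shows "has_pw_integral Y G c t0 r (N i (n + t0 *. v) (n + r *. v))"
proof -
 have "rep Y c i (\<lambda>t. n + t *. v) {t0..r}" using i l by (auto simp: rep_def smooth_on_line)
 from rep_pw[OF this, of G] show ?thesis using t N_line[OF i c t] by simp
qed

lemma line_lim:
 assumes i: "i \<in> pieces Y" and c: "cross2 n v ~= 0"
 shows "((\<lambda>r. N i (n + t0 *. v) (n + r *. v)) \<longlongrightarrow> N i (n + t0 *. v) v) at_top"
proof -
 have "cross2 (n + t0 *. v) v ~= 0" using c by (simp add: cross2_add)
 note lim = N_lim[OF i this]
 have "filterlim (\<lambda>r. r - t0) at_top at_top"
  using filterlim_tendsto_add_at_top[OF tendsto_const[of "- t0"] filterlim_ident] by (simp add: add.commute)
 from filterlim_compose[OF lim this]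
 have "((\<lambda>r. N i (n + t0 *. v) (n + t0 *. v + (r - t0) *. v)) \<longlongrightarrow> N i (n + t0 *. v) v) at_top" .
 moreover have "n + t0 *. v + (r - t0) *. v = n + r *. v" for r by (simp add: algebra_simps)
 ultimately show ?thesis by simp
qed

text \<open>A line without a decreasing height stays in its cone for ever. Otherwise it is refracted
  at the exit ray, and its angle splits at the exit point into the part already swept and the part
  taken over by the next cone.\<close>

lemma fwd_step:
 assumes s: "start i n v t0"
  and nxt: "\<And>k j l a v' n' \<tau>. t0 < \<tau> ==> opp i k = (j, l) ==> hgt i k v < 0 ==> 0 < a ==> n + \<tau> *. v = a *. ray i k ==>
   N i (ray i k) v = N j (ray j l) v' ==> n' + \<tau> *. v' = a *. ray j l ==> start j n' v' \<tau> ==> fwd j n' v' \<tau>"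
 shows "fwd i n v t0"
proof -
 have i: "i \<in> pieces Y" and v: "fnorm Y i v = 1" and c: "cross2 n v ~= 0" and h0: "\<And>k. 0 <= hgt i k (n + t0 *. v)"
  and h1: "\<And>k. hgt i k (n + t0 *. v) = 0 ==> 0 < hgt i k v" using s by (auto simp: start_def)
 show ?thesis
 proof (cases "\<exists>k. hgt i k v < 0")
  case False
  define c where "c t = chart Y i (n + t *. v)" for t
  have pos: "0 < hgt i k (n + t *. v)" if "t0 < t" for t k
  proof -
   have "0 <= hgt i k v" using False by (auto simp: not_less)
   then show ?thesis unfolding hgt_line[of _ _ _ t _ t0] using h0[of k] h1[of k] that
    by (cases "hgt i k (n + t0 *. v) = 0") (auto intro: add_pos_nonneg simp del: hgt_lin)
  qed
  have in_reg: "n + t *. v \<in> region Y i" if "t0 <= t" for t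
   using that region_pos[OF i pos] region_iff[OF i, of "n + t0 *. v" True] h0 by (cases "t = t0") (auto simp del: hgt_lin)
  have R: "regular c t" if "t0 < t" for t
  proof -
   have "regA c t i n v (t - t0)" using that i v pos by (auto simp: regA_def c_def simp del: hgt_lin)
   then show ?thesis unfolding regular_def by blast
  qed
  have P: "has_pw_integral Y G c t0 r (N i (n + t0 *. v) (n + r *. v))" if "t0 < r" for r
   using that in_reg by (intro line_pw i \<open>cross2 n v ~= 0\<close>) (auto simp: c_def)
  have E: "\<exists>\<tau>>t0. \<forall>t. t0 <= t \<and> t <= \<tau> --> n + t *. v \<in> region Y i \<and> c t = chart Y i (n + t *. v)"
   using in_reg by (intro exI[of _ "t0 + 1"]) (auto simp: c_def)
  show ?thesis unfolding fwd_def
   by (rule exI[of _ c], rule exI[of _ "\<lambda>r. N i (n + t0 *. v) (n + r *. v)"])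
    (use R P E line_lim[OF i \<open>cross2 n v ~= 0\<close>] in simp)
 next
  case True
  obtain k \<tau> a where k: "hgt i k v < 0" and \<tau>: "t0 < \<tau>" and a: "0 < a" and z: "n + \<tau> *. v = a *. ray i k"
   and pos: "\<And>t h. t0 < t ==> t < \<tau> ==> 0 < hgt i h (n + t *. v)"
   by (rule exit_ray[OF s True], rule that)
  obtain j l where o: "opp i k = (j, l)" by fastforce
  have j: "j \<in> pieces Y" using opp[OF i o] by simp
  obtain v' where v': "fnorm Y j v' = 1" "0 < hgt j l v'" "dn (fnorm Y i) v (ray i k) = dn (fnorm Y j) v' (ray j l)"
   "N i (ray i k) v = N j (ray j l) v'" using refract[OF i o v k] by blast
  \<comment> \<open>The new line is placed so that it passes the exit point at the time of
    arrival.\<close>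
  define n' where "n' = a *. ray j l - \<tau> *. v'"
  have n': "n' + \<tau> *. v' = a *. ray j l" by (simp add: n'_def)
  have cr: "cross2 (ray j l) v' ~= 0" using v'(2) by (auto simp: hgt_def)
  have st: "start j n' v' \<tau>"
   unfolding start_def n'
  proof (intro conjI allI impI)
   show "cross2 n' v' ~= 0" using cr a by (simp add: n'_def cross2_add)
   fix h
   show "0 <= hgt j h (a *. ray j l)" using a j by (cases "h = l") auto
   show "0 < hgt j h v'" if "hgt j h (a *. ray j l) = 0"
    using that a j v'(2) by (cases "h = l") auto
  qed (use j v' in auto)
  obtain c' f' \<tau>' where \<tau>': "\<tau> < \<tau>'" and c': "\<And>t. \<tau> <= t ==> t <= \<tau>' ==> n' + t *. v' \<in> region Y j \<and> c' t = chart Y j (n' + t *. v')"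
   and r': "\<And>t. \<tau> < t ==> regular c' t" and pw': "\<And>r. \<tau> < r ==> has_pw_integral Y G c' \<tau> r (f' r)"
   and lim': "(f' \<longlongrightarrow> N j (n' + \<tau> *. v') v') at_top"
   using nxt[OF \<tau> o k a z v'(4) n' st] unfolding fwd_def by metis
  define c where "c t = (if t <= \<tau> then chart Y i (n + t *. v) else c' t)" for t
  have in_reg: "n + t *. v \<in> region Y i" if "t0 <= t" "t <= \<tau>" for t
  proof -
   consider "t = t0" | "t0 < t" "t < \<tau>" | "t = \<tau>" using \<open>t0 <= t\<close> \<open>t <= \<tau>\<close> by linarith
   then show ?thesis
   proof cases
    case 1
    then show ?thesis using region_iff[OF i, of "n + t0 *. v" True] h0 by (simp del: hgt_lin)
   next
    case 2
    then show ?thesis using region_pos[OF i pos] by blast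
   next
    case 3
    then show ?thesis using region_iff[OF i, of "a *. ray i k" k] a i by (simp add: z)
   qed
  qed
  have glue\<tau>: "chart Y i (n + \<tau> *. v) = chart Y j (n' + \<tau> *. v')"
   using glue[OF i j _ in_reg[of \<tau>] conjunct1[OF c'[of \<tau>]]] opp[OF i o] \<tau> \<tau>' a o unfolding z n' by auto
  have cc': "c t = c' t" if "\<tau> <= t" for t
   using that c'[of \<tau>] \<tau>' glue\<tau> by (cases "t = \<tau>") (auto simp: c_def)
  have reg_c: "regular c t" if t: "t0 < t" for t
  proof -
   consider "t < \<tau>" | "t = \<tau>" | "\<tau> < t" by linarith
   then show ?thesis
   proof cases
    case 1
    have "regA c t i n v (min (t - t0) (\<tau> - t))"
     using 1 t i v pos by (auto simp: regA_def c_def simp del: hgt_lin)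
    then show ?thesis unfolding regular_def by blast
   next
    case 2
    have "regB c t i k n v j l n' v' a (min (\<tau> - t0) (\<tau>' - \<tau>))"
     unfolding regB_def
    proof (intro conjI allI impI)
     fix s assume "t <= s \<and> s < t + min (\<tau> - t0) (\<tau>' - \<tau>)"
     then have "\<tau> <= s" "s <= \<tau>'" using 2 by auto
     then show "n' + s *. v' \<in> region Y j" "c s = chart Y j (n' + s *. v')" using c' cc' by auto
    next
     fix s assume "t - min (\<tau> - t0) (\<tau>' - \<tau>) < s \<and> s <= t"
     then have "t0 <= s" "s <= \<tau>" using 2 by auto
     then show "n + s *. v \<in> region Y i" "c s = chart Y i (n + s *. v)" using in_reg by (auto simp: c_def)
    qed (use 2 \<tau> \<tau>' a i o v v' k z n' in auto)
    then show ?thesis unfolding regular_def by blast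
   next
    case 3
    then show ?thesis by (intro regular_cong[OF r'[OF 3], of "t - \<tau>"]) (auto intro!: cc')
   qed
  qed
  define f where "f r = (if r <= \<tau> then N i (n + t0 *. v) (n + r *. v) else N i (n + t0 *. v) (n + \<tau> *. v) + f' r)" for r
  have pw: "has_pw_integral Y G c t0 r (f r)" if r: "t0 < r" for r
  proof (cases "r <= \<tau>")
   case True
   then have "has_pw_integral Y G c t0 r (N i (n + t0 *. v) (n + r *. v))"
    using in_reg by (intro line_pw i \<open>cross2 n v ~= 0\<close> r) (auto simp: c_def)
   then show ?thesis using True by (simp add: f_def)
  next
   case False
   have 1: "has_pw_integral Y G c t0 \<tau> (N i (n + t0 *. v) (n + \<tau> *. v))"
    using in_reg \<tau> by (intro line_pw i \<open>cross2 n v ~= 0\<close>) (auto simp: c_def)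
   have "has_pw_integral Y G c \<tau> r (f' r)"
   proof (rule has_pw_integral_cong)
    show "has_pw_integral Y G c' \<tau> r (f' r)" using False by (intro pw') simp
    show "c t = c' t" if "\<tau> <= t" for t using that by (rule cc')
   qed
   from has_pw_integral.join[OF 1 this] show ?thesis using False by (simp add: f_def)
  qed
  have "N i (n + t0 *. v) v = N i (n + t0 *. v) (n + \<tau> *. v) + N i (n + \<tau> *. v) v"
   using c \<tau> by (intro N_split[OF i, of _ _ 1 "\<tau> - t0"]) (auto simp: cross2_add algebra_simps)
  moreover have "N i (n + \<tau> *. v) v = N j (n' + \<tau> *. v') v'"
   using N_scale[OF i a, of 1 "ray i k" v] N_scale[OF j a, of 1 "ray j l" v'] v'(4) by (simp add: z n')
  moreover have "((\<lambda>r. N i (n + t0 *. v) (n + \<tau> *. v) + f' r) \<longlongrightarrow>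
    N i (n + t0 *. v) (n + \<tau> *. v) + N j (n' + \<tau> *. v') v') at_top"
   by (intro tendsto_add tendsto_const lim')
  moreover have "eventually (\<lambda>r. N i (n + t0 *. v) (n + \<tau> *. v) + f' r = f r) at_top"
   using eventually_gt_at_top[of \<tau>] by eventually_elim (simp add: f_def)
  ultimately have lim: "(f \<longlongrightarrow> N i (n + t0 *. v) v) at_top" by (auto elim: Lim_transform_eventually)
  have E: "\<exists>\<tau>>t0. \<forall>t. t0 <= t \<and> t <= \<tau> --> n + t *. v \<in> region Y i \<and> c t = chart Y i (n + t *. v)"
   using \<tau> in_reg by (intro exI[of _ \<tau>]) (auto simp: c_def)
  show ?thesis unfolding fwd_def
   by (rule exI[of _ c], rule exI[of _ f]) (use E reg_c pw lim in simp)
 qed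
qed

text \<open>Induction on a bound for the remaining angle in units of \<open>\<alpha>\<close>: a line
  that enters through ray \<open>l\<close> can leave only through the other ray, and then it has
  used up the whole angle of the cone. For \<open>m = 0\<close> the bound contradicts positivity of
  angles.\<close>

lemma fwd_ray:
 assumes am: "0 < \<alpha>" "\<And>i. i \<in> pieces Y ==> \<alpha> <= N i (ray i False) (ray i True)"
 shows "start j n v t0 ==> 0 < a ==> n + t0 *. v = a *. ray j l ==> N j (ray j l) v < real m * \<alpha> ==> fwd j n v t0"
proof (induction m arbitrary: j n v t0 a l)
 case 0
 then have j: "j \<in> pieces Y" and "cross2 n v ~= 0" by (auto simp: start_def)
 moreover have "cross2 (n + t0 *. v) v = cross2 n v" by (simp add: cross2_add)
 ultimately have "cross2 (ray j l) v ~= 0" using 0(3) by auto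
 then show ?case using N_pos[OF j, of "ray j l" v] 0(4) by simp
next
 case (Suc m)
 have j: "j \<in> pieces Y" and cn: "cross2 n v ~= 0" and hl: "hgt j l (n + t0 *. v) = 0 ==> 0 < hgt j l v"
  using Suc.prems(1) by (auto simp: start_def)
 have "cross2 (n + t0 *. v) v = cross2 n v" by (simp add: cross2_add)
 then have cr: "cross2 (ray j l) v ~= 0" using Suc.prems(3) cn by auto
 have hv: "0 < hgt j l v" using hl Suc.prems(3) by simp
 show ?case
 proof (rule fwd_step[OF Suc.prems(1)])
  fix k j' l' a' v' n' \<tau>
  assume h: "t0 < \<tau>" "opp j k = (j', l')" "hgt j k v < 0" "0 < a'" "n + \<tau> *. v = a' *. ray j k"
   "N j (ray j k) v = N j' (ray j' l') v'" "n' + \<tau> *. v' = a' *. ray j' l'" "start j' n' v' \<tau>"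
  have k: "k = (\<not> l)" using h(3) hv by (cases "k = l") auto
  have "a' *. ray j k = a *. ray j l + (\<tau> - t0) *. v"
   unfolding h(5)[symmetric] Suc.prems(3)[symmetric] by (simp add: algebra_simps)
  then have "N j (ray j l) v = N j (ray j l) (a' *. ray j k) + N j (a' *. ray j k) v"
   using Suc.prems(2) h(1) by (intro N_split[OF j cr]) auto
  also have "N j (ray j l) (a' *. ray j k) = N j (ray j l) (ray j k)"
   using N_scale[OF j zero_less_one h(4), of "ray j l" "ray j k"] by simp
  also have "N j (a' *. ray j k) v = N j (ray j k) v"
   using N_scale[OF j h(4) zero_less_one, of "ray j k" v] by simp
  also have "N j (ray j l) (ray j k) = N j (ray j False) (ray j True)"
   unfolding k using N_comm[OF j] by (cases l) auto
  finally have "N j' (ray j' l') v' < real m * \<alpha>"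
   using Suc.prems(4) am(2)[OF j] h(6) by (simp add: algebra_simps)
  then show "fwd j' n' v' \<tau>" using Suc.IH h by blast
 qed
qed

text \<open>The line may start anywhere in its cone; from the first crossing on,
  \<open>fwd_ray\<close> applies with the smallest cone angle as the unit.\<close>

lemma fwd_start:
 assumes s: "start i n v t0"
 shows "fwd i n v t0"
proof -
 have i: "i \<in> pieces Y" using s by (simp add: start_def)
 define \<alpha> where "\<alpha> = Min ((\<lambda>i. N i (ray i False) (ray i True)) ` pieces Y)"
 have \<alpha>: "0 < \<alpha>" "\<And>i. i \<in> pieces Y ==> \<alpha> <= N i (ray i False) (ray i True)"
 proof -
  have S: "finite ((\<lambda>i. N i (ray i False) (ray i True)) ` pieces Y)" "(\<lambda>i. N i (ray i False) (ray i True)) ` pieces Y ~= {}"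
   using fin i by auto
  have "0 < N i (ray i False) (ray i True)" if "i \<in> pieces Y" for i
   using N_pos[OF that indep[OF that, of False]] by simp
  then show "0 < \<alpha>" unfolding \<alpha>_def Min_gr_iff[OF S] by blast
  show "\<And>i. i \<in> pieces Y ==> \<alpha> <= N i (ray i False) (ray i True)" unfolding \<alpha>_def using S by (intro Min_le) auto
 qed
 show ?thesis
 proof (rule fwd_step[OF s])
  fix k j l a v' n' \<tau> assume h: "0 < (a::real)" "n' + \<tau> *. v' = a *. ray j l" "start j n' v' \<tau>"
  obtain m where "N j (ray j l) v' < real m * \<alpha>" using reals_Archimedean3[OF \<alpha>(1)] by blast
  then show "fwd j n' v' \<tau>" using fwd_ray[OF \<alpha> h(3,1,2)] by blast
 qed
qed

text \<open>By \<open>bk\<close> the line stays in the cone at all earlier times, so only its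
  forward half meets rays. The limit consists of the angles from the point at time \<open>t1\<close>
  towards \<open>- v\<close> and towards \<open>v\<close>.\<close>

theorem passing_geodesic:
 assumes i: "i \<in> pieces Y" and v: "fnorm Y i v = 1" and c: "cross2 n v ~= 0"
  and pos: "\<And>k. 0 < hgt i k (n + t1 *. v)" and bk: "\<And>k. hgt i k v <= 0"
 obtains c f d where "\<And>t. regular c t" "0 < d" "\<And>t. \<bar>t - t1\<bar> < d ==> c t = chart Y i (n + t *. v)"
  "\<And>r. 0 <= r ==> has_pw_integral Y G c (- r) r (f r)"
  "(f \<longlongrightarrow> N i (- v) (n + t1 *. v) + N i (n + t1 *. v) v) at_top"
proof -
 have "start i n v t1" using i v c pos by (auto simp: start_def less_imp_le simp del: hgt_lin) (metis less_irrefl)+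
 from fwd_start[OF this] obtain c' f' \<tau> where \<tau>: "t1 < \<tau>"
  and c': "\<And>t. t1 <= t ==> t <= \<tau> ==> n + t *. v \<in> region Y i \<and> c' t = chart Y i (n + t *. v)"
  and r': "\<And>t. t1 < t ==> regular c' t" and pw': "\<And>r. t1 < r ==> has_pw_integral Y G c' t1 r (f' r)"
  and lim': "(f' \<longlongrightarrow> N i (n + t1 *. v) v) at_top"
  unfolding fwd_def by metis
 define g where "g t = (if t <= t1 then chart Y i (n + t *. v) else c' t)" for t
 have ev: "eventually (\<lambda>t. \<forall>k. 0 < hgt i k (n + t *. v)) (at t1)"
 proof -
  have "eventually (\<lambda>t. 0 < hgt i k (n + t *. v)) (at t1)" for k
  proof (rule order_tendstoD(1)[OF _ pos])
   show "((\<lambda>t. hgt i k (n + t *. v)) \<longlongrightarrow> hgt i k (n + t1 *. v)) (at t1)" by (intro tendsto_hgt tendsto_intros)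
  qed
  from this[of True] this[of False] show ?thesis by eventually_elim (metis (full_types))
 qed
 then obtain d0 where d0: "0 < d0" "\<And>t k. t ~= t1 ==> dist t t1 < d0 ==> 0 < hgt i k (n + t *. v)"
  unfolding eventually_at by auto
 have posl: "0 < hgt i k (n + t *. v)" if "t <= t1" for t k
 proof -
  have "0 <= (t - t1) * hgt i k v" using that bk[of k] by (simp add: mult_nonpos_nonpos)
  then show ?thesis using pos[of k] unfolding hgt_line[of _ _ _ t _ t1] by linarith
 qed
 define d where "d = min d0 (\<tau> - t1)"
 have d: "0 < d" using d0 \<tau> by (simp add: d_def)
 have gd: "g t = chart Y i (n + t *. v)" "0 < hgt i k (n + t *. v)" if "t < t1 + d" for t k
 proof -
  have t: "t < t1 + d0" "t <= \<tau>" using that by (auto simp: d_def)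
  show "g t = chart Y i (n + t *. v)" using c'[of t] t by (cases "t <= t1") (auto simp: g_def)
  show "0 < hgt i k (n + t *. v)"
  proof (cases "t <= t1")
   case True
   then show ?thesis by (rule posl)
  next
   case False
   then show ?thesis using t by (intro d0(2)) (auto simp: dist_real_def)
  qed
 qed
 have reg_g: "regular g t" for t
 proof (cases "t <= t1")
  case True
  have "regA g t i n v d" using True gd d i v by (auto simp: regA_def simp del: hgt_lin)
  then show ?thesis unfolding regular_def by blast
 next
  case False
  then show ?thesis by (intro regular_cong[OF r', of t "t - t1"]) (auto simp: g_def)
 qed
 \<comment> \<open>The formula needs \<open>t1\<close> inside the interval from \<open>- r\<close>
   to \<open>r\<close>; for the other \<open>r\<close> any value of the integral will do, since only
   the limit matters.\<close>
 define f where "f r = (if \<bar>t1\<bar> < r then N i (n + (- r) *. v) (n + t1 *. v) + f' r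
   else (SOME L. has_pw_integral Y G g (- r) r L))" for r
 have pw: "has_pw_integral Y G g (- r) r (f r)" if "0 <= r" for r
 proof (cases "\<bar>t1\<bar> < r")
  case True
  have "has_pw_integral Y G g (- r) t1 (N i (n + (- r) *. v) (n + t1 *. v))"
   using True region_pos[OF i posl] by (intro line_pw i c) (auto simp: g_def)
  moreover have "has_pw_integral Y G g t1 r (f' r)"
  proof (rule has_pw_integral_cong)
   show "has_pw_integral Y G c' t1 r (f' r)" using True by (intro pw') simp
   show "g t = c' t" if "t1 <= t" for t using that c'[of t1] \<tau> by (cases "t = t1") (auto simp: g_def)
  qed
  ultimately show ?thesis using True has_pw_integral.join by (simp add: f_def)
 next
  case False
  then show ?thesis using someI_ex[OF regular_pw[of g "- r" r G, OF reg_g]] that by (simp add: f_def)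
 qed
 have "((\<lambda>r. N i (n + t1 *. v) (n + (- r) *. v)) \<longlongrightarrow> N i (n + t1 *. v) (- v)) at_top"
  using line_lim[OF i, of n "- v" "- t1"] c by simp
 then have "((\<lambda>r. N i (n + (- r) *. v) (n + t1 *. v) + f' r) \<longlongrightarrow> N i (- v) (n + t1 *. v) + N i (n + t1 *. v) v) at_top"
  unfolding N_comm[OF i, of _ "n + t1 *. v"] by (intro tendsto_add lim')
 moreover have "eventually (\<lambda>r. N i (n + (- r) *. v) (n + t1 *. v) + f' r = f r) at_top"
  using eventually_gt_at_top[of "\<bar>t1\<bar>"] by eventually_elim (simp add: f_def)
 ultimately have "(f \<longlongrightarrow> N i (- v) (n + t1 *. v) + N i (n + t1 *. v) v) at_top" by (rule Lim_transform_eventually)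
 then show thesis using that[OF reg_g d _ pw] gd by auto
qed

end

section \<open>Triangles\<close>

definition corners :: "(real^2) set => (real^2) set" where
 "corners T = {p. p extreme_point_of T}"

lemma affine_independent_cross2:
 assumes "\<not> affine_dependent {A, B, C :: real^2}" "A ~= B" "A ~= C" "B ~= C"
 shows "cross2 (B - A) (C - A) ~= 0"
proof
 assume "cross2 (B - A) (C - A) = 0"
 then obtain c where "C - A = c *. (B - A)" using cross2_eq_0_iff[of "B - A" "C - A"] assms by auto
 then have "collinear {0, B - A, C - A}" by (auto simp: collinear_lemma)
 then have "collinear {B, A, C}" by (subst collinear_3) (auto simp: NO_MATCH_def)
 then show False using assms by (auto simp: collinear_3_eq_affine_dependent insert_commute)
qed

lemma corners_simplex:
 assumes "2 simplex T"
 shows "card (corners T) = 3" "T = convex hull (corners T)" "\<not> affine_dependent (corners T)"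
proof -
 obtain C where C: "\<not> affine_dependent C" "int (card C) = 2 + 1" "T = convex hull C"
  using assms by (auto simp: simplex_def)
 have "corners T = C" by (auto simp: corners_def C(3) extreme_point_of_convex_hull_affine_independent[OF C(1)])
 then show "card (corners T) = 3" "T = convex hull (corners T)" "\<not> affine_dependent (corners T)" using C by auto
qed

text \<open>An arbitrary but fixed labelling of the other two corners, so that the two edges at
  \<open>P\<close> are indexed by a boolean.\<close>

definition oth :: "(real^2) set => real^2 => bool => real^2" where
 "oth T P = (SOME f. corners T = {P, f False, f True} \<and> P ~= f False \<and> P ~= f True \<and> f False ~= f True)"

lemma oth:
 assumes T: "2 simplex T" and P: "P \<in> corners T"
 shows "corners T = {P, oth T P k, oth T P (\<not> k)}" "P ~= oth T P k" "oth T P k ~= oth T P (\<not> k)"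
  "cross2 (oth T P k - P) (oth T P (\<not> k) - P) ~= 0"
proof -
 have "card (corners T - {P}) = 2" using corners_simplex(1)[OF T] P by simp
 then obtain Q R where QR: "corners T - {P} = {Q, R}" "Q ~= R" by (auto simp: card_2_iff)
 then have "corners T = {P, Q, R} \<and> P ~= Q \<and> P ~= R \<and> Q ~= R" using P by auto
 then have "\<exists>f. corners T = {P, f False, f True} \<and> P ~= f False \<and> P ~= f True \<and> f False ~= f True"
  by (intro exI[of _ "\<lambda>b. if b then R else Q"]) auto
 from someI_ex[OF this] have o: "corners T = {P, oth T P False, oth T P True}" "P ~= oth T P False"
  "P ~= oth T P True" "oth T P False ~= oth T P True" unfolding oth_def[symmetric] by auto
 then show 1: "corners T = {P, oth T P k, oth T P (\<not> k)}" "P ~= oth T P k" "oth T P k ~= oth T P (\<not> k)"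
  by (cases k; auto)+
 have "P ~= oth T P (\<not> k)" using o by (cases k) auto
 then show "cross2 (oth T P k - P) (oth T P (\<not> k) - P) ~= 0"
  using affine_independent_cross2[of P "oth T P k" "oth T P (\<not> k)"] corners_simplex(3)[OF T] 1 by auto
qed

lemma corner_in: "2 simplex T ==> P \<in> corners T ==> P \<in> T"
 using corners_simplex(2) hull_inc by metis

lemma oth_corner: "2 simplex T ==> P \<in> corners T ==> oth T P k \<in> corners T"
 using oth(1)[of T P k] by auto

lemma corner_oth:
 assumes "2 simplex T" "P \<in> corners T" "Q \<in> corners T" "P ~= Q"
 obtains k where "Q = oth T P k"
 using oth(1)[OF assms(1,2), of True] assms that by auto

lemma mem_triangle:
 assumes T: "2 simplex T" and P: "P \<in> corners T"
 shows "q \<in> T \<longleftrightarrow> (\<exists>a b. 0 <= a \<and> 0 <= b \<and> a + b <= 1 \<and> q = P + a *. (oth T P k - P) + b *. (oth T P (\<not> k) - P))"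
proof -
 have "T = convex hull {P, oth T P k, oth T P (\<not> k)}" using corners_simplex(2)[OF T] oth(1)[OF T P, of k] by metis
 then show ?thesis using convex_hull_3_alt[of P "oth T P k" "oth T P (\<not> k)"] by blast
qed

lemma cross2_unique:
 assumes "cross2 u v ~= 0" "a *. u + b *. v = a' *. u + b' *. v"
 shows "a = a' \<and> b = b'"
proof -
 have "cross2 (a *. u + b *. v) v = cross2 (a' *. u + b' *. v) v"
  "cross2 u (a *. u + b *. v) = cross2 u (a' *. u + b' *. v)" using assms by auto
 then show ?thesis using assms(1) by (simp add: cross2_add)
qed

lemma bary_unique:
 assumes T: "2 simplex T" and P: "P \<in> corners T"
  and eq: "P + a *. (oth T P k - P) + b *. (oth T P (\<not> k) - P) = P + a' *. (oth T P k - P) + b' *. (oth T P (\<not> k) - P)"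
 shows "a = a' \<and> b = b'"
 using cross2_unique[OF oth(4)[OF T P, of k], of a b a' b'] eq by simp

lemma segment_param: "closed_segment P Q = {P + t *. (Q - P) | t. 0 <= t \<and> t <= 1}"
 unfolding closed_segment_def by (simp add: algebra_simps)

text \<open>The faces of the hull of an affinely independent set are the hulls of its subsets, and
  dimension 1 means two corners.\<close>

lemma edge_triangle:
 assumes T: "2 simplex T"
 shows "e edge_of T \<longleftrightarrow> (\<exists>P Q. P \<in> corners T \<and> Q \<in> corners T \<and> P ~= Q \<and> e = closed_segment P Q)"
proof -
 have nd: "\<not> affine_dependent (corners T)" and hull: "T = convex hull (corners T)" by (rule corners_simplex[OF T])+
 have fin: "finite (corners T)" using corners_simplex(1)[OF T] card.infinite by fastforce
 have ad: "aff_dim (convex hull c) = int (card c) - 1" if "c \<subseteq> corners T" for c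
 proof -
  have "\<not> affine_dependent c" using affine_dependent_subset[of c "corners T"] nd that by blast
  then show ?thesis by (simp add: aff_dim_convex_hull aff_dim_affine_independent)
 qed
 have "e edge_of T \<longleftrightarrow> (\<exists>c\<subseteq>corners T. e = convex hull c \<and> aff_dim e = 1)"
  unfolding edge_of_def using face_of_convex_hull_affine_independent[OF nd, of e] hull by auto
 also have "\<dots> \<longleftrightarrow> (\<exists>c\<subseteq>corners T. e = convex hull c \<and> card c = 2)"
 proof -
  have "aff_dim e = 1 \<longleftrightarrow> card c = 2" if "c \<subseteq> corners T" "e = convex hull c" for c
   using ad[OF that(1)] that(2) by auto
  then show ?thesis by blast
 qed
 also have "\<dots> \<longleftrightarrow> (\<exists>P Q. P \<in> corners T \<and> Q \<in> corners T \<and> P ~= Q \<and> e = closed_segment P Q)"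
 proof
  assume "\<exists>c\<subseteq>corners T. e = convex hull c \<and> card c = 2"
  then obtain c where c: "c \<subseteq> corners T" "e = convex hull c" "card c = 2" by blast
  then obtain P Q where "c = {P, Q}" "P ~= Q" by (auto simp: card_2_iff)
  then show "\<exists>P Q. P \<in> corners T \<and> Q \<in> corners T \<and> P ~= Q \<and> e = closed_segment P Q"
   using c by (auto simp: segment_convex_hull)
 next
  assume "\<exists>P Q. P \<in> corners T \<and> Q \<in> corners T \<and> P ~= Q \<and> e = closed_segment P Q"
  then obtain P Q where "P \<in> corners T" "Q \<in> corners T" "P ~= Q" "e = closed_segment P Q" by blast
  then show "\<exists>c\<subseteq>corners T. e = convex hull c \<and> card c = 2"
   by (intro exI[of _ "{P, Q}"]) (auto simp: segment_convex_hull)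
 qed
 finally show ?thesis .
qed

lemma edge_mem:
 assumes T: "2 simplex T" and P: "P \<in> corners T"
 shows "P + a *. (oth T P k - P) + b *. (oth T P (\<not> k) - P) \<in> closed_segment P (oth T P k) \<longleftrightarrow> b = 0 \<and> 0 <= a \<and> a <= 1"
proof
 assume "P + a *. (oth T P k - P) + b *. (oth T P (\<not> k) - P) \<in> closed_segment P (oth T P k)"
 then obtain t where t: "0 <= t" "t <= 1"
  "P + a *. (oth T P k - P) + b *. (oth T P (\<not> k) - P) = P + t *. (oth T P k - P) + 0 *. (oth T P (\<not> k) - P)"
  by (auto simp: segment_param)
 from bary_unique[OF T P t(3)] t show "b = 0 \<and> 0 <= a \<and> a <= 1" by auto
next
 assume "b = 0 \<and> 0 <= a \<and> a <= 1"
 then show "P + a *. (oth T P k - P) + b *. (oth T P (\<not> k) - P) \<in> closed_segment P (oth T P k)"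
  by (auto simp: segment_param)
qed

lemma inner_edge_unique:
 assumes T: "2 simplex T" and PQ: "P \<in> corners T" "Q \<in> corners T" "P ~= Q" and t: "0 < t" "t < 1"
  and AB: "A \<in> corners T" "B \<in> corners T" and m: "P + t *. (Q - P) \<in> closed_segment A B"
 shows "{A, B} = {P, Q}"
proof -
 obtain k where k: "Q = oth T P k" using corner_oth[OF T PQ] by blast
 let ?R = "oth T P (\<not> k)"
 have c: "corners T = {P, Q, ?R}" "Q ~= ?R" "P ~= ?R" using oth[OF T PQ(1), of k] oth(2)[OF T PQ(1), of "\<not> k"] k by auto
 have m': "P + t *. (Q - P) = P + t *. (oth T P k - P) + 0 *. (?R - P)" by (simp add: k)
 obtain s where s: "0 <= s" "s <= 1" "P + t *. (Q - P) = A + s *. (B - A)" using m by (auto simp: segment_param)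
 have bu: "t = a \<and> b = 0" if "A + s *. (B - A) = P + a *. (oth T P k - P) + b *. (?R - P)" for a b
  using bary_unique[OF T PQ(1), of t k 0 a b] that s(3) m' by auto
 consider "A = P" "B = P" | "A = Q" "B = Q" | "A = ?R" "B = ?R" | "A = P" "B = Q" | "A = Q" "B = P" | "A = P" "B = ?R" | "A = ?R" "B = P"
  | "A = Q" "B = ?R" | "A = ?R" "B = Q" using AB c by auto
 then show ?thesis
 proof cases
  case 1 then show ?thesis using bu[of 0 0] t by simp
 next case 2 then show ?thesis using bu[of 1 0] t by (simp add: k)
 next case 3 then show ?thesis using bu[of 0 1] t by simp
 next case 6 then show ?thesis using bu[of 0 s] t by simp
 next case 7 then show ?thesis using bu[of 0 "1 - s"] t by (simp add: algebra_simps)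
 next case 8 then show ?thesis using bu[of "1 - s" s] t by (simp add: k algebra_simps)
 next case 9 then show ?thesis using bu[of s "1 - s"] t by (simp add: k algebra_simps)
 qed auto
qed

lemma corner_on_edge:
 assumes T: "2 simplex T" and AB: "A \<in> corners T" "B \<in> corners T" "A ~= B" and C: "C \<in> corners T" "C \<in> closed_segment A B"
 shows "C = A \<or> C = B"
proof -
 have "C extreme_point_of T" using C(1) by (simp add: corners_def)
 then have "C \<notin> open_segment A B" using corner_in[OF T AB(1)] corner_in[OF T AB(2)] unfolding extreme_point_of_def by blast
 then show ?thesis using C(2) by (auto simp: open_segment_def)
qed

section \<open>Surfaces\<close>

text \<open>Invariance of domain, read in a plane chart of the surface around each image
  point.\<close>

lemma surface_open_map:
 fixes \<Phi> :: "real^2 => 'p"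
 assumes T: "topological_surface T" and D: "open D" and c: "continuous_map (top_of_set D) T \<Phi>" and inj: "inj_on \<Phi> D"
 shows "openin T (\<Phi> ` D)"
 unfolding openin_subopen[of T "\<Phi> ` D"]
proof
 fix y assume "y \<in> \<Phi> ` D"
 then obtain x where x: "x \<in> D" "y = \<Phi> x" by blast
 then have "y \<in> topspace T" using c by (auto simp: continuous_map_def)
 then obtain U g g' where U: "openin T U" "y \<in> U" and g: "homeomorphic_maps (subtopology T U) euclidean g (g' :: real^2 => 'p)"
  using T unfolding topological_surface_def homeomorphic_space_def by blast
 define D' where "D' = {x \<in> topspace (top_of_set D). \<Phi> x \<in> U}"
 have "openin (top_of_set D) D'" unfolding D'_def by (rule openin_continuous_map_preimage[OF c U(1)])
 then have D': "open D'" using D by (simp add: openin_open_eq)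
 have sub: "D' \<subseteq> D" by (auto simp: D'_def)
 have \<Phi>c: "continuous_map (top_of_set D') (subtopology T U) \<Phi>"
  using continuous_map_from_subtopology_mono[OF c sub] by (auto simp: continuous_map_in_subtopology D'_def)
 have gc: "continuous_map (subtopology T U) euclidean g" and g'g: "\<And>z. z \<in> topspace (subtopology T U) ==> g' (g z) = z"
  using g by (auto simp: homeomorphic_maps_def)
 have "continuous_map (top_of_set D') euclidean (g \<circ> \<Phi>)" by (rule continuous_map_compose[OF \<Phi>c gc])
 then have cont: "continuous_on D' (g \<circ> \<Phi>)" by simp
 have ts: "topspace (subtopology T U) = U" using openin_subset[OF U(1)] by auto
 have "inj_on (g \<circ> \<Phi>) D'"
 proof (rule inj_onI)
  fix a b assume a: "a \<in> D'" "b \<in> D'" "(g \<circ> \<Phi>) a = (g \<circ> \<Phi>) b"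
  then have "\<Phi> a \<in> U" "\<Phi> b \<in> U" by (auto simp: D'_def)
  then have "\<Phi> a = \<Phi> b" using g'g a(3) ts by (metis comp_apply)
  then show "a = b" using inj a sub by (auto dest: inj_onD)
 qed
 from invariance_of_domain[OF cont D' this] have op: "open ((g \<circ> \<Phi>) ` D')" .
 have "openin (subtopology T U) {z \<in> topspace (subtopology T U). g z \<in> (g \<circ> \<Phi>) ` D'}"
  by (rule openin_continuous_map_preimage[OF gc]) (use op in simp)
 moreover have "{z \<in> topspace (subtopology T U). g z \<in> (g \<circ> \<Phi>) ` D'} = \<Phi> ` D'"
 proof (intro equalityI subsetI)
  fix z assume "z \<in> {z \<in> topspace (subtopology T U). g z \<in> (g \<circ> \<Phi>) ` D'}"
  then obtain a where a: "z \<in> U" "a \<in> D'" "g z = g (\<Phi> a)" using ts by auto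
  then have "\<Phi> a \<in> U" by (auto simp: D'_def)
  then have "z = \<Phi> a" using g'g a ts by metis
  then show "z \<in> \<Phi> ` D'" using a by blast
 qed (use ts in \<open>auto simp: D'_def\<close>)
 ultimately have "openin (subtopology T U) (\<Phi> ` D')" by simp
 then have "openin T (\<Phi> ` D')" using U(1) by (metis openin_open_subtopology)
 moreover have "y \<in> \<Phi> ` D'" using x U(2) by (auto simp: D'_def)
 moreover have "\<Phi> ` D' \<subseteq> \<Phi> ` D" using sub by blast
 ultimately show "\<exists>S. openin T S \<and> y \<in> S \<and> S \<subseteq> \<Phi> ` D" by blast
qed

text \<open>Going from the plane through a surface chart into \<open>W\<close>, and on by the
  inverse of \<open>c\<close>, is continuous and injective, so by invariance of domain its image is
  an open set inside \<open>R\<close> that contains \<open>m\<close>.\<close>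

lemma surface_inverse_open:
 fixes c :: "real^2 => 'p"
 assumes T: "topological_surface T" and emb: "embedding_map (top_of_set R) T c"
  and W: "openin T W" "W \<subseteq> c ` R" and m: "m \<in> R" "c m \<in> W"
 shows "m \<in> interior R"
proof -
 have "c m \<in> topspace T" using openin_subset[OF W(1)] m by blast
 then obtain U g g' where U: "openin T U" "c m \<in> U" and g: "homeomorphic_maps (subtopology T U) euclidean g (g' :: real^2 => 'p)"
  using T unfolding topological_surface_def homeomorphic_space_def by blast
 have gc: "continuous_map (subtopology T U) euclidean g" and g'c: "continuous_map euclidean (subtopology T U) g'"
  and g'g: "\<And>z. z \<in> topspace (subtopology T U) ==> g' (g z) = z" and gg': "\<And>z. g (g' z) = z"
  using g by (auto simp: homeomorphic_maps_def)
 have ts: "topspace (subtopology T U) = U" using openin_subset[OF U(1)] by auto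
 obtain c' where c': "homeomorphic_maps (top_of_set R) (subtopology T (c ` R)) c c'"
  using emb by (auto simp: embedding_map_def homeomorphic_map_maps)
 then have c'c: "continuous_map (subtopology T (c ` R)) (top_of_set R) c'" and inv: "\<And>x. x \<in> R ==> c' (c x) = x"
  and inv': "\<And>z. z \<in> topspace (subtopology T (c ` R)) ==> c (c' z) = z"
  by (auto simp: homeomorphic_maps_def)
 define O' where "O' = {x \<in> topspace euclidean. g' x \<in> W \<inter> U}"
 have "openin (subtopology T U) (W \<inter> U)" using W(1) by (auto simp: openin_subtopology)
 from openin_continuous_map_preimage[OF g'c this] have O': "open O'" by (simp add: O'_def)
 have "continuous_map (top_of_set O') T g'"
  using g'c by (auto simp: continuous_map_in_subtopology intro: continuous_map_from_subtopology)
 then have "continuous_map (top_of_set O') (subtopology T (c ` R)) g'"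
  using W(2) by (auto simp: continuous_map_in_subtopology O'_def)
 from continuous_map_compose[OF this c'c] have "continuous_map (top_of_set O') (top_of_set R) (c' \<circ> g')" .
 then have cont: "continuous_on O' (c' \<circ> g')" and im: "(c' \<circ> g') ` O' \<subseteq> R" by (auto simp: continuous_map_in_subtopology)
 have "inj_on (c' \<circ> g') O'"
 proof (rule inj_onI)
  fix a b assume a: "a \<in> O'" "b \<in> O'" "(c' \<circ> g') a = (c' \<circ> g') b"
  then have "g' a \<in> c ` R" "g' b \<in> c ` R" using W(2) by (auto simp: O'_def)
  then have "g' a = g' b" using a(3) inv by auto
  then show "a = b" using gg' by metis
 qed
 from invariance_of_domain[OF cont O' this] have "open ((c' \<circ> g') ` O')" .
 moreover have gcm: "g' (g (c m)) = c m" using g'g U(2) ts by metis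
 have "m \<in> (c' \<circ> g') ` O'"
 proof
  show "m = (c' \<circ> g') (g (c m))" using gcm inv[OF m(1)] by simp
  show "g (c m) \<in> O'" using gcm U(2) m(2) by (simp add: O'_def)
 qed
 ultimately show ?thesis using im by (meson interiorI)
qed

locale pf_surface =
 fixes M :: "('p, 'i) flat_surface"
 assumes pf: "pf_finsler_surface M"
begin

abbreviation "Rg \<equiv> region M"
abbreviation "ch \<equiv> chart M"
abbreviation "Fn \<equiv> fnorm M"

lemma surf: "topological_surface (topo M)"
 using pf by (simp add: pf_finsler_surface_def)

lemma cover: "(\<Union>i\<in>pieces M. piece M i) = topspace (topo M)"
 using pf by (simp add: pf_finsler_surface_def)

lemma piece_props:
 assumes "i \<in> pieces M"
 shows simp_i: "2 simplex Rg i" and mink_i: "minkowski (Fn i)" and emb_i: "embedding_map (top_of_set (Rg i)) (topo M) (ch i)"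
 using pf assms by (simp_all add: pf_finsler_surface_def minkowski_def)

lemma ch_inj: "i \<in> pieces M ==> inj_on (ch i) (Rg i)"
 using emb_i[of i] homeomorphic_imp_injective_map unfolding embedding_map_def by fastforce

lemma ch_cont: "i \<in> pieces M ==> continuous_map (top_of_set (Rg i)) (topo M) (ch i)"
 using emb_i unfolding embedding_map_def
 by (metis continuous_map_in_subtopology homeomorphic_imp_continuous_map)

lemma closed_piece: assumes i: "i \<in> pieces M" shows "closedin (topo M) (piece M i)"
proof -
 have "compact (Rg i)" using corners_simplex[OF simp_i[OF i]] aff_independent_finite
  by (metis compact_convex_hull finite_imp_compact)
 then have "compactin (top_of_set (Rg i)) (Rg i)" by (simp add: compactin_subtopology)
 then have "compactin (topo M) (piece M i)"
  unfolding piece_def by (rule image_compactin[OF _ ch_cont[OF i]])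
 moreover have "Hausdorff_space (topo M)" using surf by (simp add: topological_surface_def)
 ultimately show ?thesis using compactin_imp_closedin by blast
qed

text \<open>By local finiteness only finitely many closed pieces that miss \<open>y\<close> have to
  be removed from a neighbourhood.\<close>

lemma local_nbhd:
 assumes "y \<in> topspace (topo M)"
 obtains W where "openin (topo M) W" "y \<in> W" "\<And>j. j \<in> pieces M ==> piece M j \<inter> W ~= {} ==> y \<in> piece M j"
proof -
 obtain U where U: "openin (topo M) U" "y \<in> U" "finite {i \<in> pieces M. piece M i \<inter> U ~= {}}"
  using pf assms by (auto simp: pf_finsler_surface_def)
 define J where "J = {i \<in> pieces M. piece M i \<inter> U ~= {} \<and> y \<notin> piece M i}"
 have fJ: "finite J" using U(3) by (rule finite_subset[rotated]) (auto simp: J_def)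
 have "closedin (topo M) (\<Union>j\<in>J. piece M j)"
  using fJ by (intro closedin_Union) (auto simp: J_def closed_piece)
 then have "openin (topo M) (U - (\<Union>j\<in>J. piece M j))" using U(1) by (rule openin_diff[rotated])
 moreover have "y \<in> U - (\<Union>j\<in>J. piece M j)" using U(2) by (auto simp: J_def)
 moreover have "y \<in> piece M j" if "j \<in> pieces M" "piece M j \<inter> (U - (\<Union>j\<in>J. piece M j)) ~= {}" for j
  using that by (auto simp: J_def)
 ultimately show thesis using that by blast
qed

lemma inter_cases:
 assumes i: "i \<in> pieces M" and j: "j \<in> pieces M" and ij: "i ~= j"
 obtains "piece M i \<inter> piece M j = {}"
  | p q where "p \<in> corners (Rg i)" "q \<in> corners (Rg j)" "piece M i \<inter> piece M j = {ch i p}" "ch i p = ch j q"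
  | P Q P' Q' where "P \<in> corners (Rg i)" "Q \<in> corners (Rg i)" "P ~= Q" "P' \<in> corners (Rg j)" "Q' \<in> corners (Rg j)" "P' ~= Q'"
   "piece M i \<inter> piece M j = ch i ` closed_segment P Q" "ch i ` closed_segment P Q = ch j ` closed_segment P' Q'"
proof -
 have "piece M i \<inter> piece M j = {} \<or>
    (\<exists>p q. p extreme_point_of region M i \<and> q extreme_point_of region M j \<and>
      piece M i \<inter> piece M j = {chart M i p} \<and> chart M i p = chart M j q) \<or>
    (\<exists>e e'. e edge_of region M i \<and> e' edge_of region M j \<and>
      piece M i \<inter> piece M j = chart M i ` e \<and> chart M i ` e = chart M j ` e')"
  using pf i j ij unfolding pf_finsler_surface_def by blast
 then show thesis
 proof (elim disjE exE conjE)
  fix e e' assume e: "e edge_of Rg i" "e' edge_of Rg j" "piece M i \<inter> piece M j = ch i ` e" "ch i ` e = ch j ` e'"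
  obtain P Q where P: "P \<in> corners (Rg i)" "Q \<in> corners (Rg i)" "P ~= Q" "e = closed_segment P Q"
   using e(1) unfolding edge_triangle[OF simp_i[OF i]] by blast
  obtain P' Q' where P': "P' \<in> corners (Rg j)" "Q' \<in> corners (Rg j)" "P' ~= Q'" "e' = closed_segment P' Q'"
   using e(2) unfolding edge_triangle[OF simp_i[OF j]] by blast
  show thesis using that(3)[OF P(1-3) P'(1-3)] e P(4) P'(4) by simp
 qed (use that in \<open>auto simp: corners_def\<close>)
qed

lemma isometric_edges:
 "i \<in> pieces M ==> j \<in> pieces M ==> i ~= j ==> p \<in> Rg i ==> q \<in> Rg i ==> p' \<in> Rg j ==> q' \<in> Rg j ==>
  ch i p = ch j p' ==> ch i q = ch j q' ==> Fn i (q - p) = Fn j (q' - p')"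
proof -
 have "\<forall>i\<in>pieces M. \<forall>j\<in>pieces M. i ~= j -->
    (\<forall>p\<in>region M i. \<forall>q\<in>region M i. \<forall>p'\<in>region M j. \<forall>q'\<in>region M j.
      chart M i p = chart M j p' \<and> chart M i q = chart M j q' -->
      fnorm M i (q - p) = fnorm M j (q' - p'))"
  using pf unfolding pf_finsler_surface_def by (elim conjE)
 then show "i \<in> pieces M ==> j \<in> pieces M ==> i ~= j ==> p \<in> Rg i ==> q \<in> Rg i ==> p' \<in> Rg j ==> q' \<in> Rg j ==>
  ch i p = ch j p' ==> ch i q = ch j q' ==> Fn i (q - p) = Fn j (q' - p')" by metis
qed

lemma segment_region: "i \<in> pieces M ==> P \<in> corners (Rg i) ==> Q \<in> corners (Rg i) ==> 0 <= t ==> t <= 1 ==>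
 P + t *. (Q - P) \<in> Rg i"
proof -
 assume i: "i \<in> pieces M" and P: "P \<in> corners (Rg i)" "Q \<in> corners (Rg i)" and t: "0 <= t" "t <= 1"
 have "convex (Rg i)" using corners_simplex(2)[OF simp_i[OF i]] convex_convex_hull by metis
 then have "closed_segment P Q \<subseteq> Rg i" using P corner_in[OF simp_i[OF i]] closed_segment_subset by metis
 then show ?thesis using t by (auto simp: segment_param)
qed

text \<open>The gluing of two edges is affine, because both norms give the same length to every segment; the
 identification of the endpoints follows from surjectivity.\<close>

lemma edge_affine:
 assumes i: "i \<in> pieces M" and j: "j \<in> pieces M" and ij: "i ~= j"
  and P: "P \<in> corners (Rg i)" "Q \<in> corners (Rg i)" "P ~= Q" and P': "P' \<in> corners (Rg j)" "Q' \<in> corners (Rg j)" "P' ~= Q'"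
  and eq: "ch i ` closed_segment P Q = ch j ` closed_segment P' Q'"
 shows "(\<forall>t\<in>{0..1}. ch i (P + t *. (Q - P)) = ch j (P' + t *. (Q' - P'))) \<or>
  (\<forall>t\<in>{0..1}. ch i (P + t *. (Q - P)) = ch j (Q' + t *. (P' - Q')))"
proof -
 interpret Fi: minkowski "Fn i" by (rule mink_i[OF i])
 interpret Fj: minkowski "Fn j" by (rule mink_i[OF j])
 have aux: "\<forall>t\<in>{0..1}. ch i (P + t *. (Q - P)) = ch j (P' + t *. (Q' - P'))"
  if P': "P' \<in> corners (Rg j)" "Q' \<in> corners (Rg j)" "P' ~= Q'" and eq: "ch i ` closed_segment P Q = ch j ` closed_segment P' Q'"
   and t01: "0 <= t0" "t0 < t1" "t1 <= 1" and e0: "ch i (P + t0 *. (Q - P)) = ch j P'" and e1: "ch i (P + t1 *. (Q - P)) = ch j Q'"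
  for P' Q' t0 t1
 proof -
  have ri: "P + t *. (Q - P) \<in> Rg i" and rj: "P' + t *. (Q' - P') \<in> Rg j" if "0 <= t" "t <= 1" for t
   using segment_region[OF i P(1,2) that] segment_region[OF j P'(1,2) that] by auto
  define \<alpha> \<beta> \<alpha>' \<beta>' where "\<alpha> = Fn i (Q - P)" and "\<beta> = Fn i (P - Q)" and "\<alpha>' = Fn j (Q' - P')" and "\<beta>' = Fn j (P' - Q')"
  have pos: "0 < \<alpha>" "0 < \<beta>" "0 < \<alpha>'" "0 < \<beta>'" using P P' by (auto simp: \<alpha>_def \<beta>_def \<alpha>'_def \<beta>'_def Fi.pos Fj.pos)
  have Fi': "Fn i ((P + b *. (Q - P)) - (P + a *. (Q - P))) = (if a <= b then (b - a) * \<alpha> else (a - b) * \<beta>)" for a b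
  proof -
   have "(P + b *. (Q - P)) - (P + a *. (Q - P)) = (b - a) *. (Q - P)" by (simp add: algebra_simps)
   moreover have "(b - a) *. (Q - P) = (a - b) *. (P - Q)" by (simp add: algebra_simps)
   ultimately show ?thesis using Fi.hom[of "b - a" "Q - P"] Fi.hom[of "a - b" "P - Q"] by (auto simp: \<alpha>_def \<beta>_def)
  qed
  have Fj': "Fn j ((P' + b *. (Q' - P')) - (P' + a *. (Q' - P'))) = (if a <= b then (b - a) * \<alpha>' else (a - b) * \<beta>')" for a b
  proof -
   have "(P' + b *. (Q' - P')) - (P' + a *. (Q' - P')) = (b - a) *. (Q' - P')" by (simp add: algebra_simps)
   moreover have "(b - a) *. (Q' - P') = (a - b) *. (P' - Q')" by (simp add: algebra_simps)
   ultimately show ?thesis using Fj.hom[of "b - a" "Q' - P'"] Fj.hom[of "a - b" "P' - Q'"] by (auto simp: \<alpha>'_def \<beta>'_def)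
  qed
  have iso: "(if a <= b then (b - a) * \<alpha> else (a - b) * \<beta>) = (if a' <= b' then (b' - a') * \<alpha>' else (a' - b') * \<beta>')"
   if "0 <= a" "a <= 1" "0 <= b" "b <= 1" "0 <= a'" "a' <= 1" "0 <= b'" "b' <= 1"
    "ch i (P + a *. (Q - P)) = ch j (P' + a' *. (Q' - P'))" "ch i (P + b *. (Q - P)) = ch j (P' + b' *. (Q' - P'))" for a b a' b'
   using isometric_edges[OF i j ij ri[OF that(1,2)] ri[OF that(3,4)] rj[OF that(5,6)] rj[OF that(7,8)] that(9,10)]
   unfolding Fi' Fj' .
  have h: "\<exists>h. 0 <= h \<and> h <= 1 \<and> ch i (P + t *. (Q - P)) = ch j (P' + h *. (Q' - P'))" if "0 <= t" "t <= 1" for t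
  proof -
   have "ch i (P + t *. (Q - P)) \<in> ch i ` closed_segment P Q" using that by (auto simp: segment_param)
   then show ?thesis unfolding eq by (auto simp: segment_param)
  qed
  have a1: "(t1 - t0) * \<alpha> = \<alpha>'" "(t1 - t0) * \<beta> = \<beta>'"
   using iso[of t0 t1 0 1] iso[of t1 t0 1 0] e0 e1 t01 by auto
  then have le: "\<alpha>' <= \<alpha>" "\<beta>' <= \<beta>" using t01 pos mult_right_mono[of "t1 - t0" 1] by auto
  obtain h0 where h0: "0 <= h0" "h0 <= 1" "ch i (P + 0 *. (Q - P)) = ch j (P' + h0 *. (Q' - P'))" using h[of 0] by auto
  obtain h1 where h1: "0 <= h1" "h1 <= 1" "ch i (P + 1 *. (Q - P)) = ch j (P' + h1 *. (Q' - P'))" using h[of 1] by auto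
  \<comment> \<open>Both directed lengths of the second edge are those of the first one times
    \<open>t1 - t0\<close>. As the first edge in turn fits into the second one, the factor cannot be
    less than 1; the two cases are the possible orders of its end points.\<close>
  have full: "t1 - t0 = 1"
  proof (cases "h0 <= h1")
   case True
   then have "\<alpha> = (h1 - h0) * \<alpha>'" using iso[of 0 1 h0 h1] h0 h1 by auto
   also have "\<dots> <= \<alpha>'" using h0 h1 pos mult_right_mono[of "h1 - h0" 1 \<alpha>'] by auto
   finally have "(t1 - t0) * \<alpha> = \<alpha>" using le a1 by auto
   then show ?thesis using pos by simp
  next
   case False
   then have "\<alpha> = (h0 - h1) * \<beta>'" "\<beta> = (h0 - h1) * \<alpha>'" using iso[of 0 1 h0 h1] iso[of 1 0 h1 h0] h0 h1 by auto
   moreover have "(h0 - h1) * \<beta>' <= \<beta>'" "(h0 - h1) * \<alpha>' <= \<alpha>'"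
    using h0 h1 pos mult_right_mono[of "h0 - h1" 1 \<beta>'] mult_right_mono[of "h0 - h1" 1 \<alpha>'] by auto
   ultimately have "(t1 - t0) * \<alpha> = \<alpha>" using le a1 by auto
   then show ?thesis using pos by simp
  qed
  then have t: "t0 = 0" "t1 = 1" using t01 by auto
  then have aa: "\<alpha> = \<alpha>'" using a1 by simp
  show ?thesis
  proof
   fix t :: real assume t': "t \<in> {0..1}"
   then obtain h' where h': "0 <= h'" "h' <= 1" "ch i (P + t *. (Q - P)) = ch j (P' + h' *. (Q' - P'))" using h[of t] by auto
   have "t * \<alpha> = h' * \<alpha>'" using iso[of 0 t 0 h'] e0 t t' h' by auto
   then have "h' = t" using aa pos by simp
   then show "ch i (P + t *. (Q - P)) = ch j (P' + t *. (Q' - P'))" using h' by simp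
  qed
 qed
 have ex: "\<exists>t. 0 <= t \<and> t <= 1 \<and> ch i (P + t *. (Q - P)) = ch j Z" if "Z \<in> closed_segment P' Q'" for Z
 proof -
  have "ch j Z \<in> ch i ` closed_segment P Q" unfolding eq using that by blast
  then obtain t where "0 <= t" "t <= 1" "ch j Z = ch i (P + t *. (Q - P))" by (auto simp: segment_param)
  then show ?thesis by metis
 qed
 obtain t0 where t0: "0 <= t0" "t0 <= 1" "ch i (P + t0 *. (Q - P)) = ch j P'" using ex[of P'] by auto
 obtain t1 where t1: "0 <= t1" "t1 <= 1" "ch i (P + t1 *. (Q - P)) = ch j Q'" using ex[of Q'] by auto
 have "t0 ~= t1"
  using t0 t1 P' inj_onD[OF ch_inj[OF j], of P' Q'] corner_in[OF simp_i[OF j]] by auto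
 then consider "t0 < t1" | "t1 < t0" by linarith
 then show ?thesis
 proof cases
  case 1
  then show ?thesis using aux[OF P' eq _ _ _ t0(3) t1(3)] t0 t1 by auto
 next
  case 2
  then show ?thesis using aux[of Q' P' t1 t0] P' eq t0 t1 by (auto simp: closed_segment_commute)
 qed
qed

text \<open>If both end points or one inner point of an edge lie in another piece, the intersection
  is neither empty nor a single corner, and the common edge can only be this one.\<close>

lemma shared_edge:
 assumes i: "i \<in> pieces M" and j: "j \<in> pieces M" and ij: "i ~= j"
  and P: "P \<in> corners (Rg i)" "Q \<in> corners (Rg i)" "P ~= Q"
  and h: "(ch i P \<in> piece M j \<and> ch i Q \<in> piece M j) \<or> (\<exists>t. 0 < t \<and> t < 1 \<and> ch i (P + t *. (Q - P)) \<in> piece M j)"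
 obtains P' Q' where "P' \<in> corners (Rg j)" "Q' \<in> corners (Rg j)" "P' ~= Q'"
  "piece M i \<inter> piece M j = ch i ` closed_segment P Q"
  "\<And>t. 0 <= t ==> t <= 1 ==> ch i (P + t *. (Q - P)) = ch j (P' + t *. (Q' - P'))"
proof -
 note Ti = simp_i[OF i] and Tj = simp_i[OF j] and goal = that
 have inp: "ch i (P + t *. (Q - P)) \<in> piece M i" if "0 <= t" "t <= 1" for t
  using segment_region[OF i P(1,2) that] by (auto simp: piece_def)
 have Pin: "ch i P \<in> piece M i" "ch i Q \<in> piece M i" using inp[of 0] inp[of 1] by auto
 have inj: "p = q" if "p \<in> Rg i" "q \<in> Rg i" "ch i p = ch i q" for p q using inj_onD[OF ch_inj[OF i]] that by blast
 have fin: thesis if AB: "A \<in> corners (Rg i)" "B \<in> corners (Rg i)" "A ~= B" and P'Q': "P' \<in> corners (Rg j)" "Q' \<in> corners (Rg j)" "P' ~= Q'"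
   and int: "piece M i \<inter> piece M j = ch i ` closed_segment A B" and eq: "ch i ` closed_segment A B = ch j ` closed_segment P' Q'"
   and s: "{A, B} = {P, Q}" for A B P' Q'
 proof -
  have seg: "closed_segment A B = closed_segment P Q" using s by (metis segment_convex_hull)
  from edge_affine[OF i j ij P P'Q' eq[unfolded seg]] show thesis
  proof
   assume "\<forall>t\<in>{0..1}. ch i (P + t *. (Q - P)) = ch j (P' + t *. (Q' - P'))"
   then show thesis using goal[OF P'Q'] int seg by auto
  next
   assume "\<forall>t\<in>{0..1}. ch i (P + t *. (Q - P)) = ch j (Q' + t *. (P' - Q'))"
   then show thesis using goal[OF P'Q'(2,1) P'Q'(3)[symmetric]] int seg by auto
  qed
 qed
 show thesis
 proof (rule inter_cases[OF i j ij])
  assume "piece M i \<inter> piece M j = {}"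
  then have e: "z \<in> piece M i ==> z \<in> piece M j ==> False" for z by blast
  from h show thesis
  proof
   assume "ch i P \<in> piece M j \<and> ch i Q \<in> piece M j"
   then show thesis using e Pin by blast
  next
   assume "\<exists>t. 0 < t \<and> t < 1 \<and> ch i (P + t *. (Q - P)) \<in> piece M j"
   then obtain t where "0 < t" "t < 1" "ch i (P + t *. (Q - P)) \<in> piece M j" by blast
   then show thesis using e[OF inp[of t]] by auto
  qed
 next
  fix p q assume p: "p \<in> corners (Rg i)" "piece M i \<inter> piece M j = {ch i p}"
  from h show thesis
  proof
   assume "ch i P \<in> piece M j \<and> ch i Q \<in> piece M j"
   then have "ch i P = ch i p" "ch i Q = ch i p" using p Pin by auto
   then show thesis using inj[of P Q] P corner_in[OF Ti] by metis
  next
   assume "\<exists>t. 0 < t \<and> t < 1 \<and> ch i (P + t *. (Q - P)) \<in> piece M j"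
   then obtain t where t: "0 < t" "t < 1" "ch i (P + t *. (Q - P)) \<in> piece M j" by blast
   then have "ch i (P + t *. (Q - P)) \<in> piece M i \<inter> piece M j" using inp[of t] by simp
   then have "ch i (P + t *. (Q - P)) = ch i p" using p(2) by simp
   then have "P + t *. (Q - P) = p"
    using t by (intro inj[OF segment_region[OF i P(1,2)] corner_in[OF Ti p(1)]]) auto
   moreover have "P + t *. (Q - P) \<in> open_segment P Q" using t P(3) by (auto simp: in_segment algebra_simps intro!: exI[of _ t])
   moreover have "p extreme_point_of Rg i" using p(1) by (simp add: corners_def)
   ultimately show thesis using corner_in[OF Ti P(1)] corner_in[OF Ti P(2)] unfolding extreme_point_of_def by metis
  qed
 next
  fix A B P' Q' assume AB: "A \<in> corners (Rg i)" "B \<in> corners (Rg i)" "A ~= B" and P'Q': "P' \<in> corners (Rg j)" "Q' \<in> corners (Rg j)" "P' ~= Q'"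
   and int: "piece M i \<inter> piece M j = ch i ` closed_segment A B" and eq: "ch i ` closed_segment A B = ch j ` closed_segment P' Q'"
  have segR: "closed_segment A B \<subseteq> Rg i" using segment_region[OF i AB(1,2)] by (auto simp: segment_param)
  have on: "x \<in> closed_segment A B" if x: "x \<in> Rg i" "ch i x \<in> ch i ` closed_segment A B" for x
  proof -
   obtain y where "y \<in> closed_segment A B" "ch i x = ch i y" using x(2) by blast
   then show ?thesis using inj[OF x(1), of y] segR by blast
  qed
  from h have "{A, B} = {P, Q}"
  proof
   assume "ch i P \<in> piece M j \<and> ch i Q \<in> piece M j"
   then have "ch i P \<in> ch i ` closed_segment A B" "ch i Q \<in> ch i ` closed_segment A B" using Pin int by auto
   then have "P \<in> closed_segment A B" "Q \<in> closed_segment A B"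
    using on corner_in[OF Ti P(1)] corner_in[OF Ti P(2)] by blast+
   then show ?thesis using corner_on_edge[OF Ti AB, of P] corner_on_edge[OF Ti AB, of Q] P by auto
  next
   assume "\<exists>t. 0 < t \<and> t < 1 \<and> ch i (P + t *. (Q - P)) \<in> piece M j"
   then obtain t where t: "0 < t" "t < 1" "ch i (P + t *. (Q - P)) \<in> piece M j" by blast
   then have "ch i (P + t *. (Q - P)) \<in> ch i ` closed_segment A B" using inp[of t] int by auto
   then have "P + t *. (Q - P) \<in> closed_segment A B"
    using t by (intro on segment_region[OF i P(1,2)]) auto
   then show ?thesis by (rule inner_edge_unique[OF Ti P t(1,2) AB(1,2)])
  qed
  then show thesis by (rule fin[OF AB P'Q' int eq])
 qed
qed

end

section \<open>Adjacency of triangles along edges\<close>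

lemma inner_not_corner:
 assumes T: "2 simplex T" and P: "P \<in> corners T" "Q \<in> corners T" "P ~= Q" and t: "0 < t" "t < 1"
 shows "P + t *. (Q - P) \<notin> corners T"
proof
 assume "P + t *. (Q - P) \<in> corners T"
 then have "P + t *. (Q - P) = P \<or> P + t *. (Q - P) = Q"
  using t by (intro corner_on_edge[OF T P]) (auto simp: segment_param)
 moreover have "P + t *. (Q - P) - Q = (t - 1) *. (Q - P)" by (simp add: algebra_simps)
 ultimately show False using t P(3) by auto
qed

lemma inner_not_interior:
 assumes T: "2 simplex T" and P: "P \<in> corners T"
 shows "P + t *. (oth T P k - P) \<notin> interior T"
proof
 let ?m = "P + t *. (oth T P k - P)" and ?N = "oth T P (\<not> k) - P"
 assume "?m \<in> interior T"
 then obtain e where e: "e > 0" "ball ?m e \<subseteq> T" by (meson mem_interior)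
 \<comment> \<open>A step of this size away from the third corner stays in the ball of radius
   \<open>e\<close> but leaves the triangle.\<close>
 define d where "d = e / (2 * (norm ?N + 1))"
 have nN: "0 < norm ?N + 1" by (simp add: add_nonneg_pos)
 have d: "0 < d" using e nN by (simp add: d_def)
 have "norm (d *. ?N) < e"
 proof -
  have "norm (d *. ?N) <= d * (norm ?N + 1)" using d by (simp add: mult_left_mono)
  also have "\<dots> = e / 2" unfolding d_def using nN by (metis (no_types) less_irrefl nonzero_mult_divide_mult_cancel_right times_divide_eq_left)
  finally show ?thesis using e by simp
 qed
 then have "?m + (- d) *. ?N \<in> T" using e(2) by (auto simp: dist_norm)
 then obtain a b where ab: "0 <= b" "P + t *. (oth T P k - P) + (- d) *. ?N = P + a *. (oth T P k - P) + b *. ?N"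
  using mem_triangle[OF T P, of _ k] by blast
 from bary_unique[OF T P ab(2)] show False using ab(1) d by simp
qed

context pf_surface
begin

text \<open>Edges of a piece are directed, because a gluing matches end points in order.\<close>

definition eflag :: "'i => real^2 => real^2 => bool" where
 "eflag i P Q \<longleftrightarrow> i \<in> pieces M \<and> P \<in> corners (Rg i) \<and> Q \<in> corners (Rg i) \<and> P ~= Q"

definition mid :: "'i => real^2 => real^2 => 'p" where
 "mid i P Q = ch i (P + (1/2) *. (Q - P))"

lemma vertices_alt: "vertices M = {ch i p | i p. i \<in> pieces M \<and> p \<in> corners (Rg i)}"
 by (simp add: vertices_def corners_def)

lemma piece_inj: "i \<in> pieces M ==> p \<in> Rg i ==> q \<in> Rg i ==> ch i p = ch i q ==> p = q"
 using inj_onD[OF ch_inj] by metis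

lemma corner_reg: "i \<in> pieces M ==> p \<in> corners (Rg i) ==> p \<in> Rg i"
 using corner_in simp_i by blast

text \<open>Another triangle through an inner point of an edge shares the whole edge with the same
  parameter, so the point is an inner point of an edge there as well.\<close>

lemma inner_not_vertex:
 assumes e: "eflag i P Q" and t: "0 < t" "t < 1"
 shows "ch i (P + t *. (Q - P)) \<notin> vertices M"
proof
 have i: "i \<in> pieces M" and P: "P \<in> corners (Rg i)" "Q \<in> corners (Rg i)" "P ~= Q" using e by (auto simp: eflag_def)
 assume "ch i (P + t *. (Q - P)) \<in> vertices M"
 then obtain m p where m: "m \<in> pieces M" "p \<in> corners (Rg m)" "ch i (P + t *. (Q - P)) = ch m p"
  by (auto simp: vertices_alt)
 have pin: "p \<in> Rg m" by (rule corner_reg[OF m(1,2)])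
 show False
 proof (cases "m = i")
  case True
  then have "P + t *. (Q - P) = p" using piece_inj[OF i segment_region[OF i P(1,2)], of t p] m t pin by auto
  then show False using inner_not_corner[OF simp_i[OF i] P t] m True by auto
 next
  case False
  have "ch i (P + t *. (Q - P)) \<in> piece M m" using m pin by (auto simp: piece_def)
  then obtain P' Q' where P': "P' \<in> corners (Rg m)" "Q' \<in> corners (Rg m)" "P' ~= Q'"
   "\<And>t. 0 <= t ==> t <= 1 ==> ch i (P + t *. (Q - P)) = ch m (P' + t *. (Q' - P'))"
   using shared_edge[OF i m(1) False[symmetric] P] t by metis
  then have "P' + t *. (Q' - P') = p" using piece_inj[OF m(1) segment_region[OF m(1) P'(1,2)] pin, of t] m(3) t by auto
  then show False using inner_not_corner[OF simp_i[OF m(1)] P'(1-3) t] m by auto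
 qed
qed

text \<open>Otherwise a neighbourhood of the midpoint would be covered by piece \<open>i\<close>
  alone, and invariance of domain would make the midpoint an interior point of the triangle.\<close>

lemma neighbour_exists:
 assumes e: "eflag i P Q"
 shows "\<exists>j\<in>pieces M. j ~= i \<and> mid i P Q \<in> piece M j"
proof (rule ccontr)
 assume none: "\<not> ?thesis"
 have i: "i \<in> pieces M" and P: "P \<in> corners (Rg i)" "Q \<in> corners (Rg i)" "P ~= Q" using e by (auto simp: eflag_def)
 let ?m = "P + (1/2) *. (Q - P)"
 have mr: "?m \<in> Rg i" by (rule segment_region[OF i P(1,2)]) auto
 then have "mid i P Q \<in> topspace (topo M)" using cover i by (auto simp: mid_def piece_def)
 then obtain W where W: "openin (topo M) W" "mid i P Q \<in> W" "\<And>j. j \<in> pieces M ==> piece M j \<inter> W ~= {} ==> mid i P Q \<in> piece M j"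
  using local_nbhd by blast
 have "W \<subseteq> ch i ` Rg i"
 proof
  fix z assume z: "z \<in> W"
  then have "z \<in> (\<Union>j\<in>pieces M. piece M j)" using openin_subset[OF W(1)] cover by blast
  then obtain j where j: "j \<in> pieces M" "z \<in> piece M j" by blast
  then have "j = i" using W(3)[OF j(1)] z none by blast
  then show "z \<in> ch i ` Rg i" using j by (simp add: piece_def)
 qed
 from surface_inverse_open[OF surf emb_i[OF i] W(1) this mr] have "?m \<in> interior (Rg i)" using W(2) by (simp add: mid_def)
 moreover obtain k where "Q = oth (Rg i) P k" by (rule corner_oth[OF simp_i[OF i] P])
 ultimately show False using inner_not_interior[OF simp_i[OF i] P(1)] by metis
qed

text \<open>Coordinates for a half disc in the triangle whose diameter lies on the edge, centred at
  the midpoint; \<open>s\<close> selects the upper or lower half of the plane. The bounds 1/4 keep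
  the barycentric coordinates nonnegative.\<close>

lemma half_disc_cont:
 assumes e: "eflag i P (oth (Rg i) P k)" and S: "\<And>w. w \<in> S ==> \<bar>w$1\<bar> <= 1/4 \<and> 0 <= s * w$2 \<and> s * w$2 <= 1/4"
 defines "\<phi> \<equiv> \<lambda>w. P + (1/2 + w$1) *. (oth (Rg i) P k - P) + (s * w$2) *. (oth (Rg i) P (\<not> k) - P)"
 shows "continuous_map (top_of_set S) (topo M) (\<lambda>w::real^2. ch i (\<phi> w))" and "\<And>w. w \<in> S ==> \<phi> w \<in> Rg i"
proof -
 have i: "i \<in> pieces M" and P: "P \<in> corners (Rg i)" using e by (auto simp: eflag_def)
 show r: "\<phi> w \<in> Rg i" if "w \<in> S" for w
 proof -
  have "\<bar>w$1\<bar> <= 1/4" "0 <= s * w$2" "s * w$2 <= 1/4" using S[OF that] by auto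
  then have "0 <= 1/2 + w$1" "1/2 + w$1 + s * w$2 <= 1" by (auto simp: abs_le_iff)
  then show ?thesis unfolding mem_triangle[OF simp_i[OF i] P, of _ k] \<phi>_def using \<open>0 <= s * w$2\<close> by blast
 qed
 have "continuous_on S \<phi>" unfolding \<phi>_def by (intro continuous_intros)
 then have "continuous_map (top_of_set S) (top_of_set (Rg i)) \<phi>" using r by auto
 from continuous_map_compose[OF this ch_cont[OF i]] show "continuous_map (top_of_set S) (topo M) (\<lambda>w. ch i (\<phi> w))"
  by (simp add: o_def)
qed

lemma vec2_ball: "w \<in> ball 0 (1/4) ==> \<bar>(w::real^2)$1\<bar> <= 1/4 \<and> \<bar>w$2\<bar> <= 1/4"
 using component_le_norm_cart[of w 1] component_le_norm_cart[of w 2] by auto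

text \<open>Two pieces sharing an edge already fill a disc around its midpoint, so by invariance of domain no
 third piece can come near it.\<close>

lemma neighbour_unique:
 assumes e: "eflag i P Q" and j: "j \<in> pieces M" "j ~= i" "mid i P Q \<in> piece M j"
  and j': "j' \<in> pieces M" "j' ~= i" "mid i P Q \<in> piece M j'"
 shows "j = j'"
proof (rule ccontr)
 assume ne: "j ~= j'"
 have i: "i \<in> pieces M" and P: "P \<in> corners (Rg i)" "Q \<in> corners (Rg i)" "P ~= Q" using e by (auto simp: eflag_def)
 obtain k where k: "Q = oth (Rg i) P k" by (rule corner_oth[OF simp_i[OF i] P])
 have h: "\<exists>t. 0 < t \<and> t < 1 \<and> ch i (P + t *. (Q - P)) \<in> piece M j"
  using j(3) by (intro exI[of _ "1/2"]) (auto simp: mid_def)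
 obtain P1 Q1 where P1: "P1 \<in> corners (Rg j)" "Q1 \<in> corners (Rg j)" "P1 ~= Q1"
  and I1: "piece M i \<inter> piece M j = ch i ` closed_segment P Q"
  and aff1: "\<And>t. 0 <= t ==> t <= 1 ==> ch i (P + t *. (Q - P)) = ch j (P1 + t *. (Q1 - P1))"
  using shared_edge[OF i j(1) j(2)[symmetric] P] h by metis
 obtain k1 where k1: "Q1 = oth (Rg j) P1 k1" by (rule corner_oth[OF simp_i[OF j(1)] P1])
 define f where "f w = ch i (P + (1/2 + w$1) *. (oth (Rg i) P k - P) + (1 * w$2) *. (oth (Rg i) P (\<not> k) - P))" for w :: "real^2"
 define g where "g w = ch j (P1 + (1/2 + w$1) *. (oth (Rg j) P1 k1 - P1) + (-1 * w$2) *. (oth (Rg j) P1 (\<not> k1) - P1))" for w :: "real^2"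
 have e1: "eflag i P (oth (Rg i) P k)" "eflag j P1 (oth (Rg j) P1 k1)" using e P1 j k k1 by (auto simp: eflag_def)
 define D where "D = ball (0::real^2) (1/4)"
 have Su: "w \<in> {x \<in> D. 0 <= x$2} ==> \<bar>w$1\<bar> <= 1/4 \<and> 0 <= 1 * w$2 \<and> 1 * w$2 <= 1/4"
  and Sl: "w \<in> {x \<in> D. x$2 <= 0} ==> \<bar>w$1\<bar> <= 1/4 \<and> 0 <= -1 * w$2 \<and> -1 * w$2 <= 1/4" for w
  using vec2_ball[of w] by (auto simp: D_def)
 note fu = half_disc_cont[where S = "{x \<in> D. 0 <= x$2}" and s = 1, OF e1(1) Su, folded f_def]
  and gl = half_disc_cont[where S = "{x \<in> D. x$2 <= 0}" and s = "-1", OF e1(2) Sl, folded g_def]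
 have fg: "f w = g w" if "w \<in> D" "w$2 = 0" for w
  using aff1[of "1/2 + w$1"] vec2_ball[of w] that by (auto simp: f_def g_def k k1 D_def abs_le_iff)
 \<comment> \<open>Two half discs, one in each triangle, glued along the edge to a full
   disc.\<close>
 define \<Phi> where "\<Phi> w = (if 0 <= w$2 then f w else g w)" for w :: "real^2"
 have cont: "continuous_map (top_of_set D) (topo M) \<Phi>"
  unfolding \<Phi>_def
 proof (rule continuous_map_cases_le)
  show "continuous_map (top_of_set D) euclideanreal (\<lambda>w. 0)" "continuous_map (top_of_set D) euclideanreal (\<lambda>w. w$2)"
   by (auto intro: continuous_intros)
  show "continuous_map (subtopology (top_of_set D) {x \<in> topspace (top_of_set D). 0 <= x$2}) (topo M) f"
   using fu(1) by (simp add: subtopology_subtopology Int_def conj_assoc cong: conj_cong)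
  show "continuous_map (subtopology (top_of_set D) {x \<in> topspace (top_of_set D). x$2 <= 0}) (topo M) g"
   using gl(1) by (simp add: subtopology_subtopology Int_def conj_assoc cong: conj_cong)
  show "f x = g x" if "x \<in> topspace (top_of_set D)" "0 = x$2" for x using fg[of x] that by auto
 qed
 have mixed: False if a: "a \<in> D" "0 <= a$2" and b: "b \<in> D" "b$2 < 0" and eq: "f a = g b" for a b
 proof -
  have "g b \<in> piece M j" using gl(2)[of b] b by (auto simp: g_def piece_def)
  moreover have "g b \<in> piece M i" using fu(2)[of a] a eq[symmetric] by (auto simp: f_def piece_def)
  ultimately have "g b \<in> ch i ` closed_segment P Q" using I1 by blast
  then obtain t where t: "0 <= t" "t <= 1" "g b = ch j (P1 + t *. (Q1 - P1))" using aff1 by (auto simp: segment_param)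
  have "P1 + (1/2 + b$1) *. (oth (Rg j) P1 k1 - P1) + (-1 * b$2) *. (oth (Rg j) P1 (\<not> k1) - P1) = P1 + t *. (Q1 - P1)"
   using piece_inj[OF j(1) gl(2) segment_region[OF j(1) P1(1,2) t(1,2)]] t(3) b unfolding g_def by auto
  also have "\<dots> = P1 + t *. (oth (Rg j) P1 k1 - P1) + 0 *. (oth (Rg j) P1 (\<not> k1) - P1)" by (simp add: k1)
  finally have "-1 * b$2 = 0" using bary_unique[OF simp_i[OF j(1)] P1(1)] by blast
  then show False using b by simp
 qed
 have inj: "inj_on \<Phi> D"
 proof (rule inj_onI)
  fix a b assume ab: "a \<in> D" "b \<in> D" "\<Phi> a = \<Phi> b"
  consider "0 <= a$2" "0 <= b$2" | "a$2 < 0" "b$2 < 0" | "0 <= a$2" "b$2 < 0" | "a$2 < 0" "0 <= b$2" by linarith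
  then show "a = b"
  proof cases
   case 1
   then have "f a = f b" using ab by (simp add: \<Phi>_def)
   then have "P + (1/2 + a$1) *. (oth (Rg i) P k - P) + (1 * a$2) *. (oth (Rg i) P (\<not> k) - P) =
     P + (1/2 + b$1) *. (oth (Rg i) P k - P) + (1 * b$2) *. (oth (Rg i) P (\<not> k) - P)"
    unfolding f_def using 1 ab by (intro piece_inj[OF i fu(2) fu(2)]) auto
   from bary_unique[OF simp_i[OF i] P(1) this] show ?thesis by (auto simp: vec2_eq_iff)
  next
   case 2
   then have "g a = g b" using ab by (simp add: \<Phi>_def)
   then have "P1 + (1/2 + a$1) *. (oth (Rg j) P1 k1 - P1) + (-1 * a$2) *. (oth (Rg j) P1 (\<not> k1) - P1) =
     P1 + (1/2 + b$1) *. (oth (Rg j) P1 k1 - P1) + (-1 * b$2) *. (oth (Rg j) P1 (\<not> k1) - P1)"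
    unfolding g_def using 2 ab by (intro piece_inj[OF j(1) gl(2) gl(2)]) auto
   from bary_unique[OF simp_i[OF j(1)] P1(1) this] show ?thesis by (auto simp: vec2_eq_iff)
  next
   case 3
   then show ?thesis using mixed[of a b] ab by (simp add: \<Phi>_def)
  next
   case 4
   then show ?thesis using mixed[of b a] ab by (simp add: \<Phi>_def)
  qed
 qed
 have op: "openin (topo M) (\<Phi> ` D)" by (rule surface_open_map[OF surf _ cont inj]) (simp add: D_def)
 have im: "\<Phi> ` D \<subseteq> piece M i \<union> piece M j"
 proof
  fix z assume "z \<in> \<Phi> ` D"
  then obtain w where w: "w \<in> D" "z = \<Phi> w" by blast
  then show "z \<in> piece M i \<union> piece M j"
   using fu(2)[of w] gl(2)[of w] by (cases "0 <= w$2") (auto simp: \<Phi>_def f_def g_def piece_def)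
 qed
 have h': "\<exists>t. 0 < t \<and> t < 1 \<and> ch i (P + t *. (Q - P)) \<in> piece M j'"
  using j'(3) by (intro exI[of _ "1/2"]) (auto simp: mid_def)
 obtain P2 Q2 where P2: "P2 \<in> corners (Rg j')" "Q2 \<in> corners (Rg j')" "P2 ~= Q2"
  and aff2: "\<And>t. 0 <= t ==> t <= 1 ==> ch i (P + t *. (Q - P)) = ch j' (P2 + t *. (Q2 - P2))"
  using shared_edge[OF i j'(1) j'(2)[symmetric] P] h' by metis
 obtain k2 where k2: "Q2 = oth (Rg j') P2 k2" by (rule corner_oth[OF simp_i[OF j'(1)] P2])
 have m2: "mid i P Q = ch j' (P2 + (1/2) *. (Q2 - P2))" using aff2[of "1/2"] by (simp add: mid_def)
 \<comment> \<open>Points of the third piece just off the edge belong neither to \<open>i\<close>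
   nor to \<open>j\<close>, because each of these meets the third piece exactly in the edge.\<close>
 have off: "ch j' (P2 + (1/2) *. (Q2 - P2) + \<epsilon> *. (oth (Rg j') P2 (\<not> k2) - P2)) \<notin> piece M l"
  if \<epsilon>: "0 < \<epsilon>" "\<epsilon> <= 1/4" and l: "l \<in> pieces M" "l ~= j'" "mid i P Q \<in> piece M l" for \<epsilon> l
 proof
  let ?p = "P2 + (1/2) *. (Q2 - P2) + \<epsilon> *. (oth (Rg j') P2 (\<not> k2) - P2)"
  assume a: "ch j' ?p \<in> piece M l"
  have "0 <= (1/2::real) \<and> 0 <= \<epsilon> \<and> 1/2 + \<epsilon> <= 1" using \<epsilon> by auto
  then have pr: "?p \<in> Rg j'" unfolding k2 mem_triangle[OF simp_i[OF j'(1)] P2(1), of _ k2] by blast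
  have "\<exists>t. 0 < t \<and> t < 1 \<and> ch j' (P2 + t *. (Q2 - P2)) \<in> piece M l"
   using l(3) m2 by (intro exI[of _ "1/2"]) auto
  then have "piece M j' \<inter> piece M l = ch j' ` closed_segment P2 Q2"
   using shared_edge[OF j'(1) l(1) l(2)[symmetric] P2] by metis
  then have "ch j' ?p \<in> ch j' ` closed_segment P2 Q2" using a pr by (auto simp: piece_def)
  then obtain t where t: "0 <= t" "t <= 1" "ch j' ?p = ch j' (P2 + t *. (Q2 - P2))" by (auto simp: segment_param)
  have "?p = P2 + t *. (Q2 - P2)" by (rule piece_inj[OF j'(1) pr segment_region[OF j'(1) P2(1,2) t(1,2)] t(3)])
  then have "?p \<in> closed_segment P2 Q2" using t(1,2) unfolding segment_param by blast
  then show False unfolding k2 edge_mem[OF simp_i[OF j'(1)] P2(1)] using \<epsilon> by simp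
 qed
 \<comment> \<open>A path in the third piece that leaves the edge at its midpoint. At small times it
   would still lie in the open disc, which is made of points of \<open>i\<close> and
   \<open>j\<close> only.\<close>
 define q where "q \<epsilon> = P2 + (1/2) *. (Q2 - P2) + \<epsilon> *. (oth (Rg j') P2 (\<not> k2) - P2)" for \<epsilon>
 have qr: "q \<epsilon> \<in> Rg j'" if "\<epsilon> \<in> {0..1/4}" for \<epsilon>
 proof -
  have "0 <= (1/2::real) \<and> 0 <= \<epsilon> \<and> 1/2 + \<epsilon> <= 1" using that by auto
  then show ?thesis unfolding q_def k2 mem_triangle[OF simp_i[OF j'(1)] P2(1), of _ k2] by blast
 qed
 have "continuous_on {0..1/4} q" unfolding q_def by (intro continuous_intros)
 then have "continuous_map (top_of_set {0..1/4}) (top_of_set (Rg j')) q" using qr by auto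
 from continuous_map_compose[OF this ch_cont[OF j'(1)]]
 have "openin (top_of_set {0..1/4}) {\<epsilon> \<in> topspace (top_of_set {0..1/4}). (ch j' \<circ> q) \<epsilon> \<in> \<Phi> ` D}"
  by (rule openin_continuous_map_preimage[OF _ op])
 then have oq: "openin (top_of_set {0..1/4}) {\<epsilon> \<in> {0..1/4}. ch j' (q \<epsilon>) \<in> \<Phi> ` D}" by simp
 have "mid i P Q = \<Phi> 0" by (simp add: \<Phi>_def f_def mid_def k)
 moreover have "ch j' (q 0) = mid i P Q" unfolding m2 q_def scaleR_zero_left add_0_right ..
 moreover have "(0::real^2) \<in> D" unfolding D_def by (rule centre_in_ball[THEN iffD2]) linarith
 ultimately have im0: "ch j' (q 0) \<in> \<Phi> ` D" by (metis imageI)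
 have "(0::real) \<in> {0..1/4}" by simp
 then have zero: "0 \<in> {\<epsilon> \<in> {0..1/4}. ch j' (q \<epsilon>) \<in> \<Phi> ` D}" using im0 by (intro CollectI conjI)
 from oq[unfolded openin_contains_ball, THEN conjunct2, THEN bspec, OF zero]
 obtain r where r: "r > 0" "ball 0 r \<inter> {0..1/4} \<subseteq> {\<epsilon> \<in> {0..1/4}. ch j' (q \<epsilon>) \<in> \<Phi> ` D}"
  by (elim exE conjE)
 define \<epsilon> where "\<epsilon> = min (r / 2) (1/4)"
 have \<epsilon>: "0 < \<epsilon>" "\<epsilon> <= 1/4" using r(1) by (auto simp: \<epsilon>_def)
 have "\<epsilon> \<in> ball 0 r \<inter> {0..1/4}" using r(1) by (auto simp: \<epsilon>_def)
 then have "ch j' (q \<epsilon>) \<in> \<Phi> ` D" using r(2) by blast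
 then have "ch j' (q \<epsilon>) \<in> piece M i \<union> piece M j" using im by blast
 moreover have "mid i P Q \<in> piece M i" using segment_region[OF i P(1,2), of "1/2"] by (auto simp: mid_def piece_def)
 ultimately show False using off[OF \<epsilon>(1,2) i j'(2)[symmetric], folded q_def] off[OF \<epsilon>(1,2) j(1) ne j(3), folded q_def] by blast
qed

lemma piece_mid: "eflag i P Q ==> mid i P Q \<in> piece M i"
 using segment_region[of i P Q "1/2"] by (auto simp: mid_def piece_def eflag_def)

text \<open>Directed edges identified with equal affine parameters; by \<open>edge_affine\<close>
  every gluing has this form after a choice of direction.\<close>

definition adj :: "'i => real^2 => real^2 => 'i => real^2 => real^2 => bool" where
 "adj i P Q j P' Q' \<longleftrightarrow> eflag i P Q \<and> eflag j P' Q' \<and> i ~= j \<and>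
   (\<forall>t. 0 <= t --> t <= 1 --> ch i (P + t *. (Q - P)) = ch j (P' + t *. (Q' - P')))"

lemma adj_sym: "adj i P Q j P' Q' ==> adj j P' Q' i P Q"
 by (auto simp: adj_def)

lemma adj_mid: "adj i P Q j P' Q' ==> mid i P Q = mid j P' Q'"
 by (auto simp: adj_def mid_def)

lemma adj_ends: "adj i P Q j P' Q' ==> ch i P = ch j P' \<and> ch i Q = ch j Q'"
proof -
 assume "adj i P Q j P' Q'"
 then have *: "ch i (P + t *. (Q - P)) = ch j (P' + t *. (Q' - P'))" if "0 <= t" "t <= 1" for t using that by (auto simp: adj_def)
 show ?thesis using *[of 0] *[of 1] by simp
qed

lemma adj_intro:
 assumes e: "eflag i P Q" and j: "j \<in> pieces M" "j ~= i"
  and h: "(ch i P \<in> piece M j \<and> ch i Q \<in> piece M j) \<or> (\<exists>t. 0 < t \<and> t < 1 \<and> ch i (P + t *. (Q - P)) \<in> piece M j)"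
 shows "\<exists>P' Q'. adj i P Q j P' Q' \<and> piece M i \<inter> piece M j = ch i ` closed_segment P Q"
proof -
 have i: "i \<in> pieces M" and P: "P \<in> corners (Rg i)" "Q \<in> corners (Rg i)" "P ~= Q" using e by (auto simp: eflag_def)
 obtain P' Q' where P': "P' \<in> corners (Rg j)" "Q' \<in> corners (Rg j)" "P' ~= Q'"
  "piece M i \<inter> piece M j = ch i ` closed_segment P Q"
  "\<And>t. 0 <= t ==> t <= 1 ==> ch i (P + t *. (Q - P)) = ch j (P' + t *. (Q' - P'))"
  by (rule shared_edge[OF i j(1) j(2)[symmetric] P h], rule that)
 then show ?thesis using e j by (intro exI[of _ P'] exI[of _ Q']) (auto simp: adj_def eflag_def)
qed

lemma adj_ex:
 assumes "eflag i P Q"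
 shows "\<exists>j P' Q'. adj i P Q j P' Q'"
proof -
 obtain j where j: "j \<in> pieces M" "j ~= i" "mid i P Q \<in> piece M j" using neighbour_exists[OF assms] by blast
 have "\<exists>t. 0 < t \<and> t < 1 \<and> ch i (P + t *. (Q - P)) \<in> piece M j"
  using j(3) by (intro exI[of _ "1/2"]) (auto simp: mid_def)
 then show ?thesis using adj_intro[OF assms j(1,2)] by blast
qed

lemma adj_unique:
 assumes a: "adj i P Q j P' Q'" and b: "adj i P Q j1 P1 Q1"
 shows "j1 = j \<and> P1 = P' \<and> Q1 = Q'"
proof -
 have e: "eflag i P Q" and ej: "eflag j P' Q'" "eflag j1 P1 Q1" and ne: "j ~= i" "j1 ~= i" using a b by (auto simp: adj_def)
 then have j: "j \<in> pieces M" "j1 \<in> pieces M" by (auto simp: eflag_def)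
 have "mid i P Q \<in> piece M j" "mid i P Q \<in> piece M j1" using piece_mid[OF ej(1)] piece_mid[OF ej(2)] adj_mid[OF a] adj_mid[OF b] by auto
 then have jj: "j = j1" using neighbour_unique[OF e j(1) ne(1) _ j(2) ne(2)] by blast
 have "ch j P1 = ch j P'" "ch j Q1 = ch j Q'" using adj_ends[OF a] adj_ends[OF b] jj by auto
 then show ?thesis using piece_inj[OF j(1)] corner_reg[OF j(1)] ej jj unfolding eflag_def by metis
qed

lemma adj_in:
 assumes a: "adj i P Q j P' Q'" and m: "m \<in> pieces M" and t: "0 < t" "t < 1" and h: "ch i (P + t *. (Q - P)) \<in> piece M m"
 shows "m = i \<or> m = j"
proof (rule ccontr)
 assume n: "\<not> (m = i \<or> m = j)"
 have e: "eflag i P Q" using a by (simp add: adj_def)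
 then obtain P1 Q1 where "adj i P Q m P1 Q1" using adj_intro[OF e m] n h t by blast
 then show False using adj_unique[OF a] n by blast
qed

lemma adj_inter: "adj i P Q j P' Q' ==> piece M i \<inter> piece M j = ch i ` closed_segment P Q"
proof -
 assume a: "adj i P Q j P' Q'"
 then have e: "eflag i P Q" and j: "j \<in> pieces M" "j ~= i" and "eflag j P' Q'" by (auto simp: adj_def eflag_def)
 then have "ch i P \<in> piece M j \<and> ch i Q \<in> piece M j" using adj_ends[OF a] corner_reg[of j] by (auto simp: piece_def eflag_def)
 then show ?thesis using adj_intro[OF e j] by blast
qed

lemma adj_norm:
 assumes a: "adj i P Q j P' Q'"
 shows "Fn i (Q - P) = Fn j (Q' - P')" "Fn i (- (Q - P)) = Fn j (- (Q' - P'))"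
proof -
 have i: "i \<in> pieces M" "P \<in> Rg i" "Q \<in> Rg i" and j: "j \<in> pieces M" "P' \<in> Rg j" "Q' \<in> Rg j" and ne: "i ~= j"
  using a by (auto simp: adj_def eflag_def corner_reg)
 have "ch i P = ch j P'" "ch i Q = ch j Q'" using adj_ends[OF a] by auto
 then show "Fn i (Q - P) = Fn j (Q' - P')" "Fn i (- (Q - P)) = Fn j (- (Q' - P'))"
  using isometric_edges[OF i(1) j(1) ne i(2,3) j(2,3)] isometric_edges[OF i(1) j(1) ne i(3,2) j(3,2)] by auto
qed

end

lemma minkowski_conv_norm: "minkowski F ==> conv_norm F"
proof -
 assume "minkowski F"
 then interpret minkowski F .
 show "conv_norm F" by (rule conv_norm_axioms)
qed

context pf_surface
begin

section \<open>The tangent cone at a vertex\<close>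

lemma coord_ch: "i \<in> pieces M ==> p \<in> Rg i ==> coord M (ch i p) i = p"
 unfolding coord_def using the_inv_into_f_f[OF ch_inj] by metis

lemma star_coord:
 assumes "i \<in> star M x"
 shows "i \<in> pieces M" "coord M x i \<in> Rg i" "ch i (coord M x i) = x"
proof -
 show i: "i \<in> pieces M" using assms by (simp add: star_def)
 obtain p where "p \<in> Rg i" "x = ch i p" using assms by (auto simp: star_def piece_def)
 then show "coord M x i \<in> Rg i" "ch i (coord M x i) = x" using coord_ch[OF i] by auto
qed

lemma coord_eqI: "i \<in> pieces M ==> p \<in> Rg i ==> ch i p = x ==> i \<in> star M x \<and> coord M x i = p"
 using coord_ch by (auto simp: star_def piece_def)

text \<open>Two triangles meet in a face of both, so a corner of one cannot lie inside an edge or in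
  the interior of the other.\<close>

lemma star_corner:
 assumes x: "x \<in> vertices M" and i: "i \<in> star M x"
 shows "coord M x i \<in> corners (Rg i)"
proof -
 obtain m p where m: "m \<in> pieces M" "p \<in> corners (Rg m)" "x = ch m p" using x by (auto simp: vertices_alt)
 note ip = star_coord[OF i]
 have pr: "p \<in> Rg m" by (rule corner_reg[OF m(1,2)])
 have xm: "x \<in> piece M m" "x \<in> piece M i" using m pr i by (auto simp: piece_def star_def)
 show ?thesis
 proof (cases "i = m")
  case True
  then show ?thesis using coord_ch[OF m(1) pr] m by simp
 next
  case False
  show ?thesis
  proof (rule inter_cases[OF m(1) ip(1) False[symmetric]])
   assume "piece M m \<inter> piece M i = {}"
   then show ?thesis using xm by blast
  next
   fix p0 q assume "p0 \<in> corners (Rg m)" and q: "q \<in> corners (Rg i)" "piece M m \<inter> piece M i = {ch m p0}" "ch m p0 = ch i q"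
   then have "x = ch i q" using xm by auto
   then show ?thesis using coord_ch[OF ip(1) corner_reg[OF ip(1) q(1)]] q(1) by simp
  next
   fix A B P' Q' assume AB: "A \<in> corners (Rg m)" "B \<in> corners (Rg m)" "A ~= B"
    and P': "P' \<in> corners (Rg i)" "Q' \<in> corners (Rg i)" "P' ~= Q'"
    and int: "piece M m \<inter> piece M i = ch m ` closed_segment A B" and eq: "ch m ` closed_segment A B = ch i ` closed_segment P' Q'"
   have "x \<in> ch m ` closed_segment A B" using xm int by blast
   then obtain z where z: "z \<in> closed_segment A B" "ch m p = ch m z" using m by auto
   have "z \<in> Rg m" using z(1) segment_region[OF m(1) AB(1,2)] by (auto simp: segment_param)
   then have "p \<in> closed_segment A B" using piece_inj[OF m(1) pr _ z(2)] z(1) by simp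
   then have pAB: "p = A \<or> p = B" by (rule corner_on_edge[OF simp_i[OF m(1)] AB m(2)])
   have "(ch m A = ch i P' \<and> ch m B = ch i Q') \<or> (ch m A = ch i Q' \<and> ch m B = ch i P')"
    using edge_affine[OF m(1) ip(1) False[symmetric] AB P' eq]
   proof
    assume a: "\<forall>t\<in>{0..1}. ch m (A + t *. (B - A)) = ch i (P' + t *. (Q' - P'))"
    show ?thesis using bspec[OF a, of 0] bspec[OF a, of 1] by simp
   next
    assume a: "\<forall>t\<in>{0..1}. ch m (A + t *. (B - A)) = ch i (Q' + t *. (P' - Q'))"
    show ?thesis using bspec[OF a, of 0] bspec[OF a, of 1] by simp
   qed
   then have "x = ch i P' \<or> x = ch i Q'" using pAB m(3) by auto
   then have "coord M x i = P' \<or> coord M x i = Q'"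
    using coord_ch[OF ip(1) corner_reg[OF ip(1) P'(1)]] coord_ch[OF ip(1) corner_reg[OF ip(1) P'(2)]] by auto
   then show ?thesis using P' by auto
  qed
 qed
qed

definition tip :: "'p => 'i => bool => real^2" where
 "tip x i k = oth (Rg i) (coord M x i) k"

definition vray :: "'p => 'i => bool => real^2" where
 "vray x i k = tip x i k - coord M x i"

definition vadj :: "'p => 'i => bool => 'i => bool => bool" where
 "vadj x i k j l \<longleftrightarrow> adj i (coord M x i) (tip x i k) j (coord M x j) (tip x j l)"

definition vopp :: "'p => 'i => bool => 'i \<times> bool" where
 "vopp x i k = (SOME f. vadj x i k (fst f) (snd f))"

end

locale surface_vertex = pf_surface M for M :: "('p, 'i) flat_surface" +
 fixes x :: 'p
 assumes vert: "x \<in> vertices M"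
begin

abbreviation "co \<equiv> coord M x"

lemma co: assumes "i \<in> star M x"
 shows "i \<in> pieces M" "co i \<in> Rg i" "ch i (co i) = x" "co i \<in> corners (Rg i)" "2 simplex Rg i"
 using star_coord[OF assms] star_corner[OF vert assms] simp_i by auto

lemma tip: assumes "i \<in> star M x"
 shows "eflag i (co i) (tip x i k)" "tip x i k ~= tip x i (\<not> k)" "cross2 (vray x i k) (vray x i (\<not> k)) ~= 0"
  "tip x i k \<in> Rg i" "tip x i k = co i + vray x i k"
 using oth[OF co(5,4)[OF assms], of k] oth_corner[OF co(5,4)[OF assms], of k] co[OF assms] corner_reg
 by (auto simp: tip_def eflag_def vray_def)

lemma vadj_ex:
 assumes i: "i \<in> star M x"
 shows "\<exists>j l. vadj x i k j l"
proof -
 obtain j P' Q' where a: "adj i (co i) (tip x i k) j P' Q'" using adj_ex[OF tip(1)[OF i]] by blast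
 then have j: "j \<in> pieces M" "P' \<in> corners (Rg j)" "Q' \<in> corners (Rg j)" "P' ~= Q'" by (auto simp: adj_def eflag_def)
 have "ch j P' = x" using adj_ends[OF a] co(3)[OF i] by simp
 then have P': "co j = P'" using coord_eqI[OF j(1) corner_reg[OF j(1,2)]] by simp
 obtain l where "Q' = oth (Rg j) P' l" by (rule corner_oth[OF simp_i[OF j(1)] j(2-4)])
 then show ?thesis using a P' by (auto simp: vadj_def tip_def)
qed

lemma vadj_star: "vadj x i k j l ==> i \<in> star M x \<and> j \<in> star M x \<and> i ~= j" if "i \<in> star M x \<or> j \<in> star M x" for i j
proof -
 assume a: "vadj x i k j l"
 then have ii: "i \<in> pieces M" "j \<in> pieces M" "i ~= j" "co i \<in> Rg i" "co j \<in> Rg j"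
  and e: "ch i (co i) = ch j (co j)"
  using adj_ends[of i "co i" "tip x i k" j "co j" "tip x j l"] by (auto simp: vadj_def adj_def eflag_def corner_reg)
 then have xi: "ch i (co i) = x" "ch j (co j) = x" using that co(3) by auto
 then have "x \<in> piece M i" "x \<in> piece M j" unfolding piece_def using ii(4,5) by (metis imageI)+
 then show ?thesis using ii by (simp add: star_def)
qed

lemma vadj_sym: "vadj x i k j l ==> vadj x j l i k"
 unfolding vadj_def by (rule adj_sym)

lemma vopp_eq:
 assumes i: "i \<in> star M x"
 shows "vopp x i k = (j, l) \<longleftrightarrow> vadj x i k j l"
proof -
 have ex: "\<exists>f. vadj x i k (fst f) (snd f)" using vadj_ex[OF i, of k] by (metis fst_conv snd_conv)
 from someI_ex[OF ex] have v: "vadj x i k (fst (vopp x i k)) (snd (vopp x i k))" by (simp add: vopp_def)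
 have u: "j = fst (vopp x i k) \<and> l = snd (vopp x i k)" if a: "vadj x i k j l"
 proof -
  let ?j = "fst (vopp x i k)"
  have js: "j \<in> star M x" using vadj_star a i by blast
  note u = adj_unique[OF v[unfolded vadj_def] a[unfolded vadj_def]]
  have jj: "j = ?j" using u by blast
  have tt: "tip x j l = tip x j (snd (vopp x i k))" using u by (metis (no_types))
  have "l = snd (vopp x i k)"
  proof (rule ccontr)
   assume "l ~= snd (vopp x i k)"
   then have "snd (vopp x i k) = (\<not> l)" by blast
   then show False using tt tip(2)[OF js, of l] by simp
  qed
  then show ?thesis using jj by blast
 qed
 show ?thesis
 proof
  assume "vopp x i k = (j, l)"
  then show "vadj x i k j l" using v by simp
 next
  assume "vadj x i k j l"
  from u[OF this] show "vopp x i k = (j, l)" by (simp add: prod_eq_iff)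
 qed
qed

lemma finite_star: "finite (star M x)"
proof -
 obtain m p where "m \<in> pieces M" "p \<in> corners (Rg m)" "x = ch m p" using vert by (auto simp: vertices_alt)
 then have "x \<in> piece M m" "m \<in> pieces M" using corner_reg by (auto simp: piece_def)
 then have "x \<in> topspace (topo M)" using cover by blast
 then obtain U where "x \<in> U" "finite {i \<in> pieces M. piece M i \<inter> U ~= {}}"
  using pf by (auto simp: pf_finsler_surface_def)
 then show ?thesis by (rule_tac finite_subset[of _ "{i \<in> pieces M. piece M i \<inter> U ~= {}}"]) (auto simp: star_def)
qed

lemma tcone_eq:
 assumes i: "i \<in> star M x"
 shows "tcone M x i = {a *. vray x i False + b *. vray x i True | a b. 0 <= a \<and> 0 <= b}"
proof -
 note mt = mem_triangle[OF co(5,4)[OF i], of _ False, folded tip_def, folded vray_def, simplified]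
 show ?thesis
 proof (intro equalityI subsetI)
  fix w assume "w \<in> tcone M x i"
  then obtain c q where c: "0 <= c" "q \<in> Rg i" "w = c *. (q - co i)" by (auto simp: tcone_def)
  then obtain a b where "0 <= a" "0 <= b" "q = co i + a *. vray x i False + b *. vray x i True"
   using mt by (auto simp: vray_def tip_def)
  then have "w = (c * a) *. vray x i False + (c * b) *. vray x i True" "0 <= c * a" "0 <= c * b"
   using c by (auto simp: scaleR_add_right)
  then show "w \<in> {a *. vray x i False + b *. vray x i True | a b. 0 <= a \<and> 0 <= b}" by blast
 next
  fix w assume "w \<in> {a *. vray x i False + b *. vray x i True | a b. 0 <= a \<and> 0 <= b}"
  then obtain a b where ab: "0 <= a" "0 <= b" "w = a *. vray x i False + b *. vray x i True" by blast
  \<comment> \<open>Division by \<open>s\<close> brings the point into the triangle, since the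
    coefficients then add up to at most 1.\<close>
  define s where "s = a + b + 1"
  have s: "0 < s" using ab by (simp add: s_def)
  define q where "q = co i + (a / s) *. vray x i False + (b / s) *. vray x i True"
  have "a / s + b / s <= 1" using s by (simp add: add_divide_distrib[symmetric] s_def)
  moreover have "0 <= a / s" "0 <= b / s" using ab s by auto
  ultimately have "q \<in> Rg i" unfolding mt using q_def by blast
  moreover have "w = s *. (q - co i)" using s by (simp add: q_def ab scaleR_add_right)
  ultimately show "w \<in> tcone M x i" using less_imp_le[OF s] unfolding tcone_def by blast
 qed
qed

lemma tpoint_zero: "i \<in> star M x ==> tpoint M x i 0 = apex M x"
proof -
 assume i: "i \<in> star M x"
 have "(j, w') \<in> tpoint M x i 0 \<longleftrightarrow> j \<in> star M x \<and> w' = 0" for j w'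
 proof
  assume "(j, w') \<in> tpoint M x i 0"
  then obtain a q q' where j: "j \<in> star M x" and q: "q \<in> Rg i" "q' \<in> Rg j" "ch i q = ch j q'" "0 = a *. (q - co i)" "w' = a *. (q' - co j)"
   by (auto simp: tpoint_def)
  have "a = 0 \<or> q = co i" using q(4) by auto
  moreover have "q' = co j" if "q = co i"
   using that q(3) co(3)[OF i] coord_ch[OF co(1)[OF j] q(2)] by auto
  ultimately show "j \<in> star M x \<and> w' = 0" using j q(5) by auto
 next
  assume j: "j \<in> star M x \<and> w' = 0"
  then show "(j, w') \<in> tpoint M x i 0"
   unfolding tpoint_def mem_Collect_eq prod.case using co(2,3)[OF i] co(2,3)[of j]
   by (intro conjI, blast, rule_tac exI[of _ "0::real"], rule_tac exI[of _ "co i"], rule_tac exI[of _ "co j"]) auto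
 qed
 then show ?thesis by (auto simp: apex_def)
qed

text \<open>Two triangles at \<open>x\<close> have only \<open>x\<close> or one edge from
  \<open>x\<close> in common, so besides \<open>w\<close> itself only partners across a common ray
  are identified with it.\<close>

lemma mem_tpoint:
 assumes i: "i \<in> star M x" and w: "w \<in> tcone M x i" "w ~= 0"
 shows "(m, w') \<in> tpoint M x i w \<longleftrightarrow> (m = i \<and> w' = w) \<or>
  (\<exists>k l a. 0 < a \<and> vopp x i k = (m, l) \<and> w = a *. vray x i k \<and> w' = a *. vray x m l)"
proof
 assume "(m, w') \<in> tpoint M x i w"
 then obtain a q q' where m: "m \<in> star M x" and q: "0 <= a" "q \<in> Rg i" "q' \<in> Rg m" "ch i q = ch m q'"
  "w = a *. (q - co i)" "w' = a *. (q' - co m)" by (auto simp: tpoint_def)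
 have a: "0 < a" using q(1,5) w(2) by (cases "a = 0") auto
 have qne: "q ~= co i" using q(5) w(2) by auto
 note ii = co[OF i] and mm = co[OF m]
 show "(m = i \<and> w' = w) \<or> (\<exists>k l a. 0 < a \<and> vopp x i k = (m, l) \<and> w = a *. vray x i k \<and> w' = a *. vray x m l)"
 proof (cases "m = i")
  case True
  then have q': "ch i q = ch i q'" "q' \<in> Rg i" using q(3,4) by auto
  have "q = q'" by (rule piece_inj[OF ii(1) q(2) q'(2,1)])
  then have "m = i \<and> w' = w" using True q(5,6) by simp
  then show ?thesis by (rule disjI1)
 next
  case False
  have both: "ch i (co i) \<in> piece M i \<inter> piece M m" "ch i q \<in> piece M i \<inter> piece M m"
   using ii mm q by (auto simp: piece_def) (metis imageI)+
  have dist: "ch i (co i) ~= ch i q" using piece_inj[OF ii(1) q(2) ii(2)] qne by auto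
  obtain A B where AB: "A \<in> corners (Rg i)" "B \<in> corners (Rg i)" "A ~= B" "piece M i \<inter> piece M m = ch i ` closed_segment A B"
  proof (rule inter_cases[OF ii(1) mm(1) False[symmetric]], goal_cases)
   case (2 p q')
   then show ?case using both dist by auto
  qed (use both in auto)
  have segR: "closed_segment A B \<subseteq> Rg i" using segment_region[OF ii(1) AB(1,2)] by (auto simp: segment_param)
  have inseg: "z \<in> closed_segment A B" if z: "z \<in> Rg i" "ch i z \<in> piece M i \<inter> piece M m" for z
  proof -
   obtain y where y: "y \<in> closed_segment A B" "ch i z = ch i y" using z(2) AB(4) by auto
   then show ?thesis using piece_inj[OF ii(1) z(1), of y] segR by auto
  qed
  have "co i = A \<or> co i = B" using corner_on_edge[OF ii(5) AB(1-3) ii(4) inseg[OF ii(2) both(1)]] .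
  then obtain B' where B': "B' \<in> corners (Rg i)" "co i ~= B'" "closed_segment A B = closed_segment (co i) B'"
   using AB by (metis closed_segment_commute)
  obtain k where k: "B' = tip x i k" unfolding tip_def by (rule corner_oth[OF ii(5,4) B'(1,2)])
  have "B' \<in> closed_segment A B" unfolding B'(3) by simp
  then have "ch i B' \<in> piece M m" using AB(4) by blast
  moreover have "ch i (co i) \<in> piece M m" using both by blast
  ultimately obtain P' Q' where ad: "adj i (co i) B' m P' Q'"
   using adj_intro[OF tip(1)[OF i, of k, folded k] mm(1) False] by blast
  have P': "P' = co m" "Q' \<in> corners (Rg m)" "P' ~= Q'"
   using adj_ends[OF ad] ii(3) coord_ch[OF mm(1), of P'] ad by (auto simp: adj_def eflag_def corner_reg)
  obtain l where l: "Q' = tip x m l" unfolding tip_def by (rule corner_oth[OF mm(5,4) P'(2)], use P' in auto)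
  have va: "vadj x i k m l" using ad P'(1) k l by (simp add: vadj_def)
  have "q \<in> closed_segment (co i) (tip x i k)" using inseg[OF q(2) both(2)] B'(3) k by simp
  then obtain t where t: "0 <= t" "t <= 1" "q = co i + t *. (tip x i k - co i)" by (auto simp: segment_param)
  have "ch i q = ch m (co m + t *. (tip x m l - co m))" using va t by (auto simp: vadj_def adj_def)
  then have "q' = co m + t *. (tip x m l - co m)"
   using q(4) va t(1,2) by (intro piece_inj[OF mm(1) q(3) segment_region[OF mm(1)]]) (auto simp: vadj_def adj_def eflag_def)
  moreover have "0 < t" using t qne by (cases "t = 0") auto
  ultimately show ?thesis using t a q va vopp_eq[OF i, of k m l]
   by (intro disjI2, rule_tac exI[of _ k], rule_tac exI[of _ l], rule_tac exI[of _ "a * t"]) (auto simp: vray_def)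
 qed
next
 assume "(m = i \<and> w' = w) \<or> (\<exists>k l a. 0 < a \<and> vopp x i k = (m, l) \<and> w = a *. vray x i k \<and> w' = a *. vray x m l)"
 then show "(m, w') \<in> tpoint M x i w"
 proof (elim disjE exE conjE)
  assume "m = i" "w' = w"
  moreover obtain a q where "0 <= a" "q \<in> Rg i" "w = a *. (q - co i)" using w(1) by (auto simp: tcone_def)
  ultimately show ?thesis using i by (auto simp: tpoint_def)
 next
  fix k l a assume h: "0 < (a::real)" "vopp x i k = (m, l)" "w = a *. vray x i k" "w' = a *. vray x m l"
  then have va: "vadj x i k m l" using vopp_eq[OF i] by simp
  then have m: "m \<in> star M x" using vadj_star i by blast
  have "ch i (tip x i k) = ch m (tip x m l)" using adj_ends[OF va[unfolded vadj_def]] by blast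
  then show ?thesis unfolding tpoint_def mem_Collect_eq prod.case using h m tip(4)[OF i, of k] tip(4)[OF m, of l]
   by (intro conjI, blast, rule_tac exI[of _ a], rule_tac exI[of _ "tip x i k"], rule_tac exI[of _ "tip x m l"]) (auto simp: vray_def)
 qed
qed

lemma tangent_cone_simps [simp]:
 "pieces (tangent_cone M x) = star M x" "region (tangent_cone M x) = tcone M x"
 "chart (tangent_cone M x) = tpoint M x" "fnorm (tangent_cone M x) = fnorm M"
 by (simp_all add: tangent_cone_def)

lemma ray_in_tcone: "i \<in> star M x ==> 0 <= a ==> a *. vray x i k \<in> tcone M x i"
proof -
 assume h: "i \<in> star M x" "0 <= a"
 show ?thesis
 proof (cases k)
  case True
  then have "a *. vray x i k = 0 *. vray x i False + a *. vray x i True" by simp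
  then show ?thesis unfolding tcone_eq[OF h(1)] using h(2) by blast
 next
  case False
  then have "a *. vray x i k = a *. vray x i False + 0 *. vray x i True" by simp
  then show ?thesis unfolding tcone_eq[OF h(1)] using h(2) by blast
 qed
qed

lemma tpoint_eq_iff:
 assumes i: "i \<in> star M x" and j: "j \<in> star M x" and ij: "i ~= j" and w: "w \<in> tcone M x i" "w' \<in> tcone M x j"
 shows "tpoint M x i w = tpoint M x j w' \<longleftrightarrow>
  (w = 0 \<and> w' = 0) \<or> (\<exists>k l a. 0 < a \<and> vopp x i k = (j, l) \<and> w = a *. vray x i k \<and> w' = a *. vray x j l)"
proof
 assume eq: "tpoint M x i w = tpoint M x j w'"
 show "(w = 0 \<and> w' = 0) \<or> (\<exists>k l a. 0 < a \<and> vopp x i k = (j, l) \<and> w = a *. vray x i k \<and> w' = a *. vray x j l)"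
 proof (cases "w = 0 \<or> w' = 0")
  case True
  have refl: "(i, w) \<in> tpoint M x i w" "(j, w') \<in> tpoint M x j w'"
   using mem_tpoint[OF i w(1), of i w] mem_tpoint[OF j w(2), of j w'] tpoint_zero[OF i] tpoint_zero[OF j] i j
   by (cases "w = 0"; cases "w' = 0"; auto simp: apex_def)+
  then have "w = 0 \<and> w' = 0" using True eq tpoint_zero[OF i] tpoint_zero[OF j] by (auto simp: apex_def)
  then show ?thesis by blast
 next
  case False
  then have "(j, w') \<in> tpoint M x i w" using mem_tpoint[OF j w(2), of j w'] eq by simp
  then show ?thesis using mem_tpoint[OF i w(1)] False ij by auto
 qed
next
 assume h: "(w = 0 \<and> w' = 0) \<or> (\<exists>k l a. 0 < a \<and> vopp x i k = (j, l) \<and> w = a *. vray x i k \<and> w' = a *. vray x j l)"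
 then show "tpoint M x i w = tpoint M x j w'"
 proof (elim disjE exE conjE)
  assume "w = 0" "w' = 0"
  then show ?thesis using tpoint_zero[OF i] tpoint_zero[OF j] by simp
 next
  fix k l a assume h: "0 < (a::real)" "vopp x i k = (j, l)" "w = a *. vray x i k" "w' = a *. vray x j l"
  have o': "vopp x j l = (i, k)" using h(2) vopp_eq[OF i] vopp_eq[OF j] vadj_sym by blast
  have nz: "vray x i k ~= 0" "vray x j l ~= 0" using tip(3)[OF i, of k] tip(3)[OF j, of l] by auto
  \<comment> \<open>A nonzero vector on a common ray has a class of exactly two elements, and the
    description is symmetric in the two cones.\<close>
  have only: "(m, u) \<in> tpoint M x i' w1 \<longleftrightarrow> (m = i' \<and> u = w1) \<or> (m = j' \<and> u = w2)"
   if i': "i' \<in> star M x" and v: "vopp x i' k' = (j', l')" "w1 = a *. vray x i' k'" "w2 = a *. vray x j' l'" for i' j' k' l' w1 w2 m u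
  proof -
   have nz': "vray x i' k' ~= 0" using tip(3)[OF i', of k'] by auto
   have uniq: "k'' = k' \<and> b = a" if b: "w1 = b *. vray x i' k''" "0 < b" for k'' b
   proof -
    have kk: "k'' = k'"
    proof (rule ccontr)
     assume "k'' ~= k'"
     then have "k'' = (\<not> k')" by auto
     then have "b *. vray x i' (\<not> k') = a *. vray x i' k'" using b(1) v(2) by simp
     then have "cross2 (vray x i' k') (b *. vray x i' (\<not> k')) = cross2 (vray x i' k') (a *. vray x i' k')" by simp
     then show False using tip(3)[OF i', of k'] b(2) by simp
    qed
    then have "a *. vray x i' k' = b *. vray x i' k'" using b(1) v(2) by simp
    then show ?thesis using kk nz' by auto
   qed
   have "w1 \<in> tcone M x i'" "w1 ~= 0" using v(2) h(1) ray_in_tcone[OF i'] nz' by auto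
   note mt = mem_tpoint[OF i' this, of m u]
   show ?thesis
   proof
    assume "(m, u) \<in> tpoint M x i' w1"
    then consider "m = i' \<and> u = w1" | k'' l'' b where "0 < b" "vopp x i' k'' = (m, l'')" "w1 = b *. vray x i' k''" "u = b *. vray x m l''"
     using mt by blast
    then show "(m = i' \<and> u = w1) \<or> (m = j' \<and> u = w2)"
    proof cases
     case (2 k'' l'' b)
     then have "k'' = k'" "b = a" using uniq[of b k''] by auto
     then show ?thesis using 2 v by simp
    qed simp
   next
    assume "(m = i' \<and> u = w1) \<or> (m = j' \<and> u = w2)"
    then show "(m, u) \<in> tpoint M x i' w1" unfolding mt using v h(1) by blast
   qed
  qed
  show ?thesis using only[OF i h(2-4)] only[OF j o' h(4,3)] by auto
 qed
qed

lemma fan: "fan (tangent_cone M x) (vray x) (vopp x)"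
proof (rule fan.intro, unfold tangent_cone_simps)
 show "finite (star M x)" by (rule finite_star)
 fix i assume i: "i \<in> star M x"
 show "conv_norm (Fn i)" by (rule minkowski_conv_norm[OF mink_i[OF co(1)[OF i]]])
 show "cross2 (vray x i k) (vray x i (\<not> k)) ~= 0" for k by (rule tip(3)[OF i])
 show "tcone M x i = {a *. vray x i False + b *. vray x i True |a b. 0 <= a \<and> 0 <= b}" by (rule tcone_eq[OF i])
 show "inj_on (tpoint M x i) (tcone M x i)"
 proof (rule inj_onI)
  fix w w' assume w: "w \<in> tcone M x i" "w' \<in> tcone M x i" and eq: "tpoint M x i w = tpoint M x i w'"
  have mi: "(i, u) \<in> tpoint M x i v \<longleftrightarrow> u = v" if v: "v \<in> tcone M x i" for u v
  proof (cases "v = 0")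
   case True
   then show ?thesis using tpoint_zero[OF i] i by (auto simp: apex_def)
  next
   case False
   then show ?thesis using mem_tpoint[OF i v False, of i u] vadj_star i vopp_eq[OF i] by blast
  qed
  show "w = w'" using mi[OF w(1), of w] mi[OF w(2), of w] eq by simp
 qed
 show "tpoint M x i w = tpoint M x j w' \<longleftrightarrow>
   (w = 0 \<and> w' = 0) \<or> (\<exists>k l a. 0 < a \<and> vopp x i k = (j, l) \<and> w = a *. vray x i k \<and> w' = a *. vray x j l)"
  if "j \<in> star M x" "i ~= j" "w \<in> tcone M x i" "w' \<in> tcone M x j" for j w w'
  by (rule tpoint_eq_iff[OF i that])
 show "j \<in> star M x \<and> j ~= i \<and> vopp x j l = (i, k)" if "vopp x i k = (j, l)" for j k l
  using that vopp_eq[OF i] vopp_eq[of j l i k] vadj_star[of i j k l] vadj_sym[of i k j l] i by auto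
 show "Fn i (vray x i k) = Fn j (vray x j l)" "Fn i (- vray x i k) = Fn j (- vray x j l)" if "vopp x i k = (j, l)" for j k l
  using that vopp_eq[OF i] adj_norm unfolding vadj_def vray_def by blast+
 \<comment> \<open>If both rays were glued to the same cone, the two triangles would share two
   different edges.\<close>
 show "fst (vopp x i k) ~= fst (vopp x i (\<not> k))" for k
 proof
  assume eq: "fst (vopp x i k) = fst (vopp x i (\<not> k))"
  obtain j l l' where o: "vopp x i k = (j, l)" "vopp x i (\<not> k) = (j, l')" using eq by (metis prod.collapse)
  then have a: "adj i (co i) (tip x i k) j (co j) (tip x j l)" "adj i (co i) (tip x i (\<not> k)) j (co j) (tip x j l')"
   using vopp_eq[OF i] by (auto simp: vadj_def)
  have "closed_segment (co i) (tip x i k) \<subseteq> Rg i" using segment_region[OF co(1)[OF i] co(4)[OF i]] tip(1)[OF i, of k]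
   by (auto simp: segment_param eflag_def)
  moreover have "ch i (tip x i (\<not> k)) \<in> ch i ` closed_segment (co i) (tip x i k)"
   using adj_inter[OF a(1)] adj_inter[OF a(2)] by auto
  ultimately obtain y where y: "y \<in> closed_segment (co i) (tip x i k)" "ch i (tip x i (\<not> k)) = ch i y" "y \<in> Rg i" by blast
  then have "tip x i (\<not> k) \<in> closed_segment (co i) (tip x i k)"
   using piece_inj[OF co(1)[OF i] tip(4)[OF i, of "\<not> k"] y(3,2)] by simp
  then have "tip x i (\<not> k) = co i \<or> tip x i (\<not> k) = tip x i k"
   using tip(1)[OF i, of k] tip(1)[OF i, of "\<not> k"] by (intro corner_on_edge[OF co(5)[OF i]]) (auto simp: eflag_def)
  then show False using tip(1)[OF i, of "\<not> k"] tip(2)[OF i, of k] by (auto simp: eflag_def)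
 qed
qed

end

section \<open>The Landsberg condition on sectors\<close>

lemma hp_cong: "0 < cross2 e z * cross2 e z' ==> hp e z = hp e z'"
 unfolding hp_def by (auto simp: zero_less_mult_iff zero_le_mult_iff)

lemma sgn_quot: "c / d < 0 \<longleftrightarrow> 0 < - sgn d * c" "0 < c / d \<longleftrightarrow> 0 < sgn d * (c::real)"
 by (auto simp: sgn_if divide_less_0_iff zero_less_divide_iff)

text \<open>The Landsberg condition at one edge, separated from the surface; \<open>\<eta>\<close>
  and \<open>\<eta>'\<close> tell on which sides of the edge vectors the two arcs lie.\<close>

locale arc_isometry = F: minkowski F + G: minkowski G for F G +
 fixes e e' :: "real^2" and \<eta> \<eta>' :: real and h :: "real^2 => real^2"
 assumes e: "e ~= 0" "e' ~= 0" "F e = G e'" "F (- e) = G (- e')"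
  and \<eta>: "\<eta> = 1 \<or> \<eta> = -1" "\<eta>' = 1 \<or> \<eta>' = -1"
  and iso: "ind_isometry F {u. F u = 1 \<and> 0 <= \<eta> * cross2 e u} G {u. G u = 1 \<and> 0 <= \<eta>' * cross2 e' u} h"
  and dn: "\<And>u. F u = 1 ==> 0 <= \<eta> * cross2 e u ==> dn F u e = dn G (h u) e'"
begin

text \<open>\<open>isometry_arc\<close> measures from \<open>e\<close>. Applied to the reversed edge
  vectors with reversed signs, which describe the same arcs, it measures from
  \<open>- e\<close>.\<close>

lemma arc:
 assumes u: "F u = 1" "0 < \<eta> * cross2 e u"
 shows "nu F (sec e u) = nu G (sec e' (h u))" "nu F (sec (- e) u) = nu G (sec (- e') (h u))"
  "0 < \<eta>' * cross2 e' (h u)" "G (h u) = 1"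
proof -
 have MF: "minkowski F" and MG: "minkowski G" by unfold_locales
 show "nu F (sec e u) = nu G (sec e' (h u))" "0 < \<eta>' * cross2 e' (h u)" "G (h u) = 1"
  using isometry_arc[OF MF MG e \<eta> iso dn u] by auto
 have hB: "G (h w) = 1" if "F w = 1" "0 <= \<eta> * cross2 e w" for w
  using iso that unfolding ind_isometry_def homeomorphism_def by blast
 have n: "- \<eta> = 1 \<or> - \<eta> = -1" "- \<eta>' = 1 \<or> - \<eta>' = -1" using \<eta> by auto
 have "nu F (sec (- e) u) = nu G (sec (- e') (h u)) \<and> 0 < - \<eta>' * cross2 (- e') (h u) \<and> G (h u) = 1"
 proof (rule isometry_arc[OF MF MG _ _ e(4) _ n])
  show "ind_isometry F {u. F u = 1 \<and> 0 <= - \<eta> * cross2 (- e) u} G {u. G u = 1 \<and> 0 <= - \<eta>' * cross2 (- e') u} h"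
   using iso by simp
  show "dn F w (- e) = dn G (h w) (- e')" if w: "F w = 1" "0 <= - \<eta> * cross2 (- e) w" for w
  proof -
   have w': "0 <= \<eta> * cross2 e w" using w by simp
   have "w ~= 0" "h w ~= 0" using w hB[OF w(1) w'] by auto
   then show ?thesis using dn[OF w(1) w'] by (simp add: F.dn_lin G.dn_lin)
  qed
 qed (use e u in auto)
 then show "nu F (sec (- e) u) = nu G (sec (- e') (h u))" by blast
qed

text \<open>One pair of corresponding directions cuts the two half planes into two sectors each, and
  corresponding sectors have equal angles by \<open>arc\<close>.\<close>

lemma arc_half:
 assumes z: "0 < \<eta> * cross2 e z" "0 < \<eta>' * cross2 e' z'"
 shows "nu F (hp e z) = nu G (hp e' z')"
proof -
 have nz: "z ~= 0" using z by auto
 define u where "u = (1 / F z) *. z"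
 have p: "0 < F z" by (rule F.pos'[OF nz])
 then have Fu: "F u = 1" using nz by (simp add: u_def F.hom)
 have "\<eta> * cross2 e u = (1 / F z) * (\<eta> * cross2 e z)" by (simp add: u_def)
 then have u: "0 < \<eta> * cross2 e u" using z p by simp
 note A = arc[OF Fu u]
 have "hp e z = hp e u" "hp e' z' = hp e' (h u)"
  using u z A(3) \<eta> by (auto intro!: hp_cong simp: zero_less_mult_iff)
 moreover have "cross2 e u ~= 0" "cross2 e' (h u) ~= 0" using u A(3) by auto
 ultimately show ?thesis using A(1,2) by (simp add: F.nu_hp_split G.nu_hp_split sec_commute[of u] sec_commute[of "h u"])
qed

text \<open>The end points of the arc correspond to each other, because there \<open>dn F u e\<close> attains its
 extreme values \<open>F e\<close> and \<open>- F (- e)\<close>.\<close>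

lemma arc_surj:
 assumes u': "G u' = 1" "0 < \<eta>' * cross2 e' u'"
 shows "\<exists>u. F u = 1 \<and> 0 < \<eta> * cross2 e u \<and> h u = u'"
proof -
 obtain g where hg: "homeomorphism {u. F u = 1 \<and> 0 <= \<eta> * cross2 e u} {u. G u = 1 \<and> 0 <= \<eta>' * cross2 e' u} h g"
  using iso by (auto simp: ind_isometry_def)
 define u where "u = g u'"
 have u'B: "u' \<in> {u. G u = 1 \<and> 0 <= \<eta>' * cross2 e' u}" using u' by simp
 have "g u' \<in> {u. F u = 1 \<and> 0 <= \<eta> * cross2 e u}" using homeomorphism_image2[OF hg] u'B by blast
 moreover have "h (g u') = u'" by (rule homeomorphism_apply2[OF hg u'B])
 ultimately have u: "F u = 1" "0 <= \<eta> * cross2 e u" "h u = u'" by (auto simp: u_def)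
 have nz: "u ~= 0" "u' ~= 0" using u u' by auto
 have "cross2 e u ~= 0"
 proof
  assume "cross2 e u = 0"
  then obtain c where c: "u = c *. e" using cross2_eq_0_iff[OF e(1)] by blast
  then have c0: "c ~= 0" using nz by auto
  have d1: "c * dn F u e = 1" using F.euler[OF nz(1)] u(1) F.dn_lin(2)[OF nz(1), of c e] c by simp
  have eq: "dn F u e = dn G u' e'" using dn[OF u(1,2)] u(3) by simp
  have npar: "r *. e' ~= d *. u'" if "r ~= 0" for d r
  proof
   assume "r *. e' = d *. u'"
   then have "cross2 (r *. e') u' = cross2 (d *. u') u'" by simp
   then show False using u'(2) that by simp
  qed
  have less: "dn G u' e' < G e'" "dn G u' (- e') < G (- e')"
   using G.dn_less[OF nz(2), of e'] G.dn_less[OF nz(2), of "- e'"] npar[of 1] npar[of "-1"] by auto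
  show False
  proof (cases "0 < c")
   case True
   then have "c * F e = 1" using u(1) c by (simp add: F.hom)
   then have "dn F u e = F e" using d1 c0 by (metis mult_left_cancel)
   then show False using less eq e by simp
  next
   case False
   have "F ((- c) *. (- e)) = - c * F (- e)" using False by (intro F.hom) simp
   then have "- c * F (- e) = 1" using u(1) c by simp
   then have "dn F u e = - F (- e)" using d1 c0 by (metis mult_minus_left mult_minus_right mult_left_cancel)
   then show False using less eq e nz by (simp add: G.dn_lin)
  qed
 qed
 then have "0 < \<eta> * cross2 e u" using u(2) \<eta> by (auto simp: less_le)
 then show ?thesis using u by blast
qed

end

locale landsberg_surface = pf_surface M for M :: "('p, 'i) flat_surface" +
 assumes landsberg: "landsberg M"
begin

lemma edge_point:
 assumes a: "adj i P Q j P' Q'"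
 shows "star M (mid i P Q) = {i, j}" "mid i P Q \<notin> vertices M"
  "coord M (mid i P Q) i = P + (1/2) *. (Q - P)" "coord M (mid i P Q) j = P' + (1/2) *. (Q' - P')"
proof -
 have e: "eflag i P Q" "eflag j P' Q'" using a by (auto simp: adj_def)
 then have ii: "i \<in> pieces M" "j \<in> pieces M" by (auto simp: eflag_def)
 have r: "P + (1/2) *. (Q - P) \<in> Rg i" "P' + (1/2) *. (Q' - P') \<in> Rg j"
  using e segment_region[of i P Q "1/2"] segment_region[of j P' Q' "1/2"] by (auto simp: eflag_def)
 show "coord M (mid i P Q) i = P + (1/2) *. (Q - P)" using coord_ch[OF ii(1) r(1)] by (simp add: mid_def)
 show "coord M (mid i P Q) j = P' + (1/2) *. (Q' - P')" unfolding adj_mid[OF a] using coord_ch[OF ii(2) r(2)] by (simp add: mid_def)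
 have "mid i P Q \<in> piece M i" "mid i P Q \<in> piece M j" using piece_mid[OF e(1)] piece_mid[OF e(2)] adj_mid[OF a] by auto
 moreover have "m = i \<or> m = j" if "m \<in> pieces M" "mid i P Q \<in> piece M m" for m
  using adj_in[OF a that(1), of "1/2"] that(2) by (simp add: mid_def)
 ultimately show "star M (mid i P Q) = {i, j}" using ii by (auto simp: star_def)
 show "mid i P Q \<notin> vertices M" using inner_not_vertex[OF e(1), of "1/2"] by (simp add: mid_def)
qed

lemma tcone_edge:
 assumes e: "eflag i P Q" and k: "Q = oth (Rg i) P k" and co: "coord M y i = P + t *. (Q - P)" and t: "0 < t" "t < 1"
 shows "tcone M y i = hp (Q - P) (oth (Rg i) P (\<not> k) - P)"
proof (rule set_eqI)
 fix w
 let ?E = "Q - P" and ?N = "oth (Rg i) P (\<not> k) - P"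
 have i: "i \<in> pieces M" and P: "P \<in> corners (Rg i)" using e by (auto simp: eflag_def)
 have D: "cross2 ?E ?N ~= 0" using oth[OF simp_i[OF i] P, of k] by (simp add: k)
 have mem: "q \<in> Rg i \<longleftrightarrow> (\<exists>a b. 0 <= a \<and> 0 <= b \<and> a + b <= 1 \<and> q = P + a *. ?E + b *. ?N)" for q
  using mem_triangle[OF simp_i[OF i] P, of q k] by (simp add: k)
 have hp: "a *. ?E + b *. ?N \<in> hp ?E ?N \<longleftrightarrow> 0 <= b" for a b
 proof -
  have "cross2 ?E ?N * cross2 ?E (a *. ?E + b *. ?N) = (cross2 ?E ?N)\<^sup>2 * b" by (simp add: cross2_add power2_eq_square)
  then show ?thesis using D unfolding hp_def by (simp add: nonneg_cmult_iff)
 qed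
 show "w \<in> tcone M y i \<longleftrightarrow> w \<in> hp ?E ?N"
 proof
  assume "w \<in> tcone M y i"
  then obtain c q where c: "0 <= c" "q \<in> Rg i" "w = c *. (q - (P + t *. ?E))" by (auto simp: tcone_def co)
  then obtain a b where ab: "0 <= b" "q = P + a *. ?E + b *. ?N" using mem by blast
  have "w = (c * (a - t)) *. ?E + (c * b) *. ?N" unfolding c(3) ab(2) by (simp add: vec2_eq_iff algebra_simps)
  then show "w \<in> hp ?E ?N" using hp ab(1) c(1) by (metis mult_nonneg_nonneg)
 next
  assume w: "w \<in> hp ?E ?N"
  obtain a b where ab: "w = a *. ?E + b *. ?N" using cross2_decomp[OF D] by metis
  then have b: "0 <= b" using w hp by simp
  \<comment> \<open>A scale so large that the displacement \<open>w / c\<close> from the edge point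
    stays inside the triangle.\<close>
  define c where "c = \<bar>a\<bar> / t + (\<bar>a\<bar> + b) / (1 - t) + 1"
  have c: "0 < c" using t b by (simp add: c_def add_nonneg_pos)
  have "\<bar>a\<bar> / t <= c" "(\<bar>a\<bar> + b) / (1 - t) <= c" using t b by (auto simp: c_def)
  then have "\<bar>a\<bar> <= c * t" "\<bar>a\<bar> + b <= c * (1 - t)" using t by (auto simp: pos_divide_le_eq)
  then have "0 <= t + a / c" "t + a / c + b / c <= 1" using c by (auto simp: field_simps)
  then have "P + (t + a / c) *. ?E + (b / c) *. ?N \<in> Rg i" using mem b c by (metis divide_nonneg_pos)
  moreover have "w = c *. (P + (t + a / c) *. ?E + (b / c) *. ?N - (P + t *. ?E))"
   unfolding ab using c by (simp add: vec2_eq_iff field_simps)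
  ultimately show "w \<in> tcone M y i" using c unfolding tcone_def co mem_Collect_eq by (blast intro: less_imp_le)
 qed
qed

lemma tpoint_edge:
 assumes a: "adj i P Q j P' Q'"
 shows "tpoint M (mid i P Q) i (Q - P) = {(i, Q - P), (j, Q' - P')}"
proof -
 note ep = edge_point[OF a]
 have e: "eflag i P Q" "eflag j P' Q'" "i ~= j" using a by (auto simp: adj_def)
 then have ii: "i \<in> pieces M" "j \<in> pieces M" "Q \<in> Rg i" "Q' \<in> Rg j" "Q ~= P" by (auto simp: eflag_def corner_reg)
 have i': "(i, w) \<in> tpoint M (mid i P Q) i (Q - P) \<longleftrightarrow> w = Q - P" for w
 proof
  assume "(i, w) \<in> tpoint M (mid i P Q) i (Q - P)"
  then obtain a q q' where "q \<in> Rg i" "q' \<in> Rg i" "ch i q = ch i q'" "Q - P = a *. (q - coord M (mid i P Q) i)" "w = a *. (q' - coord M (mid i P Q) i)"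
   by (auto simp: tpoint_def)
  then show "w = Q - P" using piece_inj[OF ii(1), of q q'] by simp
 next
  assume "w = Q - P"
  \<comment> \<open>The factor 2 comes from the midpoint: \<open>Q - P\<close> is twice the
    displacement from the midpoint to \<open>Q\<close>.\<close>
  then show "(i, w) \<in> tpoint M (mid i P Q) i (Q - P)"
   unfolding tpoint_def mem_Collect_eq prod.case ep using ii
   by (intro conjI, blast, rule_tac exI[of _ 2], rule_tac exI[of _ Q], rule_tac exI[of _ Q]) (auto simp: vec2_eq_iff field_simps)
 qed
 have j': "(j, w) \<in> tpoint M (mid i P Q) i (Q - P) \<longleftrightarrow> w = Q' - P'" for w
 proof
  assume "(j, w) \<in> tpoint M (mid i P Q) i (Q - P)"
  then obtain c q q' where q: "q \<in> Rg i" "q' \<in> Rg j" "ch i q = ch j q'" "Q - P = c *. (q - (P + (1/2) *. (Q - P)))"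
   "w = c *. (q' - (P' + (1/2) *. (Q' - P')))" by (auto simp: tpoint_def ep)
  have "ch i q \<in> piece M i" "ch i q \<in> piece M j" unfolding piece_def by (rule imageI[OF q(1)]) (unfold q(3), rule imageI[OF q(2)])
  then have "ch i q \<in> ch i ` closed_segment P Q" using adj_inter[OF a] by blast
  then obtain t where t: "0 <= t" "t <= 1" "ch i q = ch i (P + t *. (Q - P))" by (auto simp: segment_param)
  have sr: "P + t *. (Q - P) \<in> Rg i" "P' + t *. (Q' - P') \<in> Rg j" using e segment_region t by (auto simp: eflag_def)
  have q1: "q = P + t *. (Q - P)" by (rule piece_inj[OF ii(1) q(1) sr(1) t(3)])
  have "ch j q' = ch j (P' + t *. (Q' - P'))" using a t q(3) by (auto simp: adj_def)
  then have q2: "q' = P' + t *. (Q' - P')" by (rule piece_inj[OF ii(2) q(2) sr(2)])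
  have "(c * (t - 1/2)) *. (Q - P) = 1 *. (Q - P)" unfolding scaleR_one by (subst (2) q(4)) (simp add: q1 algebra_simps)
  then have "c * (t - 1/2) = 1" using ii(5) by (metis real_vector.scale_right_imp_eq right_minus_eq)
  moreover have "w = (c * (t - 1/2)) *. (Q' - P')" by (simp add: q q2 vec2_eq_iff algebra_simps)
  ultimately show "w = Q' - P'" by simp
 next
  assume "w = Q' - P'"
  then show "(j, w) \<in> tpoint M (mid i P Q) i (Q - P)"
   unfolding tpoint_def mem_Collect_eq prod.case ep using ii adj_ends[OF a]
   by (intro conjI, blast, rule_tac exI[of _ 2], rule_tac exI[of _ Q], rule_tac exI[of _ Q']) (auto simp: vec2_eq_iff field_simps)
 qed
 show ?thesis
 proof (rule set_eqI, rule iffI)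
  fix z assume z: "z \<in> tpoint M (mid i P Q) i (Q - P)"
  then have "fst z = i \<or> fst z = j" by (auto simp: tpoint_def ep)
  then show "z \<in> {(i, Q - P), (j, Q' - P')}" using i'[of "snd z"] j'[of "snd z"] z by (cases z) auto
 next
  fix z assume "z \<in> {(i, Q - P), (j, Q' - P')}"
  then show "z \<in> tpoint M (mid i P Q) i (Q - P)" using i' j' by auto
 qed
qed

text \<open>The Landsberg condition at the midpoint of the edge. An incoming vector \<open>u\<close>
  has \<open>- u\<close> in the cone, so its arc lies on the outer side of the edge; hence the minus
  sign in the first side.\<close>

lemma edge_isometry:
 assumes a: "adj i P Q j P' Q'" and k: "Q = oth (Rg i) P k" "Q' = oth (Rg j) P' l"
 shows "\<exists>h. arc_isometry (Fn i) (Fn j) (Q - P) (Q' - P')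
  (- sgn (cross2 (Q - P) (oth (Rg i) P (\<not> k) - P))) (sgn (cross2 (Q' - P') (oth (Rg j) P' (\<not> l) - P'))) h"
proof -
 let ?y = "mid i P Q" and ?E = "Q - P" and ?E' = "Q' - P'"
 let ?N = "oth (Rg i) P (\<not> k) - P" and ?N' = "oth (Rg j) P' (\<not> l) - P'"
 note ep = edge_point[OF a]
 have e: "eflag i P Q" "eflag j P' Q'" "i ~= j" using a by (auto simp: adj_def)
 then have ii: "i \<in> pieces M" "P \<in> corners (Rg i)" "j \<in> pieces M" "P' \<in> corners (Rg j)" "Q ~= P" "Q' ~= P'" by (auto simp: eflag_def)
 interpret F: minkowski "Fn i" by (rule mink_i[OF ii(1)])
 interpret G: minkowski "Fn j" by (rule mink_i[OF ii(3)])
 have tc: "tcone M ?y i = hp ?E ?N" "tcone M ?y j = hp ?E' ?N'"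
  using tcone_edge[OF e(1) k(1) ep(3)] tcone_edge[OF e(2) k(2) ep(4)] by auto
 have nz: "cross2 ?E ?N ~= 0" "cross2 ?E' ?N' ~= 0"
  using oth[OF simp_i[OF ii(1)] ii(2), of k] oth[OF simp_i[OF ii(3)] ii(4), of l] by (auto simp: k)
 obtain h where iso: "ind_isometry (Fn i) (indicatrix M (-1) ?y i) (Fn j) (indicatrix M 1 ?y j) h"
  and ff: "\<And>u v v'. u \<in> indicatrix M (-1) ?y i ==> v \<in> tcone M ?y i ==> v' \<in> tcone M ?y j ==>
   v ~= 0 ==> tpoint M ?y i v = tpoint M ?y j v' ==> fund_form (Fn i) u u v = fund_form (Fn j) (h u) (h u) v'"
  using landsberg[unfolded landsberg_def, rule_format, of i ?y j] ep(1,2) e(3) by blast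
 have I: "indicatrix M (-1) ?y i = {u. Fn i u = 1 \<and> 0 <= - sgn (cross2 ?E ?N) * cross2 ?E u}"
  unfolding indicatrix_def tc hp_def using nz(1)
  by (auto simp: sgn_if mult_le_0_iff zero_le_mult_iff not_le)
 have J: "indicatrix M 1 ?y j = {u. Fn j u = 1 \<and> 0 <= sgn (cross2 ?E' ?N') * cross2 ?E' u}"
  unfolding indicatrix_def tc hp_def using nz(2)
  by (auto simp: sgn_if mult_le_0_iff zero_le_mult_iff not_le)
 have tp: "tpoint M ?y i ?E = tpoint M ?y j ?E'"
  using tpoint_edge[OF a] tpoint_edge[OF adj_sym[OF a]] adj_mid[OF a] by auto
 have "arc_isometry (Fn i) (Fn j) ?E ?E' (- sgn (cross2 ?E ?N)) (sgn (cross2 ?E' ?N')) h"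
 proof (unfold_locales)
  show "?E ~= 0" "?E' ~= 0" using ii by auto
  show "Fn i ?E = Fn j ?E'" "Fn i (- ?E) = Fn j (- ?E')" by (rule adj_norm[OF a])+
  show "- sgn (cross2 ?E ?N) = 1 \<or> - sgn (cross2 ?E ?N) = -1" "sgn (cross2 ?E' ?N') = 1 \<or> sgn (cross2 ?E' ?N') = -1"
   using nz by (auto simp: sgn_if)
  show "ind_isometry (Fn i) {u. Fn i u = 1 \<and> 0 <= - sgn (cross2 ?E ?N) * cross2 ?E u}
   (Fn j) {u. Fn j u = 1 \<and> 0 <= sgn (cross2 ?E' ?N') * cross2 ?E' u} h" using iso unfolding I J .
  fix u assume u: "Fn i u = 1" "0 <= - sgn (cross2 ?E ?N) * cross2 ?E u"
  then have uI: "u \<in> indicatrix M (-1) ?y i" by (simp add: I)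
  then have "h u \<in> indicatrix M 1 ?y j" using iso unfolding ind_isometry_def homeomorphism_def by blast
  then have hu: "Fn j (h u) = 1" by (simp add: indicatrix_def)
  have nzu: "u ~= 0" "h u ~= 0" using u hu by auto
  have "fund_form (Fn i) u u ?E = fund_form (Fn j) (h u) (h u) ?E'"
   by (rule ff[OF uI _ _ _ tp]) (use ii in \<open>auto simp: tc hp_def\<close>)
  then show "dn (Fn i) u ?E = dn (Fn j) (h u) ?E'"
   using F.fund_form_self[OF nzu(1)] G.fund_form_self[OF nzu(2)] u hu by simp
 qed
 then show ?thesis by blast
qed

lemma half_adj:
 assumes a: "adj i P Q j P' Q'" and k: "Q = oth (Rg i) P k" "Q' = oth (Rg j) P' l"
 shows "nu (Fn i) (hp (Q - P) (- (oth (Rg i) P (\<not> k) - P))) = nu (Fn j) (hp (Q' - P') (oth (Rg j) P' (\<not> l) - P'))"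
proof -
 obtain h where "arc_isometry (Fn i) (Fn j) (Q - P) (Q' - P')
  (- sgn (cross2 (Q - P) (oth (Rg i) P (\<not> k) - P))) (sgn (cross2 (Q' - P') (oth (Rg j) P' (\<not> l) - P'))) h"
  using edge_isometry[OF a k] by blast
 then interpret arc_isometry "Fn i" "Fn j" "Q - P" "Q' - P'" "- sgn (cross2 (Q - P) (oth (Rg i) P (\<not> k) - P))"
  "sgn (cross2 (Q' - P') (oth (Rg j) P' (\<not> l) - P'))" h .
 show ?thesis
 proof (rule arc_half)
  show "0 < - sgn (cross2 (Q - P) (oth (Rg i) P (\<not> k) - P)) * cross2 (Q - P) (- (oth (Rg i) P (\<not> k) - P))"
   using \<eta>(1) by (auto simp: sgn_if simp del: minus_diff_eq split: if_splits)
  show "0 < sgn (cross2 (Q' - P') (oth (Rg j) P' (\<not> l) - P')) * cross2 (Q' - P') (oth (Rg j) P' (\<not> l) - P')"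
   using \<eta>(2) by (auto simp: sgn_if split: if_splits)
 qed
qed

text \<open>\<open>half_adj\<close> in both directions matches the outer half plane of each triangle
  with the inner one of the other, and on either side the two add up to a full turn.\<close>

lemma theta_adj:
 assumes a: "adj i P Q j P' Q'"
 shows "nu (Fn i) UNIV = nu (Fn j) UNIV"
proof -
 have e: "i \<in> pieces M" "P \<in> corners (Rg i)" "Q \<in> corners (Rg i)" "P ~= Q" "j \<in> pieces M" "P' \<in> corners (Rg j)" "Q' \<in> corners (Rg j)" "P' ~= Q'"
  using a by (auto simp: adj_def eflag_def)
 interpret F: minkowski "Fn i" by (rule mink_i[OF e(1)])
 interpret G: minkowski "Fn j" by (rule mink_i[OF e(5)])
 obtain k where k: "Q = oth (Rg i) P k" by (rule corner_oth[OF simp_i[OF e(1)] e(2-4)])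
 obtain l where l: "Q' = oth (Rg j) P' l" by (rule corner_oth[OF simp_i[OF e(5)] e(6-8)])
 have nz: "cross2 (Q - P) (oth (Rg i) P (\<not> k) - P) ~= 0" "cross2 (Q' - P') (oth (Rg j) P' (\<not> l) - P') ~= 0"
  using oth[OF simp_i[OF e(1)] e(2), of k] oth[OF simp_i[OF e(5)] e(6), of l] by (auto simp: k l)
 show ?thesis
  using half_adj[OF a k l] half_adj[OF adj_sym[OF a] l k] F.nu_hp_compl[OF nz(1)] G.nu_hp_compl[OF nz(2)] by linarith
qed

end

section \<open>Geodesics passing a vertex\<close>

lemma pw_cong_on:
 assumes "has_pw_integral X G \<gamma> a b L" "\<And>t. a <= t ==> t <= b ==> \<gamma>' t = \<gamma> t"
 shows "has_pw_integral X G \<gamma>' a b L"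
 using assms
proof (induction rule: pw_induct)
 case (smooth a b i d)
 then have "rep X \<gamma>' i d {a..b}" by (auto simp: rep_def)
 from rep_pw[OF this smooth(1)] show ?case .
next
 case (join a b d L L')
 have "a <= b" "b <= d" using pw_le[OF join(1)] pw_le[OF join(2)] by auto
 then show ?case using join(3,4,5) has_pw_integral.join by (metis order_trans)
qed

lemma geodesic_reverse:
 assumes "geodesic Y \<gamma>"
 shows "geodesic (rev_pieces Y) (\<lambda>t. \<gamma> (- t))"
proof -
 obtain \<kappa> where \<kappa>: "\<kappa> > 0" "\<And>a b. a <= b ==> has_length Y \<gamma> a b (\<kappa> * (b - a))"
  and loc: "\<And>t. \<exists>e>0. \<forall>a b. t - e < a \<and> a <= b \<and> b < t + e --> has_length Y \<gamma> a b (fdist Y (\<gamma> a) (\<gamma> b))"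
  using assms unfolding geodesic_def by auto
 have "has_length (rev_pieces Y) (\<lambda>t. \<gamma> (- t)) a b (\<kappa> * (b - a))" if "a <= b" for a b
  using has_length_reverse[OF \<kappa>(2)[of "- b" "- a"]] that by simp
 moreover have "\<exists>e>0. \<forall>a b. t - e < a \<and> a <= b \<and> b < t + e -->
   has_length (rev_pieces Y) (\<lambda>t. \<gamma> (- t)) a b (fdist (rev_pieces Y) (\<gamma> (- a)) (\<gamma> (- b)))" for t
 proof -
  obtain e where e: "e > 0" "\<And>a b. - t - e < a \<and> a <= b \<and> b < - t + e ==> has_length Y \<gamma> a b (fdist Y (\<gamma> a) (\<gamma> b))"
   using loc[of "- t"] by meson
  have "has_length (rev_pieces Y) (\<lambda>t. \<gamma> (- t)) a b (fdist (rev_pieces Y) (\<gamma> (- a)) (\<gamma> (- b)))"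
   if "t - e < a \<and> a <= b \<and> b < t + e" for a b
   using has_length_reverse[OF e(2)[of "- b" "- a"]] that by (simp add: fdist_reverse)
  then show ?thesis using e(1) by blast
 qed
 ultimately show ?thesis unfolding geodesic_def using \<kappa>(1) by blast
qed

context fan_rot
begin

lemma translate_geodesic:
 assumes i: "i \<in> pieces Y" and v: "fnorm Y i v = 1" and c: "cross2 n v ~= 0"
  and pos: "\<And>k. 0 < hgt i k (n + t1 *. v)" and bk: "\<And>k. hgt i k v <= 0"
 obtains c f d where "geodesic Y c" "\<And>t j. j \<in> pieces Y ==> c t ~= chart Y j 0"
  "0 < d" "\<And>t. \<bar>t - t1\<bar> < d ==> c t = chart Y i (n + t *. v)"
  "\<And>r. 0 <= r ==> has_pw_integral Y G c (- r) r (f r)"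
  "(f \<longlongrightarrow> N i (- v) (n + t1 *. v) + N i (n + t1 *. v) v) at_top"
  "\<And>\<gamma> e. geodesic Y \<gamma> ==> 0 < e ==> (\<And>t. \<bar>t - t1\<bar> < e ==> \<gamma> t = chart Y i (n + t *. v)) ==> \<gamma> = c"
proof -
 obtain c f d where cfd: "\<And>t. regular c t" "0 < d" "\<And>t. \<bar>t - t1\<bar> < d ==> c t = chart Y i (n + t *. v)"
  "\<And>r. 0 <= r ==> has_pw_integral Y G c (- r) r (f r)"
  "(f \<longlongrightarrow> N i (- v) (n + t1 *. v) + N i (n + t1 *. v) v) at_top"
  by (rule passing_geodesic[OF assms]) blast+
 have lm: "locmin c" by (rule regular_locmin[OF cfd(1)])
 show ?thesis
 proof (rule that[of c d f])
  show "geodesic Y c" by (rule locmin_geodesic[OF lm])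
  show "c t ~= chart Y j 0" if "j \<in> pieces Y" for t j by (rule regular_not_apex[OF cfd(1) that])
  show "\<gamma> = c" if g: "geodesic Y \<gamma>" and e: "0 < e" and eq: "\<And>t. \<bar>t - t1\<bar> < e ==> \<gamma> t = chart Y i (n + t *. v)" for \<gamma> e
  proof -
   define m where "m = min d e / 2"
   have m: "0 < m" "m < d" "m < e" using cfd(2) e by (auto simp: m_def)
   \<comment> \<open>On a short interval \<open>\<gamma>\<close> inherits unit speed from
     \<open>c\<close>, which makes it \<open>locmin\<close>, so that \<open>regular_unique\<close>
     applies.\<close>
   have "has_length Y c (t1 - m) (t1 + m) ((t1 + m) - (t1 - m))"
    by (rule lm[unfolded locmin_def, THEN conjunct1, rule_format]) (use m in simp)
   then have "has_length Y \<gamma> (t1 - m) (t1 + m) ((t1 + m) - (t1 - m))"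
    unfolding has_length_def
   proof (rule pw_cong_on)
    fix t assume "t1 - m <= t" "t <= t1 + m"
    then have "\<bar>t - t1\<bar> < d" "\<bar>t - t1\<bar> < e" using m by auto
    then show "\<gamma> t = c t" using cfd(3) eq by simp
   qed
   then have "locmin \<gamma>" by (rule geodesic_locmin[OF g]) (use m in simp)
   then show ?thesis
   proof (rule regular_unique[OF cfd(1), of _ "min d e" t1])
    show "\<gamma> s = c s" if "\<bar>s - t1\<bar> < min d e" for s using cfd(3) eq that by simp
   qed (use cfd(2) e in simp)
  qed
 qed (fact cfd)+
qed

end

locale landsberg_vertex = landsberg_surface M + surface_vertex M x for M :: "('p, 'i) flat_surface" and x :: 'p
begin

sublocale tc: fan "tangent_cone M x" "vray x" "vopp x" by (rule fan)

abbreviation hgt where "hgt \<equiv> tc.hgt"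

lemma mink: "i \<in> star M x ==> minkowski (Fn i)"
 using co(1) mink_i by blast

lemma ray_nz: "i \<in> star M x ==> vray x i k ~= 0"
 using tc.ray_nz by simp

lemma mem_tcone: "i \<in> star M x ==> w \<in> tcone M x i \<longleftrightarrow> 0 <= hgt i k w \<and> 0 <= hgt i (\<not> k) w"
 using tc.region_iff by simp

lemma vopp_star: "i \<in> star M x ==> vopp x i k = (j, l) ==> j \<in> star M x \<and> j ~= i \<and> vopp x j l = (i, k)"
 by (rule tc.opp[unfolded tangent_cone_simps])

text \<open>\<open>\<sigma>\<close> is the sign of the indicatrix to which curves are projected: the
  outgoing unit vector at a point \<open>p\<close> has the direction of \<open>p\<close>, the
  incoming one that of \<open>- p\<close>.\<close>

definition rotN :: "real => 'i => real^2 => real^2 => real" where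
 "rotN \<sigma> i p q = nu (Fn i) (sec (\<sigma> *. p) (\<sigma> *. q))"

definition rotG :: "real => 'i => (real => real^2) => real => real" where
 "rotG \<sigma> i c = ind_speed (Fn i) (\<lambda>t. unit_vec (Fn i) (\<sigma> *. c t))"

lemma rotG_eq:
 assumes i: "i \<in> star M x" and \<sigma>: "\<sigma> = 1 \<or> \<sigma> = -1"
  and c: "(c has_vector_derivative c') (at t)" "c t ~= 0"
 shows "rotG \<sigma> i c t = \<bar>cross2 (c t) c'\<bar> * kap (Fn i) (\<sigma> *. c t)"
proof -
 interpret minkowski "Fn i" by (rule mink[OF i])
 have "((\<lambda>t. \<sigma> *. c t) has_vector_derivative \<sigma> *. c') (at t)"
  by (rule bounded_linear.has_vector_derivative[OF bounded_linear_scaleR_right c(1)])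
 from ind_speed_eq[OF this] show ?thesis using \<sigma> c(2) by (auto simp: rotG_def)
qed

lemma rotN:
 assumes i: "i \<in> star M x" and \<sigma>: "\<sigma> = 1 \<or> \<sigma> = -1"
 shows "0 < a ==> 0 < b ==> rotN \<sigma> i (a *. p) (b *. q) = rotN \<sigma> i p q"
  and "rotN \<sigma> i p q = rotN \<sigma> i q p"
  and "cross2 p q ~= 0 ==> 0 < a ==> 0 < b ==> z = a *. p + b *. q ==> rotN \<sigma> i p q = rotN \<sigma> i p z + rotN \<sigma> i z q"
  and "cross2 p q ~= 0 ==> 0 < rotN \<sigma> i p q"
  and "cross2 n v ~= 0 ==> a < b ==> integral {a..b} (rotG \<sigma> i (\<lambda>t. n + t *. v)) = rotN \<sigma> i (n + a *. v) (n + b *. v)"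
  and "cross2 p v ~= 0 ==> ((\<lambda>b. rotN \<sigma> i p (p + b *. v)) \<longlongrightarrow> rotN \<sigma> i p v) at_top"
proof -
 interpret minkowski "Fn i" by (rule mink[OF i])
 have s2: "cross2 (\<sigma> *. p) (\<sigma> *. q) = cross2 p q" for p q using \<sigma> by auto
 show "rotN \<sigma> i (a *. p) (b *. q) = rotN \<sigma> i p q" if "0 < a" "0 < b"
  using sec_scale[OF that, of "\<sigma> *. p" "\<sigma> *. q"] by (simp add: rotN_def mult.commute)
 show "rotN \<sigma> i p q = rotN \<sigma> i q p" by (simp add: rotN_def sec_commute)
 show "rotN \<sigma> i p q = rotN \<sigma> i p z + rotN \<sigma> i z q" if "cross2 p q ~= 0" "0 < a" "0 < b" "z = a *. p + b *. q"
  unfolding rotN_def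
 proof (rule nu_sec_split)
  show "cross2 (\<sigma> *. p) (\<sigma> *. q) ~= 0" using that(1) unfolding s2 .
  show "\<sigma> *. z = a *. \<sigma> *. p + b *. \<sigma> *. q" unfolding that(4) using \<sigma> by auto
 qed (use that in auto)
 show "0 < rotN \<sigma> i p q" if "cross2 p q ~= 0"
  unfolding rotN_def by (rule nu_sec_pos) (unfold s2, rule that)
 have lin: "\<sigma> *. (n + t *. v) = \<sigma> *. n + t *. \<sigma> *. v" for n v :: "real^2" and t using \<sigma> by auto
 show "integral {a..b} (rotG \<sigma> i (\<lambda>t. n + t *. v)) = rotN \<sigma> i (n + a *. v) (n + b *. v)" if c: "cross2 n v ~= 0" and ab: "a < b"
  unfolding rotN_def lin
 proof (rule integral_unique, rule has_integral_eq[rotated])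
  show "((\<lambda>t. \<bar>cross2 (\<sigma> *. n + t *. \<sigma> *. v) (\<sigma> *. v)\<bar> * kap (Fn i) (\<sigma> *. n + t *. \<sigma> *. v)) has_integral
    nu (Fn i) (sec (\<sigma> *. n + a *. \<sigma> *. v) (\<sigma> *. n + b *. \<sigma> *. v))) {a..b}"
   by (rule line_rotation[OF _ ab]) (unfold s2, rule c)
  fix t
  have "cross2 (n + t *. v) v ~= 0" using c by (simp add: cross2_add)
  then have nz: "n + t *. v ~= 0" by auto
  have d: "((\<lambda>t. n + t *. v) has_vector_derivative v) (at t)" by (rule line_hvd)
  show "\<bar>cross2 (\<sigma> *. n + t *. \<sigma> *. v) (\<sigma> *. v)\<bar> * kap (Fn i) (\<sigma> *. n + t *. \<sigma> *. v) =
    rotG \<sigma> i (\<lambda>t. n + t *. v) t"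
   unfolding lin[symmetric] s2 by (rule rotG_eq[OF i \<sigma> d nz, symmetric])
 qed
 show "((\<lambda>b. rotN \<sigma> i p (p + b *. v)) \<longlongrightarrow> rotN \<sigma> i p v) at_top" if "cross2 p v ~= 0"
  unfolding rotN_def lin by (rule nu_sec_tendsto) (unfold s2, rule that)
qed

lemma vertex_iso:
 assumes i: "i \<in> star M x" and o: "vopp x i k = (j, l)"
 shows "\<exists>h. arc_isometry (Fn i) (Fn j) (vray x i k) (vray x j l)
  (- sgn (cross2 (vray x i k) (vray x i (\<not> k)))) (sgn (cross2 (vray x j l) (vray x j (\<not> l)))) h"
proof -
 have "vadj x i k j l" using o vopp_eq[OF i] by simp
 from edge_isometry[OF this[unfolded vadj_def] tip_def tip_def] show ?thesis by (simp add: vray_def tip_def)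
qed

lemma vertex_half:
 assumes i: "i \<in> star M x" and o: "vopp x i k = (j, l)"
 shows "nu (Fn i) (hp (vray x i k) (- vray x i (\<not> k))) = nu (Fn j) (hp (vray x j l) (vray x j (\<not> l)))"
  "nu (Fn i) UNIV = nu (Fn j) UNIV"
proof -
 have a: "vadj x i k j l" using o vopp_eq[OF i] by simp
 from half_adj[OF this[unfolded vadj_def] tip_def tip_def] show "nu (Fn i) (hp (vray x i k) (- vray x i (\<not> k))) = nu (Fn j) (hp (vray x j l) (vray x j (\<not> l)))"
  by (simp add: vray_def tip_def)
 show "nu (Fn i) UNIV = nu (Fn j) UNIV" by (rule theta_adj[OF a[unfolded vadj_def]])
qed

lemma fan_rot_out: "fan_rot (tangent_cone M x) (vray x) (vopp x) (rotN 1) (rotG 1)"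
proof (rule fan_rot.intro[OF fan], rule fan_rot_axioms.intro, unfold tangent_cone_simps)
 fix i j k l v assume i: "i \<in> star M x" and o: "vopp x i k = (j, l)" and v: "Fn i v = 1" "hgt i k v < 0"
 obtain h where "arc_isometry (Fn i) (Fn j) (vray x i k) (vray x j l)
  (- sgn (cross2 (vray x i k) (vray x i (\<not> k)))) (sgn (cross2 (vray x j l) (vray x j (\<not> l)))) h"
  using vertex_iso[OF i o] by blast
 then interpret arc_isometry "Fn i" "Fn j" "vray x i k" "vray x j l"
  "- sgn (cross2 (vray x i k) (vray x i (\<not> k)))" "sgn (cross2 (vray x j l) (vray x j (\<not> l)))" h .
 have u: "0 < - sgn (cross2 (vray x i k) (vray x i (\<not> k))) * cross2 (vray x i k) v" using v(2) unfolding tc.hgt_def sgn_quot .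
 note A = arc[OF v(1) u]
 show "\<exists>v'. Fn j v' = 1 \<and> 0 < hgt j l v' \<and> dn (Fn i) v (vray x i k) = dn (Fn j) v' (vray x j l) \<and>
    rotN 1 i (vray x i k) v = rotN 1 j (vray x j l) v'"
  using A dn[OF v(1) less_imp_le[OF u]] unfolding tc.hgt_def sgn_quot rotN_def scaleR_one by blast
qed (rule rotN; simp)+

text \<open>In the reversed fan a curve passes from \<open>i\<close> to \<open>j\<close> where the
  original one passes from \<open>j\<close> to \<open>i\<close>. The isometry therefore starts in
  \<open>j\<close>, and \<open>arc_surj\<close> supplies the preimage of \<open>- v\<close>. Since
  \<open>rotN (-1)\<close> negates all vectors, the angles are those measured from the negated rays
  in \<open>arc\<close>.\<close>

lemma fan_rot_in: "fan_rot (rev_pieces (tangent_cone M x)) (vray x) (vopp x) (rotN (-1)) (rotG (-1))"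
proof (rule fan_rot.intro[OF tc.reverse], rule fan_rot_axioms.intro, unfold rev_pieces_simps tangent_cone_simps)
 fix i j k l v assume i: "i \<in> star M x" and o: "vopp x i k = (j, l)" and v: "Fn i (- v) = 1" "hgt i k v < 0"
 note j = vopp_star[OF i o]
 obtain h where "arc_isometry (Fn j) (Fn i) (vray x j l) (vray x i k)
  (- sgn (cross2 (vray x j l) (vray x j (\<not> l)))) (sgn (cross2 (vray x i k) (vray x i (\<not> k)))) h"
  using vertex_iso[of j l i k] j by blast
 then interpret arc_isometry "Fn j" "Fn i" "vray x j l" "vray x i k"
  "- sgn (cross2 (vray x j l) (vray x j (\<not> l)))" "sgn (cross2 (vray x i k) (vray x i (\<not> k)))" h .
 have "0 < sgn (cross2 (vray x i k) (vray x i (\<not> k))) * cross2 (vray x i k) (- v)" using v(2) unfolding tc.hgt_def sgn_quot by simp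
 from arc_surj[OF v(1) this] obtain u where u: "Fn j u = 1"
  "0 < - sgn (cross2 (vray x j l) (vray x j (\<not> l))) * cross2 (vray x j l) u" "h u = - v" by blast
 have nz: "u ~= 0" "v ~= 0" using u v by auto
 have "dn (\<lambda>w. Fn i (- w)) v (vray x i k) = dn (Fn i) (- v) (- vray x i k)"
  by (rule dn_reverse(2)) (use nz G.diff in simp)
 moreover have "dn (\<lambda>w. Fn j (- w)) (- u) (vray x j l) = dn (Fn j) (- (- u)) (- vray x j l)"
  by (rule dn_reverse(2)) (use nz F.diff in simp)
 moreover have "dn (Fn j) u (vray x j l) = dn (Fn i) (- v) (vray x i k)" using dn[OF u(1) less_imp_le[OF u(2)]] u(3) by simp
 ultimately have dne: "dn (\<lambda>w. Fn i (- w)) v (vray x i k) = dn (\<lambda>w. Fn j (- w)) (- u) (vray x j l)"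
  using nz by (simp add: F.dn_lin G.dn_lin)
 have hj: "0 < hgt j l (- u)" using u(2) unfolding tc.hgt_def sgn_quot by simp
 have "rotN (-1) i (vray x i k) v = rotN (-1) j (vray x j l) (- u)"
  using arc(2)[OF u(1,2)] u(3) by (simp add: rotN_def)
 then show "\<exists>v'. Fn j (- v') = 1 \<and> 0 < hgt j l v' \<and> dn (\<lambda>w. Fn i (- w)) v (vray x i k) = dn (\<lambda>w. Fn j (- w)) v' (vray x j l) \<and>
    rotN (-1) i (vray x i k) v = rotN (-1) j (vray x j l) v'"
  using dne hj u(1) by (intro exI[of _ "- u"]) simp
qed (rule rotN; simp)+

lemma has_rotation_rotG:
 "has_rotation M x \<sigma> \<gamma> A \<longleftrightarrow>
  (\<exists>f. (\<forall>r\<ge>0. has_pw_integral (tangent_cone M x) (rotG \<sigma>) \<gamma> (- r) r (f r)) \<and> (f \<longlongrightarrow> A) at_top)"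
 unfolding has_rotation_def rotG_def[abs_def] ..

lemma rep_nz: "rep (tangent_cone M x) \<gamma> i c S ==> t \<in> S ==> \<gamma> t ~= apex M x ==> c t ~= 0"
 using tpoint_zero by (auto simp: rep_def)

lemma pw_rotG_reverse:
 assumes "has_pw_integral (rev_pieces (tangent_cone M x)) (rotG \<sigma>) \<gamma> a b L"
  and av: "\<And>t. \<gamma> t ~= apex M x" and \<sigma>: "\<sigma> = 1 \<or> \<sigma> = -1"
 shows "has_pw_integral (tangent_cone M x) (rotG \<sigma>) (\<lambda>t. \<gamma> (- t)) (- b) (- a) L"
 using assms(1)
proof (induction rule: pw_induct)
 case (smooth a b i c)
 then have r0: "rep (tangent_cone M x) \<gamma> i c {a..b}" by (simp add: rep_def)
 then have i: "i \<in> star M x" and c: "smooth_on UNIV c" by (auto simp: rep_def)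
 have nz: "c t ~= 0" if "t \<in> {a..b}" for t by (rule rep_nz[OF r0 that av])
 have r: "rep (tangent_cone M x) (\<lambda>t. \<gamma> (- t)) i (\<lambda>t. c (- t)) {- b..- a}" using r0 by (auto simp: rep_def smooth_on_reflect)
 have pt: "rotG \<sigma> i (\<lambda>t. c (- t)) t = rotG \<sigma> i c (- t)" if "t \<in> {- b..- a}" for t
 proof -
  have d: "(c has_vector_derivative vector_derivative c (at (- t))) (at (- t))" by (rule smooth_curve(1)[OF c])
  have "(uminus has_vector_derivative (-1)) (at t)" by (auto intro!: derivative_eq_intros)
  from vector_diff_chain_at[OF this d]
  have d': "((\<lambda>t. c (- t)) has_vector_derivative - vector_derivative c (at (- t))) (at t)" by (simp add: o_def)
  have z: "c (- t) ~= 0" using nz that by auto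
  show ?thesis using rotG_eq[OF i \<sigma> d z] rotG_eq[OF i \<sigma> d' z] by simp
 qed
 have "integral {- b..- a} (rotG \<sigma> i (\<lambda>t. c (- t))) = integral {- b..- a} (\<lambda>t. rotG \<sigma> i c (- t))"
  by (rule integral_cong) (rule pt)
 also have "\<dots> = integral {a..b} (rotG \<sigma> i c)" by (rule Henstock_Kurzweil_Integration.integral_reflect_real)
 finally show ?case using rep_pw[OF r, of "rotG \<sigma>"] smooth(1) by simp
next
 case (join a b d L L')
 then show ?case using has_pw_integral.join[of "tangent_cone M x" "rotG \<sigma>" "\<lambda>t. \<gamma> (- t)" "- d" "- b" L' "- a" L] by (simp add: add.commute)
qed

text \<open>Two representations in different cones around a time force position and velocity onto
  one line through the apex, so both integrands vanish there.\<close>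

lemma rotation_unique:
 assumes "has_rotation M x \<sigma> \<gamma> A" "has_rotation M x \<sigma> \<gamma> B" and av: "\<And>t. \<gamma> t ~= apex M x" and \<sigma>: "\<sigma> = 1 \<or> \<sigma> = -1"
 shows "A = B"
proof -
 obtain f g where f: "\<And>r. 0 <= r ==> has_pw_integral (tangent_cone M x) (rotG \<sigma>) \<gamma> (- r) r (f r)" "(f \<longlongrightarrow> A) at_top"
  and g: "\<And>r. 0 <= r ==> has_pw_integral (tangent_cone M x) (rotG \<sigma>) \<gamma> (- r) r (g r)" "(g \<longlongrightarrow> B) at_top"
  using assms(1,2) unfolding has_rotation_rotG by blast
 have eq: "L = L'" if L: "has_pw_integral (tangent_cone M x) (rotG \<sigma>) \<gamma> a b L" "has_pw_integral (tangent_cone M x) (rotG \<sigma>) \<gamma> a b L'" for a b L L'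
 proof (rule pw_unique[OF _ _ L])
  fix i c and a b :: real assume r: "rep (tangent_cone M x) \<gamma> i c {a..b}"
  then have i: "i \<in> star M x" and c: "smooth_on UNIV c" by (auto simp: rep_def)
  interpret minkowski "Fn i" by (rule mink[OF i])
  have nz: "c t ~= 0" if "t \<in> {a..b}" for t by (rule rep_nz[OF r that av])
  have nz': "\<sigma> *. c t ~= 0" if "t \<in> {a..b}" for t using nz[OF that] \<sigma> by auto
  have "continuous_on {a..b} (\<lambda>t. \<bar>cross2 (c t) (vector_derivative c (at t))\<bar> * kap (Fn i) (\<sigma> *. c t))"
   by (intro continuous_intros continuous_on_subset[OF smooth_curve(2)[OF c, of UNIV]] continuous_on_subset[OF smooth_curve(3)[OF c, of UNIV]] nz') auto
  then have "(\<lambda>t. \<bar>cross2 (c t) (vector_derivative c (at t))\<bar> * kap (Fn i) (\<sigma> *. c t)) integrable_on {a..b}"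
   by (rule integrable_continuous_interval)
  then show "rotG \<sigma> i c integrable_on {a..b}"
   by (rule integrable_eq) (use rotG_eq[OF i \<sigma> smooth_curve(1)[OF c]] nz in simp)
 next
  fix i j c d and t e :: real assume e: "0 < e" and r: "rep (tangent_cone M x) \<gamma> i c {t - e<..<t + e}" "rep (tangent_cone M x) \<gamma> j d {t - e<..<t + e}"
  have i: "i \<in> star M x" "smooth_on UNIV c" and j: "j \<in> star M x" "smooth_on UNIV d" using r by (auto simp: rep_def)
  have tin: "t \<in> {t - e<..<t + e}" using e by simp
  have G: "rotG \<sigma> i c t = \<bar>cross2 (c t) (vector_derivative c (at t))\<bar> * kap (Fn i) (\<sigma> *. c t)"
   "rotG \<sigma> j d t = \<bar>cross2 (d t) (vector_derivative d (at t))\<bar> * kap (Fn j) (\<sigma> *. d t)"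
   using rotG_eq[OF i(1) \<sigma> smooth_curve(1)[OF i(2)] rep_nz[OF r(1) tin av]] rotG_eq[OF j(1) \<sigma> smooth_curve(1)[OF j(2)] rep_nz[OF r(2) tin av]] by auto
  show "rotG \<sigma> i c t = rotG \<sigma> j d t"
  proof (cases "i = j")
   case True
   have cd: "c s = d s" if "s \<in> {t - e<..<t + e}" for s
    using r True that tc.chart_inj[of i] i by (auto simp: rep_def inj_on_def)
   have "vector_derivative c (at t) = vector_derivative d (at t)"
    by (rule tc.vector_derivative_ev[OF i(2) j(2) e cd])
   then show ?thesis using G cd[OF tin] True by simp
  next
   case False
   obtain x1 k l where 1: "vector_derivative c (at t) = x1 *. vray x i k" "\<exists>y. c t = y *. vray x i k"
    by (rule tc.common_ray[OF r False e]) blast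
   obtain x2 k2 l2 where 2: "vector_derivative d (at t) = x2 *. vray x j k2" "\<exists>y. d t = y *. vray x j k2"
    by (rule tc.common_ray[OF r(2,1) False[symmetric] e]) blast
   show ?thesis using G 1 2 by auto
  qed
 qed
 have "eventually (\<lambda>r. f r = g r) at_top"
  using eventually_ge_at_top[of 0] by eventually_elim (rule eq[OF f(1) g(1)])
 from tendsto_cong[OF this] show ?thesis using f(2) g(2) tendsto_unique[of at_top] by (metis trivial_limit_at_top_linorder)
qed

text \<open>Being in the cone at all times near \<open>s\<close> puts the point at time
  \<open>s\<close> into the interior: if a height vanished there, the times slightly nearer to the
  apex would force both \<open>u\<close> and \<open>n\<close> to be parallel to the ray.\<close>

lemma translate_pos:
 assumes j: "j \<in> star M x" and s: "s = 1 \<or> s = -1" and u: "s *. u \<in> tcone M x j" and c: "cross2 u n ~= 0"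
  and t: "translatable M x s j u n"
 shows "0 < hgt j k (n + s *. u)" "0 <= hgt j k (s *. u)"
proof -
 have ge: "0 <= hgt j k w" if "w \<in> tcone M x j" for w using mem_tcone[OF j, of w k] that by blast
 show a: "0 <= hgt j k (s *. u)" by (rule ge[OF u])
 obtain d where d: "d > 0" "\<And>t. \<bar>t - s\<bar> < d ==> t *. u + n \<in> tcone M x j" using t unfolding translatable_def by blast
 have 0: "0 <= t * hgt j k u + hgt j k n" if "\<bar>t - s\<bar> < d" for t using ge[OF d(2)[OF that]] by simp
 have "\<bar>(s - s * d / 2) - s\<bar> < d" using d(1) s by auto
 from 0[OF this] have 1: "0 <= (s * hgt j k u + hgt j k n) - (d / 2) * (s * hgt j k u)" by (simp add: algebra_simps)
 have 2: "0 <= s * hgt j k u + hgt j k n" using 0[of s] d(1) by simp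
 have "s * hgt j k u + hgt j k n ~= 0"
 proof
  assume e: "s * hgt j k u + hgt j k n = 0"
  then have "(d / 2) * (s * hgt j k u) <= 0" using 1 by simp
  then have "s * hgt j k u <= 0" using d(1) by (simp add: mult_le_0_iff)
  then have "hgt j k u = 0" using a s by auto
  moreover have "hgt j k n = 0" using e calculation by simp
  ultimately have "cross2 (vray x j k) u = 0" "cross2 (vray x j k) n = 0" using tip(3)[OF j, of k] by (auto simp: tc.hgt_def)
  then obtain p q where "u = p *. vray x j k" "n = q *. vray x j k" using cross2_eq_0_iff[OF ray_nz[OF j]] by metis
  then show False using c by simp
 qed
 then show "0 < hgt j k (n + s *. u)" using 2 by (simp add: add.commute)
qed

text \<open>The angles from the point of the line towards \<open>u\<close> and towards
  \<open>- u\<close> add up to a half plane bounded by \<open>u\<close>. For outgoing vectors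
  everything happens in the reversed fan with negated directions, which puts the half plane on the
  other side; hence the factor \<open>- s\<close>.\<close>

lemma side_geodesic:
 assumes j: "j \<in> star M x" and s: "s = 1 \<or> s = -1" and u: "s *. u \<in> tcone M x j" "Fn j u = 1" and c: "cross2 u n ~= 0"
  and t: "translatable M x s j u n"
 shows "\<exists>\<gamma>. extends_translate M x s j u n \<gamma> \<and> has_rotation M x (- s) \<gamma> (nu (Fn j) (hp u (- (s *. n)))) \<and>
  (\<forall>\<gamma>'. extends_translate M x s j u n \<gamma>' --> \<gamma>' = \<gamma>)"
 using s
proof
 interpret minkowski "Fn j" by (rule mink[OF j])
 note tp = translate_pos[OF j s u(1) c t]
 { assume s1: "s = -1"
  interpret R: fan_rot "tangent_cone M x" "vray x" "vopp x" "rotN 1" "rotG 1" by (rule fan_rot_out)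
  have cnu: "cross2 n u ~= 0" using c cross2_commute[of n u] by simp
  obtain \<gamma> f d where R: "geodesic (tangent_cone M x) \<gamma>" "\<And>t i. i \<in> star M x ==> \<gamma> t ~= tpoint M x i 0"
   "0 < d" "\<And>t. \<bar>t - (-1)\<bar> < d ==> \<gamma> t = tpoint M x j (n + t *. u)"
   "\<And>r. 0 <= r ==> has_pw_integral (tangent_cone M x) (rotG 1) \<gamma> (- r) r (f r)"
   "(f \<longlongrightarrow> rotN 1 j (- u) (n + (-1) *. u) + rotN 1 j (n + (-1) *. u) u) at_top"
   "\<And>\<gamma>' e. geodesic (tangent_cone M x) \<gamma>' ==> 0 < e ==> (\<And>t. \<bar>t - (-1)\<bar> < e ==> \<gamma>' t = tpoint M x j (n + t *. u)) ==> \<gamma>' = \<gamma>"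
  proof (rule R.translate_geodesic[of j u n "-1", unfolded tangent_cone_simps, OF j u(2) cnu])
   show "0 < hgt j k (n + (-1) *. u)" for k using tp(1)[of k] s1 by simp
   show "hgt j k u <= 0" for k using tp(2)[of k] s1 by simp
  qed blast
  have cu: "cross2 u (n - u) ~= 0" "cross2 u (n - u) = cross2 u n" using c by (auto simp: cross2_add)
  have "rotN 1 j (- u) (n + (-1) *. u) + rotN 1 j (n + (-1) *. u) u = nu (Fn j) (hp u (n - u))"
   unfolding nu_hp_split[OF cu(1)] rotN_def by (simp add: sec_commute[of u] sec_commute[of "- u"])
  also have "hp u (n - u) = hp u (- (s *. n))" using cu(2) by (simp add: hp_def s1)
  finally have "has_rotation M x (- s) \<gamma> (nu (Fn j) (hp u (- (s *. n))))"
   unfolding has_rotation_rotG using R(5,6) s1 by auto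
  moreover have "extends_translate M x s j u n \<gamma>"
   unfolding extends_translate_def
  proof (intro conjI allI)
   show "geodesic (tangent_cone M x) \<gamma>" by (rule R(1))
   show "\<gamma> t ~= apex M x" for t using R(2)[OF j] tpoint_zero[OF j] by simp
   show "\<exists>d>0. \<forall>t. \<bar>t - s\<bar> < d --> \<gamma> t = tpoint M x j (t *. u + n)"
    using R(3,4) unfolding s1 by (metis add.commute)
  qed
  moreover have "\<gamma>' = \<gamma>" if g: "extends_translate M x s j u n \<gamma>'" for \<gamma>'
  proof -
   obtain e where e: "e > 0" "\<And>t. \<bar>t - s\<bar> < e ==> \<gamma>' t = tpoint M x j (t *. u + n)"
    using g unfolding extends_translate_def by blast
   show ?thesis by (rule R(7)[of _ e]) (use g e s1 in \<open>auto simp: extends_translate_def add.commute\<close>)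
  qed
  ultimately show ?thesis by blast }
 { assume s1: "s = 1"
  interpret R: fan_rot "rev_pieces (tangent_cone M x)" "vray x" "vopp x" "rotN (-1)" "rotG (-1)" by (rule fan_rot_in)
  have cnu: "cross2 n (- u) ~= 0" using c cross2_commute[of n u] by simp
  obtain \<gamma> f d where R: "geodesic (rev_pieces (tangent_cone M x)) \<gamma>" "\<And>t i. i \<in> star M x ==> \<gamma> t ~= tpoint M x i 0"
   "0 < d" "\<And>t. \<bar>t - (-1)\<bar> < d ==> \<gamma> t = tpoint M x j (n + t *. (- u))"
   "\<And>r. 0 <= r ==> has_pw_integral (rev_pieces (tangent_cone M x)) (rotG (-1)) \<gamma> (- r) r (f r)"
   "(f \<longlongrightarrow> rotN (-1) j (- (- u)) (n + (-1) *. (- u)) + rotN (-1) j (n + (-1) *. (- u)) (- u)) at_top"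
   "\<And>\<gamma>' e. geodesic (rev_pieces (tangent_cone M x)) \<gamma>' ==> 0 < e ==> (\<And>t. \<bar>t - (-1)\<bar> < e ==> \<gamma>' t = tpoint M x j (n + t *. (- u))) ==> \<gamma>' = \<gamma>"
  proof (rule R.translate_geodesic[of j "- u" n "-1", unfolded rev_pieces_simps tangent_cone_simps, OF j _ cnu])
   show "Fn j (- (- u)) = 1" using u(2) by simp
   show "0 < hgt j k (n + (-1) *. (- u))" for k using tp(1)[of k] s1 by simp
   show "hgt j k (- u) <= 0" for k using tp(2)[of k] s1 by simp
  qed blast
  let ?g = "\<lambda>t. \<gamma> (- t)"
  have av: "\<gamma> t ~= apex M x" for t using R(2)[OF j] tpoint_zero[OF j] by simp
  have cu: "cross2 u (- (n + u)) ~= 0" "cross2 u (- (n + u)) = cross2 u (- n)" using c by (auto simp: cross2_add)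
  have "rotN (-1) j (- (- u)) (n + (-1) *. (- u)) + rotN (-1) j (n + (-1) *. (- u)) (- u) = nu (Fn j) (hp u (- (n + u)))"
   unfolding nu_hp_split[OF cu(1)] rotN_def by (simp add: sec_commute[of u] sec_commute[of "- u"])
  also have "hp u (- (n + u)) = hp u (- (s *. n))" using cu(2) unfolding hp_def s1 scaleR_one by simp
  finally have lim: "(f \<longlongrightarrow> nu (Fn j) (hp u (- (s *. n)))) at_top" using R(6) by simp
  have "has_pw_integral (tangent_cone M x) (rotG (-1)) ?g (- r) r (f r)" if "0 <= r" for r
   using pw_rotG_reverse[OF R(5)[OF that] av] by simp
  then have "has_rotation M x (- s) ?g (nu (Fn j) (hp u (- (s *. n))))"
   unfolding has_rotation_rotG using lim s1 by auto
  moreover have "extends_translate M x s j u n ?g"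
   unfolding extends_translate_def
  proof (intro conjI allI)
   show "geodesic (tangent_cone M x) ?g" using geodesic_reverse[OF R(1)] by simp
   show "\<gamma> (- t) ~= apex M x" for t by (rule av)
   have "\<gamma> (- t) = tpoint M x j (t *. u + n)" if "\<bar>t - s\<bar> < d" for t
    using R(4)[of "- t"] that s1 by (simp add: add.commute abs_minus_commute)
   then show "\<exists>d>0. \<forall>t. \<bar>t - s\<bar> < d --> \<gamma> (- t) = tpoint M x j (t *. u + n)" using R(3) by blast
  qed
  moreover have "\<gamma>' = ?g" if g: "extends_translate M x s j u n \<gamma>'" for \<gamma>'
  proof -
   obtain e where e: "e > 0" "\<And>t. \<bar>t - s\<bar> < e ==> \<gamma>' t = tpoint M x j (t *. u + n)"
    using g unfolding extends_translate_def by blast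
   have "(\<lambda>t. \<gamma>' (- t)) = \<gamma>"
   proof (rule R(7)[OF _ e(1)])
    show "geodesic (rev_pieces (tangent_cone M x)) (\<lambda>t. \<gamma>' (- t))"
     by (rule geodesic_reverse) (use g in \<open>simp add: extends_translate_def\<close>)
    show "\<gamma>' (- t) = tpoint M x j (n + t *. (- u))" if "\<bar>t - (-1)\<bar> < e" for t
     using e(2)[of "- t"] that s1 by (simp add: add.commute abs_minus_commute)
   qed
   then have "\<gamma> (- t) = \<gamma>' t" for t by auto
   then show ?thesis by auto
  qed
  ultimately show ?thesis by blast }
qed

end

section \<open>Orientations\<close>

text \<open>The orbits of two involutions without fixed points are even cycles, hence can be coloured
 alternatingly. The induction removes one pair of the first involution and reconnects the second.\<close>

lemma two_involutions:
 assumes "finite S"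
  and "\<And>x. x \<in> S ==> \<alpha> x \<in> S \<and> \<alpha> x ~= x \<and> \<alpha> (\<alpha> x) = x"
  and "\<And>x. x \<in> S ==> \<beta> x \<in> S \<and> \<beta> x ~= x \<and> \<beta> (\<beta> x) = x"
 shows "\<exists>\<tau>::'a => real. \<forall>x\<in>S. (\<tau> x = 1 \<or> \<tau> x = -1) \<and> \<tau> (\<alpha> x) = - \<tau> x \<and> \<tau> (\<beta> x) = - \<tau> x"
 using assms
proof (induction S arbitrary: \<beta> rule: finite_psubset_induct)
 case (psubset S)
 note \<alpha> = psubset.prems(1) and \<beta> = psubset.prems(2)
 show ?case
 proof (cases "S = {}")
  case True
  then show ?thesis by auto
 next
  case False
  then obtain x where x: "x \<in> S" by blast
  define y where "y = \<alpha> x"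
  have y: "y \<in> S" "y ~= x" "\<alpha> y = x" "\<alpha> x = y" using \<alpha>[OF x] by (auto simp: y_def)
  note bx = \<beta>[OF x] and by' = \<beta>[OF y(1)]
  define \<beta>' where "\<beta>' z = (if \<beta> z = x then \<beta> y else if \<beta> z = y then \<beta> x else \<beta> z)" for z
  define S' where "S' = S - {x, y}"
  have sub: "S' \<subset> S" using x by (auto simp: S'_def)
  have a: "\<alpha> z \<in> S' \<and> \<alpha> z ~= z \<and> \<alpha> (\<alpha> z) = z" if "z \<in> S'" for z
  proof -
   have z: "z \<in> S" "z ~= x" "z ~= y" using that by (auto simp: S'_def)
   have "\<alpha> z ~= x" "\<alpha> z ~= y" using \<alpha>[OF z(1)] y z by auto
   then show ?thesis using \<alpha>[OF z(1)] by (simp add: S'_def)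
  qed
  have inj: "w = z" if "\<beta> z = \<beta> w" "z \<in> S" "w \<in> S" for z w using \<beta>[OF that(2)] \<beta>[OF that(3)] that(1) by metis
  have b: "\<beta>' z \<in> S' \<and> \<beta>' z ~= z \<and> \<beta>' (\<beta>' z) = z" if "z \<in> S'" for z
  proof -
   have z: "z \<in> S" "z ~= x" "z ~= y" using that by (auto simp: S'_def)
   note bz = \<beta>[OF z(1)]
   consider "\<beta> z = x" | "\<beta> z = y" | "\<beta> z ~= x" "\<beta> z ~= y" by blast
   then show ?thesis
   proof cases
    case 1
    then have zx: "z = \<beta> x" using bz by simp
    then have "\<beta> y ~= x" using by' y z by auto
    moreover have "\<beta> y ~= z" using zx inj[of y x] x y by auto
    ultimately show ?thesis using 1 zx by' bx y by (auto simp: \<beta>'_def S'_def)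
   next
    case 2
    then have zy: "z = \<beta> y" using bz by simp
    then have "\<beta> x ~= y" using bx y z by auto
    moreover have "\<beta> x ~= z" using zy inj[of y x] x y by auto
    ultimately show ?thesis using 2 zy by' bx y by (auto simp: \<beta>'_def S'_def)
   next
    case 3
    then show ?thesis using bz z by (auto simp: \<beta>'_def S'_def)
   qed
  qed
  obtain \<tau>' :: "'a => real" where \<tau>': "\<And>z. z \<in> S' ==> (\<tau>' z = 1 \<or> \<tau>' z = -1) \<and> \<tau>' (\<alpha> z) = - \<tau>' z \<and> \<tau>' (\<beta>' z) = - \<tau>' z"
   using psubset.IH[OF sub a b] by blast
  \<comment> \<open>The partner of \<open>x\<close> under \<open>\<beta>\<close> determines the
    colours of \<open>x\<close> and \<open>y\<close>; if \<open>x\<close> and \<open>y\<close> are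
    themselves partners, their colours are free up to opposite signs.\<close>
  define \<tau> where "\<tau> z = (if z = x then (if \<beta> x = y then 1 else - \<tau>' (\<beta> x)) else
   if z = y then (if \<beta> x = y then -1 else \<tau>' (\<beta> x)) else \<tau>' z)" for z
  have \<tau>S: "\<tau> z = \<tau>' z" if "z \<in> S'" for z using that by (auto simp: \<tau>_def S'_def)
  have \<tau>xy: "\<tau> y = - \<tau> x" using y by (simp add: \<tau>_def)
  have cross: "\<beta> x \<in> S'" "\<beta> y \<in> S'" "\<tau>' (\<beta> y) = - \<tau>' (\<beta> x)" "\<tau> x = - \<tau>' (\<beta> x)" if ne: "\<beta> x ~= y"
  proof -
   have "\<beta> y ~= x" using by' ne by auto
   then show s: "\<beta> x \<in> S'" "\<beta> y \<in> S'" using bx by' ne by (auto simp: S'_def)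
   have "\<beta>' (\<beta> x) = \<beta> y" using bx by (simp add: \<beta>'_def)
   then show "\<tau>' (\<beta> y) = - \<tau>' (\<beta> x)" using \<tau>'[OF s(1)] by simp
   show "\<tau> x = - \<tau>' (\<beta> x)" using ne by (simp add: \<tau>_def)
  qed
  have x1: "\<tau> x = 1 \<or> \<tau> x = -1"
  proof (cases "\<beta> x = y")
   case False
   then show ?thesis using cross(4)[OF False] \<tau>'[OF cross(1)[OF False]] by auto
  qed (simp add: \<tau>_def)
  have bxy: "\<tau> (\<beta> x) = - \<tau> x \<and> \<tau> (\<beta> y) = - \<tau> y"
  proof (cases "\<beta> x = y")
   case True
   then have "\<beta> y = x" using bx by auto
   then show ?thesis using True \<tau>xy by simp
  next
   case False
   note c = cross[OF False]
   show ?thesis using \<tau>S[OF c(1)] \<tau>S[OF c(2)] c \<tau>xy by simp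
  qed
  have "(\<tau> z = 1 \<or> \<tau> z = -1) \<and> \<tau> (\<alpha> z) = - \<tau> z \<and> \<tau> (\<beta> z) = - \<tau> z" if z: "z \<in> S" for z
  proof -
   consider "z = x" | "z = y" | "z \<in> S'" using z by (auto simp: S'_def)
   then show ?thesis
   proof cases
    case 1
    then show ?thesis using x1 bxy \<tau>xy y by simp
   next
    case 2
    then show ?thesis using x1 bxy \<tau>xy y by auto
   next
    case 3
    note t = \<tau>'[OF 3] \<tau>S[OF 3]
    have "\<tau> (\<beta> z) = - \<tau> z"
    proof (cases "\<beta> z = x \<or> \<beta> z = y")
     case True
     then have "z = \<beta> x \<or> z = \<beta> y" using \<beta>[OF z] by auto
     then show ?thesis
     proof
      assume "z = \<beta> x"
      then show ?thesis using bxy bx by simp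
     next
      assume "z = \<beta> y"
      then show ?thesis using bxy by' by simp
     qed
    next
     case False
     then have "\<beta>' z = \<beta> z" by (simp add: \<beta>'_def)
     then show ?thesis using t b[OF 3] \<tau>S[of "\<beta> z"] by simp
    qed
    then show ?thesis using t a[OF 3] \<tau>S[of "\<alpha> z"] by simp
   qed
  qed
  then show ?thesis by blast
 qed
qed

section \<open>The curvature at a vertex\<close>

context landsberg_vertex
begin

lemma fin_star: "finite (star M x)"
 using tc.fin by simp

lemma fnorm_vopp: "i \<in> star M x ==> vopp x i k = (j, l) ==> Fn i (a *. vray x i k) = Fn j (a *. vray x j l)"
 using tc.fnorm_ray by simp

text \<open>\<open>\<tau>\<close> colours the flags, pairs of a cone and one of its rays, so that
  the sign changes from one ray of a cone to the other and across every gluing. Comparing it with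
  the orientation of the two rays in the chart gives \<open>\<epsilon>\<close>.\<close>

lemma orientation_ex: "\<exists>\<epsilon>. cone_orientation M x \<epsilon>"
proof -
 let ?S = "star M x \<times> (UNIV :: bool set)"
 have "\<exists>\<tau>::'i \<times> bool => real. \<forall>f\<in>?S. (\<tau> f = 1 \<or> \<tau> f = -1) \<and> \<tau> (fst f, \<not> snd f) = - \<tau> f \<and> \<tau> (vopp x (fst f) (snd f)) = - \<tau> f"
 proof (rule two_involutions)
  show "finite ?S" using fin_star by simp
  show "(fst f, \<not> snd f) \<in> ?S \<and> (fst f, \<not> snd f) ~= f \<and> (fst (fst f, \<not> snd f), \<not> snd (fst f, \<not> snd f)) = f" if "f \<in> ?S" for f
   using that by (cases f) auto
  show "vopp x (fst f) (snd f) \<in> ?S \<and> vopp x (fst f) (snd f) ~= f \<and>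
   vopp x (fst (vopp x (fst f) (snd f))) (snd (vopp x (fst f) (snd f))) = f" if "f \<in> ?S" for f
  proof -
   obtain i k where f: "f = (i, k)" "i \<in> star M x" using \<open>f \<in> ?S\<close> by auto
   obtain j l where o: "vopp x i k = (j, l)" by fastforce
   show ?thesis using vopp_star[OF f(2) o] o f by auto
  qed
 qed
 then obtain \<tau> :: "'i \<times> bool => real" where \<tau>0: "\<forall>f\<in>?S. (\<tau> f = 1 \<or> \<tau> f = -1) \<and> \<tau> (fst f, \<not> snd f) = - \<tau> f \<and> \<tau> (vopp x (fst f) (snd f)) = - \<tau> f"
  by (rule exE)
 have \<tau>: "\<And>i k. i \<in> star M x ==> \<tau> (i, k) = 1 \<or> \<tau> (i, k) = -1"
  "\<And>i k. i \<in> star M x ==> \<tau> (i, \<not> k) = - \<tau> (i, k)" "\<And>i k. i \<in> star M x ==> \<tau> (vopp x i k) = - \<tau> (i, k)"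
  subgoal for i k using bspec[OF \<tau>0, of "(i, k)"] by simp
  subgoal for i k using bspec[OF \<tau>0, of "(i, k)"] by simp
  subgoal for i k using bspec[OF \<tau>0, of "(i, k)"] by simp
  done
 define D where "D i k = cross2 (vray x i k) (vray x i (\<not> k))" for i k
 have D0: "D i k ~= 0" if "i \<in> star M x" for i k unfolding D_def by (rule tip(3)[OF that])
 have Dn: "D i (\<not> k) = - D i k" for i k by (simp add: D_def cross2_commute[of "vray x i (\<not> k)"])
 define \<epsilon> where "\<epsilon> i = \<tau> (i, False) * sgn (D i False)" for i
 have pos: "0 < \<tau> (i, k) * (\<epsilon> i * D i k)" if i: "i \<in> star M x" for i k
 proof -
  have "\<tau> (i, k) * (\<epsilon> i * D i k) = \<bar>D i False\<bar>"
   using \<tau>(1)[OF i, of False] \<tau>(2)[OF i, of False] Dn[of i False] by (cases k) (auto simp: \<epsilon>_def abs_sgn)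
  then show ?thesis using D0[OF i] by simp
 qed
 have "cone_orientation M x \<epsilon>"
  unfolding cone_orientation_def
 proof (intro conjI ballI impI)
  show "\<epsilon> i \<in> {1, -1}" if "i \<in> star M x" for i
   using \<tau>(1)[OF that, of False] D0[OF that, of False] by (auto simp: \<epsilon>_def sgn_if)
  fix i j w w' a b assume i: "i \<in> star M x" and j: "j \<in> star M x" and ij: "i ~= j" and w: "w \<in> tcone M x i" "w' \<in> tcone M x j"
   and e: "w ~= 0 \<and> tpoint M x i w = tpoint M x j w'" and a: "a \<in> tcone M x i" and b: "b \<in> tcone M x j"
  obtain k l c where c: "0 < c" "vopp x i k = (j, l)" "w = c *. vray x i k" "w' = c *. vray x j l"
   using e tpoint_eq_iff[OF i j ij w] by blast
  have ha: "cross2 (vray x i k) a = hgt i k a * D i k" "0 <= hgt i k a"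
   using D0[OF i, of k] a mem_tcone[OF i, of a k] by (auto simp: tc.hgt_def D_def)
  have hb: "cross2 (vray x j l) b = hgt j l b * D j l" "0 <= hgt j l b"
   using D0[OF j, of l] b mem_tcone[OF j, of b l] by (auto simp: tc.hgt_def D_def)
  have t: "\<tau> (j, l) = - \<tau> (i, k)" using \<tau>(3)[OF i, of k] c(2) by simp
  have "(\<epsilon> i * D i k) * (\<epsilon> j * D j l) < 0"
   using pos[OF i, of k] pos[OF j, of l] \<tau>(1)[OF i, of k] t by (auto simp: mult_less_0_iff)
  from less_imp_le[OF this] have le: "(c * hgt i k a * (c * hgt j l b)) * ((\<epsilon> i * D i k) * (\<epsilon> j * D j l)) <= 0"
   by (rule mult_nonneg_nonpos[rotated]) (use c(1) ha(2) hb(2) in simp)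
  have eq: "(\<epsilon> i * cross2 w a) * (\<epsilon> j * cross2 w' b) = (c * hgt i k a * (c * hgt j l b)) * ((\<epsilon> i * D i k) * (\<epsilon> j * D j l))"
   unfolding c(3,4) cross2_simps ha(1) hb(1) by (simp only: mult_ac)
  show "(\<epsilon> i * cross2 w a) * (\<epsilon> j * cross2 w' b) <= 0" unfolding eq by (rule le)
 qed
 then show ?thesis by blast
qed

section \<open>Rotation on the two sides of a ray\<close>

lemma rep_cases:
 assumes i: "i \<in> star M x" and j: "j \<in> star M x" and w: "w \<in> tcone M x i" "w ~= 0" "w' \<in> tcone M x j"
  and e: "tpoint M x j w' = tpoint M x i w"
 obtains "j = i" "w' = w" | k l a where "0 < a" "vopp x i k = (j, l)" "w = a *. vray x i k" "w' = a *. vray x j l"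
proof (cases "i = j")
 case True
 have "inj_on (tpoint M x i) (tcone M x i)" using tc.chart_inj[of i] i by simp
 then have "w' = w" using e w True by (auto dest: inj_onD)
 then show ?thesis using that(1) True by blast
next
 case False
 then show ?thesis using tpoint_eq_iff[OF i j False w(1,3)] e w(2) that(2) by metis
qed

lemma side_rotationI:
 assumes i: "i \<in> star M x" and s: "s = 1 \<or> s = -1" and u: "u \<in> indicatrix M s x i"
  and val: "\<And>j u' n. j \<in> star M x ==> s *. u' \<in> tcone M x j ==> tpoint M x j (s *. u') = tpoint M x i (s *. u) ==>
   0 < \<sigma> * (\<epsilon> j * cross2 u' n) ==> (\<And>k. 0 < hgt j k (n + s *. u')) ==> nu (Fn j) (hp u' (- (s *. n))) = A"
 shows "side_rotation M x \<epsilon> s i u \<sigma> A"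
 unfolding side_rotation_def
\<comment> \<open>Translatability already places the line in the interior of the cone near time
  \<open>s\<close>, so any positive number serves as \<open>\<delta>\<close>.\<close>
proof (rule exI[of _ "1::real"], rule conjI[OF zero_less_one], intro allI impI)
 fix j u' n assume "j \<in> star M x \<and> s *. u' \<in> tcone M x j \<and> tpoint M x j (s *. u') = tpoint M x i (s *. u) \<and>
  norm n < 1 \<and> 0 < \<sigma> * (\<epsilon> j * cross2 u' n) \<and> translatable M x s j u' n"
 then have j: "j \<in> star M x" and u': "s *. u' \<in> tcone M x j" and e: "tpoint M x j (s *. u') = tpoint M x i (s *. u)"
  and sg: "0 < \<sigma> * (\<epsilon> j * cross2 u' n)" and t: "translatable M x s j u' n" by simp_all
 have ui: "s *. u \<in> tcone M x i" "Fn i u = 1" using u by (auto simp: indicatrix_def)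
 interpret Fi: minkowski "Fn i" by (rule mink[OF i])
 have su: "s *. u ~= 0" using ui(2) s by auto
 have ss: "s *. s *. v = v" for v :: "real^2" using s by auto
 have "Fn j u' = 1"
 proof (rule rep_cases[OF i j ui(1) su u' e])
  assume "j = i" "s *. u' = s *. u"
  then show ?thesis using ui(2) ss by metis
 next
  fix k l a assume h: "0 < a" "vopp x i k = (j, l)" "s *. u = a *. vray x i k" "s *. u' = a *. vray x j l"
  have "u = (s * a) *. vray x i k" "u' = (s * a) *. vray x j l" using h(3,4) ss by (metis scaleR_scaleR)+
  then show ?thesis using fnorm_vopp[OF i h(2), of "s * a"] ui(2) by simp
 qed
 note F1 = this
 have c: "cross2 u' n ~= 0" using sg by auto
 have v: "nu (Fn j) (hp u' (- (s *. n))) = A"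
  by (rule val[OF j u' e sg]) (rule translate_pos(1)[OF j s u' c t])
 obtain \<gamma> where \<gamma>: "extends_translate M x s j u' n \<gamma>" "has_rotation M x (- s) \<gamma> A"
  "\<And>\<gamma>'. extends_translate M x s j u' n \<gamma>' ==> \<gamma>' = \<gamma>"
  using side_geodesic[OF j s u' F1 c t] unfolding v by blast
 have "has_rotation M x (- s) \<gamma>' A" if "extends_translate M x s j u' n \<gamma>'" for \<gamma>' using \<gamma>(2) \<gamma>(3)[OF that] by simp
 then show "(\<exists>\<gamma>. extends_translate M x s j u' n \<gamma>) \<and> (\<forall>\<gamma>. extends_translate M x s j u' n \<gamma> --> has_rotation M x (- s) \<gamma> A)"
  using \<gamma>(1) by blast
qed

text \<open>Inside a cone the left and right translates give complementary half planes of one chart.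
  On a common ray they lie in two adjacent cones, and \<open>vertex_half\<close> moves one of the
  half planes into the other chart, where the two are complementary.\<close>

lemma side_sum:
 assumes o: "cone_orientation M x \<epsilon>" and i: "i \<in> star M x" and s: "s = 1 \<or> s = -1" and u: "u \<in> indicatrix M s x i"
 shows "\<exists>A B. side_rotation M x \<epsilon> s i u 1 A \<and> side_rotation M x \<epsilon> s i u (-1) B \<and> A + B = nu (Fn i) UNIV"
proof -
 note mk = mink
 interpret minkowski "Fn i" by (rule mink[OF i])
 have ui: "s *. u \<in> tcone M x i" "Fn i u = 1" using u by (auto simp: indicatrix_def)
 have u0: "u ~= 0" and su: "s *. u ~= 0" using ui(2) s by auto
 have ss: "s *. s *. v = v" "s * (s * r) = r" for v :: "real^2" and r :: real using s by auto
 have e1: "\<epsilon> j = 1 \<or> \<epsilon> j = -1" if "j \<in> star M x" for j using o that by (auto simp: cone_orientation_def)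
 show ?thesis
 proof (cases "\<exists>k. hgt i k (s *. u) = 0")
  case False
  \<comment> \<open>The quarter turn of \<open>u\<close>; up to sign it represents every translation
    to a given side.\<close>
  define m where "m = (vector [- (u$2), u$1] :: real^2)"
  have "cross2 u m = (u$1)\<^sup>2 + (u$2)\<^sup>2" by (simp add: cross2_def m_def power2_eq_square)
  then have cm: "0 < cross2 u m" using u0 by (auto simp: vec2_eq_iff sum_power2_gt_zero_iff)
  define A where "A \<sigma> = nu (Fn i) (hp u ((- (s * \<sigma> * \<epsilon> i)) *. m))" for \<sigma> :: real
  have "side_rotation M x \<epsilon> s i u \<sigma> (A \<sigma>)" for \<sigma>
  proof (rule side_rotationI[OF i s u])
   fix j u' n assume j: "j \<in> star M x" and u': "s *. u' \<in> tcone M x j" and e: "tpoint M x j (s *. u') = tpoint M x i (s *. u)"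
    and sg: "0 < \<sigma> * (\<epsilon> j * cross2 u' n)"
   show "nu (Fn j) (hp u' (- (s *. n))) = A \<sigma>"
   proof (rule rep_cases[OF i j ui(1) su u' e])
    assume h: "j = i" "s *. u' = s *. u"
    then have uu: "u' = u" using ss(1) by metis
    have "cross2 u (- (s *. n)) * cross2 u ((- (s * \<sigma> * \<epsilon> i)) *. m) = (s * (s * (\<sigma> * (\<epsilon> i * cross2 u n)))) * cross2 u m"
     by (simp add: mult_ac)
    also have "\<dots> > 0" unfolding ss(2) using sg cm h uu by simp
    finally show ?thesis unfolding A_def h(1) uu using hp_cong by metis
   next
    fix k l a assume "s *. u = a *. vray x i k"
    then show ?thesis using False by (metis mult_zero_right tc.hgt_lin(3) tc.hgt_ray(1))
   qed
  qed
  moreover have "A 1 + A (-1) = nu (Fn i) UNIV"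
  proof -
   have "cross2 u ((- (s * \<epsilon> i)) *. m) ~= 0" using cm s e1[OF i] by auto
   from nu_hp_compl[OF this] show ?thesis by (simp add: A_def)
  qed
  ultimately show ?thesis by blast
 next
  case True
  then obtain k where k: "hgt i k (s *. u) = 0" by blast
  obtain j0 l0 where o0: "vopp x i k = (j0, l0)" by fastforce
  note j0 = vopp_star[OF i o0]
  have "cross2 (vray x i k) (s *. u) = 0" using k tip(3)[OF i, of k] by (simp add: tc.hgt_def)
  then obtain a where a: "s *. u = a *. vray x i k" using cross2_eq_0_iff[OF ray_nz[OF i]] by blast
  have "hgt i (\<not> k) (s *. u) = a" unfolding a using i tc.hgt_ray(3)[of i k] by simp
  then have a0: "0 < a" using mem_tcone[OF i, of "s *. u" k] ui(1) su a by (cases "a = 0") auto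
  define D where "D j l = \<epsilon> j * cross2 (vray x j l) (vray x j (\<not> l))" for j l
  have D0: "D j l ~= 0" if "j \<in> star M x" for j l using e1[OF that] tip(3)[OF that, of l] by (auto simp: D_def)
  define V where "V j l = nu (Fn j) (hp (vray x j l) (- (s *. vray x j (\<not> l))))" for j l
  \<comment> \<open>Coherence of the orientation: the two cones lie on opposite sides of the common
    ray, so exactly one of them receives the left translates.\<close>
  have opposite: "D i k * D j0 l0 < 0"
  proof -
   have in': "vray x j l \<in> tcone M x j" if "j \<in> star M x" for j l using ray_in_tcone[OF that, of 1 l] by simp
   have "tpoint M x i (vray x i k) = tpoint M x j0 (vray x j0 l0)"
    using tpoint_eq_iff[OF i _ _ in'[OF i] in', of j0 k l0] j0 o0 zero_less_one[where 'a=real] by (metis scaleR_one)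
   then have "D i k * D j0 l0 <= 0"
    using o[unfolded cone_orientation_def, THEN conjunct2, rule_format, of i j0 "vray x i k" "vray x j0 l0" "vray x i (\<not> k)" "vray x j0 (\<not> l0)"]
     i j0 in' ray_nz[OF i] by (auto simp: D_def)
   then show ?thesis using D0[OF i, of k] D0[of j0 l0] j0 by (auto simp: less_le)
  qed
  \<comment> \<open>A translate that runs inside cone \<open>j\<close> lies on the side of the other
    ray of \<open>j\<close>, so that ray can replace \<open>n\<close> in the half plane.\<close>
  have gen: "nu (Fn j) (hp u' (- (s *. n))) = V j l \<and> (0 < \<sigma> * (\<epsilon> j * cross2 u' n) --> 0 < \<sigma> * s * D j l)"
   if j: "j \<in> star M x" and u': "s *. u' = a *. vray x j l" and p: "0 < hgt j l (n + s *. u')" for j l u' n \<sigma>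
  proof -
   have n: "0 < cross2 (vray x j l) n / cross2 (vray x j l) (vray x j (\<not> l))" (is "0 < ?c / ?d")
    using p unfolding u' by (simp add: tc.hgt_def cross2_add)
   have uu: "u' = (s * a) *. vray x j l" using u' ss(1) by (metis scaleR_scaleR)
   have cu: "cross2 u' w = s * a * cross2 (vray x j l) w" for w by (simp add: uu)
   have "hp u' (- (s *. n)) = hp (vray x j l) (- (s *. vray x j (\<not> l)))"
   proof (rule set_eqI)
    fix w
    let ?w = "cross2 (vray x j l) w"
    have "cross2 u' (- (s *. n)) * cross2 u' w = (a * a) * (?c / ?d) * (s * (s * (- (s * ?d) * ?w)))"
     using n unfolding cu by (auto simp: field_simps)
    also have "\<dots> = (a * a * (?c / ?d)) * (cross2 (vray x j l) (- (s *. vray x j (\<not> l))) * ?w)" unfolding ss(2) by simp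
    finally have E: "cross2 u' (- (s *. n)) * cross2 u' w =
     (a * a * (?c / ?d)) * (cross2 (vray x j l) (- (s *. vray x j (\<not> l))) * ?w)" .
    have K: "0 < a * a * (?c / ?d)" by (intro mult_pos_pos a0 n)
    show "w \<in> hp u' (- (s *. n)) \<longleftrightarrow> w \<in> hp (vray x j l) (- (s *. vray x j (\<not> l)))"
     unfolding hp_def mem_Collect_eq E by (rule nonneg_cmult_iff[OF K])
   qed
   moreover have "0 < \<sigma> * s * D j l" if sg: "0 < \<sigma> * (\<epsilon> j * cross2 u' n)"
   proof -
    have "\<sigma> * (\<epsilon> j * cross2 u' n) = (a * (?c / ?d)) * (\<sigma> * s * D j l)" using n unfolding cu D_def by (auto simp: field_simps)
    then have "0 < (a * (?c / ?d)) * (\<sigma> * s * D j l)" using sg by metis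
    then show ?thesis by (rule zero_less_mult_pos) (rule mult_pos_pos[OF a0 n])
   qed
   ultimately show ?thesis by (simp add: V_def)
  qed
  \<comment> \<open>The sign tells which of the two cones contains the translates to the side
    \<open>\<sigma>\<close>.\<close>
  define A where "A \<sigma> = (if 0 < \<sigma> * s * D i k then V i k else V j0 l0)" for \<sigma> :: real
  have "side_rotation M x \<epsilon> s i u \<sigma> (A \<sigma>)" for \<sigma>
  proof (rule side_rotationI[OF i s u])
   fix j u' n assume j: "j \<in> star M x" and u': "s *. u' \<in> tcone M x j" and e: "tpoint M x j (s *. u') = tpoint M x i (s *. u)"
    and sg: "0 < \<sigma> * (\<epsilon> j * cross2 u' n)" and p: "\<And>k. 0 < hgt j k (n + s *. u')"
   show "nu (Fn j) (hp u' (- (s *. n))) = A \<sigma>"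
   proof (rule rep_cases[OF i j ui(1) su u' e])
    assume h: "j = i" "s *. u' = s *. u"
    have gv: "nu (Fn i) (hp u' (- (s *. n))) = V i k \<and> (0 < \<sigma> * (\<epsilon> i * cross2 u' n) --> 0 < \<sigma> * s * D i k)"
     by (rule gen[OF i]) (use h(2) a p[of k, unfolded h(1)] in \<open>simp_all only:\<close>)
    then show ?thesis using sg unfolding h(1) A_def by simp
   next
    fix k' l b assume h: "0 < b" "vopp x i k' = (j, l)" "s *. u = b *. vray x i k'" "s *. u' = b *. vray x j l"
    have eq: "a *. vray x i k = b *. vray x i k'" using a h(3) by simp
    have "cross2 (vray x i k) (b *. vray x i k') = 0" unfolding eq[symmetric] by simp
    then have "k' = k" using tip(3)[OF i, of k] h(1) by (cases k'; cases k; simp)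
    then have "b = a" using eq ray_nz[OF i] by simp
    then have jj: "j = j0" "s *. u' = a *. vray x j0 l0" using h o0 \<open>k' = k\<close> by auto
    have "nu (Fn j0) (hp u' (- (s *. n))) = V j0 l0 \<and> (0 < \<sigma> * (\<epsilon> j0 * cross2 u' n) --> 0 < \<sigma> * s * D j0 l0)"
     by (rule gen[OF conjunct1[OF j0] jj(2) p[of l0, unfolded jj(1)]])
    then have "nu (Fn j) (hp u' (- (s *. n))) = V j0 l0" "0 < \<sigma> * s * D j0 l0" using sg unfolding jj(1) by blast+
    moreover have "\<not> 0 < \<sigma> * s * D i k" using opposite calculation(2) by (auto simp: zero_less_mult_iff mult_less_0_iff)
    ultimately show ?thesis by (simp add: A_def)
   qed
  qed
  moreover have "A 1 + A (-1) = V i k + V j0 l0" using D0[OF i, of k] s by (auto simp: A_def zero_less_mult_iff mult_less_0_iff)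
  moreover have "V i k + V j0 l0 = nu (Fn i) UNIV"
  proof -
   interpret J: minkowski "Fn j0" by (rule mk[OF conjunct1[OF j0]])
   note vh = vertex_half[OF i o0] and t = tip(3)[OF i, of k] tip(3)[of j0 l0]
   show ?thesis using s vh nu_hp_compl[OF t(1)] J.nu_hp_compl[OF t(2)] j0 by (auto simp: V_def)
  qed
  ultimately show ?thesis by metis
 qed
qed

lemma dir_curvature:
 assumes i: "i \<in> star M x" and s: "s = 1 \<or> s = -1" and u: "u \<in> indicatrix M s x i"
 shows "has_dir_curvature M x s i u (nu (Fn i) UNIV - total_angle M (- s) x)"
proof -
 obtain \<epsilon> where o: "cone_orientation M x \<epsilon>" using orientation_ex by blast
 show ?thesis unfolding has_dir_curvature_def using o side_sum[OF o i s u] by metis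
qed

text \<open>\<open>side_rotation\<close> would hold for every value if there were no admissible
  translate, so the definite description in \<open>curvature\<close> needs one unit vector with
  explicit translates to both sides. It is taken in the direction of the sum of the two rays, where
  both heights are equal.\<close>

lemma dir_curvature_unique:
 assumes i: "i \<in> star M x"
 shows "\<exists>u\<in>indicatrix M 1 x i. \<forall>k. has_dir_curvature M x 1 i u k --> k = nu (Fn i) UNIV - total_angle M (-1) x"
proof -
 interpret minkowski "Fn i" by (rule mink[OF i])
 define w where "w = vray x i False + vray x i True"
 have hw: "hgt i k w = 1" for k using i tc.hgt_ray[of i k] tc.hgt_ray[of i "\<not> k"] unfolding w_def by (cases k) auto
 have w0: "w ~= 0" using hw[of True] by auto
 define f where "f = Fn i w"
 have f: "0 < f" unfolding f_def by (rule pos'[OF w0])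
 define u where "u = (1 / f) *. w"
 have Fu: "Fn i u = 1" using f w0 by (simp add: u_def hom f_def)
 have hu: "hgt i k u = 1 / f" for k unfolding u_def by (simp add: hw)
 have ut: "u \<in> tcone M x i" unfolding mem_tcone[OF i, of _ True] hu using f by simp
 then have ui: "u \<in> indicatrix M 1 x i" using Fu by (simp add: indicatrix_def)
 define m where "m = vray x i True"
 have cm: "cross2 u m ~= 0" using tip(3)[OF i, of False] f by (simp add: u_def m_def w_def cross2_add)
 have hm: "\<bar>hgt i k m\<bar> <= 1" for k using i tc.hgt_ray[of i True] unfolding m_def by (cases k) auto
 have val: "A = nu (Fn i) (hp u ((- (\<sigma> * \<epsilon> i * cross2 u m)) *. m))"
  if o: "cone_orientation M x \<epsilon>" and sr: "side_rotation M x \<epsilon> 1 i u \<sigma> A" and \<sigma>: "\<sigma> = 1 \<or> \<sigma> = -1" for \<epsilon> \<sigma> A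
 proof -
  have e1: "\<epsilon> i = 1 \<or> \<epsilon> i = -1" using o i by (auto simp: cone_orientation_def)
  obtain \<delta> where \<delta>: "\<delta> > 0" and all: "\<And>j u' n. j \<in> star M x \<and> 1 *. u' \<in> tcone M x j \<and> tpoint M x j (1 *. u') = tpoint M x i (1 *. u) \<and>
    norm n < \<delta> \<and> 0 < \<sigma> * (\<epsilon> j * cross2 u' n) \<and> translatable M x 1 j u' n ==>
    (\<forall>\<gamma>. extends_translate M x 1 j u' n \<gamma> --> has_rotation M x (- 1) \<gamma> A)"
   using sr unfolding side_rotation_def by blast
  \<comment> \<open>The first bound keeps the translate in the cone at times within 1/2 of 1, where
    the heights of the ray are at least \<open>1 / (2 * f)\<close>; the second one makes
    \<open>norm n < \<delta>\<close>.\<close>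
  define \<rho> where "\<rho> = min (1 / (4 * f)) (\<delta> / (2 * (norm m + 1)))"
  have \<rho>: "0 < \<rho>" "\<rho> <= 1 / (4 * f)" "\<rho> <= \<delta> / (2 * (norm m + 1))" using f \<delta> by (auto simp: \<rho>_def add_nonneg_pos)
  define z where "z = \<sigma> * \<epsilon> i * sgn (cross2 u m)"
  have z: "z = 1 \<or> z = -1" using \<sigma> e1 cm by (auto simp: z_def sgn_if)
  define n where "n = (\<rho> * z) *. m"
  have "norm n = \<rho> * norm m" using z \<rho>(1) by (auto simp: n_def)
  also have "\<dots> <= \<delta> / (2 * (norm m + 1)) * (norm m + 1)" using \<rho>(1,3) by (intro mult_mono) auto
  also have "\<dots> = \<delta> / 2" using add_nonneg_pos[OF norm_ge_zero[of m] zero_less_one] by (simp add: field_simps)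
  finally have nn: "norm n < \<delta>" using \<delta> by simp
  have "\<sigma> * (\<epsilon> i * cross2 u n) = \<rho> * \<bar>cross2 u m\<bar>"
   using \<sigma> e1 by (auto simp: n_def z_def abs_sgn)
  then have sg: "0 < \<sigma> * (\<epsilon> i * cross2 u n)" using \<rho>(1) cm by simp
  then have cn: "cross2 u n ~= 0" by auto
  have tr: "translatable M x 1 i u n"
   unfolding translatable_def
  proof (intro exI[of _ "1/2"] conjI allI impI)
   fix t :: real assume t: "\<bar>t - 1\<bar> < 1 / 2"
   have "0 <= hgt i k (t *. u + n)" for k
   proof -
    have "\<bar>\<rho> * z * hgt i k m\<bar> <= \<rho> * 1" unfolding abs_mult using \<rho>(1) z hm[of k] by (intro mult_mono) auto
    moreover have "1 / 2 * (1 / f) <= t * (1 / f)"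
     using t f by (intro mult_right_mono) (linarith, simp)
    moreover have "\<rho> <= 1 / 4 * (1 / f)" using \<rho>(2) by simp
    moreover have "0 < 1 / f" using f by simp
    moreover have "hgt i k (t *. u + n) = t * (1 / f) + \<rho> * z * hgt i k m" unfolding tc.hgt_lin hu n_def by simp
    ultimately show ?thesis by linarith
   qed
   then show "t *. u + n \<in> tcone M x i" unfolding mem_tcone[OF i, of _ True] by blast
  qed simp
  have ut1: "1 *. u \<in> tcone M x i" using ut by simp
  obtain \<gamma> where \<gamma>: "extends_translate M x 1 i u n \<gamma>" "has_rotation M x (- 1) \<gamma> (nu (Fn i) (hp u (- (1 *. n))))"
   using side_geodesic[OF i disjI1[OF refl] ut1 Fu cn tr] by blast
  have "has_rotation M x (- 1) \<gamma> A" using all[of i u n] i ut1 nn sg tr \<gamma>(1) by blast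
  then have "A = nu (Fn i) (hp u (- (1 *. n)))"
   by (rule rotation_unique[OF _ \<gamma>(2)]) (use \<gamma>(1) in \<open>auto simp: extends_translate_def\<close>)
  moreover have "hp u (- (1 *. n)) = hp u ((- (\<sigma> * \<epsilon> i * cross2 u m)) *. m)"
  proof (rule hp_cong)
   have "cross2 u (- (1 *. n)) * cross2 u ((- (\<sigma> * \<epsilon> i * cross2 u m)) *. m) = (\<sigma> * (\<epsilon> i * cross2 u n)) * (cross2 u m)\<^sup>2"
    by (simp add: power2_eq_square)
   also have "\<dots> > 0" using sg cm by simp
   finally show "0 < cross2 u (- (1 *. n)) * cross2 u ((- (\<sigma> * \<epsilon> i * cross2 u m)) *. m)" .
  qed
  ultimately show ?thesis by simp
 qed
 have "k = nu (Fn i) UNIV - total_angle M (-1) x" if "has_dir_curvature M x 1 i u k" for k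
 proof -
  obtain \<epsilon> A B where h: "cone_orientation M x \<epsilon>" "side_rotation M x \<epsilon> 1 i u 1 A" "side_rotation M x \<epsilon> 1 i u (-1) B"
   "k = A + B - total_angle M (- 1) x" using \<open>has_dir_curvature M x 1 i u k\<close> unfolding has_dir_curvature_def by blast
  have e1: "\<epsilon> i = 1 \<or> \<epsilon> i = -1" using h(1) i by (auto simp: cone_orientation_def)
  let ?z = "(- (1 * \<epsilon> i * cross2 u m)) *. m"
  have "A = nu (Fn i) (hp u ?z)" "B = nu (Fn i) (hp u (- ?z))" using val[OF h(1,2)] val[OF h(1,3)] by auto
  moreover have "cross2 u ?z ~= 0" using e1 cm by auto
  ultimately show ?thesis using nu_hp_compl[of u ?z] h(4) by simp
 qed
 then show ?thesis using ui by blast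
qed

lemma total_angle_sec:
 "total_angle M 1 x = (\<Sum>i\<in>star M x. nu (Fn i) (sec (vray x i False) (vray x i True)))"
 "total_angle M (-1) x = (\<Sum>i\<in>star M x. nu (Fn i) (sec (- vray x i False) (- vray x i True)))"
proof -
 have tc': "tcone M x i = sec (vray x i False) (vray x i True)" if "i \<in> star M x" for i
  using tip(3)[OF that, of False] by (simp add: tcone_eq[OF that] sec_eq)
 have sc: "c *. w \<in> sec p q" if "0 < c" "w \<in> sec p q" for c w p q
 proof -
  have "cross2 p q * cross2 p (c *. w) = c * (cross2 p q * cross2 p w)" "cross2 p q * cross2 (c *. w) q = c * (cross2 p q * cross2 w q)" by simp_all
  then show ?thesis using that(2) unfolding sec_def mem_Collect_eq by (simp only: nonneg_cmult_iff[OF that(1)])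
 qed
 have "ind_arclen (Fn i) (indicatrix M 1 x i) = nu (Fn i) (sec (vray x i False) (vray x i True))" if i: "i \<in> star M x" for i
 proof -
  interpret minkowski "Fn i" by (rule mink[OF i])
  show ?thesis unfolding indicatrix_def tc'[OF i] scaleR_one by (rule ind_arclen_nu[OF sc])
 qed
 then show "total_angle M 1 x = (\<Sum>i\<in>star M x. nu (Fn i) (sec (vray x i False) (vray x i True)))"
  unfolding total_angle_def by simp
 have "ind_arclen (Fn i) (indicatrix M (-1) x i) = nu (Fn i) (sec (- vray x i False) (- vray x i True))" if i: "i \<in> star M x" for i
 proof -
  interpret minkowski "Fn i" by (rule mink[OF i])
  have "indicatrix M (-1) x i = {u. u \<in> sec (- vray x i False) (- vray x i True) \<and> Fn i u = 1}"
   unfolding indicatrix_def tc'[OF i] mem_sec_uminus by simp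
  then show ?thesis using ind_arclen_nu[OF sc] by simp
 qed
 then show "total_angle M (-1) x = (\<Sum>i\<in>star M x. nu (Fn i) (sec (- vray x i False) (- vray x i True)))"
  unfolding total_angle_def by simp
qed

text \<open>In one cone the two angles differ by the excess of its two half planes over a full turn, and
 these excesses cancel at the common rays.\<close>

lemma total_angle_sign: "total_angle M 1 x = total_angle M (-1) x"
proof -
 define h where "h i k = nu (Fn i) (hp (vray x i k) (vray x i (\<not> k)))" for i k
 \<comment> \<open>The excess of the half plane at one ray over half a full turn. The angle of a
   cone minus that of its negative is the sum of the excesses at its two rays.\<close>
 define g where "g f = h (fst f) (snd f) - nu (Fn (fst f)) UNIV / 2" for f
 have one: "nu (Fn i) (sec (vray x i False) (vray x i True)) - nu (Fn i) (sec (- vray x i False) (- vray x i True)) = (\<Sum>k\<in>UNIV. g (i, k))"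
  if i: "i \<in> star M x" for i
 proof -
  interpret minkowski "Fn i" by (rule mink[OF i])
  let ?p = "vray x i False" and ?q = "vray x i True"
  have c: "cross2 ?p ?q ~= 0" "cross2 ?q ?p ~= 0" "cross2 ?p (- ?q) ~= 0" using tip(3)[OF i, of False] tip(3)[OF i, of True] by auto
  have "(\<Sum>k\<in>UNIV. g (i, k)) = nu (Fn i) (hp ?p ?q) + nu (Fn i) (hp ?q ?p) - nu (Fn i) UNIV"
   by (simp add: UNIV_bool g_def h_def)
  then show ?thesis
   using nu_hp_split[OF c(1)] nu_hp_split[OF c(2)] nu_hp_split[OF c(3)] nu_hp_compl[OF c(1)]
    sec_commute[of ?p ?q] sec_commute[of "- ?p" "- ?q"] by simp
 qed
 let ?S = "star M x \<times> (UNIV :: bool set)"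
 let ?v = "\<lambda>f. vopp x (fst f) (snd f)"
 have inv: "?v f \<in> ?S \<and> ?v (?v f) = f \<and> g (?v f) = - g f" if fS: "f \<in> ?S" for f
 proof -
  obtain i k where f: "f = (i, k)" "i \<in> star M x" using fS by auto
  obtain j l where o: "vopp x i k = (j, l)" by fastforce
  interpret minkowski "Fn i" by (rule mink[OF f(2)])
  have "h j l = nu (Fn i) UNIV - h i k"
   using vertex_half(1)[OF f(2) o] nu_hp_compl[OF tip(3)[OF f(2), of k]] by (simp add: h_def)
  then have "g (j, l) = - g (i, k)" using vertex_half(2)[OF f(2) o] by (simp add: g_def)
  then show ?thesis using vopp_star[OF f(2) o] o f by auto
 qed
 \<comment> \<open>Gluing permutes the flags and changes the sign of the excess, so the sum equals
   its own negative.\<close>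
 have "bij_betw ?v ?S ?S" by (rule bij_betw_byWitness[where f' = ?v]) (use inv in blast)+
 then have "sum g ?S = (\<Sum>f\<in>?S. g (?v f))" by (rule sum.reindex_bij_betw[symmetric])
 also have "\<dots> = (\<Sum>f\<in>?S. - g f)" by (rule sum.cong[OF refl]) (use inv in blast)
 finally have "sum g ?S = 0" by (simp add: sum_negf)
 moreover have "sum g ?S = (\<Sum>i\<in>star M x. \<Sum>k\<in>UNIV. g (i, k))"
  by (simp add: sum.cartesian_product)
 moreover have "total_angle M 1 x - total_angle M (-1) x = (\<Sum>i\<in>star M x. \<Sum>k\<in>UNIV. g (i, k))"
  unfolding total_angle_sec sum_subtractf[symmetric] by (rule sum.cong[OF refl]) (rule one)
 ultimately show ?thesis by simp
qed

text \<open>The two total angles are equal. They are written symmetrically for the sum over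
  triangles, where the corner cones tile the plane only together with their negatives.\<close>

lemma curvature_vertex:
 assumes const: "\<And>i. i \<in> star M x ==> nu (Fn i) UNIV = \<theta>"
 shows "2 * curvature M x = 2 * \<theta> - total_angle M 1 x - total_angle M (-1) x"
proof -
 obtain m p where m: "m \<in> pieces M" "p \<in> corners (Rg m)" "x = ch m p" using vert by (auto simp: vertices_alt)
 then have ms: "m \<in> star M x" using corner_reg by (auto simp: star_def piece_def)
 have "curvature M x = (THE k. \<forall>s\<in>{1, -1}. \<forall>i\<in>star M x. \<forall>u\<in>indicatrix M s x i. has_dir_curvature M x s i u k)"
  using vert by (simp add: curvature_def)
 also have "\<dots> = \<theta> - total_angle M (-1) x"
 proof (rule the_equality)
  show "\<forall>s\<in>{1, -1}. \<forall>i\<in>star M x. \<forall>u\<in>indicatrix M s x i. has_dir_curvature M x s i u (\<theta> - total_angle M (-1) x)"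
   using dir_curvature const total_angle_sign by force
  fix k assume k: "\<forall>s\<in>{1, -1}. \<forall>i\<in>star M x. \<forall>u\<in>indicatrix M s x i. has_dir_curvature M x s i u k"
  obtain u where "u \<in> indicatrix M 1 x m" "has_dir_curvature M x 1 m u k ==> k = nu (Fn m) UNIV - total_angle M (-1) x"
   using dir_curvature_unique[OF ms] by blast
  then show "k = \<theta> - total_angle M (-1) x" using k ms const[OF ms] by simp
 qed
 finally show ?thesis using total_angle_sign by simp
qed

end

section \<open>Constancy of the total angle\<close>

context pf_surface
begin

lemma piece_ne: "i \<in> pieces M ==> piece M i ~= {}"
proof -
 assume i: "i \<in> pieces M"
 have "corners (Rg i) ~= {}" using corners_simplex(1)[OF simp_i[OF i]] by auto
 then show ?thesis using corner_reg[OF i] by (auto simp: piece_def)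
qed

text \<open>A finite subcover by open sets that meet finitely many pieces each accounts for all
  pieces, since none of them is empty.\<close>

lemma finite_pieces:
 assumes "compact_space (topo M)"
 shows "finite (pieces M)"
proof -
 define C where "C = {U. openin (topo M) U \<and> finite {i \<in> pieces M. piece M i \<inter> U ~= {}}}"
 have "topspace (topo M) \<subseteq> \<Union>C"
 proof
  fix y assume "y \<in> topspace (topo M)"
  then obtain U where "openin (topo M) U" "y \<in> U" "finite {i \<in> pieces M. piece M i \<inter> U ~= {}}"
   using pf by (auto simp: pf_finsler_surface_def)
  then show "y \<in> \<Union>C" by (auto simp: C_def)
 qed
 moreover have "\<forall>U\<in>C. openin (topo M) U" by (auto simp: C_def)
 ultimately obtain D where D: "finite D" "D \<subseteq> C" "topspace (topo M) \<subseteq> \<Union>D"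
  using assms unfolding compact_space_alt by metis
 have "pieces M \<subseteq> (\<Union>U\<in>D. {i \<in> pieces M. piece M i \<inter> U ~= {}})"
 proof
  fix i assume i: "i \<in> pieces M"
  obtain y where y: "y \<in> piece M i" using piece_ne[OF i] by blast
  then have "y \<in> \<Union>D" using cover i D(3) by blast
  then show "i \<in> (\<Union>U\<in>D. {i \<in> pieces M. piece M i \<inter> U ~= {}})" using y i by blast
 qed
 moreover have "finite (\<Union>U\<in>D. {i \<in> pieces M. piece M i \<inter> U ~= {}})" using D(1,2) by (auto simp: C_def)
 ultimately show ?thesis by (rule finite_subset)
qed

lemma piece_not_isolated:
 assumes V: "openin (topo M) V" "y \<in> V" and j: "j \<in> pieces M" "y \<in> piece M j"
 shows "\<exists>z\<in>V. z \<in> piece M j \<and> z ~= y"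
proof -
 obtain q where q: "q \<in> Rg j" "y = ch j q" using j(2) by (auto simp: piece_def)
 have "card (corners (Rg j)) = 3" by (rule corners_simplex(1)[OF simp_i[OF j(1)]])
 then have "\<not> corners (Rg j) \<subseteq> {q}" using card_mono[of "{q}" "corners (Rg j)"] by auto
 then obtain q' where q': "q' \<in> Rg j" "q' ~= q" using corner_reg[OF j(1)] by blast
 define f where "f t = q + t *. (q' - q)" for t :: real
 have conv: "convex (Rg j)" using corners_simplex(2)[OF simp_i[OF j(1)]] convex_convex_hull by metis
 have fr: "f t \<in> Rg j" if "t \<in> {0..1}" for t
 proof -
  have "f t = (1 - t) *. q + t *. q'" by (simp add: f_def algebra_simps)
  then show ?thesis using convexD_alt[OF conv q(1) q'(1), of t] that by simp
 qed
 have "continuous_on {0..1} f" unfolding f_def by (intro continuous_intros)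
 then have "continuous_map (top_of_set {0..1}) (top_of_set (Rg j)) f" using fr by auto
 from continuous_map_compose[OF this ch_cont[OF j(1)]]
 have "openin (top_of_set {0..1}) {t \<in> topspace (top_of_set {0..1}). (ch j \<circ> f) t \<in> V}"
  by (rule openin_continuous_map_preimage[OF _ V(1)])
 then have op: "openin (top_of_set {0..1}) {t \<in> {0..1}. ch j (f t) \<in> V}" by simp
 have "ch j (f 0) \<in> V" using V(2) q by (simp add: f_def)
 moreover have "(0::real) \<in> {0..1}" by simp
 ultimately have zero: "0 \<in> {t \<in> {0..1}. ch j (f t) \<in> V}" by (intro CollectI conjI)
 from op[unfolded openin_contains_ball, THEN conjunct2, THEN bspec, OF zero]
 obtain r where r: "r > 0" "ball 0 r \<inter> {0..1} \<subseteq> {t \<in> {0..1}. ch j (f t) \<in> V}" by (elim exE conjE)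
 define t where "t = min (r / 2) 1"
 have t: "0 < t" "t \<in> {0..1}" "t \<in> ball 0 r \<inter> {0..1}" using r(1) by (auto simp: t_def)
 have "ch j (f t) \<in> V" using r(2) t(3) by blast
 moreover have "ch j (f t) ~= y"
 proof
  assume "ch j (f t) = y"
  then have "f t = q" using piece_inj[OF j(1) fr[OF t(2)] q(1)] q(2) by simp
  then show False using t(1) q'(2) by (simp add: f_def)
 qed
 ultimately show ?thesis using fr[OF t(2)] by (auto simp: piece_def)
qed

text \<open>A point common to two closed unions of pieces that meet only in isolated points would cut a
 small disc around it into two parts.\<close>

lemma colour_constant:
 fixes \<theta> :: "'i => 'c"
 assumes fin: "finite (pieces M)" and con: "connected_space (topo M)"
  and adj: "\<And>i P Q j P' Q'. adj i P Q j P' Q' ==> \<theta> i = \<theta> j" and ij: "i \<in> pieces M" "j \<in> pieces M"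
 shows "\<theta> i = \<theta> j"
proof (rule ccontr)
 assume ne: "\<theta> i ~= \<theta> j"
 define A where "A = (\<Union>m\<in>{m \<in> pieces M. \<theta> m = \<theta> i}. piece M m)"
 define B where "B = (\<Union>m\<in>{m \<in> pieces M. \<theta> m ~= \<theta> i}. piece M m)"
 have cl: "closedin (topo M) A" "closedin (topo M) B"
  unfolding A_def B_def using fin by (auto intro!: closedin_Union closed_piece)
 have cov: "topspace (topo M) \<subseteq> A \<union> B" using cover by (auto simp: A_def B_def)
 have nemp: "A ~= {}" "B ~= {}" using ij ne piece_ne by (auto simp: A_def B_def)
 \<comment> \<open>Pieces of different colour have at most one point in common, because a common
   edge would make them adjacent and hence equally coloured.\<close>
 have single: "z = y" if m: "m \<in> pieces M" "n \<in> pieces M" "\<theta> m ~= \<theta> n" and z: "z \<in> piece M m" "z \<in> piece M n" "y \<in> piece M m" "y \<in> piece M n" for m n y z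
 proof -
  have mn: "m ~= n" using m(3) by auto
  show ?thesis
  proof (rule inter_cases[OF m(1,2) mn])
   assume "piece M m \<inter> piece M n = {}"
   then show ?thesis using z by blast
  next
   fix p q assume A: "piece M m \<inter> piece M n = {ch m p}"
   have "z \<in> {ch m p}" "y \<in> {ch m p}" unfolding A[symmetric] using z by blast+
   then show ?thesis by simp
  next
   fix P Q assume PQ: "P \<in> corners (Rg m)" "Q \<in> corners (Rg m)" "P ~= Q" "piece M m \<inter> piece M n = ch m ` closed_segment P Q"
   have e: "eflag m P Q" using m PQ by (simp add: eflag_def)
   have "P \<in> closed_segment P Q" "Q \<in> closed_segment P Q" by auto
   then have "ch m P \<in> piece M n \<and> ch m Q \<in> piece M n" using PQ(4) by blast
   then obtain P' Q' where "adj m P Q n P' Q'" using adj_intro[OF e m(2)] mn by blast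
   then show ?thesis using adj m(3) by blast
  qed
 qed
 have "A \<inter> B = {}"
 proof (rule ccontr)
  assume "A \<inter> B ~= {}"
  then obtain y a b where ya: "a \<in> pieces M" "\<theta> a = \<theta> i" "y \<in> piece M a" and yb: "b \<in> pieces M" "\<theta> b ~= \<theta> i" "y \<in> piece M b"
   by (auto simp: A_def B_def)
  have yT: "y \<in> topspace (topo M)" using ya cover by blast
  obtain W where W: "openin (topo M) W" "y \<in> W" "\<And>m. m \<in> pieces M ==> piece M m \<inter> W ~= {} ==> y \<in> piece M m"
   by (rule local_nbhd[OF yT]) blast
  obtain U where U: "openin (topo M) U" "y \<in> U" "subtopology (topo M) U homeomorphic_space (euclidean :: (real^2) topology)"
   using surf yT unfolding topological_surface_def by blast
  obtain g g' where gg: "homeomorphic_maps (subtopology (topo M) U) (euclidean :: (real^2) topology) g g'"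
   using U(3) unfolding homeomorphic_space_def by blast
  have UT: "U \<subseteq> topspace (topo M)" by (rule openin_subset[OF U(1)])
  then have tU: "topspace (subtopology (topo M) U) = U" by (auto simp: topspace_subtopology)
  have cg: "continuous_map (subtopology (topo M) U) euclidean g" and cg': "continuous_map euclidean (subtopology (topo M) U) g'"
   and g'g: "\<And>z. z \<in> U ==> g' (g z) = z" and gg': "\<And>p. g (g' p) = p"
   using gg tU by (auto simp: homeomorphic_maps_def)
  have cg'T: "continuous_map euclidean (topo M) g'" using cg' by (simp add: continuous_map_in_subtopology)
  have g'U: "g' p \<in> U" for p using cg' tU by (auto simp: continuous_map_def)
  have "openin euclidean {p \<in> topspace euclidean. g' p \<in> W}" by (rule openin_continuous_map_preimage[OF cg'T W(1)])
  then have "open {p. g' p \<in> W}" by simp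
  moreover have "g y \<in> {p. g' p \<in> W}" using g'g[OF U(2)] W(2) by simp
  ultimately obtain r where r: "r > 0" "ball (g y) r \<subseteq> {p. g' p \<in> W}" using open_contains_ball by blast
  \<comment> \<open>A punctured disc in the plane is connected, whereas the two colours would split
    it into two closed parts.\<close>
  define S where "S = ball (g y) r - {g y}"
  have con: "connected S" unfolding S_def by (rule connected_punctured_ball) simp
  have SW: "g' p \<in> W" "g' p ~= y" if "p \<in> S" for p
  proof -
   show "g' p \<in> W" using that r(2) by (auto simp: S_def)
   show "g' p ~= y" using that gg'[of p] by (auto simp: S_def)
  qed
  have csub: "closedin (top_of_set S) {p \<in> S. g' p \<in> K}" if "closedin (topo M) K" for K
  proof -
   have "continuous_map (top_of_set S) (topo M) g'" by (rule continuous_map_from_subtopology[OF cg'T])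
   from closedin_continuous_map_preimage[OF this \<open>closedin (topo M) K\<close>] show ?thesis by simp
  qed
  \<comment> \<open>Both colours reach the punctured disc, because \<open>y\<close> is not an
    isolated point of any piece that contains it.\<close>
  have meets: "\<exists>p\<in>S. g' p \<in> piece M m" if m: "m \<in> pieces M" "y \<in> piece M m" for m
  proof -
   have "openin (subtopology (topo M) U) {z \<in> topspace (subtopology (topo M) U). g z \<in> ball (g y) r}"
    by (rule openin_continuous_map_preimage[OF cg]) simp
   then have "openin (subtopology (topo M) U) {z \<in> U. g z \<in> ball (g y) r}" unfolding tU .
   then have V: "openin (topo M) {z \<in> U. g z \<in> ball (g y) r}" by (rule openin_trans_full[OF _ U(1)])
   have "y \<in> {z \<in> U. g z \<in> ball (g y) r}" using U(2) r(1) by simp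
   from piece_not_isolated[OF V this m] obtain z where z: "z \<in> U" "g z \<in> ball (g y) r" "z \<in> piece M m" "z ~= y" by blast
   have "g z ~= g y" using g'g[OF z(1)] g'g[OF U(2)] z(4) by auto
   then show ?thesis using z g'g[OF z(1)] by (intro bexI[of _ "g z"]) (auto simp: S_def)
  qed
  have "\<exists>p\<in>S. g' p \<in> A" "\<exists>p\<in>S. g' p \<in> B" using meets[OF ya(1,3)] meets[OF yb(1,3)] ya yb by (auto simp: A_def B_def)
  then have n12: "{p \<in> S. g' p \<in> A} ~= {}" "{p \<in> S. g' p \<in> B} ~= {}" by blast+
  have disj: "{p \<in> S. g' p \<in> A} \<inter> {p \<in> S. g' p \<in> B} = {}"
  proof (rule ccontr)
   assume "{p \<in> S. g' p \<in> A} \<inter> {p \<in> S. g' p \<in> B} ~= {}"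
   then obtain p m n where p: "p \<in> S" "m \<in> pieces M" "\<theta> m = \<theta> i" "g' p \<in> piece M m" "n \<in> pieces M" "\<theta> n ~= \<theta> i" "g' p \<in> piece M n"
    by (auto simp: A_def B_def)
   have "y \<in> piece M m" "y \<in> piece M n" using W(3)[OF p(2)] W(3)[OF p(5)] p SW(1)[OF p(1)] by blast+
   then have "g' p = y" using single[OF p(2,5) _ p(4,7)] p(3,6) by metis
   then show False using SW(2)[OF p(1)] by simp
  qed
  have "S \<subseteq> {p \<in> S. g' p \<in> A} \<union> {p \<in> S. g' p \<in> B}"
   using g'U UT cov by blast
  then show False using con csub[OF cl(1)] csub[OF cl(2)] disj n12 unfolding connected_closedin by blast
 qed
 then show False using con cl cov nemp unfolding connected_space_closedin by blast
qed

section \<open>Total angles at points that are not vertices\<close>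

lemma inner_or_edge:
 assumes i: "i \<in> pieces M" and p: "p \<in> Rg i" "p \<notin> corners (Rg i)"
 obtains P k t where "P \<in> corners (Rg i)" "0 < t" "t < 1" "p = P + t *. (oth (Rg i) P k - P)"
  | P k a b where "P \<in> corners (Rg i)" "0 < a" "0 < b" "a + b < 1"
    "p = P + a *. (oth (Rg i) P k - P) + b *. (oth (Rg i) P (\<not> k) - P)"
proof -
 note T = simp_i[OF i]
 have "corners (Rg i) ~= {}" using corners_simplex(1)[OF T] by auto
 then obtain P where P: "P \<in> corners (Rg i)" by blast
 let ?Q = "oth (Rg i) P True" and ?R = "oth (Rg i) P False"
 have c: "?Q \<in> corners (Rg i)" "?R \<in> corners (Rg i)" "?Q ~= ?R" using oth_corner[OF T P] oth(3)[OF T P, of True] by auto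
 obtain a b where ab: "0 <= a" "0 <= b" "a + b <= 1" "p = P + a *. (?Q - P) + b *. (?R - P)"
  using mem_triangle[OF T P, of p True] p(1) by auto
 have np: "p ~= P" "p ~= ?Q" "p ~= ?R" using p(2) P c by auto
 consider "a = 0" | "b = 0" | "0 < a" "0 < b" "a + b = 1" | "0 < a" "0 < b" "a + b < 1" using ab by linarith
 then show ?thesis
 proof cases
  case 1
  then have "0 < b" "b < 1" using np ab by (auto simp: less_le)
  then show ?thesis using that(1)[OF P, of b False] 1 ab by simp
 next
  case 2
  then have "0 < a" "a < 1" using np ab by (auto simp: less_le)
  then show ?thesis using that(1)[OF P, of a True] 2 ab by simp
 next
  case 3
  \<comment> \<open>The point lies on the edge opposite to \<open>P\<close> and is described from
    the corner \<open>?Q\<close> instead.\<close>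
  obtain l where l: "?R = oth (Rg i) ?Q l" by (rule corner_oth[OF T c])
  have a1: "a = 1 - b" using 3 by simp
  have pe: "p = ?Q + b *. (?R - ?Q)" unfolding ab(4) a1 by (simp add: vec2_eq_iff algebra_simps)
  have b1: "b < 1" using 3 by linarith
  have "p = ?Q + b *. (oth (Rg i) ?Q l - ?Q)" using pe by (simp only: l[symmetric])
  from that(1)[OF c(1) 3(2) b1 this] show ?thesis .
 next
  case 4
  have "p = P + a *. (oth (Rg i) P True - P) + b *. (oth (Rg i) P (\<not> True) - P)" using ab(4) by simp
  from that(2)[OF P 4 this] show ?thesis .
 qed
qed

lemma inner_star:
 assumes i: "i \<in> pieces M" and P: "P \<in> corners (Rg i)" and ab: "0 < a" "0 < b" "a + b < 1"
  and p: "p = P + a *. (oth (Rg i) P k - P) + b *. (oth (Rg i) P (\<not> k) - P)" and nv: "ch i p \<notin> vertices M"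
 shows "star M (ch i p) = {i}" "tcone M (ch i p) i = UNIV"
proof -
 note T = simp_i[OF i]
 let ?E = "oth (Rg i) P k - P" and ?N = "oth (Rg i) P (\<not> k) - P"
 have D: "cross2 ?E ?N ~= 0" by (rule oth(4)[OF T P])
 have pr: "p \<in> Rg i"
  by (rule mem_triangle[OF T P, THEN iffD2], rule exI[of _ a], rule exI[of _ b]) (use p ab in simp)
 have noedge: "p \<notin> closed_segment A B" if AB: "A \<in> corners (Rg i)" "B \<in> corners (Rg i)" "A ~= B" for A B
 proof
  assume "p \<in> closed_segment A B"
  then obtain t where t: "p = A + t *. (B - A)" by (auto simp: segment_param)
  have c: "corners (Rg i) = {P, oth (Rg i) P k, oth (Rg i) P (\<not> k)}" by (rule oth(1)[OF T P])
  have bary: "\<exists>x y. X = P + x *. ?E + y *. ?N \<and> ((x = 0 \<and> y = 0) \<or> (x = 1 \<and> y = 0) \<or> (x = 0 \<and> y = 1))"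
   if X: "X \<in> corners (Rg i)" for X
  proof -
   have "X = P \<or> X = oth (Rg i) P k \<or> X = oth (Rg i) P (\<not> k)" using X unfolding c by blast
   then show ?thesis
   proof (elim disjE)
    assume "X = P"
    then show ?thesis by (intro exI[of _ 0]) simp
   next
    assume "X = oth (Rg i) P k"
    then show ?thesis by (rule_tac exI[of _ 1], rule_tac exI[of _ 0]) simp
   next
    assume "X = oth (Rg i) P (\<not> k)"
    then show ?thesis by (rule_tac exI[of _ 0], rule_tac exI[of _ 1]) simp
   qed
  qed
  obtain x y where xy: "A = P + x *. ?E + y *. ?N" "(x = 0 \<and> y = 0) \<or> (x = 1 \<and> y = 0) \<or> (x = 0 \<and> y = 1)"
   using bary[OF AB(1)] by blast
  obtain x' y' where xy': "B = P + x' *. ?E + y' *. ?N" "(x' = 0 \<and> y' = 0) \<or> (x' = 1 \<and> y' = 0) \<or> (x' = 0 \<and> y' = 1)"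
   using bary[OF AB(2)] by blast
  have "p = P + (x + t * (x' - x)) *. ?E + (y + t * (y' - y)) *. ?N"
   unfolding t xy(1) xy'(1) by (simp add: vec2_eq_iff algebra_simps)
  then have "P + a *. ?E + b *. ?N = P + (x + t * (x' - x)) *. ?E + (y + t * (y' - y)) *. ?N"
   by (rule trans[OF p[symmetric]])
  from bary_unique[OF T P this] have "a = x + t * (x' - x)" "b = y + t * (y' - y)" by blast+
  then show False using xy(2) xy'(2) ab by (elim disjE conjE) auto
 qed
 have "m = i" if m: "m \<in> pieces M" "ch i p \<in> piece M m" for m
 proof (rule ccontr)
  assume ne: "m ~= i"
  have b: "ch i p \<in> piece M i \<inter> piece M m" using m pr by (auto simp: piece_def)
  show False
  proof (rule inter_cases[OF i m(1) ne[symmetric]])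
   fix p' q assume "p' \<in> corners (Rg i)" "piece M i \<inter> piece M m = {ch i p'}"
   then show False using b nv i by (auto simp: vertices_alt)
  next
   fix A B assume AB: "A \<in> corners (Rg i)" "B \<in> corners (Rg i)" "A ~= B" "piece M i \<inter> piece M m = ch i ` closed_segment A B"
   then obtain y where y: "y \<in> closed_segment A B" "ch i p = ch i y" using b by blast
   have "y \<in> Rg i" using y(1) segment_region[OF i AB(1,2)] by (auto simp: segment_param)
   then have "p = y" using piece_inj[OF i pr _ y(2)] by blast
   then show False using y(1) noedge[OF AB(1-3)] by simp
  qed (use b in blast)
 qed
 then show "star M (ch i p) = {i}" using i pr by (auto simp: star_def piece_def)
 show "tcone M (ch i p) i = UNIV"
 proof (rule UNIV_eq_I[symmetric])
  fix w
  obtain x y where w: "w = x *. ?E + y *. ?N" using cross2_decomp[OF D] by metis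
  \<comment> \<open>A scale so large that adding \<open>w / c\<close> leaves all three barycentric
    coordinates of the inner point nonnegative.\<close>
  define c where "c = \<bar>x\<bar> / a + \<bar>y\<bar> / b + (\<bar>x\<bar> + \<bar>y\<bar>) / (1 - a - b) + 1"
  have nn: "0 <= \<bar>x\<bar> / a" "0 <= \<bar>y\<bar> / b" "0 <= (\<bar>x\<bar> + \<bar>y\<bar>) / (1 - a - b)" using ab by auto
  have c: "0 < c" "\<bar>x\<bar> / a <= c" "\<bar>y\<bar> / b <= c" "(\<bar>x\<bar> + \<bar>y\<bar>) / (1 - a - b) <= c" unfolding c_def using nn by linarith+
  then have "\<bar>x\<bar> <= c * a" "\<bar>y\<bar> <= c * b" "\<bar>x\<bar> + \<bar>y\<bar> <= c * (1 - a - b)" using ab by (auto simp: pos_divide_le_eq)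
  then have "0 <= a * c + x" "0 <= b * c + y" "(a * c + x) + (b * c + y) <= c" by (auto simp: algebra_simps abs_le_iff)
  moreover have "a + x / c = (a * c + x) / c" "b + y / c = (b * c + y) / c" using c(1) by (auto simp: field_simps)
  ultimately have "0 <= a + x / c" "0 <= b + y / c" "(a + x / c) + (b + y / c) <= 1"
   using c(1) by (auto simp: add_divide_distrib[symmetric])
  then have "P + (a + x / c) *. ?E + (b + y / c) *. ?N \<in> Rg i" using mem_triangle[OF T P, of _ k] by blast
  moreover have "w = c *. (P + (a + x / c) *. ?E + (b + y / c) *. ?N - coord M (ch i p) i)"
  proof -
   have "P + (a + x / c) *. ?E + (b + y / c) *. ?N - p = (x / c) *. ?E + (y / c) *. ?N"
    unfolding p scaleR_add_left by simp
   then show ?thesis unfolding coord_ch[OF i pr] w using c(1) by (simp add: scaleR_add_right)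
  qed
  ultimately show "w \<in> tcone M (ch i p) i" using less_imp_le[OF c(1)] unfolding tcone_def by blast
 qed
qed

end

context landsberg_surface
begin

lemma arclen_hp:
 assumes i: "i \<in> pieces M" and tc: "tcone M x i = hp e z"
 shows "ind_arclen (Fn i) (indicatrix M 1 x i) = nu (Fn i) (hp e z)"
  "ind_arclen (Fn i) (indicatrix M (-1) x i) = nu (Fn i) (hp e (- z))"
proof -
 interpret minkowski "Fn i" by (rule mink_i[OF i])
 have sc: "c *. w \<in> hp e z" if "0 < c" "w \<in> hp e z" for c w z
 proof -
  have "cross2 e z * cross2 e (c *. w) = c * (cross2 e z * cross2 e w)" by simp
  then show ?thesis using that(2) unfolding hp_def mem_Collect_eq by (simp only: nonneg_cmult_iff[OF that(1)])
 qed
 show "ind_arclen (Fn i) (indicatrix M 1 x i) = nu (Fn i) (hp e z)"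
  unfolding indicatrix_def tc scaleR_one by (rule ind_arclen_nu[OF sc])
 have "indicatrix M (-1) x i = {u. u \<in> hp e (- z) \<and> Fn i u = 1}" unfolding indicatrix_def tc hp_def by simp
 then show "ind_arclen (Fn i) (indicatrix M (-1) x i) = nu (Fn i) (hp e (- z))" using ind_arclen_nu[OF sc] by simp
qed

text \<open>At an edge point the inner half plane of one triangle has the angle of the outer half
  plane of the other, which completes the other's own inner half plane to a full turn. For incoming
  vectors inner and outer are exchanged.\<close>

lemma total_angle_nonvertex:
 assumes x: "x \<in> topspace (topo M)" "x \<notin> vertices M" and s: "s = 1 \<or> s = -1"
  and const: "\<And>i. i \<in> pieces M ==> nu (Fn i) UNIV = \<theta>"
 shows "total_angle M s x = \<theta>"
proof -
 obtain i where i: "i \<in> pieces M" "x \<in> piece M i" using x(1) cover by blast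
 then obtain p where p: "p \<in> Rg i" "x = ch i p" by (auto simp: piece_def)
 have nc: "p \<notin> corners (Rg i)" using x(2) p i by (auto simp: vertices_alt)
 show ?thesis
 proof (rule inner_or_edge[OF i(1) p(1) nc])
  fix P k t assume P: "P \<in> corners (Rg i)" and t: "0 < t" "t < 1" and pe: "p = P + t *. (oth (Rg i) P k - P)"
  let ?Q = "oth (Rg i) P k"
  have e: "eflag i P ?Q" using i(1) P oth(2)[OF simp_i[OF i(1)] P, of k] oth_corner[OF simp_i[OF i(1)] P] by (simp add: eflag_def)
  obtain j P' Q' where a: "adj i P ?Q j P' Q'" using adj_ex[OF e] by blast
  then have e': "eflag j P' Q'" and ij: "i ~= j" by (auto simp: adj_def)
  then have j: "j \<in> pieces M" "P' \<in> corners (Rg j)" "Q' \<in> corners (Rg j)" "P' ~= Q'" by (auto simp: eflag_def)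
  obtain l where l: "Q' = oth (Rg j) P' l" by (rule corner_oth[OF simp_i[OF j(1)] j(2-4)])
  have xj: "x = ch j (P' + t *. (Q' - P'))" using a t pe p(2) by (auto simp: adj_def)
  have pj: "P' + t *. (Q' - P') \<in> Rg j" using segment_region[OF j(1-3)] t by simp
  have xin: "x \<in> piece M j" unfolding xj piece_def by (rule imageI[OF pj])
  have st: "star M x = {i, j}"
  proof -
   have "m = i \<or> m = j" if "m \<in> pieces M" "x \<in> piece M m" for m
    using adj_in[OF a that(1) t] that(2) pe p(2) by simp
   then show ?thesis using i j xin by (auto simp: star_def)
  qed
  have ci: "coord M x i = P + t *. (?Q - P)" using coord_ch[OF i(1) p(1)] p(2) pe by simp
  have cj: "coord M x j = P' + t *. (Q' - P')" using coord_ch[OF j(1) pj] xj by simp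
  let ?N = "oth (Rg i) P (\<not> k) - P" and ?N' = "oth (Rg j) P' (\<not> l) - P'"
  have D: "cross2 (?Q - P) ?N ~= 0" "cross2 (Q' - P') ?N' ~= 0"
   using oth(4)[OF simp_i[OF i(1)] P, of k] oth(4)[OF simp_i[OF j(1)] j(2), of l] by (auto simp: l)
  interpret F: minkowski "Fn i" by (rule mink_i[OF i(1)])
  interpret G: minkowski "Fn j" by (rule mink_i[OF j(1)])
  note A = arclen_hp[OF i(1) tcone_edge[OF e refl ci t]] and B = arclen_hp[OF j(1) tcone_edge[OF e' l cj t]]
  have ta: "total_angle M s x = ind_arclen (Fn i) (indicatrix M s x i) + ind_arclen (Fn j) (indicatrix M s x j)" for s
   unfolding total_angle_def st using ij by simp
  have h: "nu (Fn i) (hp (?Q - P) (- ?N)) = nu (Fn j) (hp (Q' - P') ?N')" by (rule half_adj[OF a refl l])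
  show ?thesis using s
  proof
   assume "s = 1"
   then show ?thesis using ta[of 1] A(1) B(1) h F.nu_hp_compl[OF D(1)] const[OF i(1)] by simp
  next
   assume "s = -1"
   then show ?thesis using ta[of "-1"] A(2) B(2) h G.nu_hp_compl[OF D(2)] const[OF j(1)] by simp
  qed
 next
  fix P k a b assume P: "P \<in> corners (Rg i)" and ab: "0 < a" "0 < b" "a + b < 1"
   and pe: "p = P + a *. (oth (Rg i) P k - P) + b *. (oth (Rg i) P (\<not> k) - P)"
  note I = inner_star[OF i(1) P ab pe x(2)[unfolded p(2)], folded p(2)]
  interpret minkowski "Fn i" by (rule mink_i[OF i(1)])
  have "indicatrix M s x i = {u. u \<in> UNIV \<and> Fn i u = 1}" unfolding indicatrix_def I(2) by simp
  then have "ind_arclen (Fn i) (indicatrix M s x i) = nu (Fn i) UNIV" using ind_arclen_nu[of UNIV] by simp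
  then show ?thesis using const[OF i(1)] by (simp add: total_angle_def I(1))
 qed
qed

text \<open>The definite description is unique because there is a point that is not a vertex, the
  midpoint of an edge.\<close>

lemma theta_eq:
 assumes const: "\<And>i. i \<in> pieces M ==> nu (Fn i) UNIV = \<theta>" and ne: "pieces M ~= {}"
 shows "theta M = \<theta>"
proof -
 obtain i where i: "i \<in> pieces M" using ne by blast
 have "corners (Rg i) ~= {}" using corners_simplex(1)[OF simp_i[OF i]] by auto
 then obtain P where P: "P \<in> corners (Rg i)" by blast
 have e: "eflag i P (oth (Rg i) P True)" using i P oth(2)[OF simp_i[OF i] P, of True] oth_corner[OF simp_i[OF i] P] by (simp add: eflag_def)
 have m: "mid i P (oth (Rg i) P True) \<in> topspace (topo M)" "mid i P (oth (Rg i) P True) \<notin> vertices M"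
  using piece_mid[OF e] cover i inner_not_vertex[OF e, of "1/2"] by (auto simp: mid_def)
 show ?thesis unfolding theta_def
 proof (rule the_equality)
  show "\<forall>x\<in>topspace (topo M) - vertices M. \<forall>s\<in>{1, - 1}. total_angle M s x = \<theta>"
   using total_angle_nonvertex[OF _ _ _ const] by auto
  fix \<theta>' assume "\<forall>x\<in>topspace (topo M) - vertices M. \<forall>s\<in>{1, - 1}. total_angle M s x = \<theta>'"
  then have "total_angle M 1 (mid i P (oth (Rg i) P True)) = \<theta>'" using m by blast
  then show "\<theta>' = \<theta>" using total_angle_nonvertex[OF m _ const, of 1] by simp
 qed
qed

end

section \<open>Counting\<close>

text \<open>The lines of \<open>e\<close> and \<open>n\<close> cut the plane into four sectors. The
  one between \<open>n\<close> and \<open>- e\<close> is divided by the third edge direction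
  \<open>n - e\<close>, the one between \<open>e\<close> and \<open>- n\<close> by its
  negative.\<close>

lemma (in minkowski) triangle_angles:
 assumes c: "cross2 e n ~= 0"
 shows "(nu F (sec e n) + nu F (sec (- e) (- n))) + (nu F (sec (n - e) (- e)) + nu F (sec (e - n) e))
  + (nu F (sec (- n) (e - n)) + nu F (sec n (n - e))) = nu F UNIV"
proof -
 have c': "cross2 e (- n) ~= 0" "cross2 n (- e) ~= 0" using c cross2_commute[of n e] by auto
 have 1: "nu F (sec n (- e)) = nu F (sec n (n - e)) + nu F (sec (n - e) (- e))"
  by (rule nu_sec_split[OF c'(2), of _ 1 1]) simp_all
 have 2: "nu F (sec e (- n)) = nu F (sec e (e - n)) + nu F (sec (e - n) (- n))"
  by (rule nu_sec_split[OF c'(1), of _ 1 1]) simp_all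
 show ?thesis
  using nu_hp_split[OF c] nu_hp_split[OF c'(1)] nu_hp_compl[OF c] 1 2
   sec_commute[of e "e - n"] sec_commute[of "e - n" "- n"] sec_commute[of "- n" "- e"] by simp
qed

context pf_surface
begin

text \<open>The contribution of one corner to the sum of the two total angles at its vertex.\<close>

definition corner_angle :: "'i => real^2 => real" where
 "corner_angle i P = nu (Fn i) (sec (oth (Rg i) P False - P) (oth (Rg i) P True - P))
   + nu (Fn i) (sec (- (oth (Rg i) P False - P)) (- (oth (Rg i) P True - P)))"

lemma corner_angle_eq:
 assumes i: "i \<in> pieces M" and c: "corners (Rg i) = {P, Q, R}" "P ~= Q" "P ~= R" "Q ~= R"
 shows "corner_angle i P = nu (Fn i) (sec (Q - P) (R - P)) + nu (Fn i) (sec (- (Q - P)) (- (R - P)))"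
proof -
 note o = oth(1-3)[OF simp_i[OF i], of P False]
 have "{oth (Rg i) P False, oth (Rg i) P True} = {Q, R}"
 proof -
  have "corners (Rg i) - {P} = {oth (Rg i) P False, oth (Rg i) P True}" using o c(1) oth(2)[OF simp_i[OF i], of P True] by auto
  then show ?thesis using c by auto
 qed
 then have "(oth (Rg i) P False = Q \<and> oth (Rg i) P True = R) \<or> (oth (Rg i) P False = R \<and> oth (Rg i) P True = Q)"
  by (auto simp: doubleton_eq_iff)
 then show ?thesis using sec_commute[of "R - P"] sec_commute[of "- (R - P)"] unfolding corner_angle_def by auto
qed

lemma triangle_sum:
 assumes i: "i \<in> pieces M"
 shows "(\<Sum>P\<in>corners (Rg i). corner_angle i P) = nu (Fn i) UNIV"
proof -
 interpret minkowski "Fn i" by (rule mink_i[OF i])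
 have "corners (Rg i) ~= {}" using corners_simplex(1)[OF simp_i[OF i]] by auto
 then obtain P where P: "P \<in> corners (Rg i)" by blast
 define Q R where "Q = oth (Rg i) P True" and "R = oth (Rg i) P False"
 have c: "corners (Rg i) = {P, Q, R}" "P ~= Q" "P ~= R" "Q ~= R" "cross2 (Q - P) (R - P) ~= 0"
  using oth[OF simp_i[OF i] P, of True] oth(2)[OF simp_i[OF i] P, of False] by (auto simp: Q_def R_def)
 have cq: "corners (Rg i) = {Q, R, P}" and cr: "corners (Rg i) = {R, P, Q}" using c(1) by auto
 have "corner_angle i P = nu (Fn i) (sec (Q - P) (R - P)) + nu (Fn i) (sec (- (Q - P)) (- (R - P)))"
  by (rule corner_angle_eq[OF i c(1-4)])
 moreover have "corner_angle i Q = nu (Fn i) (sec (R - Q) (P - Q)) + nu (Fn i) (sec (- (R - Q)) (- (P - Q)))"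
  using c by (intro corner_angle_eq[OF i cq]) auto
 moreover have "corner_angle i R = nu (Fn i) (sec (P - R) (Q - R)) + nu (Fn i) (sec (- (P - R)) (- (Q - R)))"
  using c by (intro corner_angle_eq[OF i cr]) auto
 moreover have "(\<Sum>P\<in>corners (Rg i). corner_angle i P) = corner_angle i P + corner_angle i Q + corner_angle i R"
  unfolding c(1) using c(2-4) by simp
 moreover have "(R - P) - (Q - P) = R - Q" "(Q - P) - (R - P) = Q - R" by simp_all
 ultimately show ?thesis using triangle_angles[OF c(5)] by simp
qed

text \<open>Two pieces with the same image would contain all three corners in their intersection,
  but a single corner or an edge always misses one.\<close>

lemma card_faces: "card (faces M) = card (pieces M)"
 unfolding faces_def
proof (rule card_image, rule inj_onI, rule ccontr)
 fix i j assume i: "i \<in> pieces M" and j: "j \<in> pieces M" and eq: "piece M i = piece M j" and ne: "i ~= j"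
 have c3: "card (corners (Rg i)) = 3" by (rule corners_simplex(1)[OF simp_i[OF i]])
 have cin: "ch i p \<in> piece M i \<inter> piece M j" if "p \<in> corners (Rg i)" for p
  using corner_reg[OF i that] eq by (auto simp: piece_def)
 have fewer: "\<exists>p. p \<in> corners (Rg i) \<and> p ~= A \<and> p ~= B" for A B
 proof (rule ccontr)
  assume "\<not> ?thesis"
  then have "corners (Rg i) \<subseteq> {A, B}" by blast
  then have "card (corners (Rg i)) <= card {A, B}" by (rule card_mono[rotated]) simp
  also have "\<dots> <= 2" by (simp add: card_insert_if)
  finally show False using c3 by simp
 qed
 show False
 proof (rule inter_cases[OF i j ne])
  assume "piece M i \<inter> piece M j = {}"
  then show False using eq piece_ne[OF i] by simp
 next
  fix p q assume p: "p \<in> corners (Rg i)" "piece M i \<inter> piece M j = {ch i p}"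
  obtain p' where p': "p' \<in> corners (Rg i)" "p' ~= p" using fewer by blast
  have "ch i p' = ch i p" using cin[OF p'(1)] p(2) by simp
  then show False using piece_inj[OF i corner_reg[OF i p'(1)] corner_reg[OF i p(1)]] p'(2) by simp
 next
  fix P Q assume PQ: "P \<in> corners (Rg i)" "Q \<in> corners (Rg i)" "P ~= Q" "piece M i \<inter> piece M j = ch i ` closed_segment P Q"
  obtain R where R: "R \<in> corners (Rg i)" "R ~= P" "R ~= Q" using fewer by blast
  obtain y where y: "y \<in> closed_segment P Q" "ch i R = ch i y" using cin[OF R(1)] PQ(4) by auto
  have "y \<in> Rg i" using y(1) segment_region[OF i PQ(1,2)] by (auto simp: segment_param)
  then have "R \<in> closed_segment P Q" using piece_inj[OF i corner_reg[OF i R(1)] _ y(2)] y(1) by simp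
  from corner_on_edge[OF simp_i[OF i] PQ(1-3) R(1) this] show False using R by blast
 qed
qed

lemma segment_corners:
 assumes i: "i \<in> pieces M" and P: "P \<in> corners (Rg i)" "Q \<in> corners (Rg i)" and A: "A \<in> corners (Rg i)" "B \<in> corners (Rg i)"
  and eq: "ch i ` closed_segment A B = ch i ` closed_segment P Q"
 shows "{A, B} = {P, Q}"
proof -
 have sub: "closed_segment P Q \<subseteq> Rg i" "closed_segment A B \<subseteq> Rg i"
  using segment_region[OF i P] segment_region[OF i A] by (auto simp: segment_param)
 have "closed_segment A B = closed_segment P Q" using inj_on_image_eq_iff[OF ch_inj[OF i] sub(2,1)] eq by simp
 then show ?thesis by simp
qed

text \<open>The directed edges of all triangles are counted in two ways: each triangle has 6 of
  them, and each edge of the surface comes from 4, two directions in each of its two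
  triangles.\<close>

lemma card_edges:
 assumes fin: "finite (pieces M)"
 shows "4 * card (edges M) = 6 * card (pieces M)"
proof -
 define L where "L = Sigma (pieces M) (\<lambda>i. Sigma (corners (Rg i)) (\<lambda>P. corners (Rg i) - {P}))"
 define g where "g f = ch (fst f) ` closed_segment (fst (snd f)) (snd (snd f))" for f
 have c3: "card (corners (Rg i)) = 3" "finite (corners (Rg i))" if "i \<in> pieces M" for i
  using corners_simplex(1)[OF simp_i[OF that]] card.infinite[of "corners (Rg i)"] by auto
 have finL: "finite L" unfolding L_def using fin c3 by auto
 have mem: "(i, P, Q) \<in> L \<longleftrightarrow> eflag i P Q" for i P Q by (auto simp: L_def eflag_def)
 have "card L = (\<Sum>i\<in>pieces M. card (Sigma (corners (Rg i)) (\<lambda>P. corners (Rg i) - {P})))"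
  unfolding L_def using fin c3 by (intro card_SigmaI) auto
 also have "\<dots> = (\<Sum>i\<in>pieces M. 6)"
 proof (rule sum.cong[OF refl])
  fix i assume i: "i \<in> pieces M"
  have "card (Sigma (corners (Rg i)) (\<lambda>P. corners (Rg i) - {P})) = (\<Sum>P\<in>corners (Rg i). card (corners (Rg i) - {P}))"
   using c3[OF i] by (intro card_SigmaI) auto
  also have "\<dots> = (\<Sum>P\<in>corners (Rg i). 2)" using c3[OF i] by (intro sum.cong) auto
  finally show "card (Sigma (corners (Rg i)) (\<lambda>P. corners (Rg i) - {P})) = 6" using c3[OF i] by simp
 qed
 finally have cL: "card L = 6 * card (pieces M)" by simp
 have gL: "g ` L = edges M"
 proof
  show "g ` L \<subseteq> edges M"
  proof
   fix z assume "z \<in> g ` L"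
   then obtain i P Q where "eflag i P Q" "z = ch i ` closed_segment P Q" using mem by (auto simp: g_def)
   then show "z \<in> edges M" unfolding edges_def eflag_def using edge_triangle[OF simp_i] by blast
  qed
  show "edges M \<subseteq> g ` L"
  proof
   fix z assume "z \<in> edges M"
   then obtain i e where i: "i \<in> pieces M" "e edge_of Rg i" "z = ch i ` e" by (auto simp: edges_def)
   then obtain P Q where "P \<in> corners (Rg i)" "Q \<in> corners (Rg i)" "P ~= Q" "e = closed_segment P Q"
    using edge_triangle[OF simp_i[OF i(1)]] by blast
   then have "(i, P, Q) \<in> L" "z = g (i, P, Q)" using i mem by (auto simp: g_def eflag_def)
   then show "z \<in> g ` L" by blast
  qed
 qed
 have fib: "card {f \<in> L. g f = z} = 4" if zL: "z \<in> g ` L" for z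
 proof -
  obtain i P Q where e: "eflag i P Q" and z: "z = ch i ` closed_segment P Q" using zL mem by (auto simp: g_def)
  obtain j P' Q' where a: "adj i P Q j P' Q'" using adj_ex[OF e] by blast
  then have e': "eflag j P' Q'" and ij: "i ~= j" by (auto simp: adj_def)
  have z': "z = ch j ` closed_segment P' Q'"
   unfolding z adj_inter[OF a, symmetric] Int_commute[of "piece M i"] by (rule adj_inter[OF adj_sym[OF a]])
  have "{f \<in> L. g f = z} = {(i, P, Q), (i, Q, P), (j, P', Q'), (j, Q', P')}"
  proof
   show "{(i, P, Q), (i, Q, P), (j, P', Q'), (j, Q', P')} \<subseteq> {f \<in> L. g f = z}"
   proof -
    have "(i, P, Q) \<in> L" "(i, Q, P) \<in> L" "(j, P', Q') \<in> L" "(j, Q', P') \<in> L" using e e' unfolding mem eflag_def by blast+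
    moreover have "g (i, P, Q) = z" "g (i, Q, P) = z" "g (j, P', Q') = z" "g (j, Q', P') = z"
     unfolding g_def fst_conv snd_conv closed_segment_commute[of Q P] closed_segment_commute[of Q' P']
     by (rule z[symmetric] z'[symmetric])+
    ultimately show ?thesis by blast
   qed
   show "{f \<in> L. g f = z} \<subseteq> {(i, P, Q), (i, Q, P), (j, P', Q'), (j, Q', P')}"
   proof
    fix f assume f: "f \<in> {f \<in> L. g f = z}"
    obtain m A B where fm: "f = (m, A, B)" by (cases f) auto
    have em: "eflag m A B" and gz: "ch m ` closed_segment A B = z" using f mem by (auto simp: fm g_def)
    \<comment> \<open>A directed edge with the same image contains the midpoint, hence belongs to
      one of the two triangles \<open>i\<close> and \<open>j\<close>.\<close>
    have "P + (1/2) *. (Q - P) \<in> closed_segment P Q" unfolding segment_param by (intro CollectI exI[of _ "1/2"]) auto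
    then have "mid i P Q \<in> z" unfolding z mid_def by (rule imageI)
    moreover have "z \<subseteq> piece M m" unfolding gz[symmetric] piece_def
     using em segment_region[of m A B] by (auto simp: segment_param eflag_def)
    ultimately have "mid i P Q \<in> piece M m" by blast
    then have "m = i \<or> m = j" using adj_in[OF a, of m "1/2"] em by (auto simp: mid_def eflag_def)
    then show "f \<in> {(i, P, Q), (i, Q, P), (j, P', Q'), (j, Q', P')}"
    proof
     assume m: "m = i"
     have "{A, B} = {P, Q}" using e em gz z unfolding m eflag_def by (intro segment_corners[of i]) auto
     then show ?thesis by (auto simp: fm m doubleton_eq_iff)
    next
     assume m: "m = j"
     have "{A, B} = {P', Q'}" using e' em gz z' unfolding m eflag_def by (intro segment_corners[of j]) auto
     then show ?thesis by (auto simp: fm m doubleton_eq_iff)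
    qed
   qed
  qed
  moreover have "P ~= Q" "P' ~= Q'" using e e' by (auto simp: eflag_def)
  ultimately show ?thesis using ij by simp
 qed
 have "card L = (\<Sum>z\<in>g ` L. card {f \<in> L. g f = z})"
  using sum.image_gen[OF finL, of "\<lambda>_. 1::nat" g] by simp
 also have "\<dots> = (\<Sum>z\<in>g ` L. 4)" by (rule sum.cong[OF refl fib])
 finally show ?thesis using cL gL by simp
qed

end

context landsberg_surface
begin

lemma gauss_bonnet:
 assumes fin: "finite (pieces M)" and const: "\<And>i. i \<in> pieces M ==> nu (Fn i) UNIV = \<theta>"
 shows "(\<Sum>x\<in>vertices M. curvature M x) = \<theta> * of_int (euler_char M)"
proof -
 have c3: "finite (corners (Rg i))" if "i \<in> pieces M" for i
  using corners_simplex(1)[OF simp_i[OF that]] card.infinite[of "corners (Rg i)"] by auto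
 have "vertices M = (\<lambda>(i, p). ch i p) ` Sigma (pieces M) (\<lambda>i. corners (Rg i))" by (auto simp: vertices_alt)
 then have finV: "finite (vertices M)" using fin c3 by auto
 have finst: "finite (star M x)" for x using fin by (simp add: star_def)
 have curv: "2 * curvature M x = 2 * \<theta> - (\<Sum>i\<in>star M x. corner_angle i (coord M x i))" if x: "x \<in> vertices M" for x
 proof -
  interpret landsberg_vertex M x by unfold_locales (rule x)
  have "total_angle M 1 x + total_angle M (-1) x = (\<Sum>i\<in>star M x. corner_angle i (coord M x i))"
   unfolding total_angle_sec sum.distrib[symmetric] by (simp add: corner_angle_def vray_def tip_def)
  moreover have "2 * curvature M x = 2 * \<theta> - total_angle M 1 x - total_angle M (-1) x"
   by (rule curvature_vertex) (rule const, rule co(1))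
  ultimately show ?thesis by simp
 qed
 have "(\<Sum>x\<in>vertices M. \<Sum>i\<in>star M x. corner_angle i (coord M x i)) =
   (\<Sum>(x, i)\<in>Sigma (vertices M) (star M). corner_angle i (coord M x i))"
  by (rule sum.Sigma) (use finV finst in auto)
 also have "\<dots> = (\<Sum>(i, P)\<in>Sigma (pieces M) (\<lambda>i. corners (Rg i)). corner_angle i P)"
 \<comment> \<open>Incidences of vertices with triangles are the same as corners of triangles, the
   corner being the coordinate of the vertex in the triangle.\<close>
 proof (rule sum.reindex_bij_witness[where i = "\<lambda>(i, P). (ch i P, i)" and j = "\<lambda>(x, i). (i, coord M x i)"])
  fix z assume "z \<in> Sigma (vertices M) (star M)"
  then obtain x i where z: "z = (x, i)" "x \<in> vertices M" "i \<in> star M x" by auto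
  note sc = star_coord[OF z(3)] and cc = star_corner[OF z(2,3)]
  show "(case case z of (x, i) => (i, coord M x i) of (i, P) => (ch i P, i)) = z" using z sc by simp
  show "(case z of (x, i) => (i, coord M x i)) \<in> Sigma (pieces M) (\<lambda>i. corners (Rg i))" using z sc cc by simp
  show "(case case z of (x, i) => (i, coord M x i) of (i, P) => corner_angle i P) = (case z of (x, i) => corner_angle i (coord M x i))"
   using z by simp
 next
  fix z assume "z \<in> Sigma (pieces M) (\<lambda>i. corners (Rg i))"
  then obtain i P where z: "z = (i, P)" "i \<in> pieces M" "P \<in> corners (Rg i)" by auto
  note cr = corner_reg[OF z(2,3)]
  show "(case case z of (i, P) => (ch i P, i) of (x, i) => (i, coord M x i)) = z" using z coord_ch[OF z(2) cr] by simp
  show "(case z of (i, P) => (ch i P, i)) \<in> Sigma (vertices M) (star M)"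
   using z cr by (auto simp: vertices_alt star_def piece_def)
 qed
 also have "\<dots> = (\<Sum>i\<in>pieces M. \<Sum>P\<in>corners (Rg i). corner_angle i P)"
  by (rule sum.Sigma[symmetric]) (use fin c3 in auto)
 also have "\<dots> = (\<Sum>i\<in>pieces M. \<theta>)" by (rule sum.cong[OF refl]) (simp add: triangle_sum const)
 finally have ang: "(\<Sum>x\<in>vertices M. \<Sum>i\<in>star M x. corner_angle i (coord M x i)) = card (pieces M) * \<theta>" by simp
 have "2 * (\<Sum>x\<in>vertices M. curvature M x) = (\<Sum>x\<in>vertices M. 2 * \<theta> - (\<Sum>i\<in>star M x. corner_angle i (coord M x i)))"
  unfolding sum_distrib_left by (rule sum.cong[OF refl]) (rule curv)
 also have "\<dots> = card (vertices M) * (2 * \<theta>) - card (pieces M) * \<theta>" unfolding sum_subtractf ang by simp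
 finally have main: "2 * (\<Sum>x\<in>vertices M. curvature M x) = card (vertices M) * (2 * \<theta>) - card (pieces M) * \<theta>" .
 have E: "real (card (edges M)) = 3 / 2 * real (card (pieces M))"
 proof -
  have "real (4 * card (edges M)) = real (6 * card (pieces M))" unfolding card_edges[OF fin] ..
  then show ?thesis by simp
 qed
 have X: "of_int (euler_char M) = real (card (vertices M)) - 3 / 2 * real (card (pieces M)) + real (card (pieces M))"
  unfolding euler_char_def card_faces by (simp add: E)
 have "2 * (\<theta> * of_int (euler_char M)) = card (vertices M) * (2 * \<theta>) - card (pieces M) * \<theta>"
  unfolding X by (simp add: algebra_simps)
 then show ?thesis using main by simp
qed

end

theorem theorem7p2:
  fixes M :: "('p, 'i) flat_surface"
  assumes "pf_landsberg_surface M"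
    and "compact_space (topo M)"
    and "connected_space (topo M)"
  shows "(\<Sum>\<^sub>\<infinity>x\<in>topspace (topo M). curvature M x) = theta M * of_int (euler_char M)"
proof -
 interpret landsberg_surface M
  using assms(1) by unfold_locales (auto simp: pf_landsberg_surface_def)
 have fin: "finite (pieces M)" by (rule finite_pieces[OF assms(2)])
 have sub: "vertices M \<subseteq> topspace (topo M)"
 proof
  fix y assume "y \<in> vertices M"
  then obtain i p where "i \<in> pieces M" "p \<in> corners (Rg i)" "y = ch i p" by (auto simp: vertices_alt)
  then have "i \<in> pieces M" "y \<in> piece M i" using corner_reg by (auto simp: piece_def)
  then show "y \<in> topspace (topo M)" using cover by blast
 qed
 have "finite (vertices M)"
 proof -
  have "finite (corners (Rg i))" if "i \<in> pieces M" for i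
   using corners_simplex(1)[OF simp_i[OF that]] card.infinite[of "corners (Rg i)"] by auto
  moreover have "vertices M = (\<lambda>(i, p). ch i p) ` Sigma (pieces M) (\<lambda>i. corners (Rg i))" by (auto simp: vertices_alt)
  ultimately show ?thesis using fin by auto
 qed
 have "(\<Sum>\<^sub>\<infinity>x\<in>topspace (topo M). curvature M x) = (\<Sum>\<^sub>\<infinity>x\<in>vertices M. curvature M x)"
  by (rule infsum_cong_neutral) (use sub in \<open>auto simp: curvature_def\<close>)
 also have "\<dots> = (\<Sum>x\<in>vertices M. curvature M x)" by (rule infsum_finite) fact
 also have "\<dots> = theta M * of_int (euler_char M)"
 proof (cases "pieces M = {}")
  \<comment> \<open>Without pieces the surface is empty and \<open>theta\<close> is an unspecified
    number, but the sum and \<open>euler_char\<close> are both 0.\<close>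
  case True
  then show ?thesis by (simp add: vertices_alt euler_char_def edges_def faces_def)
 next
  case False
  then obtain i0 where i0: "i0 \<in> pieces M" by blast
  have const: "nu (Fn i) UNIV = nu (Fn i0) UNIV" if "i \<in> pieces M" for i
   by (rule colour_constant[OF fin assms(3) _ that i0]) (rule theta_adj)
  have th: "theta M = nu (Fn i0) UNIV" by (rule theta_eq[OF _ False]) (rule const)
  show ?thesis unfolding th by (rule gauss_bonnet[OF fin]) (rule const)
 qed
 finally show ?thesis .
qed

end
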